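(* Let $(X,d)$ be a complete and separable metric space, $I=[0,1]$, and let $(\mu_t)_{t\in I}\in \mathcal{BV}(I:P_1(X))$. Then there exists a Borel probability measure $\tilde\pi\in P(D(I:X))$ such that (i) $\tilde\pi$ is concentrated on $\mathcal{BV}(I:X)\subset D(I:X)$; (ii) $(e_t)_\#\tilde\pi=\mu_t$ for all $t\in I$; (iii) the total variation measure $|D\mu|$ of $(\mu_t)$ satisfies $$|D\mu|=\int |D\gamma|\,\mathrm{d}\tilde\pi(\gamma)\quad\text{as measures on } I.$$ Moreover, the absolutely continuous part $|\dot\mu|\mathcal L^1$ of the measure $|D\mu|$, whose density is given by the metric derivative $|\dot\mu_t|$, satisfies $$|\dot\mu_t|=\lim_{h\to0}\int\frac{d(\gamma_t,\gamma_{t+h})}{|h|}\,\mathrm{d}\tilde\pi(\gamma)=\lim_{h\to0}\int\frac{|D\gamma|([t,t+h])}{|h|}\,\mathrm{d}\tilde\pi(\gamma)$$ for $\mathcal L^1$-a.e. $t\in I$. In particular, if $(\mu_t)\in\mathcal{AC}^1(I:P_1(X))$, then $|D\mu|=|\dot\mu|\mathcal L^1$ and the metric speed $|\dot\mu_t|$ is characterized by the equation above.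
   Context: $I=[0,1]$; $\mathcal L^1$ is Lebesgue measure. $P_1(X)$ is the set of Borel probability measures on $X$ with finite first moment, endowed with the $1$-Wasserstein distance $W_1$ (a complete separable metric space). For a complete separable metric space $(Y,d)$ (below $Y=X$ or $Y=(P_1(X),W_1)$): - $L^1(I:Y)$ is the space of (measurable) maps $u:I\to Y$ with $\int_I d(u(t),\bar y)\,dt<\infty$ for some (every) $\bar y\in Y$. - For $J\subset I$, $\mathrm{Var}(u;J)=\sup\{\sum_{i=0}^k d(u(t_i),u(t_{i+1})): t_0<\dots<t_{k+1},\ t_j\in J\}$ and $\mathrm{ess\,Var}(u;J)=\inf\{\mathrm{Var}(v;J): v=u \text{ a.e. on } J\}$. - $u\in L^1(I:Y)$ is a BV-curve if $\mathrm{ess\,Var}(u;I)<\infty$. - $D(I:Y)$ is the set of càdlàg curves (right-continuous with left limits), equipped with the Skorokhod metric $d_{Sk}(\gamma,\tilde\gamma)=\inf_\lambda\max\{\|\lambda\|_B,\sup_{t}d(\gamma(t),\tilde\gamma(\lambda(t)))\}$, the infimum over increasing homeomorphisms $\lambda:I\to I$, with $\|\lambda\|_B=\sup_{0\le s<t\le1}|\log\frac{\lambda(t)-\lambda(s)}{t-s}|$; it is complete and separable. $\mathcal{BV}(I:Y)\subset D(I:Y)$ is the set of càdlàg BV-curves. - The variation measure $|Du|$ of a BV-curve $u$ is the Lebesgue–Stieltjes measure on $I$ induced by the non-decreasing function $V(t)=\mathrm{ess\,Var}(u;(0,t))$, i.e. $|Du|((a,b))=V(b^-)-V(a^+)$;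 it gives no mass to $\{0\}$ and $\{1\}$. Its Lebesgue decomposition is $|Du|=|\dot u|\mathcal L^1+|Du|^C+|Du|^J$ ($|\dot u|$ the density of the absolutely continuous part, $|Du|^C$ continuous singular, $|Du|^J$ purely atomic). - The metric derivative is $|\dot u_t|=\lim_{h\to0} d(u(t),u(t+h))/|h|$ when it exists; for $u\in\mathcal{BV}(I:Y)$ it exists for a.e. $t$ and equals $|\dot u|(t)$. It is called metric speed when $u$ is absolutely continuous. - $\mathcal{AC}^1(I:Y)$ is the set of absolutely continuous curves: $d(u(s),u(t))\le\int_s^t m\,dr$ for all $s\le t$ and some $m\in L^1(I)$. $e_t(\gamma)=\gamma_t=\gamma(t)$ is the evaluation map on $D(I:X)$ and $\#$ denotes push-forward. The measure $\int|D\gamma|\,\mathrm d\tilde\pi(\gamma)$ on $I$ is defined by $A\mapsto\int_{D(I:X)}|D\gamma|(A)\,\mathrm d\tilde\pi(\gamma)$ for Borel $A\subset I$. For $h<0$, $[t,t+h]$ means $[t+h,t]$. *)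

theory Defs
  imports "HOL-Probability.Probability"
begin

text \<open>
  A metric space \<open>(Y, d)\<close> is given by a carrier \<open>M\<close> and a distance \<open>d\<close>, as in the locale
  \<open>Metric_space\<close>, because the curves considered below take their values either in a metric type
  or in a set of measures. A curve on \<open>I = [0,1]\<close> is a function in \<open>{0..1} \<rightarrow>\<^sub>E M\<close>.
\<close>

definition metric_borel :: "'b set \<Rightarrow> ('b \<Rightarrow> 'b \<Rightarrow> real) \<Rightarrow> 'b measure" where
  "metric_borel M d = sigma M {U. openin (Metric_space.mtopology M d) U}"

definition P1 :: "'a::metric_space measure set" where
  "P1 = {\<mu>. sets \<mu> = sets borel \<and> prob_space \<mu> \<and>
             (\<exists>x0. (\<integral>\<^sup>+x. ennreal (dist x0 x) \<partial>\<mu>) < \<infinity>)}"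

definition couplings :: "'a::metric_space measure \<Rightarrow> 'a measure \<Rightarrow> ('a \<times> 'a) measure set" where
  "couplings \<mu> \<nu> = {\<sigma>. sets \<sigma> = sets borel \<and> prob_space \<sigma> \<and>
                         distr \<sigma> borel fst = \<mu> \<and> distr \<sigma> borel snd = \<nu>}"

definition W1 :: "'a::metric_space measure \<Rightarrow> 'a measure \<Rightarrow> real" where
  "W1 \<mu> \<nu> = enn2real (INF \<sigma>\<in>couplings \<mu> \<nu>. \<integral>\<^sup>+z. ennreal (dist (fst z) (snd z)) \<partial>\<sigma>)"

definition L1_curves :: "'b set \<Rightarrow> ('b \<Rightarrow> 'b \<Rightarrow> real) \<Rightarrow> (real \<Rightarrow> 'b) set" where
  "L1_curves M d = {u \<in> {0..1} \<rightarrow>\<^sub>E M.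
     u \<in> measurable (lebesgue_on {0..1}) (metric_borel M d) \<and>
     (\<exists>y\<in>M. (\<integral>\<^sup>+t. ennreal (d (u t) y) \<partial>lebesgue_on {0..1}) < \<infinity>)}"

definition pvar :: "('b \<Rightarrow> 'b \<Rightarrow> real) \<Rightarrow> (real \<Rightarrow> 'b) \<Rightarrow> real set \<Rightarrow> ennreal" where
  "pvar d u J =
     (SUP (k, p) \<in> {(k::nat, p::nat \<Rightarrow> real). (\<forall>i\<le>k. p i < p (Suc i)) \<and> (\<forall>i\<le>Suc k. p i \<in> J)}.
        \<Sum>i\<le>k. ennreal (d (u (p i)) (u (p (Suc i)))))"

definition ess_var :: "'b set \<Rightarrow> ('b \<Rightarrow> 'b \<Rightarrow> real) \<Rightarrow> (real \<Rightarrow> 'b) \<Rightarrow> real set \<Rightarrow> ennreal" where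
  "ess_var M d u J = (INF v \<in> {v \<in> J \<rightarrow> M. AE t in lebesgue_on J. v t = u t}. pvar d v J)"

definition cadlag :: "'b set \<Rightarrow> ('b \<Rightarrow> 'b \<Rightarrow> real) \<Rightarrow> (real \<Rightarrow> 'b) set" where
  "cadlag M d = {u \<in> {0..1} \<rightarrow>\<^sub>E M.
     (\<forall>t\<in>{0..<1}. limitin (Metric_space.mtopology M d) u (u t) (at_right t)) \<and>
     (\<forall>t\<in>{0<..1}. \<exists>l. limitin (Metric_space.mtopology M d) u l (at_left t))}"

definition cadlag_BV :: "'b set \<Rightarrow> ('b \<Rightarrow> 'b \<Rightarrow> real) \<Rightarrow> (real \<Rightarrow> 'b) set" where
  "cadlag_BV M d = {u \<in> cadlag M d. u \<in> L1_curves M d \<and> ess_var M d u {0..1} < \<infinity>}"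

definition AC1 :: "'b set \<Rightarrow> ('b \<Rightarrow> 'b \<Rightarrow> real) \<Rightarrow> (real \<Rightarrow> 'b) set" where
  "AC1 M d = {u \<in> {0..1} \<rightarrow>\<^sub>E M. \<exists>m::real \<Rightarrow> real. set_integrable lebesgue {0..1} m \<and>
     (\<forall>s t. 0 \<le> s \<longrightarrow> s \<le> t \<longrightarrow> t \<le> 1 \<longrightarrow>
        d (u s) (u t) \<le> set_lebesgue_integral lebesgue {s..t} m)}"

text \<open>The function \<open>V(t) = ess Var (u; (0,t))\<close>, extended from \<open>(0,1]\<close> to the real line by \<open>0\<close> on the left and by \<open>V(1)\<close> on the right.\<close>

definition var_fun :: "'b set \<Rightarrow> ('b \<Rightarrow> 'b \<Rightarrow> real) \<Rightarrow> (real \<Rightarrow> 'b) \<Rightarrow> real \<Rightarrow> real" where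
  "var_fun M d u t = enn2real (ess_var M d u {0<..<min t 1})"

text \<open>
  \<open>interval_measure F\<close> assigns \<open>F b - F a\<close> to \<open>{a<..b}\<close> and requires \<open>F\<close> to be right-continuous,
  whereas \<open>V\<close> is left-continuous. With \<open>F(t) = V(t+)\<close>, open intervals \<open>{a<..<b}\<close> in \<open>[0,1]\<close>
  get mass \<open>V(b-) - V(a+)\<close>. The end points carry no mass since \<open>V(0+) = 0\<close> and \<open>V(1-) = V(1)\<close>;
  in particular a jump of the curve at time \<open>1\<close> is not seen.
\<close>

definition var_measure :: "'b set \<Rightarrow> ('b \<Rightarrow> 'b \<Rightarrow> real) \<Rightarrow> (real \<Rightarrow> 'b) \<Rightarrow> real measure" where
  "var_measure M d u =
     restrict_space (interval_measure (\<lambda>t. Lim (at_right t) (var_fun M d u))) {0..1}"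

definition increments_at :: "real \<Rightarrow> real filter" where
  "increments_at t = at 0 within {h. t + h \<in> {0..1}}"

definition metric_deriv :: "('b \<Rightarrow> 'b \<Rightarrow> real) \<Rightarrow> (real \<Rightarrow> 'b) \<Rightarrow> real \<Rightarrow> real" where
  "metric_deriv d u t = Lim (increments_at t) (\<lambda>h. d (u t) (u (t + h)) / \<bar>h\<bar>)"

text \<open>
  The measure \<open>N\<close> on \<open>[0,1]\<close> has Lebesgue decomposition \<open>f \<L>\<^sup>1 + \<sigma>\<close> with \<open>\<sigma>\<close> singular
  (for a variation measure, \<open>\<sigma>\<close> is the sum of the Cantor part and the jump part).
\<close>

definition abs_cont_part :: "real measure \<Rightarrow> (real \<Rightarrow> real) \<Rightarrow> bool" where
  "abs_cont_part N f \<longleftrightarrow>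
     f \<in> borel_measurable (lebesgue_on {0..1}) \<and>
     (\<exists>\<sigma> Z. sets \<sigma> = sets N \<and> Z \<in> sets N \<and> Z \<in> null_sets lebesgue \<and>
            emeasure \<sigma> ({0..1} - Z) = 0 \<and>
            (\<forall>A\<in>sets N. emeasure N A =
               (\<integral>\<^sup>+t\<in>A. ennreal (f t) \<partial>lebesgue_on {0..1}) + emeasure \<sigma> A))"

definition time_changes :: "(real \<Rightarrow> real) set" where
  "time_changes =
     {\<theta>. strict_mono_on {0..1} \<theta> \<and> (\<exists>\<kappa>. homeomorphism {0..1} {0..1} \<theta> \<kappa>)}"

definition time_change_norm :: "(real \<Rightarrow> real) \<Rightarrow> ennreal" where
  "time_change_norm \<theta> =
     (SUP (s, t) \<in> {(s, t). 0 \<le> s \<and> s < t \<and> t \<le> 1}. ennreal \<bar>ln ((\<theta> t - \<theta> s) / (t - s))\<bar>)"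

definition skorokhod_dist :: "('b \<Rightarrow> 'b \<Rightarrow> real) \<Rightarrow> (real \<Rightarrow> 'b) \<Rightarrow> (real \<Rightarrow> 'b) \<Rightarrow> real" where
  "skorokhod_dist d \<gamma> \<gamma>' = enn2real
     (INF \<theta>\<in>time_changes.
        max (time_change_norm \<theta>) (SUP t\<in>{0..1}. ennreal (d (\<gamma> t) (\<gamma>' (\<theta> t)))))"

definition skorokhod_borel :: "'b set \<Rightarrow> ('b \<Rightarrow> 'b \<Rightarrow> real) \<Rightarrow> (real \<Rightarrow> 'b) measure" where
  "skorokhod_borel M d = metric_borel (cadlag M d) (skorokhod_dist d)"

end

(*
  Along the dyadic times of level n, gluing almost optimal couplings of consecutive marginals into a
  Markov chain gives random variables with laws mu_t and E d(xi_s, xi_t) <= W(t) - W(s) up to a small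
  error, where W(t) is the variation of mu on [0,t]. A limit in law over n exists because all
  one-dimensional marginals are fixed; it is a process on the dyadics with the error removed.
  Monotone convergence of the dyadic sums shows that its paths almost surely have finite variation,
  so that their right limits are cadlag paths; pi is the law of this regularization.

  Comparing E d(gamma_s, gamma_t) with W1(mu_s, mu_t) from below and with W(t) - W(s) from above, the
  dyadic sums give E |D gamma|([0,t]) = |D mu|([0,t]), hence equality of the measures. The increment
  quotients are squeezed between W1(mu_t, mu_(t+h))/|h| and (W(t+h) - W(t))/|h|, which both
  converge almost everywhere to the density of |D mu|.
*)
theory Submission
  imports Defs
begin

section \<open>Pointwise variation\<close>

text \<open>Dyadic sums stopped at \<open>t\<close> replace the supremum over all partitions: for a
  right-continuous curve they increase to its variation on [0,t], so measurability in the path and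
  the exchange of supremum and expectation reduce to countably many evaluations. The curve of
  measures and the paths share the same lemmas on an abstract metric space. Time 1 is delicate:
  \<open>var_measure\<close> ignores a jump there, while the process must have the prescribed law at
  1. Hence \<open>W\<close> is the variation on closed intervals and counts this jump, whereas
  \<open>var_upto\<close> stops before 1; they agree below 1. The obstacle in differentiation is the
  lower bound for the metric derivative: differentiating the monotone function
  \<open>var_upto\<close> bounds the quotients from above only, since the variation on a short
  interval may exceed the distance of its end values. A partition that almost exhausts the variation
  closes this gap. As many objects are defined by \<open>enn2real\<close>, \<open>lim\<close> or
  \<open>Lim\<close>, finiteness or convergence has to be established before they can be
  used.\<close>

lemma SUP_add_le_ennreal:
  fixes c B :: ennreal
  assumes "\<And>i. i \<in> I \<Longrightarrow> f i + c \<le> B" "c \<le> B"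
  shows "(SUP i\<in>I. f i) + c \<le> B"
proof (cases "I = {}")
  case False
  then have "(SUP i\<in>I. f i) + c = (SUP i\<in>I. f i + c)" by (simp add: ennreal_SUP_add_left)
  then show ?thesis using assms by (simp add: SUP_least)
\<comment> \<open>For an empty index set the supremum is 0, and \<open>c \<le> B\<close> is what
  remains.\<close>
qed (simp add: assms bot_ennreal)

lemma pvar_least:
  assumes "\<And>k p. (\<And>i. i \<le> k \<Longrightarrow> p i < p (Suc i)) \<Longrightarrow> (\<And>i. i \<le> Suc k \<Longrightarrow> p i \<in> J) \<Longrightarrow>
      (\<Sum>i\<le>k. ennreal (d (u (p i)) (u (p (Suc i))))) \<le> B"
  shows "pvar d u J \<le> B"
  unfolding pvar_def by (rule SUP_least) (use assms in auto)

lemma sum_le_pvar_strict: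
  assumes "\<And>i. i \<le> k \<Longrightarrow> p i < p (Suc i)" "\<And>i. i \<le> Suc k \<Longrightarrow> p i \<in> J"
  shows "(\<Sum>i\<le>k. ennreal (d (u (p i)) (u (p (Suc i))))) \<le> pvar d u J"
  unfolding pvar_def
  by (rule SUP_upper2[where i="(k, p)"]) (use assms in auto)

lemma pvar_mono: "J \<subseteq> K \<Longrightarrow> pvar d u J \<le> pvar d u K"
  by (rule pvar_least, rule sum_le_pvar_strict) auto

context Metric_space
begin

lemma sum_le_pvar:
  assumes "\<And>i. i < n \<Longrightarrow> p i \<le> p (Suc i)" "\<And>i. i \<le> n \<Longrightarrow> p i \<in> J" "u \<in> J \<rightarrow> M"
  shows "(\<Sum>i<n. ennreal (d (u (p i)) (u (p (Suc i))))) \<le> pvar d u J"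
proof -
  let ?S = "\<lambda>n. (\<Sum>i<n. ennreal (d (u (p i)) (u (p (Suc i)))))"
  have "?S n = 0 \<or> (\<exists>k q. (\<forall>i\<le>k. q i < q (Suc i)) \<and> (\<forall>i\<le>Suc k. q i \<in> J) \<and> q (Suc k) = p n \<and>
      ?S n = (\<Sum>i\<le>k. ennreal (d (u (q i)) (u (q (Suc i))))))"
    using assms(1,2)
  proof (induction n)
    case (Suc n)
    have pJ: "p n \<in> J" "p (Suc n) \<in> J" and le: "p n \<le> p (Suc n)" using Suc.prems by auto
    from Suc have IH: "?S n = 0 \<or> (\<exists>k q. (\<forall>i\<le>k. q i < q (Suc i)) \<and> (\<forall>i\<le>Suc k. q i \<in> J) \<and> q (Suc k) = p n \<and>
      ?S n = (\<Sum>i\<le>k. ennreal (d (u (q i)) (u (q (Suc i))))))" by simp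
    show ?case
    proof (cases "p n = p (Suc n)")
      case True
      then have "d (u (p n)) (u (p (Suc n))) = 0" using pJ assms(3) by (metis PiE mdist_zero)
      then have "?S (Suc n) = ?S n" by simp
      with IH True show ?thesis by auto
    next
      case False
      with le have lt: "p n < p (Suc n)" by simp
      from IH show ?thesis
      proof
        assume "?S n = 0"
        then show ?thesis
          using lt pJ
          by (intro disjI2 exI[of _ 0] exI[of _ "\<lambda>i. if i = 0 then p n else p (Suc n)"]) (auto simp: le_Suc_eq)
      next
        assume "\<exists>k q. (\<forall>i\<le>k. q i < q (Suc i)) \<and> (\<forall>i\<le>Suc k. q i \<in> J) \<and> q (Suc k) = p n \<and>
          ?S n = (\<Sum>i\<le>k. ennreal (d (u (q i)) (u (q (Suc i)))))"
        then obtain k q where q: "\<forall>i\<le>k. q i < q (Suc i)" "\<forall>i\<le>Suc k. q i \<in> J" "q (Suc k) = p n"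
          "?S n = (\<Sum>i\<le>k. ennreal (d (u (q i)) (u (q (Suc i)))))" by blast
        define q' where "q' = q(Suc (Suc k) := p (Suc n))"
        have "(\<Sum>i\<le>k. ennreal (d (u (q' i)) (u (q' (Suc i))))) = (\<Sum>i\<le>k. ennreal (d (u (q i)) (u (q (Suc i)))))"
          by (intro sum.cong) (auto simp: q'_def)
        moreover have "q' (Suc k) = p n" "q' (Suc (Suc k)) = p (Suc n)" by (auto simp: q'_def q)
        moreover have "\<forall>i\<le>Suc k. q' i < q' (Suc i)"
          using q lt by (auto simp: q'_def le_Suc_eq)
        moreover have "\<forall>i\<le>Suc (Suc k). q' i \<in> J"
          using q pJ by (auto simp: q'_def le_Suc_eq)
        ultimately show ?thesis using q(4)
          by (intro disjI2 exI[of _ "Suc k"] exI[of _ q']) simp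
      qed
    qed
  qed simp
  then show ?thesis
    using sum_le_pvar_strict[of _ _ J d u] by fastforce
qed

text \<open>Appending \<open>s\<close> and \<open>t\<close> to a partition of the part below
  \<open>s\<close> creates at worst repeated points, which \<open>sum_le_pvar\<close> allows. This
  makes the running variation dominate every increment.\<close>

lemma pvar_append:
  assumes "s \<in> J" "t \<in> J" "s \<le> t" and u: "u \<in> J \<rightarrow> M"
  shows "pvar d u (J \<inter> {..s}) + ennreal (d (u s) (u t)) \<le> pvar d u (J \<inter> {..t})"
  unfolding pvar_def[of d u "J \<inter> {..s}"]
proof (rule SUP_add_le_ennreal, safe)
  fix k :: nat and p :: "nat \<Rightarrow> real"
  assume p: "\<forall>i\<le>k. p i < p (Suc i)" "\<forall>i\<le>Suc k. p i \<in> J \<inter> {..s}"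
  define q where "q i = (if i \<le> Suc k then p i else if i = Suc (Suc k) then s else t)" for i
  have "(\<Sum>i\<le>k. ennreal (d (u (p i)) (u (p (Suc i))))) = (\<Sum>i<Suc k. ennreal (d (u (q i)) (u (q (Suc i)))))"
    unfolding lessThan_Suc_atMost by (intro sum.cong) (auto simp: q_def)
  also have "\<dots> + ennreal (d (u s) (u t)) \<le> (\<Sum>i<Suc (Suc (Suc k)). ennreal (d (u (q i)) (u (q (Suc i)))))"
    by (simp add: q_def add_right_mono)
  also have "\<dots> \<le> pvar d u (J \<inter> {..t})"
  proof (rule sum_le_pvar)
    fix i assume "i < Suc (Suc (Suc k))"
    then consider "i \<le> k" | "i = Suc k" | "i = Suc (Suc k)" by linarith
    then show "q i \<le> q (Suc i)"
      by cases (use p assms in \<open>auto simp: q_def less_imp_le\<close>)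
  next
    fix i show "q i \<in> J \<inter> {..t}" using p assms by (auto simp: q_def)
  qed (use u in auto)
  finally show "(\<Sum>i\<le>k. ennreal (d (u (p i)) (u (p (Suc i))))) + ennreal (d (u s) (u t)) \<le> pvar d u (J \<inter> {..t})" .
next
  show "ennreal (d (u s) (u t)) \<le> pvar d u (J \<inter> {..t})"
    using sum_le_pvar[of 1 "\<lambda>i. if i = 0 then s else t" "J \<inter> {..t}" u] assms
    by (auto simp: Pi_iff split: if_splits)
qed

text \<open>The increments of \<open>G\<close> telescope along every partition. Several bounds below
  come from a suitable choice of \<open>G\<close>, often one altered by hand at a jump.\<close>

lemma pvar_le_dominated:
  assumes dom: "\<And>s t. s \<in> J \<Longrightarrow> t \<in> J \<Longrightarrow> s < t \<Longrightarrow> d (u s) (u t) \<le> G t - G s"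
    and G: "\<And>s. s \<in> J \<Longrightarrow> a \<le> G s \<and> G s \<le> b"
  shows "pvar d u J \<le> ennreal (b - a)"
proof (rule pvar_least)
  fix k :: nat and p :: "nat \<Rightarrow> real"
  assume p: "\<And>i. i \<le> k \<Longrightarrow> p i < p (Suc i)" "\<And>i. i \<le> Suc k \<Longrightarrow> p i \<in> J"
  have "(\<Sum>i\<le>k. d (u (p i)) (u (p (Suc i)))) \<le> (\<Sum>i\<le>k. G (p (Suc i)) - G (p i))"
    by (intro sum_mono dom) (use p in auto)
  also have "\<dots> = G (p (Suc k)) - G (p 0)"
    using sum_lessThan_telescope[of "\<lambda>i. G (p i)" "Suc k"] by (simp add: lessThan_Suc_atMost)
  also have "\<dots> \<le> b - a" using G[of "p (Suc k)"] G[of "p 0"] p by auto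
  finally show "(\<Sum>i\<le>k. ennreal (d (u (p i)) (u (p (Suc i))))) \<le> ennreal (b - a)"
    by (simp add: sum_ennreal ennreal_leI)
qed

text \<open>Each partition point is pushed to the right by less than the smallest gap, which keeps
  the points ordered. It serves to compare a curve with a modification of it, or with its
  restriction to a set that is dense from the right.\<close>

lemma pvar_le_right_approx:
  assumes ap: "\<And>t \<epsilon> \<delta>. t \<in> J \<Longrightarrow> 0 < \<epsilon> \<Longrightarrow> 0 < \<delta> \<Longrightarrow> \<exists>t'\<in>J'. t \<le> t' \<and> t' < t + \<delta> \<and> d (u t) (v t') < \<epsilon>"
    and u: "u \<in> J \<rightarrow> M" and v: "v \<in> J' \<rightarrow> M"
  shows "pvar d u J \<le> pvar d v J'"
proof (rule pvar_least)
  fix k :: nat and p :: "nat \<Rightarrow> real"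
  assume p: "\<And>i. i \<le> k \<Longrightarrow> p i < p (Suc i)" "\<And>i. i \<le> Suc k \<Longrightarrow> p i \<in> J"
  show "(\<Sum>i\<le>k. ennreal (d (u (p i)) (u (p (Suc i))))) \<le> pvar d v J'"
  proof (rule ennreal_le_epsilon)
    fix e :: real assume e: "0 < e"
    \<comment> \<open>There are \<open>k + 1\<close> intervals and each loses at most
      \<open>2 * \<epsilon>\<close>, one error per end point; the total is \<open>e\<close>.\<close>
    define \<epsilon> where "\<epsilon> = e / (2 * (real k + 1))"
    have \<epsilon>: "\<epsilon> > 0" using e by (simp add: \<epsilon>_def)
    define \<delta> where "\<delta> = Min ((\<lambda>i. p (Suc i) - p i) ` {..k})"
    have \<delta>: "\<delta> > 0" unfolding \<delta>_def using p by (subst Min_gr_iff) auto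
    have \<delta>le: "\<delta> \<le> p (Suc i) - p i" if "i \<le> k" for i unfolding \<delta>_def using that by (intro Min_le) auto
    have "\<forall>i\<in>{..Suc k}. \<exists>t'. t' \<in> J' \<and> p i \<le> t' \<and> t' < p i + \<delta> \<and> d (u (p i)) (v t') < \<epsilon>"
      using ap[OF p(2) \<epsilon> \<delta>] by blast
    then obtain q where q: "\<And>i. i \<le> Suc k \<Longrightarrow> q i \<in> J' \<and> p i \<le> q i \<and> q i < p i + \<delta> \<and> d (u (p i)) (v (q i)) < \<epsilon>"
      by (metis atMost_iff)
    have lt: "q i < q (Suc i)" if "i \<le> k" for i
      using \<delta>le[OF that] q[of i] q[of "Suc i"] that by auto
    have le: "d (u (p i)) (u (p (Suc i))) \<le> d (v (q i)) (v (q (Suc i))) + 2 * \<epsilon>" if i: "i \<le> k" for i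
    proof -
      have m: "u (p i) \<in> M" "u (p (Suc i)) \<in> M" "v (q i) \<in> M" "v (q (Suc i)) \<in> M"
        using i p(2)[of i] p(2)[of "Suc i"] q[of i] q[of "Suc i"] u v by auto
      have "d (u (p i)) (u (p (Suc i))) \<le> d (u (p i)) (v (q i)) + d (v (q i)) (u (p (Suc i)))"
        using triangle m by blast
      also have "d (v (q i)) (u (p (Suc i))) \<le> d (v (q i)) (v (q (Suc i))) + d (u (p (Suc i))) (v (q (Suc i)))"
        using triangle' commute m by metis
      finally show ?thesis using q[of i] q[of "Suc i"] i by auto
    qed
    have "(\<Sum>i\<le>k. d (u (p i)) (u (p (Suc i)))) \<le> (\<Sum>i\<le>k. d (v (q i)) (v (q (Suc i))) + 2 * \<epsilon>)"
      by (intro sum_mono le) auto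
    also have "\<dots> = (\<Sum>i\<le>k. d (v (q i)) (v (q (Suc i)))) + e"
      by (simp add: sum.distrib \<epsilon>_def add_divide_distrib[symmetric]) (simp add: field_simps)
    finally have "(\<Sum>i\<le>k. ennreal (d (u (p i)) (u (p (Suc i))))) \<le> (\<Sum>i\<le>k. ennreal (d (v (q i)) (v (q (Suc i))))) + ennreal e"
      using e by (simp add: sum_ennreal ennreal_leI sum_nonneg flip: ennreal_plus)
    also have "(\<Sum>i\<le>k. ennreal (d (v (q i)) (v (q (Suc i))))) \<le> pvar d v J'"
      by (rule sum_le_pvar_strict) (use lt q in auto)
    finally show "(\<Sum>i\<le>k. ennreal (d (u (p i)) (u (p (Suc i))))) \<le> pvar d v J' + ennreal e" by (simp add: add_right_mono)
  qed
qed

text \<open>Triangle inequality: skipping intermediate points of a chain only shortens it. Working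
  with indices covers both the refinement of a grid and arbitrary partitions by grid points.\<close>

lemma sum_subchain_le:
  assumes g: "\<And>i. g i \<in> M" and a: "\<And>i. i < n \<Longrightarrow> a i \<le> a (Suc i)"
  shows "(\<Sum>i<n. d (g (a i)) (g (a (Suc i)))) \<le> (\<Sum>j\<in>{a 0..<a n}. d (g j) (g (Suc j)))"
proof -
  have one: "d (g x) (g y) \<le> (\<Sum>j\<in>{x..<y}. d (g j) (g (Suc j)))" if "x \<le> y" for x y :: nat
    using that
  proof (induction y)
    case (Suc y)
    show ?case
    proof (cases "x = Suc y")
      case False
      with Suc have "x \<le> y" by simp
      with Suc have "d (g x) (g y) \<le> (\<Sum>j\<in>{x..<y}. d (g j) (g (Suc j)))" by simp
      with triangle[of "g x" "g y" "g (Suc y)"] g \<open>x \<le> y\<close> show ?thesis by simp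
    qed (simp add: g)
  qed (simp add: g)
  have "a 0 \<le> a n \<and> (\<Sum>i<n. d (g (a i)) (g (a (Suc i)))) \<le> (\<Sum>j\<in>{a 0..<a n}. d (g j) (g (Suc j)))"
    using a
  proof (induction n)
    case (Suc n)
    then have IH: "a 0 \<le> a n" "(\<Sum>i<n. d (g (a i)) (g (a (Suc i)))) \<le> (\<Sum>j\<in>{a 0..<a n}. d (g j) (g (Suc j)))" and
      le: "a n \<le> a (Suc n)" by auto
    have "(\<Sum>j\<in>{a 0..<a (Suc n)}. d (g j) (g (Suc j))) = (\<Sum>j\<in>{a 0..<a n}. d (g j) (g (Suc j))) + (\<Sum>j\<in>{a n..<a (Suc n)}. d (g j) (g (Suc j)))"
      using IH le by (simp add: sum.atLeastLessThan_concat)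
    with IH one[OF le] le show ?case by simp
  qed simp
  then show ?thesis by simp
qed

end

text \<open>Time 1 is left out because \<open>var_measure\<close> does not see a jump there. The
  closed end at \<open>t\<close> makes it the right-continuous version of
  \<open>var_fun\<close>.\<close>

definition var_upto :: "('b \<Rightarrow> 'b \<Rightarrow> real) \<Rightarrow> (real \<Rightarrow> 'b) \<Rightarrow> real \<Rightarrow> real" where
  "var_upto d u t = enn2real (pvar d u ({..t} \<inter> {0..<1}))"

text \<open>Stopping the grid at \<open>t\<close> keeps \<open>2^n\<close> summands for every
  \<open>t\<close>; those beyond \<open>t\<close> compare \<open>u t\<close> with itself.\<close>

definition dyadic_sum :: "('b \<Rightarrow> 'b \<Rightarrow> real) \<Rightarrow> (real \<Rightarrow> 'b) \<Rightarrow> real \<Rightarrow> nat \<Rightarrow> real" where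
  "dyadic_sum d u t n = (\<Sum>i<2^n. d (u (min (real i / 2^n) t)) (u (min (real (Suc i) / 2^n) t)))"

lemma emeasure_interval_measure_atMost:
  assumes "\<And>x y. x \<le> y \<Longrightarrow> F x \<le> F y" "\<And>a. continuous (at_right a) F" "\<And>t. t < 0 \<Longrightarrow> F t = 0"
  shows "emeasure (interval_measure F) {..t} = ennreal (F t)"
proof -
  define A where "A n = {- real (Suc n) <.. t}" for n
  have U: "(\<Union>n. A n) = {..t}"
  proof -
    have "\<exists>n. - real (Suc n) < x" for x :: real
      using reals_Archimedean2[of "-x"] by (metis less_Suc_eq minus_less_iff of_nat_less_iff order.strict_trans)
    then show ?thesis by (auto simp: A_def)
  qed
  have "(\<lambda>n. emeasure (interval_measure F) (A n)) \<longlonglongrightarrow> emeasure (interval_measure F) {..t}"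
    unfolding U[symmetric] by (intro Lim_emeasure_incseq) (auto simp: A_def incseq_def)
  moreover have "(\<lambda>n. emeasure (interval_measure F) (A n)) \<longlonglongrightarrow> ennreal (F t)"
  proof -
    obtain N where N: "real N > -t" using reals_Archimedean2[of "-t"] by auto
    have "emeasure (interval_measure F) (A n) = ennreal (F t)" if "N \<le> n" for n
      unfolding A_def using emeasure_interval_measure_Ioc[of "- real (Suc n)" t F] assms that N
      by (simp add: assms)
    then show ?thesis by (intro tendsto_eventually) (auto simp: eventually_sequentially)
  qed
  ultimately show ?thesis by (rule LIMSEQ_unique)
qed

section \<open>Essential and cumulative variation of right-continuous curves\<close>

context Metric_space
begin

text \<open>An epsilon-delta form of right continuity with the neighbourhood kept inside the time
  interval; it serves the curve of measures and the paths alike.\<close>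

definition right_cont :: "(real \<Rightarrow> 'a) \<Rightarrow> bool" where
  "right_cont u \<longleftrightarrow> u \<in> {0..1} \<rightarrow> M \<and>
     (\<forall>t\<in>{0..<1}. \<forall>\<epsilon>>0. \<exists>\<delta>>0. t + \<delta> \<le> 1 \<and> (\<forall>s\<in>{t..<t+\<delta>}. d (u t) (u s) < \<epsilon>))"

lemma right_contD:
  assumes "right_cont u" "0 \<le> t" "t < 1" "0 < \<epsilon>"
  obtains \<delta> where "0 < \<delta>" "t + \<delta> \<le> 1" "\<And>s. t \<le> s \<Longrightarrow> s < t + \<delta> \<Longrightarrow> d (u t) (u s) < \<epsilon>"
proof -
  have "t \<in> {0..<1}" using assms by simp
  then show ?thesis using assms(1,4) that unfolding right_cont_def by (meson atLeastLessThan_iff)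
qed

lemma right_cont_in: "right_cont u \<Longrightarrow> 0 \<le> t \<Longrightarrow> t \<le> 1 \<Longrightarrow> u t \<in> M"
  by (auto simp: right_cont_def)

lemma cadlag_right_cont:
  assumes "u \<in> cadlag M d"
  shows "right_cont u"
  unfolding right_cont_def
proof (intro conjI ballI allI impI)
  show u: "u \<in> {0..1} \<rightarrow> M" using assms by (auto simp: cadlag_def)
  fix t \<epsilon> :: real assume t: "t \<in> {0..<1}" and \<epsilon>: "0 < \<epsilon>"
  then have "limitin mtopology u (u t) (at_right t)" using assms by (auto simp: cadlag_def)
  with \<epsilon> have "eventually (\<lambda>s. u s \<in> M \<and> d (u s) (u t) < \<epsilon>) (at_right t)" by (auto simp: limitin_metric)
  then obtain b where b: "b > t" "\<And>s. t < s \<Longrightarrow> s < b \<Longrightarrow> d (u s) (u t) < \<epsilon>"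
    by (auto simp: eventually_at_right_field)
  have "d (u t) (u t) < \<epsilon>" using u t \<epsilon> by (metis Pi_mem atLeastAtMost_iff atLeastLessThan_iff less_imp_le mdist_zero)
  then show "\<exists>\<delta>>0. t + \<delta> \<le> 1 \<and> (\<forall>s\<in>{t..<t + \<delta>}. d (u t) (u s) < \<epsilon>)"
    using b t by (intro exI[of _ "min b 1 - t"]) (auto simp: commute le_less)
qed

text \<open>An interval to the right of a point of \<open>J\<close> has positive length, hence meets
  the set where \<open>v\<close> and \<open>u\<close> agree; right continuity of \<open>u\<close>
  then makes this an instance of \<open>pvar_le_right_approx\<close>. This is why a right-continuous
  curve attains its essential variation on the intervals (0,t).\<close>

lemma pvar_le_ae_eq:
  assumes u: "right_cont u" and J: "J \<subseteq> {0..<1}" and v: "v \<in> J' \<rightarrow> M" and J': "J' \<in> sets lebesgue" "J' \<subseteq> {0..1}"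
    and ae: "AE t in lebesgue_on J'. v t = u t"
    and right: "\<And>x. x \<in> J \<Longrightarrow> \<exists>\<eta>>0. {x<..<x+\<eta>} \<subseteq> J'"
  shows "pvar d u J \<le> pvar d v J'"
proof (rule pvar_le_right_approx)
  fix t \<epsilon> \<delta> :: real assume t: "t \<in> J" and \<epsilon>: "0 < \<epsilon>" and \<delta>: "0 < \<delta>"
  obtain \<delta>1 where \<delta>1: "0 < \<delta>1" "\<And>s. t \<le> s \<Longrightarrow> s < t + \<delta>1 \<Longrightarrow> d (u t) (u s) < \<epsilon>"
    using right_contD[OF u _ _ \<epsilon>, of t] t J by (metis atLeastLessThan_iff subset_iff)
  obtain \<eta> where \<eta>: "\<eta> > 0" "{t<..<t+\<eta>} \<subseteq> J'" using right[OF t] by blast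
  define m where "m = min \<delta> (min \<delta>1 \<eta>)"
  have m: "0 < m" using \<delta> \<delta>1 \<eta> by (simp add: m_def)
  have sub: "{t<..<t+m} \<subseteq> J'" using \<eta>(2) by (rule order_trans[rotated]) (auto simp: m_def)
  have AE: "AE s in lebesgue. s \<in> J' \<longrightarrow> v s = u s" using ae J' by (subst (asm) AE_restrict_space_iff) auto
  have "\<exists>s\<in>{t<..<t+m}. v s = u s"
  proof (rule ccontr)
    assume "\<not> ?thesis"
    with sub have "AE s in lebesgue. s \<notin> {t<..<t+m}" using AE by (auto elim!: eventually_mono)
    then have "{t<..<t+m} \<in> null_sets lebesgue" by (subst AE_iff_null_sets) auto
    then show False using m by (auto simp: null_sets_def)
  qed
  then obtain s where s: "t < s" "s < t + m" "v s = u s" by auto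
  then have "s \<in> J'" using sub by auto
  then show "\<exists>t'\<in>J'. t \<le> t' \<and> t' < t + \<delta> \<and> d (u t) (v t') < \<epsilon>"
    using s \<delta>1(2)[of s] by (intro bexI[of _ s]) (auto simp: m_def)
next
  show "u \<in> J \<rightarrow> M" using u J by (force simp: right_cont_def)
qed (rule v)

lemma pvar_le_right_open:
  assumes "right_cont u" "J \<subseteq> {0..<1}" "J' \<in> sets lebesgue" "J' \<subseteq> {0..1}" "\<And>x. x \<in> J \<Longrightarrow> \<exists>\<eta>>0. {x<..<x+\<eta>} \<subseteq> J'"
  shows "pvar d u J \<le> pvar d u J'"
  by (rule pvar_le_ae_eq) (use assms in \<open>auto simp: right_cont_def Pi_iff\<close>)

lemma ess_var_eq_pvar:
  assumes u: "right_cont u" and t: "t \<le> 1"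
  shows "ess_var M d u {0<..<t} = pvar d u {0<..<t}"
proof (rule antisym)
  show "ess_var M d u {0<..<t} \<le> pvar d u {0<..<t}"
    unfolding ess_var_def by (rule INF_lower) (use u t in \<open>auto simp: right_cont_def\<close>)
  show "pvar d u {0<..<t} \<le> ess_var M d u {0<..<t}"
    unfolding ess_var_def
  proof (rule INF_greatest)
    fix v assume "v \<in> {v \<in> {0<..<t} \<rightarrow> M. AE s in lebesgue_on {0<..<t}. v s = u s}"
    then show "pvar d u {0<..<t} \<le> pvar d v {0<..<t}"
    proof (intro pvar_le_ae_eq[OF u], goal_cases)
      case (6 x)
      then show ?case by (intro exI[of _ "t - x"]) auto
    qed (use t in auto)
  qed
qed

text \<open>A modification \<open>v\<close> may differ from \<open>u\<close> at 1, so only [0,1) is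
  controlled here; the jump at 1 is added in \<open>pvar_Icc01_less_top\<close>.\<close>

lemma pvar_less_top_of_ess_var:
  assumes u: "right_cont u" and "ess_var M d u {0..1} < \<infinity>"
  shows "pvar d u {0..<1} < \<infinity>"
proof -
  obtain v where v: "v \<in> {0..1} \<rightarrow> M" "AE t in lebesgue_on {0..1}. v t = u t" "pvar d v {0..1} < \<infinity>"
    using assms(2) unfolding ess_var_def by (auto simp: INF_less_iff)
  have "pvar d u {0..<1} \<le> pvar d v {0..1}"
  proof (rule pvar_le_ae_eq[OF u])
    fix x :: real assume "x \<in> {0..<1}"
    then show "\<exists>\<eta>>0. {x<..<x + \<eta>} \<subseteq> {0..1}" by (intro exI[of _ "1 - x"]) auto
  qed (use v in auto)
  with v(3) show ?thesis by order
qed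

context
  fixes u assumes u: "right_cont u" and fin: "pvar d u {0..<1} < \<infinity>"
begin

lemma ennreal_var_upto: "ennreal (var_upto d u t) = pvar d u ({..t} \<inter> {0..<1})"
proof -
  have "pvar d u ({..t} \<inter> {0..<1}) \<le> pvar d u {0..<1}" by (intro pvar_mono) auto
  with fin show ?thesis by (auto simp: var_upto_def ennreal_enn2real_if top_unique)
qed

lemma var_upto_mono: "s \<le> t \<Longrightarrow> var_upto d u s \<le> var_upto d u t"
proof -
  assume "s \<le> t"
  then have "pvar d u ({..s} \<inter> {0..<1}) \<le> pvar d u ({..t} \<inter> {0..<1})" by (intro pvar_mono) auto
  then have "ennreal (var_upto d u s) \<le> ennreal (var_upto d u t)" by (simp add: ennreal_var_upto)
  then show ?thesis by (simp add: ennreal_le_iff var_upto_def)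
qed

lemma var_upto_nonneg: "0 \<le> var_upto d u t" by (simp add: var_upto_def)

lemma var_upto_neg: "t < 0 \<Longrightarrow> var_upto d u t = 0"
proof -
  assume "t < 0"
  then have "{..t} \<inter> {0..<1} = {}" by auto
  moreover have "pvar d u {} \<le> 0" by (rule pvar_least) auto
  ultimately show ?thesis by (simp add: var_upto_def)
qed

lemma var_upto_ge1: "1 \<le> t \<Longrightarrow> var_upto d u t = var_upto d u 1"
proof -
  assume "1 \<le> t"
  then have "{..t} \<inter> {0..<1} = {..1} \<inter> {0..<1}" by auto
  then show ?thesis by (simp add: var_upto_def)
qed

lemma dist_le_var_upto:
  assumes "0 \<le> s" "s \<le> t" "t < 1"
  shows "d (u s) (u t) \<le> var_upto d u t - var_upto d u s"
proof -
  have "pvar d u ({0..<1} \<inter> {..s}) + ennreal (d (u s) (u t)) \<le> pvar d u ({0..<1} \<inter> {..t})"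
    using assms u by (intro pvar_append) (auto simp: right_cont_def)
  then have "ennreal (var_upto d u s + d (u s) (u t)) \<le> ennreal (var_upto d u t)"
    by (simp add: ennreal_var_upto Int_commute var_upto_nonneg)
  then show ?thesis using var_upto_nonneg by (simp add: ennreal_le_iff flip: ennreal_plus)
qed

text \<open>If the variation jumped by \<open>\<epsilon>\<close> to the right of \<open>t\<close>, it would still dominate the increments
  of \<open>u\<close> after this jump is removed, contradicting the minimality of the variation.\<close>

lemma var_upto_right_cont: "(var_upto d u \<longlongrightarrow> var_upto d u t) (at_right t)"
proof -
  let ?W = "var_upto d u"
  consider "t < 0" | "1 \<le> t" | "0 \<le> t" "t < 1" by linarith
  then show ?thesis
  proof cases
    case 1
    then have "eventually (\<lambda>s. ?W s = ?W t) (at_right t)"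
      unfolding eventually_at_right_field by (intro exI[of _ 0]) (auto simp: var_upto_neg)
    then show ?thesis by (rule tendsto_eventually)
  next
    case 2
    then have "eventually (\<lambda>s. ?W s = ?W t) (at_right t)"
      unfolding eventually_at_right_field
      by (intro exI[of _ "t + 1"]) (auto intro: var_upto_ge1[THEN trans] var_upto_ge1[symmetric])
    then show ?thesis by (rule tendsto_eventually)
  next
    case 3
    have ex: "\<exists>r>t. r < 1 \<and> ?W r < ?W t + \<epsilon>" if \<epsilon>: "\<epsilon> > 0" for \<epsilon>
    proof (rule ccontr)
      assume "\<not> ?thesis"
      then have jump: "?W t + \<epsilon> \<le> ?W r" if "t < r" "r < 1" for r using that by (meson not_less)
      define G where "G s = (if s \<le> t then ?W s else ?W s - \<epsilon>)" for s
      define r where "r = (t + 1) / 2"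
      have r: "t < r" "r < 1" "0 \<le> r" using 3 by (auto simp: r_def)
      have key: "d (u t) (u s) \<le> ?W s - ?W t - \<epsilon>" if s: "t < s" "s < 1" for s
      proof (rule field_le_epsilon)
        fix e :: real assume e: "0 < e"
        obtain \<delta> where \<delta>: "0 < \<delta>" "t + \<delta> \<le> 1" "\<And>s. t \<le> s \<Longrightarrow> s < t + \<delta> \<Longrightarrow> d (u t) (u s) < e"
          using right_contD[OF u 3 e] by blast
        \<comment> \<open>\<open>q\<close> is so close to \<open>t\<close> that \<open>u q\<close>
          is within \<open>e\<close> of \<open>u t\<close>, yet already beyond the supposed jump, so
          the variation from \<open>q\<close> to \<open>s\<close> has lost
          \<open>\<epsilon>\<close>.\<close>
        define q where "q = min (t + \<delta>/2) s"
        have q: "t < q" "q \<le> s" "q < t + \<delta>" using \<delta> s by (auto simp: q_def)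
        have "d (u t) (u s) \<le> d (u t) (u q) + d (u q) (u s)"
          using 3 s q by (intro triangle right_cont_in[OF u]) auto
        moreover have "d (u q) (u s) \<le> ?W s - ?W q" using 3 s q by (intro dist_le_var_upto) auto
        moreover have "?W t + \<epsilon> \<le> ?W q" using jump q s by auto
        ultimately show "d (u t) (u s) \<le> ?W s - ?W t - \<epsilon> + e" using \<delta>(3)[of q] q by auto
      qed
      have "pvar d u {0..r} \<le> ennreal (G r - 0)"
      proof (rule pvar_le_dominated)
        fix s s' assume *: "s \<in> {0..r}" "s' \<in> {0..r}" "s < s'"
        show "d (u s) (u s') \<le> G s' - G s"
        proof (cases "s \<le> t \<and> t < s'")
          case True
          have "d (u s) (u s') \<le> d (u s) (u t) + d (u t) (u s')"
            using 3 * r by (intro triangle right_cont_in[OF u]) auto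
          moreover have "d (u s) (u t) \<le> ?W t - ?W s" using * 3 True by (intro dist_le_var_upto) auto
          ultimately show ?thesis using key[of s'] * r True by (auto simp: G_def)
        next
          case False
          then show ?thesis using dist_le_var_upto[of s s'] * r by (auto simp: G_def)
        qed
      next
        fix s assume s: "s \<in> {0..r}"
        show "0 \<le> G s \<and> G s \<le> G r"
        proof (cases "s \<le> t")
          case True
          then show ?thesis using jump[of r] r var_upto_mono[of s t] by (auto simp: G_def var_upto_nonneg)
        next
          case False
          then show ?thesis using jump[of s] s r var_upto_mono[of s r] var_upto_nonneg[of t] by (auto simp: G_def)
        qed
      qed
      moreover have "{..r} \<inter> {0..<1} = {0..r}" using r by auto
      ultimately have "ennreal (?W r) \<le> ennreal (G r)" by (simp add: ennreal_var_upto)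
      moreover have "0 \<le> G r" using jump[of r] r var_upto_nonneg[of t] \<epsilon> by (auto simp: G_def)
      ultimately show False using r \<epsilon> by (simp add: ennreal_le_iff G_def)
    qed
    show ?thesis
    proof (rule order_tendstoI)
      fix a assume "a < ?W t"
      then show "eventually (\<lambda>s. a < ?W s) (at_right t)"
        unfolding eventually_at_right_field
        by (intro exI[of _ "t + 1"]) (auto intro: less_le_trans[OF _ var_upto_mono])
    next
      fix a assume "?W t < a"
      then obtain r where "r > t" "?W r < a" using ex[of "a - ?W t"] by auto
      then show "eventually (\<lambda>s. ?W s < a) (at_right t)"
        unfolding eventually_at_right_field
        by (intro exI[of _ r]) (auto intro: le_less_trans[OF var_upto_mono[OF less_imp_le]])
    qed
  qed
qed

text \<open>For \<open>t < s\<close> the value of \<open>var_fun\<close> at \<open>s\<close> lies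
  between those of \<open>var_upto\<close> at \<open>t\<close> and at \<open>s\<close>: partitions
  up to \<open>t\<close> can be moved to the right into an open interval ending at \<open>s\<close>
  or at 1. Right continuity of \<open>var_upto\<close> closes the sandwich.\<close>

lemma var_fun_tendsto: "(var_fun M d u \<longlongrightarrow> var_upto d u t) (at_right t)"
proof -
  have le: "var_fun M d u s \<le> var_upto d u s" for s
  proof -
    have "ess_var M d u {0<..<min s 1} = pvar d u {0<..<min s 1}" by (intro ess_var_eq_pvar[OF u]) auto
    also have "\<dots> \<le> pvar d u ({..s} \<inter> {0..<1})" by (intro pvar_mono) auto
    finally have "ess_var M d u {0<..<min s 1} \<le> ennreal (var_upto d u s)" by (simp add: ennreal_var_upto)
    then show ?thesis unfolding var_fun_def using var_upto_nonneg by (simp add: enn2real_leI)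
  qed
  have ge: "var_upto d u t \<le> var_fun M d u s" if "t < s" for s
  proof -
    have "pvar d u ({..t} \<inter> {0..<1}) \<le> pvar d u {0<..<min s 1}"
    proof (rule pvar_le_right_open[OF u])
      fix x assume "x \<in> {..t} \<inter> {0..<1}"
      then show "\<exists>\<eta>>0. {x<..<x + \<eta>} \<subseteq> {0<..<min s 1}" using that by (intro exI[of _ "min s 1 - x"]) auto
    qed auto
    also have "\<dots> = ess_var M d u {0<..<min s 1}" by (intro ess_var_eq_pvar[OF u, symmetric]) auto
    finally have *: "pvar d u ({..t} \<inter> {0..<1}) \<le> ess_var M d u {0<..<min s 1}" .
    have "ess_var M d u {0<..<min s 1} = pvar d u {0<..<min s 1}" by (intro ess_var_eq_pvar[OF u]) auto
    also have "\<dots> \<le> pvar d u {0..<1}" by (intro pvar_mono) auto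
    finally have "ess_var M d u {0<..<min s 1} < top" using fin by (simp add: order.strict_trans1)
    with * show ?thesis unfolding var_fun_def var_upto_def by (intro enn2real_mono) auto
  qed
  show ?thesis
    by (rule tendsto_sandwich[OF _ _ tendsto_const var_upto_right_cont])
      (auto simp: eventually_at_right_field le intro!: exI[of _ "t+1"] ge)
qed

lemma Lim_var_fun: "Lim (at_right t) (var_fun M d u) = var_upto d u t"
  by (intro tendsto_Lim var_fun_tendsto) simp

lemma var_measure_eq: "var_measure M d u = restrict_space (interval_measure (var_upto d u)) {0..1}"
  by (simp add: var_measure_def Lim_var_fun)

lemma var_upto_continuous: "continuous (at_right t) (var_upto d u)"
  using var_upto_right_cont by (simp add: continuous_within)

lemma emeasure_var_measure:
  "A \<subseteq> {0..1} \<Longrightarrow> emeasure (var_measure M d u) A = emeasure (interval_measure (var_upto d u)) A"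
  by (simp add: var_measure_eq emeasure_restrict_space)

lemma emeasure_var_upto_atMost: "emeasure (interval_measure (var_upto d u)) {..t} = ennreal (var_upto d u t)"
  by (rule emeasure_interval_measure_atMost) (auto intro: var_upto_mono var_upto_continuous var_upto_neg)

lemma pvar_Icc01_less_top: "pvar d u {0..1} < \<infinity>"
proof -
  \<comment> \<open>The jump of \<open>G\<close> at 1 has to pay for \<open>d (u s) (u 1)\<close>,
    which is at most \<open>d (u 0) (u s) + d (u 0) (u 1)\<close>; the second copy of
    \<open>var_upto d u 1\<close> covers the first term uniformly in \<open>s\<close>.\<close>
  define G where "G s = (if s < 1 then var_upto d u s else 2 * var_upto d u 1 + d (u 0) (u 1))" for s
  have "pvar d u {0..1} \<le> ennreal (G 1 - 0)"
  proof (rule pvar_le_dominated)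
    fix s t :: real assume *: "s \<in> {0..1}" "t \<in> {0..1}" "s < t"
    show "d (u s) (u t) \<le> G t - G s"
    proof (cases "t < 1")
      case True then show ?thesis using * dist_le_var_upto[of s t] by (auto simp: G_def)
    next
      case False
      then have t: "t = 1" "s < 1" using * by auto
      have "d (u s) (u 1) \<le> d (u 0) (u s) + d (u 0) (u 1)"
        using * by (intro triangle'' right_cont_in[OF u]) auto
      then show ?thesis using dist_le_var_upto[of 0 s] * t var_upto_mono[of s 1] var_upto_nonneg[of 0] by (auto simp: G_def)
    qed
  next
    fix s :: real assume "s \<in> {0..1}"
    then show "0 \<le> G s \<and> G s \<le> G 1"
      using var_upto_nonneg[of s] var_upto_nonneg[of 1] var_upto_mono[of s 1]
      by (auto simp: G_def intro!: add_nonneg_nonneg add_increasing2)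
  qed
  also have "\<dots> < \<infinity>" by simp
  finally show ?thesis .
qed

end

lemma cadlag_BV_right_cont:
  assumes "u \<in> cadlag_BV M d"
  shows "right_cont u" "pvar d u {0..<1} < \<infinity>"
proof -
  show "right_cont u" using assms cadlag_right_cont by (auto simp: cadlag_BV_def)
  then show "pvar d u {0..<1} < \<infinity>" using assms pvar_less_top_of_ess_var by (auto simp: cadlag_BV_def)
qed

section \<open>Variation as the limit of dyadic sums\<close>

lemma sum_dyadic_eq: "ennreal (dyadic_sum d u t n) =
    (\<Sum>i<2^n. ennreal (d (u (min (real i / 2^n) t)) (u (min (real (Suc i) / 2^n) t))))"
  by (simp add: dyadic_sum_def sum_ennreal)

text \<open>The grid of level \<open>n\<close> consists of every second point of the grid of level
  \<open>n + 1\<close>.\<close>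

lemma dyadic_sum_incseq:
  assumes "u \<in> {0..1} \<rightarrow> M" "t \<in> {0..1}"
  shows "incseq (dyadic_sum d u t)"
proof (rule incseq_SucI)
  fix n
  define g where "g j = u (min (real j / 2 ^ Suc n) t)" for j
  have g: "g j \<in> M" for j unfolding g_def using assms by (auto simp: Pi_iff)
  have "dyadic_sum d u t n = (\<Sum>i<2^n. d (g (2 * i)) (g (2 * Suc i)))"
  proof -
    have "real (2 * i) / 2 ^ Suc n = real i / 2^n" for i by simp
    then show ?thesis unfolding dyadic_sum_def g_def by (simp only: )
  qed
  also have "\<dots> \<le> (\<Sum>j\<in>{2 * 0..<2 * 2^n}. d (g j) (g (Suc j)))"
    by (rule sum_subchain_le[where a="\<lambda>i. 2 * i"]) (use g in auto)
  also have "\<dots> = dyadic_sum d u t (Suc n)"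
    unfolding dyadic_sum_def g_def by (simp add: atLeast0LessThan)
  finally show "dyadic_sum d u t n \<le> dyadic_sum d u t (Suc n)" .
qed

lemma dyadic_sum_le_pvar:
  assumes "u \<in> {0..1} \<rightarrow> M" "t \<in> {0..1}"
  shows "ennreal (dyadic_sum d u t n) \<le> pvar d u {0..t}"
  unfolding sum_dyadic_eq
  by (rule sum_le_pvar[of "2^n" "\<lambda>i. min (real i / 2^n) t"]) (use assms in \<open>auto simp: min_le_iff_disj divide_right_mono\<close>)

text \<open>Finitely many dyadic points have a common level \<open>m\<close>, so the partition is a
  subchain of one dyadic grid. Only values at dyadic times and at \<open>t\<close> enter, which lets
  it apply to a process that is meaningful on the dyadics alone.\<close>

lemma pvar_dyadics_le:
  assumes u: "u \<in> J \<rightarrow> M" and u01: "\<And>n i. u (min (real i / 2^n) t) \<in> M" and t: "t \<in> {0..1}"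
    and J: "\<And>x. x \<in> J \<Longrightarrow> x = t \<or> (\<exists>n i. x = real i / 2^n \<and> x \<le> t)"
  shows "pvar d u J \<le> (SUP n. ennreal (dyadic_sum d u t n))"
proof (rule pvar_least)
  fix k p assume p: "\<And>i. i \<le> k \<Longrightarrow> p i < p (Suc i)" "\<And>i. i \<le> Suc k \<Longrightarrow> p i \<in> J"
  have "\<forall>i\<in>{..Suc k}. \<exists>n. p i = t \<or> (\<exists>j. p i = real j / 2^n \<and> p i \<le> t)" using J p(2) by blast
  then obtain N where N: "\<And>i. i \<le> Suc k \<Longrightarrow> p i = t \<or> (\<exists>j. p i = real j / 2^(N i) \<and> p i \<le> t)"
    by (metis atMost_iff)
  define m where "m = Max (N ` {..Suc k})"
  have Nm: "N i \<le> m" if "i \<le> Suc k" for i unfolding m_def using that by (intro Max_ge) auto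
  have rep: "p i = t \<or> (\<exists>j. p i = real j / 2^m \<and> p i \<le> t)" if i: "i \<le> Suc k" for i
  proof (cases "p i = t")
    case False
    then obtain j where j: "p i = real j / 2^(N i)" "p i \<le> t" using N[OF i] by blast
    have "real j / 2^(N i) = real (j * 2^(m - N i)) / 2^m"
      using Nm[OF i] by (simp add: field_simps flip: power_add)
    with j show ?thesis by metis
  qed simp
  \<comment> \<open>The ceiling sends a dyadic \<open>p i\<close> to its exact index, and
    \<open>t\<close> to the first index at or beyond \<open>t\<close>, where the stopped grid takes
    the value \<open>t\<close>.\<close>
  define a where "a i = nat \<lceil>p i * 2^m\<rceil>" for i
  define g where "g j = u (min (real j / 2 ^ m) t)" for j
  have ug: "u (p i) = g (a i)" if "i \<le> Suc k" for i
    using rep[OF that]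
  proof
    assume *: "p i = t"
    have "t \<le> real (nat \<lceil>t * 2^m\<rceil>) / 2^m"
      using real_nat_ceiling_ge[of "t * 2^m"] by (simp add: field_simps)
    with * show ?thesis by (simp add: g_def a_def min_def)
  next
    assume "\<exists>j. p i = real j / 2^m \<and> p i \<le> t"
    then obtain j where "p i = real j / 2^m" "p i \<le> t" by blast
    then show ?thesis by (simp add: g_def a_def min_def)
  qed
  have p1: "p i \<le> 1" if "i \<le> Suc k" for i using rep[OF that] t by (metis atLeastAtMost_iff order_trans order_refl)
  have "(\<Sum>i\<le>k. d (u (p i)) (u (p (Suc i)))) = (\<Sum>i<Suc k. d (g (a i)) (g (a (Suc i))))"
    unfolding lessThan_Suc_atMost by (intro sum.cong) (auto simp: ug)
  also have "\<dots> \<le> (\<Sum>j\<in>{a 0..<a (Suc k)}. d (g j) (g (Suc j)))"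
  proof (rule sum_subchain_le)
    fix i assume "i < Suc k"
    then have "p i \<le> p (Suc i)" using p(1)[of i] by auto
    then show "a i \<le> a (Suc i)" unfolding a_def by (intro nat_mono ceiling_mono mult_right_mono) auto
  qed (use u01 in \<open>auto simp: g_def\<close>)
  also have "\<dots> \<le> (\<Sum>j<2^m. d (g j) (g (Suc j)))"
  proof (rule sum_mono2)
    have "p (Suc k) * 2^m \<le> 2^m" using p1[of "Suc k"] by simp
    then have "\<lceil>p (Suc k) * 2^m\<rceil> \<le> 2^m" by (subst ceiling_le_iff) simp
    then have "a (Suc k) \<le> 2^m" unfolding a_def by (simp add: nat_le_iff)
    then show "{a 0..<a (Suc k)} \<subseteq> {..<2^m}" by auto
  qed auto
  also have "\<dots> = dyadic_sum d u t m" by (simp add: dyadic_sum_def g_def)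
  finally have "(\<Sum>i\<le>k. ennreal (d (u (p i)) (u (p (Suc i))))) \<le> ennreal (dyadic_sum d u t m)"
    by (simp add: sum_ennreal ennreal_leI)
  also have "\<dots> \<le> (SUP n. ennreal (dyadic_sum d u t n))" by (rule SUP_upper) simp
  finally show "(\<Sum>i\<le>k. ennreal (d (u (p i)) (u (p (Suc i))))) \<le> (SUP n. ennreal (dyadic_sum d u t n))" .
qed

text \<open>The dyadic points up to \<open>t\<close> together with \<open>t\<close> itself
  approximate every point of [0,t] from the right; the end point is kept because nothing of [0,t]
  lies to its right.\<close>

lemma pvar_eq_SUP_dyadic:
  assumes u: "right_cont u" and t: "t \<in> {0..1}"
  shows "pvar d u {0..t} = (SUP n. ennreal (dyadic_sum d u t n))"
proof (rule antisym)
  define J where "J = {x. x = t \<or> (\<exists>n i. x = real i / 2^n \<and> x \<le> t)}"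
  have J01: "J \<subseteq> {0..1}"
  proof
    fix x assume "x \<in> J"
    then have "0 \<le> x" "x \<le> t" using t unfolding J_def by auto
    then show "x \<in> {0..1}" using t by auto
  qed
  have uM: "u \<in> {0..1} \<rightarrow> M" using u by (simp add: right_cont_def)
  have "pvar d u {0..t} \<le> pvar d u J"
  proof (rule pvar_le_right_approx)
    fix x \<epsilon> \<delta> :: real assume x: "x \<in> {0..t}" "0 < \<epsilon>" "0 < \<delta>"
    show "\<exists>t'\<in>J. x \<le> t' \<and> t' < x + \<delta> \<and> d (u x) (u t') < \<epsilon>"
    proof (cases "x = t")
      case True
      then show ?thesis using x t uM by (intro bexI[of _ t]) (auto simp: J_def Pi_iff)
    next
      case False
      then have x1: "x < 1" "x < t" "0 \<le> x" using x t by auto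
      obtain \<delta>1 where \<delta>1: "0 < \<delta>1" "x + \<delta>1 \<le> 1" "\<And>s. x \<le> s \<Longrightarrow> s < x + \<delta>1 \<Longrightarrow> d (u x) (u s) < \<epsilon>"
        using right_contD[OF u x1(3,1) x(2)] by blast
      define m where "m = min (min \<delta> \<delta>1) (t - x)"
      have m: "m > 0" using x \<delta>1 x1 by (simp add: m_def)
      obtain n where n: "(1/2)^n < m" using real_arch_pow_inv[of m "1/2"] m by auto
      \<comment> \<open>Adding 1 to the floor puts the grid point strictly to the right of
        \<open>x\<close>, at distance at most \<open>(1/2)^n\<close>.\<close>
      define i where "i = nat (\<lfloor>x * 2^n\<rfloor> + 1)"
      have ri: "real i = of_int \<lfloor>x * 2^n\<rfloor> + 1" using x1 by (simp add: i_def)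
      have "x * 2^n < real i" "real i \<le> x * 2^n + 1" unfolding ri by linarith+
      then have "x < real i / 2^n" "real i / 2^n \<le> x + (1/2)^n"
        by (auto simp: field_simps)
      then have "real i / 2^n \<in> J" "x \<le> real i / 2^n" "real i / 2^n < x + \<delta>" "real i / 2^n < x + \<delta>1"
        using n by (auto simp: J_def m_def)
      then show ?thesis using \<delta>1(3) by blast
    qed
  qed (use uM J01 t in \<open>auto simp: Pi_iff\<close>)
  also have "\<dots> \<le> (SUP n. ennreal (dyadic_sum d u t n))"
    by (rule pvar_dyadics_le) (use uM J01 t in \<open>auto simp: J_def Pi_iff\<close>)
  finally show "pvar d u {0..t} \<le> (SUP n. ennreal (dyadic_sum d u t n))" .
  show "(SUP n. ennreal (dyadic_sum d u t n)) \<le> pvar d u {0..t}"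
    by (rule SUP_least) (rule dyadic_sum_le_pvar[OF uM t])
qed

end

section \<open>Differentiation of finite measures on the line\<close>

text \<open>Vitali covering: \<open>A\<close> has an open neighbourhood \<open>U\<close> of small
  mass. The points in question are covered, up to a null set, by disjoint balls inside
  \<open>U\<close>, each of length \<open>2 * h\<close> and mass above \<open>c * h\<close>, so
  their total length is at most \<open>2 / c\<close> times the mass of \<open>U\<close>.\<close>

lemma AE_not_null_imp:
  fixes N :: "real measure"
  assumes N: "finite_measure N" "sets N = sets borel" and A: "A \<in> sets borel" "emeasure N A = 0" and c: "0 < c"
  shows "negligible {t\<in>A. \<forall>\<delta>>0. \<exists>h. 0 < h \<and> h < \<delta> \<and> c * h < measure N (cball t h)}" (is "negligible ?E")
  unfolding negligible_outer_le
proof (intro allI impI)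
  interpret finite_measure N by fact
  fix e :: real assume e: "0 < e"
  have "emeasure N A = (INF U\<in>{U. A \<subseteq> U \<and> open U}. emeasure N U)"
    by (rule outer_regular) (use N A emeasure_finite in auto)
  \<comment> \<open>The bound on the mass of \<open>U\<close> cancels the factor
    \<open>2 / c\<close> of the covering estimate.\<close>
  then have "(INF U\<in>{U. A \<subseteq> U \<and> open U}. emeasure N U) < ennreal (e * c / 2)" using A(2) e c by simp
  then obtain U where U: "A \<subseteq> U" "open U" "emeasure N U < ennreal (e * c / 2)" by (auto simp: INF_less_iff)
  \<comment> \<open>The covering is indexed by pairs of centre and radius, since one centre has many
    admissible radii.\<close>
  define K where "K = {(t, h). t \<in> A \<and> 0 < h \<and> cball t h \<subseteq> U \<and> c * h < measure N (cball t h)}"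
  have r: "0 < snd i" if "i \<in> K" for i using that by (auto simp: K_def)
  have cover: "\<exists>i. i \<in> K \<and> x \<in> cball (fst i) (snd i) \<and> snd i < \<delta>" if x: "x \<in> ?E" and \<delta>: "0 < \<delta>" for x \<delta>
  proof -
    have "x \<in> U" using x U(1) by auto
    then obtain \<delta>' where \<delta>': "\<delta>' > 0" "ball x \<delta>' \<subseteq> U" using U(2) open_contains_ball by metis
    have "0 < min \<delta> \<delta>'" using \<delta> \<delta>'(1) by simp
    then obtain h where h: "0 < h" "h < min \<delta> \<delta>'" "c * h < measure N (cball x h)" using x by blast
    have "cball x h \<subseteq> U"
    proof (rule subset_trans[OF _ \<delta>'(2)])
      show "cball x h \<subseteq> ball x \<delta>'" using h by auto
    qed
    then show "\<exists>i. i \<in> K \<and> x \<in> cball (fst i) (snd i) \<and> snd i < \<delta>"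
      using x h by (intro exI[of _ "(x, h)"]) (auto simp: K_def)
  qed
  obtain C where C: "countable C" "C \<subseteq> K" "pairwise (\<lambda>i j. disjnt (cball (fst i) (snd i)) (cball (fst j) (snd j))) C"
    "negligible (?E - (\<Union>i \<in> C. cball (fst i) (snd i)))"
    using Vitali_covering_theorem_cballs[of K snd ?E fst, OF r cover] by blast
  let ?B = "\<lambda>i. cball (fst i) (snd i) :: real set"
  let ?V = "\<Union>i\<in>C. ?B i"
  have disj: "disjoint_family_on ?B C"
    using C(3) by (auto simp: disjoint_family_on_def pairwise_def disjnt_def)
  have "emeasure lborel ?V = (\<integral>\<^sup>+i. emeasure lborel (?B i) \<partial>count_space C)"
    by (rule emeasure_UN_countable) (use C disj in auto)
  also have "\<dots> \<le> (\<integral>\<^sup>+i. ennreal (2 / c) * emeasure N (?B i) \<partial>count_space C)"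
  proof (rule nn_integral_mono)
    fix i assume "i \<in> space (count_space C)"
    then have i: "0 < snd i" "c * snd i < measure N (?B i)" using C(2) by (auto simp: K_def)
    then have "2 * snd i \<le> 2 / c * measure N (?B i)" using c by (simp add: field_simps)
    moreover have "emeasure lborel (?B i) = ennreal (2 * snd i)"
      using i by (simp add: cball_eq_atLeastAtMost)
    ultimately show "emeasure lborel (?B i) \<le> ennreal (2 / c) * emeasure N (?B i)"
      using c by (simp add: emeasure_eq_measure ennreal_leI flip: ennreal_mult)
  qed
  also have "\<dots> = ennreal (2 / c) * emeasure N ?V"
    by (subst nn_integral_cmult, simp, subst emeasure_UN_countable) (use C disj N in auto)
  also have "\<dots> \<le> ennreal (2 / c) * emeasure N U"
  proof (intro mult_left_mono emeasure_mono UN_least)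
    fix i assume "i \<in> C"
    then have "i \<in> K" using C(2) by auto
    then show "?B i \<subseteq> U" by (cases i) (simp add: K_def)
  qed (use N U in auto)
  also have "\<dots> \<le> ennreal (2 / c) * ennreal (e * c / 2)" using U by (intro mult_left_mono) auto
  also have "\<dots> = ennreal e" using c e by (simp flip: ennreal_mult)
  finally have V: "emeasure lborel ?V \<le> ennreal e" .
  have Vs: "?V \<in> sets borel" using C(1) by (intro sets.countable_UN') auto
  have Vm: "?V \<in> lmeasurable"
    using V Vs by (intro fmeasurableI) (auto simp: order.strict_trans1)
  have "measure lebesgue ?V \<le> e" using V Vs e by (auto simp: measure_def intro!: enn2real_leI)
  moreover define D where "D = ?E - ?V"
  moreover have D: "D \<in> lmeasurable" "measure lebesgue D = 0"
    using C(4) by (auto simp: D_def intro: negligible_imp_measurable negligible_imp_measure0)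
  moreover have "measure lebesgue (D \<union> ?V) \<le> measure lebesgue D + measure lebesgue ?V"
    by (rule measure_Un_le) (use D(1) Vm in \<open>auto dest: fmeasurableD\<close>)
  moreover have "D \<union> ?V \<in> lmeasurable" using D(1) Vm by (rule fmeasurable.Un)
  ultimately show "\<exists>T. ?E \<subseteq> T \<and> T \<in> lmeasurable \<and> measure lebesgue T \<le> e"
    by (intro exI[of _ "D \<union> ?V"]) auto
qed

text \<open>The exceptional sets for the thresholds \<open>1 / (n + 1)\<close> are null, and these
  countably many sets exhaust the points of \<open>A\<close> where the quotient fails to tend to
  zero.\<close>

lemma AE_null_density_zero:
  fixes N :: "real measure"
  assumes N: "finite_measure N" "sets N = sets borel" and A: "A \<in> sets borel" "emeasure N A = 0"
  shows "AE t in lborel. t \<in> A \<longrightarrow> ((\<lambda>h. measure N (cball t \<bar>h\<bar>) / \<bar>h\<bar>) \<longlongrightarrow> 0) (at 0)"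
proof -
  let ?E = "\<lambda>c. {t\<in>A. \<forall>\<delta>>0. \<exists>h. 0 < h \<and> h < \<delta> \<and> c * h < measure N (cball t h)}"
  have "AE t in lebesgue. t \<notin> ?E (1 / real (Suc n))" for n
    using AE_not_null_imp[OF assms, of "1 / real (Suc n)"]
    by (subst AE_iff_null_sets[symmetric]) (auto simp: negligible_iff_null_sets)
  then have "AE t in lborel. \<forall>n. t \<notin> ?E (1 / real (Suc n))"
    unfolding AE_completion_iff by (subst AE_all_countable) simp
  then show ?thesis
  proof eventually_elim
    case (elim t)
    show ?case
    proof
      assume tA: "t \<in> A"
      show "((\<lambda>h. measure N (cball t \<bar>h\<bar>) / \<bar>h\<bar>) \<longlongrightarrow> 0) (at 0)"
      proof (rule order_tendstoI)
        fix a :: real assume "a < 0"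
        then show "eventually (\<lambda>h. a < measure N (cball t \<bar>h\<bar>) / \<bar>h\<bar>) (at 0)"
          by (intro always_eventually allI) (auto intro: less_le_trans)
      next
        fix a :: real assume "0 < a"
        then obtain n where n: "1 / real (Suc n) < a" using reals_Archimedean by (metis inverse_eq_divide)
        have "\<not> (\<forall>\<delta>>0. \<exists>h. 0 < h \<and> h < \<delta> \<and> 1 / real (Suc n) * h < measure N (cball t h))"
          using elim[rule_format, of n] tA by blast
        then obtain \<delta> where \<delta>: "\<delta> > 0" "\<And>h. 0 < h \<Longrightarrow> h < \<delta> \<Longrightarrow> measure N (cball t h) \<le> 1 / real (Suc n) * h"
          by (meson not_less)
        show "eventually (\<lambda>h. measure N (cball t \<bar>h\<bar>) / \<bar>h\<bar> < a) (at 0)"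
          unfolding eventually_at
        proof (intro exI[of _ \<delta>] conjI ballI impI)
          fix h :: real assume "h \<noteq> 0 \<and> dist h 0 < \<delta>"
          then have h: "0 < \<bar>h\<bar>" "\<bar>h\<bar> < \<delta>" by auto
          have "measure N (cball t \<bar>h\<bar>) / \<bar>h\<bar> \<le> 1 / real (Suc n)"
            using \<delta>(2)[OF h] h(1) by (simp add: divide_le_eq del: of_nat_Suc)
          with n show "measure N (cball t \<bar>h\<bar>) / \<bar>h\<bar> < a" by linarith
        qed (use \<delta> in auto)
      qed
    qed
  qed
qed

text \<open>The singular part is the restriction of \<open>N\<close> to the null set
  \<open>Z\<close>, so only a real density and a set have to be carried around.\<close>

definition lebesgue_decomp :: "real measure \<Rightarrow> (real \<Rightarrow> real) \<Rightarrow> real set \<Rightarrow> bool" where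
  "lebesgue_decomp N f Z \<longleftrightarrow> f \<in> borel_measurable borel \<and> (\<forall>x. 0 \<le> f x) \<and> Z \<in> null_sets lborel \<and>
     (\<forall>A\<in>sets borel. emeasure N A = (\<integral>\<^sup>+x\<in>A. ennreal (f x) \<partial>lborel) + emeasure N (A \<inter> Z))"

text \<open>The singular part lives on a Lebesgue null set of maximal mass.\<close>

lemma lebesgue_decomp_exists:
  fixes N :: "real measure"
  assumes N: "finite_measure N" "sets N = sets borel"
  obtains f Z where "lebesgue_decomp N f Z"
proof -
  interpret finite_measure N by fact
  let ?S = "emeasure N ` null_sets lborel"
  have "?S \<noteq> {}" by blast
  then obtain g :: "nat \<Rightarrow> ennreal" where g: "range g \<subseteq> ?S" "Sup ?S = (SUP i. g i)"
    using ennreal_Sup_countable_SUP by metis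
  then have "\<forall>i. \<exists>Y. Y \<in> null_sets lborel \<and> g i = emeasure N Y" by blast
  then obtain Y where Y: "\<And>i. Y i \<in> null_sets lborel" "\<And>i. g i = emeasure N (Y i)" by metis
  define Z where "Z = (\<Union>i. Y i)"
  have Z: "Z \<in> null_sets lborel" unfolding Z_def by (rule null_sets_UN) (rule Y)
  then have Zs[measurable]: "Z \<in> sets borel" by (auto simp: null_sets_def)
  have Ys: "Y i \<in> sets borel" for i using Y(1)[of i] by (auto simp: null_sets_def)
  have max: "emeasure N B \<le> emeasure N Z" if "B \<in> null_sets lborel" for B
  proof -
    have "emeasure N B \<le> Sup ?S" using that by (intro Sup_upper) auto
    also have "\<dots> \<le> emeasure N Z"
      unfolding g(2) Y(2) by (intro SUP_least emeasure_mono) (auto simp: Z_def N Ys intro!: sets.countable_UN)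
    finally show ?thesis .
  qed
  define N' where "N' = density N (indicator (- Z))"
  have N'e: "emeasure N' A = emeasure N (A - Z)" if "A \<in> sets borel" for A
    unfolding N'_def using that N by (subst emeasure_density) (auto simp: nn_integral_indicator[symmetric] indicator_inter_arith[symmetric] Diff_eq Int_commute simp del: nn_integral_indicator intro!: nn_integral_cong split: split_indicator)
  \<comment> \<open>Adding \<open>B - Z\<close> to \<open>Z\<close> gives another null set;
    maximality and finiteness leave no mass for \<open>B - Z\<close>.\<close>
  have "absolutely_continuous lborel N'"
    unfolding absolutely_continuous_def
  proof
    fix B :: "real set" assume B: "B \<in> null_sets lborel"
    then have Bs[measurable]: "B \<in> sets borel" by (auto simp: null_sets_def)
    have "emeasure N (Z \<union> (B - Z)) \<le> emeasure N Z"
    proof (rule max)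
      have "Z \<union> B \<in> null_sets lborel" using Z B by blast
      then show "Z \<union> (B - Z) \<in> null_sets lborel" by simp
    qed
    also have "emeasure N (Z \<union> (B - Z)) = emeasure N Z + emeasure N (B - Z)"
      using N by (intro plus_emeasure[symmetric]) auto
    finally have "emeasure N (B - Z) = 0"
      by (simp add: emeasure_eq_measure measure_le_0_iff ennreal_le_iff flip: ennreal_plus)
    then show "B \<in> null_sets N'" using Bs N by (simp add: null_sets_def N'e) (simp add: N'_def)
  qed
  then obtain f where f: "f \<in> borel_measurable lborel" "density lborel f = N'"
    using sigma_finite_measure.Radon_Nikodym[OF sigma_finite_lborel, of N'] N by (auto simp: N'_def)
  have "emeasure (density lborel f) UNIV = (\<integral>\<^sup>+x. f x \<partial>lborel)"
    using f(1) by (subst emeasure_density) auto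
  then have "(\<integral>\<^sup>+x. f x \<partial>lborel) = emeasure N' UNIV" by (simp only: f(2))
  also have "\<dots> < \<infinity>" by (simp add: N'e emeasure_eq_measure)
  finally have "AE x in lborel. f x \<noteq> \<infinity>" using f by (intro nn_integral_PInf_AE) auto
  then have fr: "AE x in lborel. f x = ennreal (enn2real (f x))"
    by eventually_elim (auto simp: less_top[symmetric])
  have "lebesgue_decomp N (\<lambda>x. enn2real (f x)) Z"
    unfolding lebesgue_decomp_def
  proof (intro conjI ballI allI)
    fix A :: "real set" assume A[measurable]: "A \<in> sets borel"
    have "emeasure N A = emeasure N (A - Z) + emeasure N (A \<inter> Z)"
      using N by (subst plus_emeasure) (auto intro!: arg_cong[where f="emeasure N"])
    also have "emeasure N (A - Z) = (\<integral>\<^sup>+x\<in>A. f x \<partial>lborel)"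
      using f A by (simp add: N'e[symmetric] f(2)[symmetric] emeasure_density)
    also have "\<dots> = (\<integral>\<^sup>+x\<in>A. ennreal (enn2real (f x)) \<partial>lborel)"
      by (intro nn_integral_cong_AE) (use fr in eventually_elim, simp)
    finally show "emeasure N A = (\<integral>\<^sup>+x\<in>A. ennreal (enn2real (f x)) \<partial>lborel) + emeasure N (A \<inter> Z)" .
  qed (use f Z in auto)
  then show ?thesis by (rule that)
qed

text \<open>For rational \<open>q\<close>, the excess of \<open>f\<close> over \<open>q\<close>
  vanishes where \<open>f \<le> q\<close>, the deficit below \<open>q\<close> vanishes where
  \<open>q \<le> f\<close>, and the singular part vanishes off \<open>Z\<close>;
  \<open>AE_null_density_zero\<close> gives each of them density zero at almost every such point.
  Squeezing \<open>f t\<close> between rationals yields the limit. The sets \<open>I h\<close> are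
  constrained only by size and nearness to \<open>t\<close>, and the exceptional null set does not
  depend on them, so half-open and closed intervals on either side are covered at once.\<close>

lemma lebesgue_decomp_AE_derivative:
  fixes N :: "real measure"
  assumes N: "finite_measure N" "sets N = sets borel" and dec: "lebesgue_decomp N f Z"
  shows "AE t in lborel. t \<in> {0<..<1} \<longrightarrow>
    (\<forall>I. (\<forall>h. I h \<in> sets borel \<and> I h \<subseteq> cball t \<bar>h\<bar> \<and> emeasure lborel (I h) = ennreal \<bar>h\<bar>) \<longrightarrow>
      ((\<lambda>h. measure N (I h) / \<bar>h\<bar>) \<longlongrightarrow> f t) (at 0))"
proof -
  interpret finite_measure N by fact
  have f[measurable]: "f \<in> borel_measurable borel" and f0: "\<And>x. 0 \<le> f x" and Z: "Z \<in> null_sets lborel"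
    and Ne: "\<And>A. A \<in> sets borel \<Longrightarrow> emeasure N A = (\<integral>\<^sup>+x\<in>A. ennreal (f x) \<partial>lborel) + emeasure N (A \<inter> Z)"
    using dec by (auto simp: lebesgue_decomp_def)
  have [measurable]: "Z \<in> sets borel" using Z by (auto simp: null_sets_def)
  have fint: "(\<integral>\<^sup>+x. ennreal (f x) \<partial>lborel) < \<infinity>"
    using Ne[of UNIV] by (simp add: emeasure_eq_measure) (metis ennreal_add_eq_top ennreal_neq_top less_top)
  define S where "S = density N (indicator Z)"
  have Se: "emeasure S A = emeasure N (A \<inter> Z)" if "A \<in> sets borel" for A
    unfolding S_def using that N
    by (subst emeasure_density) (auto simp: nn_integral_indicator[symmetric] simp del: nn_integral_indicator intro!: nn_integral_cong split: split_indicator)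
  define P where "P q = density lborel (\<lambda>x. ennreal (max 0 (f x - q)))" for q
  \<comment> \<open>The cut to [0,1] keeps the deficit measure finite.\<close>
  define R where "R q = density lborel (\<lambda>x. ennreal (max 0 (q - f x)) * indicator {0..1} x)" for q
  have Sfin: "finite_measure S"
  proof (rule finite_measureI)
    have "space S = UNIV" using N by (auto simp: S_def dest: sets_eq_imp_space_eq)
    then show "emeasure S (space S) \<noteq> \<infinity>" by (simp add: Se emeasure_eq_measure)
  qed
  have Pfin: "finite_measure (P q)" if "0 \<le> q" for q
  proof (rule finite_measureI)
    have "emeasure (P q) (space (P q)) \<le> (\<integral>\<^sup>+x. ennreal (f x) \<partial>lborel)"
      unfolding P_def using that f0 by (subst emeasure_density) (auto intro!: nn_integral_mono ennreal_leI split: split_indicator)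
    then show "emeasure (P q) (space (P q)) \<noteq> \<infinity>" using fint by (auto simp: top_unique)
  qed
  have Rfin: "finite_measure (R q)" if "0 \<le> q" for q
  proof (rule finite_measureI)
    have "emeasure (R q) (space (R q)) \<le> (\<integral>\<^sup>+x. ennreal q * indicator {0..1::real} x \<partial>lborel)"
      unfolding R_def using that f0 by (subst emeasure_density) (auto intro!: nn_integral_mono ennreal_leI split: split_indicator)
    also have "\<dots> < \<infinity>" by (subst nn_integral_cmult_indicator) auto
    finally show "emeasure (R q) (space (R q)) \<noteq> \<infinity>" by auto
  qed
  have sets: "sets S = sets borel" "sets (P q) = sets borel" "sets (R q) = sets borel" for q
    by (auto simp: S_def P_def R_def N)
  let ?lim = "\<lambda>(M :: real measure) (t :: real). ((\<lambda>h. measure M (cball t \<bar>h\<bar>) / \<bar>h\<bar>) \<longlongrightarrow> 0) (at 0)"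
  have 1: "AE t in lborel. t \<in> - Z \<longrightarrow> ?lim S t"
    by (rule AE_null_density_zero) (auto simp: Sfin sets Se)
  have 2: "AE t in lborel. \<forall>q\<in>\<rat>. 0 \<le> q \<longrightarrow> t \<in> {x. f x \<le> q} \<longrightarrow> ?lim (P q) t"
  proof (subst AE_ball_countable[OF countable_rat], intro ballI)
    fix q :: real
    show "AE t in lborel. 0 \<le> q \<longrightarrow> t \<in> {x. f x \<le> q} \<longrightarrow> ?lim (P q) t"
    proof (cases "0 \<le> q")
      case True
      have "AE t in lborel. t \<in> {x. f x \<le> q} \<longrightarrow> ?lim (P q) t"
      proof (rule AE_null_density_zero)
        have "(\<integral>\<^sup>+x\<in>{x. f x \<le> q}. ennreal (max 0 (f x - q)) \<partial>lborel) = (\<integral>\<^sup>+x. 0 \<partial>(lborel :: real measure))"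
          by (intro nn_integral_cong) (auto split: split_indicator simp: max_def)
        then show "emeasure (P q) {x. f x \<le> q} = 0" unfolding P_def by (subst emeasure_density) auto
      qed (auto simp: Pfin[OF True] sets)
      then show ?thesis by simp
    qed simp
  qed
  have 3: "AE t in lborel. \<forall>q\<in>\<rat>. 0 \<le> q \<longrightarrow> t \<in> {x. q \<le> f x} \<longrightarrow> ?lim (R q) t"
  proof (subst AE_ball_countable[OF countable_rat], intro ballI)
    fix q :: real
    show "AE t in lborel. 0 \<le> q \<longrightarrow> t \<in> {x. q \<le> f x} \<longrightarrow> ?lim (R q) t"
    proof (cases "0 \<le> q")
      case True
      have "AE t in lborel. t \<in> {x. q \<le> f x} \<longrightarrow> ?lim (R q) t"
      proof (rule AE_null_density_zero)
        have "(\<integral>\<^sup>+x\<in>{x. q \<le> f x}. ennreal (max 0 (q - f x)) * indicator {0..1} x \<partial>lborel) = (\<integral>\<^sup>+x. 0 \<partial>(lborel :: real measure))"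
          by (intro nn_integral_cong) (auto split: split_indicator simp: max_def)
        then show "emeasure (R q) {x. q \<le> f x} = 0" unfolding R_def by (subst emeasure_density) auto
      qed (auto simp: Rfin[OF True] sets)
      then show ?thesis by simp
    qed simp
  qed
  have 4: "AE t in lborel. t \<notin> Z" using Z by (rule AE_not_in)
  from 1 2 3 4 show ?thesis
  proof eventually_elim
    case (elim t)
    show ?case
    proof (intro allI impI)
      fix I assume t: "t \<in> {0<..<1}" and I: "\<forall>h. I h \<in> sets borel \<and> I h \<subseteq> cball t \<bar>h\<bar> \<and> emeasure lborel (I h) = ennreal \<bar>h\<bar>"
      then have Is[measurable]: "I h \<in> sets borel" and Ic: "I h \<subseteq> cball t \<bar>h\<bar>" and Il: "emeasure lborel (I h) = ennreal \<bar>h\<bar>" for h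
        by auto
      have le_cball: "measure M (I h) / \<bar>h\<bar> \<le> measure M (cball t \<bar>h\<bar>) / \<bar>h\<bar>"
        if "finite_measure M" "sets M = sets borel" for M h
        using Ic that by (intro divide_right_mono finite_measure.finite_measure_mono) auto
      show "((\<lambda>h. measure N (I h) / \<bar>h\<bar>) \<longlongrightarrow> f t) (at 0)"
      proof (rule order_tendstoI)
        fix a assume "f t < a"
        then obtain q where q: "q \<in> \<rat>" "f t < q" "q < a" using Rats_dense_in_real by blast
        then have q0: "0 \<le> q" using f0[of t] by linarith
        interpret Pq: finite_measure "P q" using Pfin[OF q0] .
        interpret S: finite_measure S by (rule Sfin)
        have "?lim (P q) t" using elim(2) q q0 by auto
        moreover have "?lim S t" using elim by auto
        ultimately have "((\<lambda>h. measure (P q) (cball t \<bar>h\<bar>) / \<bar>h\<bar> + measure S (cball t \<bar>h\<bar>) / \<bar>h\<bar>) \<longlongrightarrow> 0 + 0) (at 0)"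
          by (intro tendsto_add)
        then have "eventually (\<lambda>h. measure (P q) (cball t \<bar>h\<bar>) / \<bar>h\<bar> + measure S (cball t \<bar>h\<bar>) / \<bar>h\<bar> < a - q) (at 0)"
          by (rule order_tendstoD) (use q in auto)
        moreover have "eventually (\<lambda>h::real. h \<noteq> 0) (at 0)" by (simp add: eventually_at_filter)
        ultimately show "eventually (\<lambda>h. measure N (I h) / \<bar>h\<bar> < a) (at 0)"
        proof eventually_elim
          case (elim h)
          have fq: "ennreal (f x) \<le> ennreal q + ennreal (max 0 (f x - q))" for x
          proof -
            have "ennreal (f x) \<le> ennreal (q + max 0 (f x - q))" by (rule ennreal_leI) simp
            also have "\<dots> = ennreal q + ennreal (max 0 (f x - q))" by (rule ennreal_plus) (use q0 in auto)
            finally show ?thesis .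
          qed
          have "(\<integral>\<^sup>+x\<in>I h. ennreal (f x) \<partial>lborel)
              \<le> (\<integral>\<^sup>+x. ennreal q * indicator (I h) x + ennreal (max 0 (f x - q)) * indicator (I h) x \<partial>lborel)"
            using fq by (intro nn_integral_mono) (auto split: split_indicator)
          also have "\<dots> = ennreal q * ennreal \<bar>h\<bar> + emeasure (P q) (I h)"
            by (subst nn_integral_add) (auto simp: nn_integral_cmult_indicator Il P_def emeasure_density)
          finally have "emeasure N (I h) \<le> ennreal q * ennreal \<bar>h\<bar> + emeasure (P q) (I h) + emeasure S (I h)"
            unfolding Ne[OF Is] Se[OF Is] by (rule add_right_mono)
          then have "measure N (I h) \<le> q * \<bar>h\<bar> + measure (P q) (I h) + measure S (I h)"
            using q0 by (simp add: emeasure_eq_measure Pq.emeasure_eq_measure S.emeasure_eq_measure flip: ennreal_mult ennreal_plus)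
          then have "measure N (I h) / \<bar>h\<bar> \<le> q + measure (P q) (I h) / \<bar>h\<bar> + measure S (I h) / \<bar>h\<bar>"
            using elim by (simp add: field_simps)
          also have "\<dots> \<le> q + measure (P q) (cball t \<bar>h\<bar>) / \<bar>h\<bar> + measure S (cball t \<bar>h\<bar>) / \<bar>h\<bar>"
            by (intro add_mono le_cball order_refl Pfin Sfin sets q0)
          finally show ?case using elim by linarith
        qed
      next
        fix a assume a: "a < f t"
        show "eventually (\<lambda>h. a < measure N (I h) / \<bar>h\<bar>) (at 0)"
        proof (cases "a < 0")
          case True
          then show ?thesis by (intro always_eventually allI) (auto intro: less_le_trans)
        next
          case False
          obtain q where q: "q \<in> \<rat>" "a < q" "q < f t" using Rats_dense_in_real[OF a] by blast
          then have q0: "0 \<le> q" using False by linarith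
          interpret Rq: finite_measure "R q" using Rfin[OF q0] .
          have "?lim (R q) t" using elim(3) q q0 by auto
          then have "eventually (\<lambda>h. measure (R q) (cball t \<bar>h\<bar>) / \<bar>h\<bar> < q - a) (at 0)"
            by (rule order_tendstoD) (use q in auto)
          moreover have "eventually (\<lambda>h::real. h \<noteq> 0) (at 0)" by (simp add: eventually_at_filter)
          \<comment> \<open>Small \<open>h\<close> keep \<open>I h\<close> inside [0,1], where the
            cut in \<open>R\<close> has no effect.\<close>
          moreover have "eventually (\<lambda>h::real. \<bar>h\<bar> < min t (1 - t)) (at 0)"
            using t by (auto simp: eventually_at dist_real_def intro!: exI[of _ "min t (1 - t)"])
          ultimately show ?thesis
          proof eventually_elim
            case (elim h)
            have I01: "I h \<subseteq> {0..1}"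
            proof
              fix x assume "x \<in> I h"
              then have "\<bar>t - x\<bar> \<le> \<bar>h\<bar>" using Ic[of h] by (auto simp: dist_real_def)
              then show "x \<in> {0..1}" using elim(3) by (auto simp: min_def split: if_splits)
            qed
            have fq: "ennreal q \<le> ennreal (f x) + ennreal (max 0 (q - f x))" for x
            proof -
              have "ennreal q \<le> ennreal (f x + max 0 (q - f x))" by (rule ennreal_leI) simp
              also have "\<dots> = ennreal (f x) + ennreal (max 0 (q - f x))" by (rule ennreal_plus) (use f0 in auto)
              finally show ?thesis .
            qed
            have "ennreal q * ennreal \<bar>h\<bar> = (\<integral>\<^sup>+x\<in>I h. ennreal q \<partial>lborel)"
              by (subst nn_integral_cmult_indicator) (auto simp: Il)
            also have "\<dots> \<le> (\<integral>\<^sup>+x. ennreal (f x) * indicator (I h) x + ennreal (max 0 (q - f x)) * indicator {0..1} x * indicator (I h) x \<partial>lborel)"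
              using fq I01 by (intro nn_integral_mono) (auto split: split_indicator)
            also have "\<dots> = (\<integral>\<^sup>+x\<in>I h. ennreal (f x) \<partial>lborel) + emeasure (R q) (I h)"
              by (subst nn_integral_add) (auto simp: R_def emeasure_density)
            also have "\<dots> \<le> emeasure N (I h) + emeasure (R q) (I h)"
              unfolding Ne[OF Is] by (intro add_right_mono) simp
            finally have "q * \<bar>h\<bar> \<le> measure N (I h) + measure (R q) (I h)"
              using q0 by (simp add: emeasure_eq_measure Rq.emeasure_eq_measure flip: ennreal_mult ennreal_plus)
            then have "q \<le> measure N (I h) / \<bar>h\<bar> + measure (R q) (I h) / \<bar>h\<bar>"
              using elim by (simp add: field_simps)
            also have "measure (R q) (I h) / \<bar>h\<bar> \<le> measure (R q) (cball t \<bar>h\<bar>) / \<bar>h\<bar>"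
              by (intro le_cball Rfin sets q0)
            finally show ?case using elim by linarith
          qed
        qed
      qed
    qed
  qed
qed

lemma lebesgue_decomp_nn_integral_le:
  assumes "lebesgue_decomp N f Z"
  shows "(\<integral>\<^sup>+x. ennreal (f x) \<partial>lborel) \<le> emeasure N UNIV"
proof -
  have "emeasure N UNIV = (\<integral>\<^sup>+x. ennreal (f x) \<partial>lborel) + emeasure N Z"
    using assms by (auto simp: lebesgue_decomp_def)
  then show ?thesis by simp
qed

text \<open>The half-open interval between \<open>t\<close> and \<open>t + h\<close> has as mass
  exactly the increment of \<open>F\<close>, for either sign of \<open>h\<close>.\<close>

lemma AE_increment_derivative:
  fixes F :: "real \<Rightarrow> real"
  assumes F: "\<And>x y. x \<le> y \<Longrightarrow> F x \<le> F y" "\<And>a. continuous (at_right a) F"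
    and fin: "finite_measure (interval_measure F)" and dec: "lebesgue_decomp (interval_measure F) f Z"
  shows "AE t in lborel. t \<in> {0<..<1} \<longrightarrow> ((\<lambda>h. \<bar>F (t + h) - F t\<bar> / \<bar>h\<bar>) \<longlongrightarrow> f t) (at 0)"
  using lebesgue_decomp_AE_derivative[OF fin _ dec]
proof (rule AE_mp[OF _ AE_I2, OF _ impI], goal_cases)
  case (2 t)
  show ?case
  proof
    assume t: "t \<in> {0<..<1}"
    let ?I = "\<lambda>h. {min t (t + h)<..max t (t + h)}"
    have "((\<lambda>h. measure (interval_measure F) (?I h) / \<bar>h\<bar>) \<longlongrightarrow> f t) (at 0)"
      by (rule 2(2)[rule_format, OF t]) (auto simp: dist_real_def)
    moreover have "measure (interval_measure F) (?I h) = \<bar>F (t + h) - F t\<bar>" for h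
      using F(1)[of t "t + h"] F(1)[of "t + h" t]
      by (cases "0 \<le> h") (auto simp: measure_interval_measure_Ioc[OF _ F])
    ultimately show "((\<lambda>h. \<bar>F (t + h) - F t\<bar> / \<bar>h\<bar>) \<longlongrightarrow> f t) (at 0)" by simp
  qed
qed auto

text \<open>A partition almost exhausting the variation gives a comparison function \<open>f\<close> whose increments
  are locally bounded by those of the curve, while \<open>var_upto - f\<close> is monotone with small total mass;
  so the density of the latter is small, and the metric derivative is at least the difference.\<close>

context Metric_space
begin

context
  fixes u assumes u: "right_cont u" and fin: "pvar d u {0..<1} < \<infinity>"
begin

lemma finite_interval_measure_var_upto: "finite_measure (interval_measure (var_upto d u))"
proof (rule finite_measureI)
  define A where "A n = {.. real n}" for n
  have "emeasure (interval_measure (var_upto d u)) (A n) \<le> ennreal (var_upto d u 1)" for n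
    unfolding A_def emeasure_var_upto_atMost[OF u fin]
    using var_upto_mono[OF u fin, of "real n" 1] var_upto_ge1[OF u fin, of "real n"]
    by (cases "real n \<le> 1") (auto intro!: ennreal_leI)
  moreover have "(SUP n. emeasure (interval_measure (var_upto d u)) (A n)) = emeasure (interval_measure (var_upto d u)) (\<Union>n. A n)"
    by (rule SUP_emeasure_incseq) (auto simp: A_def incseq_def)
  moreover have "(\<Union>n. A n) = UNIV" by (auto simp: A_def real_arch_simple)
  ultimately have "emeasure (interval_measure (var_upto d u)) UNIV \<le> ennreal (var_upto d u 1)"
    by (metis SUP_least)
  then show "emeasure (interval_measure (var_upto d u)) (space (interval_measure (var_upto d u))) \<noteq> \<infinity>"
    by (auto simp: top_unique)
qed

lemma partition_comparison:
  assumes \<epsilon>: "0 < \<epsilon>"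
  obtains H P where "\<And>s t. s \<le> t \<Longrightarrow> H s \<le> H t" "\<And>a. continuous (at_right a) H" "\<And>t. t < 0 \<Longrightarrow> H t = 0"
    "\<And>t. H t \<le> \<epsilon>" "finite P"
    "\<And>s t. 0 \<le> s \<Longrightarrow> s \<le> t \<Longrightarrow> t < 1 \<Longrightarrow> {s..t} \<inter> P = {} \<Longrightarrow>
      (var_upto d u t - var_upto d u s) - (H t - H s) \<le> d (u s) (u t)"
proof -
  let ?F = "var_upto d u"
  note Fmono = var_upto_mono[OF u fin] and Fge1 = var_upto_ge1[OF u fin] and F0 = var_upto_nonneg[OF u fin]
  have F1: "ennreal (?F 1) = pvar d u {0..<1}"
    using ennreal_var_upto[OF u fin, of 1] by (simp add: Int_absorb1 atLeastLessThan_subset_iff subset_eq)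
  obtain k p where p: "\<And>i. i \<le> k \<Longrightarrow> p i < p (Suc i)" "\<And>i. i \<le> Suc k \<Longrightarrow> p i \<in> {0..<1}"
    "?F 1 - \<epsilon> < (\<Sum>i\<le>k. d (u (p i)) (u (p (Suc i))))"
  proof (cases "?F 1 - \<epsilon> < 0")
    \<comment> \<open>If \<open>\<epsilon>\<close> exceeds the whole variation every partition will
      do, and this one is just a valid choice.\<close>
    case True
    show ?thesis
      by (rule that[of 0 "\<lambda>i. if i = 0 then 0 else 1/2"]) (use True in \<open>auto intro: less_le_trans[OF _ nonneg]\<close>)
  next
    case False
    then have "ennreal (?F 1 - \<epsilon>) < pvar d u {0..<1}" using \<epsilon> unfolding F1[symmetric] by (intro ennreal_lessI) auto
    then obtain k p where "\<And>i. i \<le> k \<Longrightarrow> p i < p (Suc i)" "\<And>i. i \<le> Suc k \<Longrightarrow> p i \<in> {0..<1}"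
      "ennreal (?F 1 - \<epsilon>) < (\<Sum>i\<le>k. ennreal (d (u (p i)) (u (p (Suc i)))))"
      unfolding pvar_def less_SUP_iff by auto
    then show ?thesis using that[of k p] False by (simp add: sum_ennreal ennreal_less_iff)
  qed
  have pmono: "p i \<le> p j" if "i \<le> j" "j \<le> Suc k" for i j
    using that
  proof (induction j)
    case (Suc j)
    then show ?case using p(1)[of j] by (cases "i = Suc j") (auto intro: order_trans less_imp_le)
  qed simp
  \<comment> \<open>\<open>c i\<close> clamps the time to the cell from \<open>p i\<close> to
    \<open>p (Suc i)\<close>. Hence \<open>f\<close> adds the full partition distances of the cells
    already passed and, in the current cell, the distance from its left end.\<close>
  define c where "c i t = max (p i) (min t (p (Suc i)))" for i t
  define f where "f t = (\<Sum>i\<le>k. d (u (p i)) (u (c i t)))" for t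
  define H where "H t = ?F t - f t" for t
  have c01: "0 \<le> c i t" "c i t < 1" if "i \<le> k" for i t
    using p(2)[of i] p(2)[of "Suc i"] that p(1)[of i] by (auto simp: c_def min_def max_def)
  have uM: "u (c i t) \<in> M" "u (p i) \<in> M" if "i \<le> k" for i t
    using c01[OF that, of t] p(2)[of i] that by (auto intro!: right_cont_in[OF u])
  have cmono: "c i s \<le> c i t" if "s \<le> t" for i s t using that by (auto simp: c_def)
  \<comment> \<open>Clamping to the whole range of the partition turns the sum of cellwise
    increments of the variation into a single increment.\<close>
  define C where "C t = max (p 0) (min t (p (Suc k)))" for t
  have tele: "(\<Sum>i\<le>k. ?F (c i t) - ?F (p i)) = ?F (C t) - ?F (p 0)" for t
  proof -
    have "(\<Sum>i\<le>m. ?F (c i t) - ?F (p i)) = ?F (max (p 0) (min t (p (Suc m)))) - ?F (p 0)" if "m \<le> k" for m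
      using that
    proof (induction m)
      case (Suc m)
      have "p 0 \<le> p (Suc m)" "p (Suc m) < p (Suc (Suc m))" using Suc.prems pmono[of 0 "Suc m"] p(1)[of "Suc m"] by auto
      then have "?F (max (p 0) (min t (p (Suc m)))) + (?F (c (Suc m) t) - ?F (p (Suc m))) = ?F (max (p 0) (min t (p (Suc (Suc m)))))"
        unfolding c_def max_def min_def by (auto split: if_splits)
      with Suc show ?case by auto
    qed (simp add: c_def)
    from this[of k] show ?thesis by (simp add: C_def)
  qed
  have CF: "?F (C t) - ?F (C s) \<le> ?F t - ?F s" if "s \<le> t" for s t
  proof -
    have "p 0 \<le> p (Suc k)" by (rule pmono) auto
    moreover have "?F s \<le> ?F t" "s \<le> p 0 \<Longrightarrow> ?F s \<le> ?F (p 0)" "p (Suc k) \<le> t \<Longrightarrow> ?F (p (Suc k)) \<le> ?F t" using Fmono that by auto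
    ultimately show ?thesis using that unfolding C_def max_def min_def
      by (smt (verit) Fmono)
  qed
  \<comment> \<open>The reverse triangle inequality in each cell bounds the increments of
    \<open>f\<close> by those of \<open>u\<close> between clamped times.\<close>
  have diff: "\<bar>f t - f s\<bar> \<le> (\<Sum>i\<le>k. d (u (c i s)) (u (c i t)))" for s t
  proof -
    have "\<bar>f t - f s\<bar> \<le> (\<Sum>i\<le>k. \<bar>d (u (p i)) (u (c i t)) - d (u (p i)) (u (c i s))\<bar>)"
      unfolding f_def sum_subtractf[symmetric] by (rule sum_abs)
    also have "\<dots> \<le> (\<Sum>i\<le>k. d (u (c i s)) (u (c i t)))"
    proof (rule sum_mono)
      fix i assume "i \<in> {..k}"
      then have m: "u (p i) \<in> M" "u (c i t) \<in> M" "u (c i s) \<in> M" using uM by auto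
      then show "\<bar>d (u (p i)) (u (c i t)) - d (u (p i)) (u (c i s))\<bar> \<le> d (u (c i s)) (u (c i t))"
        using mdist_reverse_triangle[of "u (c i t)" "u (p i)" "u (c i s)"] by (simp add: commute)
    qed
    finally show ?thesis .
  qed
  have fF: "\<bar>f t - f s\<bar> \<le> ?F t - ?F s" if "s \<le> t" for s t
  proof -
    note diff[of t s]
    also have "(\<Sum>i\<le>k. d (u (c i s)) (u (c i t))) \<le> (\<Sum>i\<le>k. ?F (c i t) - ?F (c i s))"
      using c01 cmono[OF that] by (intro sum_mono dist_le_var_upto[OF u fin]) auto
    also have "\<dots> = (\<Sum>i\<le>k. (?F (c i t) - ?F (p i)) - (?F (c i s) - ?F (p i)))" by simp
    also have "\<dots> = ?F (C t) - ?F (C s)" unfolding sum_subtractf[of "\<lambda>i. ?F (c i t) - ?F (p i)"] tele by simp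
    also have "\<dots> \<le> ?F t - ?F s" using CF[OF that] .
    finally show ?thesis using diff[of s t] by (simp add: abs_minus_commute)
  qed
  show ?thesis
  proof (rule that[of H "p ` {..Suc k}"])
    show Hmono: "H s \<le> H t" if "s \<le> t" for s t using fF[OF that] by (auto simp: H_def)
    show "continuous (at_right a) H" for a
    proof -
      have "((\<lambda>t. ?F t - ?F a) \<longlongrightarrow> 0) (at_right a)" using var_upto_right_cont[OF u fin, of a] LIM_zero by blast
      moreover have "eventually (\<lambda>t. norm (f t - f a) \<le> ?F t - ?F a) (at_right a)"
        unfolding eventually_at_right_field by (intro exI[of _ "a+1"]) (auto intro: fF)
      ultimately have "((\<lambda>t. f t - f a) \<longlongrightarrow> 0) (at_right a)" by (rule Lim_null_comparison[rotated])
      then have "(f \<longlongrightarrow> f a) (at_right a)" by (rule LIM_zero_cancel)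
      then have "(H \<longlongrightarrow> H a) (at_right a)" unfolding H_def by (intro tendsto_diff var_upto_right_cont[OF u fin])
      then show ?thesis by (simp add: continuous_within)
    qed
    show H0: "H t = 0" if "t < 0" for t
    proof -
      have "c i t = p i" if "i \<le> k" for i using p(2)[of i] p(1)[of i] that \<open>t < 0\<close> by (auto simp: c_def)
      then have "f t = 0" unfolding f_def using uM by (intro sum.neutral) auto
      then show ?thesis using that by (simp add: H_def var_upto_neg[OF u fin])
    qed
    \<comment> \<open>All partition points lie below 1, so at time 1 every cell is complete and
      \<open>f 1\<close> is the partition sum.\<close>
    have "c i 1 = p (Suc i)" if "i \<le> k" for i using p(2)[of "Suc i"] p(1)[of i] that by (auto simp: c_def)
    then have "f 1 = (\<Sum>i\<le>k. d (u (p i)) (u (p (Suc i))))" unfolding f_def by (intro sum.cong) auto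
    then have H1: "H 1 \<le> \<epsilon>" using p(3) by (simp add: H_def)
    show "H t \<le> \<epsilon>" for t
    proof (cases "t \<le> 1")
      case True then show ?thesis using Hmono[OF True] H1 by simp
    next
      case False
      then have "c i t = c i 1" if "i \<le> k" for i using p(2)[of "Suc i"] that by (auto simp: c_def)
      then have "f t = f 1" unfolding f_def by (intro sum.cong) auto
      then show ?thesis using H1 Fge1[of t] False by (simp add: H_def)
    qed
    show "(?F t - ?F s) - (H t - H s) \<le> d (u s) (u t)"
      if st: "0 \<le> s" "s \<le> t" "t < 1" and P: "{s..t} \<inter> p ` {..Suc k} = {}" for s t
    proof -
      \<comment> \<open>With no partition point in [s,t] at most one open cell contains this
        interval; in every other cell the two clamped times coincide.\<close>
      let ?in = "\<lambda>i. p i < s \<and> t < p (Suc i)"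
      have "p i \<notin> {s..t}" if "i \<le> Suc k" for i using P that by auto
      then have out: "p i < s \<or> t < p i" if "i \<le> Suc k" for i using that by fastforce
      have summand: "d (u (c i s)) (u (c i t)) = (if ?in i then d (u s) (u t) else 0)" if i: "i \<le> k" for i
      proof (cases "?in i")
        case True then show ?thesis using st by (simp add: c_def)
      next
        case False
        with out[of i] out[of "Suc i"] i p(1)[of i] st have "t < p i \<or> p (Suc i) < s" by auto
        then have "c i s = c i t" using st p(1)[OF i] by (auto simp: c_def)
        then have "d (u (c i s)) (u (c i t)) = 0" using uM[OF i] by simp
        then show ?thesis unfolding if_not_P[OF False] .
      qed
      have uniq: "i = j" if "i \<le> k" "j \<le> k" "?in i" "?in j" for i j
      proof (rule ccontr)
        assume "i \<noteq> j"
        then consider "Suc i \<le> j" | "Suc j \<le> i" by linarith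
        then show False
          using that pmono[of "Suc i" j] pmono[of "Suc j" i] st by cases auto
      qed
      have "f t - f s \<le> (\<Sum>i\<le>k. d (u (c i s)) (u (c i t)))" using diff[of t s] by linarith
      also have "\<dots> = (\<Sum>i\<le>k. if ?in i then d (u s) (u t) else 0)" by (intro sum.cong) (auto simp: summand)
      also have "\<dots> \<le> d (u s) (u t)"
      proof (cases "\<exists>i\<le>k. ?in i")
        case True
        then obtain j where j: "j \<le> k" "?in j" by blast
        have "(\<Sum>i\<le>k. if ?in i then d (u s) (u t) else 0) = (\<Sum>i\<le>k. if i = j then d (u s) (u t) else 0)"
        proof (intro sum.cong refl)
          fix i assume "i \<in> {..k}"
          then have "?in i \<longleftrightarrow> i = j" using uniq[of i j] j by (metis atMost_iff)
          then show "(if ?in i then d (u s) (u t) else 0) = (if i = j then d (u s) (u t) else 0)"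
            by (simp only: )
        qed
        also have "\<dots> = d (u s) (u t)" using j by simp
        finally show ?thesis by simp
      next
        case False
        then have "(\<Sum>i\<le>k. if ?in i then d (u s) (u t) else 0) = 0" by (intro sum.neutral) auto
        then show ?thesis by simp
      qed
      finally show ?thesis by (simp add: H_def)
    qed
  qed simp
qed

lemma AE_metric_derivative:
  assumes dec: "lebesgue_decomp (interval_measure (var_upto d u)) f Z"
  shows "AE t in lborel. t \<in> {0<..<1} \<longrightarrow> ((\<lambda>h. d (u t) (u (t + h)) / \<bar>h\<bar>) \<longlongrightarrow> f t) (at 0)"
proof -
  let ?F = "var_upto d u"
  have "\<forall>n. \<exists>H P. (\<forall>s t. s \<le> t \<longrightarrow> H s \<le> H t) \<and> (\<forall>a. continuous (at_right a) H) \<and> (\<forall>t<0. H t = 0) \<and>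
    (\<forall>t. H t \<le> (1/2)^n) \<and> finite P \<and> (\<forall>s t. 0 \<le> s \<longrightarrow> s \<le> t \<longrightarrow> t < 1 \<longrightarrow> {s..t} \<inter> P = {} \<longrightarrow>
      (?F t - ?F s) - (H t - H s) \<le> d (u s) (u t))"
  proof
    fix n :: nat
    have "(0::real) < (1/2)^n" by simp
    from partition_comparison[OF this] show "\<exists>H P. (\<forall>s t. s \<le> t \<longrightarrow> H s \<le> H t) \<and> (\<forall>a. continuous (at_right a) H) \<and> (\<forall>t<0. H t = 0) \<and>
    (\<forall>t. H t \<le> (1/2)^n) \<and> finite P \<and> (\<forall>s t. 0 \<le> s \<longrightarrow> s \<le> t \<longrightarrow> t < 1 \<longrightarrow> {s..t} \<inter> P = {} \<longrightarrow>
      (?F t - ?F s) - (H t - H s) \<le> d (u s) (u t))" by metis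
  qed
  then obtain H P where H: "\<And>n s t. s \<le> t \<Longrightarrow> H n s \<le> H n t" "\<And>n a. continuous (at_right a) (H n)"
    "\<And>n t. t < 0 \<Longrightarrow> H n t = 0" "\<And>n t. H n t \<le> (1/2)^n" "\<And>n. finite (P n)"
    "\<And>n s t. 0 \<le> s \<Longrightarrow> s \<le> t \<Longrightarrow> t < 1 \<Longrightarrow> {s..t} \<inter> P n = {} \<Longrightarrow>
      (?F t - ?F s) - (H n t - H n s) \<le> d (u s) (u t)"
    by metis
  have HU: "emeasure (interval_measure (H n)) UNIV \<le> ennreal ((1/2)^n)" for n
  proof -
    have "(SUP m::nat. emeasure (interval_measure (H n)) {.. real m}) = emeasure (interval_measure (H n)) (\<Union>m::nat. {..real m})"
      by (rule SUP_emeasure_incseq) (auto simp: incseq_def)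
    moreover have "(\<Union>m::nat. {..real m}) = UNIV" by (auto simp: real_arch_simple)
    moreover have "emeasure (interval_measure (H n)) {..real m} \<le> ennreal ((1/2)^n)" for m
      using emeasure_interval_measure_atMost[of "H n"] H by (simp add: ennreal_leI)
    ultimately show ?thesis by (metis (mono_tags, lifting) SUP_least)
  qed
  have Hfin: "finite_measure (interval_measure (H n))" for n
    using HU[of n] by (intro finite_measureI) (auto simp: top_unique)
  have "\<forall>n. \<exists>g Y. lebesgue_decomp (interval_measure (H n)) g Y"
    using lebesgue_decomp_exists[OF Hfin] by (metis sets_interval_measure)
  then obtain g Y where g: "\<And>n. lebesgue_decomp (interval_measure (H n)) (g n) (Y n)" by metis
  then have gm[measurable]: "g n \<in> borel_measurable borel" for n by (auto simp: lebesgue_decomp_def)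
  \<comment> \<open>The density \<open>g n\<close> integrates to at most the mass of the remainder
    \<open>H n\<close>, hence to at most \<open>(1/2)^n\<close>. So the infimum over
    \<open>n\<close> vanishes almost everywhere, and at such a \<open>t\<close> some
    \<open>g n t\<close> is as small as desired.\<close>
  have "(\<integral>\<^sup>+t. (INF n. ennreal (g n t)) \<partial>lborel) = 0"
  proof -
    have le: "(\<integral>\<^sup>+t. (INF n. ennreal (g n t)) \<partial>lborel) \<le> ennreal ((1/2)^n)" for n
    proof -
      have "(\<integral>\<^sup>+t. (INF n. ennreal (g n t)) \<partial>lborel) \<le> (\<integral>\<^sup>+t. ennreal (g n t) \<partial>lborel)"
        by (intro nn_integral_mono INF_lower) auto
      also have "\<dots> \<le> ennreal ((1/2)^n)" using lebesgue_decomp_nn_integral_le[OF g] HU order_trans by blast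
      finally show ?thesis .
    qed
    have "(\<lambda>n. ennreal ((1/2)^n)) \<longlonglongrightarrow> ennreal 0" by (intro tendsto_ennrealI LIMSEQ_power_zero) auto
    then have "(\<integral>\<^sup>+t. (INF n. ennreal (g n t)) \<partial>lborel) \<le> 0"
      using le by (intro LIMSEQ_le_const[where X="\<lambda>n. ennreal ((1/2)^n)"]) auto
    then show ?thesis by simp
  qed
  then have inf0: "AE t in lborel. (INF n. ennreal (g n t)) = 0"
    by (subst (asm) nn_integral_0_iff_AE) auto
  have P: "AE t in lborel. t \<notin> (\<Union>n. P n)"
  proof -
    have "countable (\<Union>n. P n)" using H(5) by (intro countable_UN) (auto intro: countable_finite)
    then show ?thesis by (intro AE_not_in countable_imp_null_set_lborel)
  qed
  have gd: "AE t in lborel. \<forall>n. t \<in> {0<..<1} \<longrightarrow> ((\<lambda>h. \<bar>H n (t + h) - H n t\<bar> / \<bar>h\<bar>) \<longlongrightarrow> g n t) (at 0)"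
    by (subst AE_all_countable) (intro allI AE_increment_derivative[OF _ _ Hfin g] H)
  have Fd: "AE t in lborel. t \<in> {0<..<1} \<longrightarrow> ((\<lambda>h. \<bar>?F (t + h) - ?F t\<bar> / \<bar>h\<bar>) \<longlongrightarrow> f t) (at 0)"
    by (intro AE_increment_derivative[OF _ _ finite_interval_measure_var_upto dec])
      (auto intro: var_upto_mono[OF u fin] var_upto_continuous[OF u fin])
  from inf0 P gd Fd show ?thesis
  proof eventually_elim
    case (elim t)
    show ?case
    proof
      assume t: "t \<in> {0<..<1}"
      have near: "eventually (\<lambda>h::real. \<bar>h\<bar> < r) (at 0)" if "0 < r" for r
        using that by (auto simp: eventually_at dist_real_def)
      let ?Q = "\<lambda>h. \<bar>?F (t + h) - ?F t\<bar> / \<bar>h\<bar>"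
      have lim: "(?Q \<longlongrightarrow> f t) (at 0)" using elim t by blast
      have in01: "eventually (\<lambda>h. 0 < t + h \<and> t + h < 1) (at 0)"
        using near[of "min t (1 - t)"] t by (auto elim!: eventually_mono)
      show "((\<lambda>h. d (u t) (u (t + h)) / \<bar>h\<bar>) \<longlongrightarrow> f t) (at 0)"
      proof (rule order_tendstoI)
        fix a assume "f t < a"
        then have "eventually (\<lambda>h. ?Q h < a) (at 0)" by (rule order_tendstoD(2)[OF lim])
        then show "eventually (\<lambda>h. d (u t) (u (t + h)) / \<bar>h\<bar> < a) (at 0)"
          using in01
        proof eventually_elim
          case (elim h)
          have "d (u t) (u (t + h)) \<le> \<bar>?F (t + h) - ?F t\<bar>"
            using dist_le_var_upto[OF u fin, of t "t + h"] dist_le_var_upto[OF u fin, of "t + h" t] elim t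
            by (cases "0 \<le> h") (auto simp: commute)
          then have "d (u t) (u (t + h)) / \<bar>h\<bar> \<le> ?Q h" by (rule divide_right_mono) simp
          with elim show ?case by linarith
        qed
      next
        fix a assume a: "a < f t"
        have "(INF n. ennreal (g n t)) < ennreal (f t - a)" using elim(1) a by simp
        then obtain n where n: "g n t < f t - a" by (auto simp: INF_less_iff ennreal_less_iff)
          (metis ennreal_less_iff g lebesgue_decomp_def)
        have "((\<lambda>h. ?Q h - \<bar>H n (t + h) - H n t\<bar> / \<bar>h\<bar>) \<longlongrightarrow> f t - g n t) (at 0)"
          using lim elim(3) t by (intro tendsto_diff) auto
        then have big: "eventually (\<lambda>h. a < ?Q h - \<bar>H n (t + h) - H n t\<bar> / \<bar>h\<bar>) (at 0)"
          by (rule order_tendstoD) (use n in auto)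
        \<comment> \<open>\<open>t\<close> avoids all partitions and \<open>P n\<close> is finite,
          so short intervals at \<open>t\<close> contain no partition point and the comparison
          applies to them.\<close>
        have "\<exists>r>0. \<forall>x\<in>P n. r \<le> \<bar>t - x\<bar>"
        proof (cases "P n = {}")
          case False
          then show ?thesis using H(5)[of n] elim(2)
            by (intro exI[of _ "Min ((\<lambda>x. \<bar>t - x\<bar>) ` P n)"]) (auto simp: Min_gr_iff)
        qed (auto intro: exI[of _ 1])
        then obtain r where r: "r > 0" "\<And>x. x \<in> P n \<Longrightarrow> r \<le> \<bar>t - x\<bar>" by blast
        from big near[OF r(1)] in01 show "eventually (\<lambda>h. a < d (u t) (u (t + h)) / \<bar>h\<bar>) (at 0)"
        proof eventually_elim
          case (elim h)
          have disj: "{min t (t+h)..max t (t+h)} \<inter> P n = {}" using r(2) elim(2) by (force simp: min_def max_def split: if_splits)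
          have "\<bar>?F (t + h) - ?F t\<bar> - \<bar>H n (t + h) - H n t\<bar> \<le> d (u t) (u (t + h))"
          proof (cases "0 \<le> h")
            case True
            then have "(?F (t+h) - ?F t) - (H n (t+h) - H n t) \<le> d (u t) (u (t+h))"
              using H(6)[of t "t + h" n] elim t disj by auto
            then show ?thesis using H(1)[of t "t+h" n] var_upto_mono[OF u fin, of t "t+h"] True by auto
          next
            case False
            then have "(?F t - ?F (t+h)) - (H n t - H n (t+h)) \<le> d (u (t+h)) (u t)"
              using H(6)[of "t+h" t n] elim t disj by auto
            then show ?thesis using H(1)[of "t+h" t n] var_upto_mono[OF u fin, of "t+h" t] False by (auto simp: commute)
          qed
          then have "(\<bar>?F (t + h) - ?F t\<bar> - \<bar>H n (t + h) - H n t\<bar>) / \<bar>h\<bar> \<le> d (u t) (u (t + h)) / \<bar>h\<bar>"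
            by (rule divide_right_mono) simp
          with elim(1) show ?case by (simp add: diff_divide_distrib)
        qed
      qed
    qed
  qed
qed

end

end

section \<open>Couplings and the Wasserstein distance\<close>

definition dense_seq :: "nat \<Rightarrow> 'a::polish_space" where
  "dense_seq = (SOME e. \<forall>x r. 0 < r \<longrightarrow> (\<exists>i. dist x (e i) < r))"

lemma dense_seq: "0 < r \<Longrightarrow> \<exists>i. dist x (dense_seq i :: 'a::polish_space) < r"
proof -
  obtain D :: "'a set" where D: "countable D" "\<And>X. open X \<Longrightarrow> X \<noteq> {} \<Longrightarrow> \<exists>d\<in>D. d \<in> X"
    using countable_dense_exists by blast
  have "D \<noteq> {}" using D(2)[of UNIV] by auto
  have "\<exists>e::nat \<Rightarrow> 'a. \<forall>x r. 0 < r \<longrightarrow> (\<exists>i. dist x (e i) < r)"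
  proof (intro exI[of _ "from_nat_into D"] allI impI)
    fix x :: 'a and r :: real assume "0 < r"
    then obtain y where "y \<in> D" "y \<in> ball x r" using D(2)[of "ball x r"] by auto
    then show "\<exists>i. dist x (from_nat_into D i) < r" using D(1) by (metis from_nat_into_to_nat_on mem_ball)
  qed
  from someI_ex[OF this] show "0 < r \<Longrightarrow> \<exists>i. dist x (dense_seq i) < r" unfolding dense_seq_def by blast
qed

text \<open>It yields a measurable partition into countably many cells of diameter at most
  \<open>2 * r\<close>: two points with the same code are closer than \<open>r\<close> to the same
  dense point.\<close>

definition code :: "real \<Rightarrow> 'a::polish_space \<Rightarrow> nat" where
  "code r x = (LEAST i. dist x (dense_seq i) < r)"

lemma dist_code: "0 < r \<Longrightarrow> dist x (dense_seq (code r x)) < r"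
  unfolding code_def by (rule LeastI_ex) (rule dense_seq)

lemma measurable_code[measurable]: "code r \<in> measurable borel (count_space UNIV)"
  unfolding code_def by measurable

abbreviation seq_space :: "(nat \<Rightarrow> 'a::topological_space) measure" where
  "seq_space \<equiv> PiM UNIV (\<lambda>_. borel)"

lemma measurable_fun_upd_seq[measurable]:
  "(\<lambda>(w, y). w(i := y)) \<in> measurable (seq_space \<Otimes>\<^sub>M borel) seq_space"
  unfolding split_beta by (rule measurable_fun_upd[where J=UNIV]) auto

lemma nn_integral_split_code:
  fixes c :: "'b \<Rightarrow> nat"
  assumes [measurable]: "f \<in> borel_measurable M" "c \<in> measurable M (count_space UNIV)"
  shows "(\<integral>\<^sup>+z. f z \<partial>M) = (\<Sum>j. \<integral>\<^sup>+z. f z * indicator {z\<in>space M. c z = j} z \<partial>M)"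
proof -
  have "(\<integral>\<^sup>+z. f z \<partial>M) = (\<integral>\<^sup>+z. (\<Sum>j. f z * indicator {z\<in>space M. c z = j} z) \<partial>M)"
  proof (rule nn_integral_cong)
    fix z assume "z \<in> space M"
    then have "(\<Sum>j. f z * indicator {z\<in>space M. c z = j} z) = f z"
      by (intro suminf_cmult_indicator[where i="c z"]) (auto simp: disjoint_family_on_def)
    then show "f z = (\<Sum>j. f z * indicator {z\<in>space M. c z = j} z)" by (simp only:)
  qed
  also have "\<dots> = (\<Sum>j. \<integral>\<^sup>+z. f z * indicator {z\<in>space M. c z = j} z \<partial>M)"
    by (rule nn_integral_suminf) measurable
  finally show ?thesis .
qed

lemma borel_pair: "sets (borel :: ('a::second_countable_topology \<times> 'b::second_countable_topology) measure) = sets (borel \<Otimes>\<^sub>M borel)"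
  by (simp add: borel_prod[symmetric])

lemma couplingsD:
  assumes "\<sigma> \<in> couplings \<mu> \<nu>"
  shows "prob_space \<sigma>" "sets \<sigma> = sets borel" "distr \<sigma> borel fst = \<mu>" "distr \<sigma> borel snd = \<nu>"
  using assms by (auto simp: couplings_def)

text \<open>The next state is drawn from the second marginal of the coupling conditioned on the cell of
  diameter at most \<open>2r\<close> containing the present state, so no disintegration is needed.\<close>

lemma extend_by_coupling:
  fixes Q :: "(nat \<Rightarrow> 'a::polish_space) measure"
  assumes Q: "prob_space Q" "sets Q = sets seq_space" "distr Q borel (\<lambda>w. w i) = \<mu>"
    and \<sigma>: "\<sigma> \<in> couplings \<mu> \<nu>" and r: "0 < r"
  obtains Q' where "prob_space Q'" "sets Q' = sets seq_space" "distr Q' borel (\<lambda>w. w (Suc i)) = \<nu>"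
    "(\<integral>\<^sup>+w. ennreal (dist (w i) (w (Suc i))) \<partial>Q') \<le> (\<integral>\<^sup>+z. ennreal (dist (fst z) (snd z)) \<partial>\<sigma>) + ennreal (2 * r)"
    "\<And>f. f \<in> borel_measurable seq_space \<Longrightarrow> (\<And>w y. f (w(Suc i := y)) = f w) \<Longrightarrow> (\<integral>\<^sup>+w. f w \<partial>Q') = (\<integral>\<^sup>+w. f w \<partial>Q)"
proof -
  note \<sigma>' = couplingsD[OF \<sigma>]
  interpret Q: prob_space Q by fact
  interpret \<sigma>: prob_space \<sigma> by fact
  have [measurable_cong]: "sets Q = sets seq_space" by fact
  have sets\<sigma>[measurable_cong]: "sets \<sigma> = sets (borel \<Otimes>\<^sub>M borel)" using \<sigma>' by (simp add: borel_pair)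
  define A where "A j = {z\<in>space \<sigma>. code r (fst z) = j}" for j
  have A[measurable]: "A j \<in> sets \<sigma>" for j unfolding A_def by measurable
  \<comment> \<open>On a cell of mass zero the choice is immaterial; the second marginal merely
    keeps the kernel a probability measure.\<close>
  define K where "K j = (if emeasure \<sigma> (A j) = 0 then distr \<sigma> borel snd else distr (uniform_measure \<sigma> (A j)) borel snd)" for j
  have Kp: "prob_space (K j)" for j
  proof (cases "emeasure \<sigma> (A j) = 0")
    case False
    then have "prob_space (uniform_measure \<sigma> (A j))" by (intro prob_space_uniform_measure) auto
    then have "prob_space (distr (uniform_measure \<sigma> (A j)) borel snd)" by (rule prob_space.prob_space_distr) auto
    then show ?thesis using False by (simp add: K_def)
  next
    case True
    have "prob_space (distr \<sigma> borel snd)" by (rule \<sigma>.prob_space_distr) auto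
    then show ?thesis using True by (simp add: K_def)
  qed
  have Ks[measurable_cong]: "sets (K j) = sets borel" for j by (simp add: K_def)
  have Km[measurable]: "K \<in> measurable (count_space UNIV) (subprob_algebra borel)"
    using Kp Ks by (auto simp: space_subprob_algebra intro: prob_space_imp_subprob_space)
  \<comment> \<open>Multiplying by the mass of the cell removes the normalisation and makes the
    identity hold for null cells as well.\<close>
  have Kint: "emeasure \<sigma> (A j) * (\<integral>\<^sup>+y. h y \<partial>K j) = (\<integral>\<^sup>+z. h (snd z) * indicator (A j) z \<partial>\<sigma>)"
    if [measurable]: "h \<in> borel_measurable borel" for h j
  proof (cases "emeasure \<sigma> (A j) = 0")
    case True
    then have "AE z in \<sigma>. z \<notin> A j" by (intro AE_not_in) (auto simp: null_sets_def)
    then have "(\<integral>\<^sup>+z. h (snd z) * indicator (A j) z \<partial>\<sigma>) = (\<integral>\<^sup>+z. 0 \<partial>\<sigma>)"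
      by (intro nn_integral_cong_AE) (auto elim!: eventually_mono)
    then show ?thesis using True by simp
  next
    case False
    have fin: "emeasure \<sigma> (A j) < top" by (simp add: \<sigma>.emeasure_eq_measure)
    have "(\<integral>\<^sup>+y. h y \<partial>K j) = (\<integral>\<^sup>+z. h (snd z) \<partial>uniform_measure \<sigma> (A j))"
      using False by (simp add: K_def nn_integral_distr)
    also have "\<dots> = (\<integral>\<^sup>+z. h (snd z) * indicator (A j) z \<partial>\<sigma>) / emeasure \<sigma> (A j)"
      by (rule nn_integral_uniform_measure) auto
    finally have "emeasure \<sigma> (A j) * (\<integral>\<^sup>+y. h y \<partial>K j) = (\<integral>\<^sup>+z. h (snd z) * indicator (A j) z \<partial>\<sigma>) * emeasure \<sigma> (A j) / emeasure \<sigma> (A j)"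
      by (simp only: ennreal_times_divide mult.commute)
    then show ?thesis using False fin by (simp only: ennreal_mult_divide_eq less_top[symmetric] simp_thms)
  qed
  \<comment> \<open>Only coordinate \<open>Suc i\<close> is overwritten, so functionals of the other
    coordinates keep their expectation.\<close>
  define k where "k w = distr (K (code r (w i))) seq_space (\<lambda>y. w(Suc i := y))" for w :: "nat \<Rightarrow> 'a"
  have k[measurable]: "k \<in> measurable Q (subprob_algebra seq_space)"
    unfolding k_def by (rule measurable_distr2[where M=borel]) measurable
  define Q' where "Q' = Q \<bind> k"
  have upd: "(\<lambda>y. w(Suc i := y)) \<in> measurable (K j) seq_space" for w :: "nat \<Rightarrow> 'a" and j
  proof -
    have "(\<lambda>y. w(Suc i := y)) \<in> measurable borel seq_space"
      by (rule measurable_fun_upd[where J=UNIV]) (auto simp: space_PiM)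
    then show ?thesis using Ks by (simp cong: measurable_cong_sets)
  qed
  have kp: "prob_space (k w)" for w
    unfolding k_def by (rule prob_space.prob_space_distr[OF Kp upd])
  have sp: "space Q \<noteq> {}" by (rule Q.not_empty)
  have Q's: "sets Q' = sets seq_space"
    unfolding Q'_def by (rule sets_bind[OF _ sp]) (simp add: k_def)
  have Q'p: "prob_space Q'"
    unfolding Q'_def by (rule Q.prob_space_bind[OF _ k]) (use kp in simp)
  have int: "(\<integral>\<^sup>+w. f w \<partial>Q') = (\<integral>\<^sup>+w. \<integral>\<^sup>+y. f (w(Suc i := y)) \<partial>K (code r (w i)) \<partial>Q)"
    if [measurable]: "f \<in> borel_measurable seq_space" for f
  proof -
    have "(\<integral>\<^sup>+w. f w \<partial>Q') = (\<integral>\<^sup>+w. \<integral>\<^sup>+v. f v \<partial>k w \<partial>Q)"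
      unfolding Q'_def by (rule nn_integral_bind[OF that k])
    then show ?thesis by (simp add: k_def nn_integral_distr[OF upd] that)
  qed
  \<comment> \<open>The kernel sees the present state only through its code, and the code has the
    same law under \<open>Q\<close> and under \<open>\<sigma>\<close>. For integrands that depend on
    the first point through its code, the chain step and the coupling therefore agree
    exactly.\<close>
  have key: "(\<integral>\<^sup>+w. \<integral>\<^sup>+y. h (code r (w i)) y \<partial>K (code r (w i)) \<partial>Q) = (\<integral>\<^sup>+z. h (code r (fst z)) (snd z) \<partial>\<sigma>)"
    if h[measurable]: "\<And>j. h j \<in> borel_measurable borel" for h :: "nat \<Rightarrow> 'a \<Rightarrow> ennreal"
  proof -
    define \<Phi> where "\<Phi> j = (\<integral>\<^sup>+y. h j y \<partial>K j)" for j
    have hc[measurable]: "(\<lambda>z. h (code r (fst z)) (snd z)) \<in> borel_measurable \<sigma>"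
      by (rule measurable_compose_countable[where f="\<lambda>j z. h j (snd z)"]) measurable
    have "(\<integral>\<^sup>+w. \<Phi> (code r (w i)) \<partial>Q) = (\<integral>\<^sup>+x. \<Phi> (code r x) \<partial>distr Q borel (\<lambda>w. w i))"
      by (subst nn_integral_distr) auto
    also have "\<dots> = (\<integral>\<^sup>+x. \<Phi> (code r x) \<partial>distr \<sigma> borel fst)" using Q(3) \<sigma>'(3) by simp
    also have "\<dots> = (\<integral>\<^sup>+z. \<Phi> (code r (fst z)) \<partial>\<sigma>)" by (subst nn_integral_distr) auto
    also have "\<dots> = (\<Sum>j. \<integral>\<^sup>+z. \<Phi> (code r (fst z)) * indicator (A j) z \<partial>\<sigma>)"
      unfolding A_def by (rule nn_integral_split_code) measurable
    also have "\<dots> = (\<Sum>j. \<integral>\<^sup>+z. h (code r (fst z)) (snd z) * indicator (A j) z \<partial>\<sigma>)"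
    proof (rule suminf_cong)
      fix j
      have "(\<integral>\<^sup>+z. \<Phi> (code r (fst z)) * indicator (A j) z \<partial>\<sigma>) = (\<integral>\<^sup>+z. \<Phi> j * indicator (A j) z \<partial>\<sigma>)"
        by (intro nn_integral_cong) (auto simp: A_def split: split_indicator)
      also have "\<dots> = emeasure \<sigma> (A j) * \<Phi> j" by (simp add: nn_integral_cmult_indicator mult.commute)
      also have "\<dots> = (\<integral>\<^sup>+z. h j (snd z) * indicator (A j) z \<partial>\<sigma>)" unfolding \<Phi>_def by (rule Kint) measurable
      also have "\<dots> = (\<integral>\<^sup>+z. h (code r (fst z)) (snd z) * indicator (A j) z \<partial>\<sigma>)"
        by (intro nn_integral_cong) (auto simp: A_def split: split_indicator)
      finally show "(\<integral>\<^sup>+z. \<Phi> (code r (fst z)) * indicator (A j) z \<partial>\<sigma>) = (\<integral>\<^sup>+z. h (code r (fst z)) (snd z) * indicator (A j) z \<partial>\<sigma>)" .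
    qed
    also have "\<dots> = (\<integral>\<^sup>+z. h (code r (fst z)) (snd z) \<partial>\<sigma>)"
      unfolding A_def by (rule nn_integral_split_code[symmetric]) measurable
    finally show ?thesis by (simp add: \<Phi>_def)
  qed
  have law: "distr Q' borel (\<lambda>w. w (Suc i)) = \<nu>"
  proof (rule measure_eqI)
    have \<nu>s: "sets \<nu> = sets borel" using \<sigma>'(4) by auto
    then show "sets (distr Q' borel (\<lambda>w. w (Suc i))) = sets \<nu>" by simp
    fix B assume "B \<in> sets (distr Q' borel (\<lambda>w. w (Suc i)))"
    then have B[measurable]: "B \<in> sets borel" by simp
    have [measurable_cong]: "sets Q' = sets seq_space" by fact
    have "emeasure (distr Q' borel (\<lambda>w. w (Suc i))) B = (\<integral>\<^sup>+w. indicator B (w (Suc i)) \<partial>Q')"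
      by (subst nn_integral_indicator[symmetric], simp, subst nn_integral_distr) auto
    also have "\<dots> = (\<integral>\<^sup>+w. \<integral>\<^sup>+y. indicator B y \<partial>K (code r (w i)) \<partial>Q)"
      by (subst int) (auto simp del: nn_integral_indicator)
    also have "\<dots> = (\<integral>\<^sup>+z. indicator B (snd z) \<partial>\<sigma>)"
      by (rule key[of "\<lambda>_ y. indicator B y"]) measurable
    also have "\<dots> = emeasure (distr \<sigma> borel snd) B"
      by (subst nn_integral_indicator[symmetric], simp, subst nn_integral_distr) auto
    finally show "emeasure (distr Q' borel (\<lambda>w. w (Suc i))) B = emeasure \<nu> B" using \<sigma>'(4) by simp
  qed
  have cost: "(\<integral>\<^sup>+w. ennreal (dist (w i) (w (Suc i))) \<partial>Q') \<le> (\<integral>\<^sup>+z. ennreal (dist (fst z) (snd z)) \<partial>\<sigma>) + ennreal (2 * r)"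
  proof -
    \<comment> \<open>Replacing the present state by the dense point of its cell costs
      \<open>r\<close> before and \<open>r\<close> after the use of \<open>key\<close>, which gives
      the term \<open>2 * r\<close>.\<close>
    let ?h = "\<lambda>j y. ennreal (dist (dense_seq j) y) + ennreal r"
    have "(\<integral>\<^sup>+w. ennreal (dist (w i) (w (Suc i))) \<partial>Q') = (\<integral>\<^sup>+w. \<integral>\<^sup>+y. ennreal (dist (w i) y) \<partial>K (code r (w i)) \<partial>Q)"
      by (subst int) auto
    also have "\<dots> \<le> (\<integral>\<^sup>+w. \<integral>\<^sup>+y. ?h (code r (w i)) y \<partial>K (code r (w i)) \<partial>Q)"
    proof (intro nn_integral_mono)
      fix w :: "nat \<Rightarrow> 'a" and y
      have "dist (w i) y \<le> dist (dense_seq (code r (w i))) y + r"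
        using dist_code[OF r, of "w i"] dist_triangle[of "w i" y "dense_seq (code r (w i))"] by linarith
      then show "ennreal (dist (w i) y) \<le> ?h (code r (w i)) y"
        using r by (simp add: ennreal_leI flip: ennreal_plus)
    qed
    also have "\<dots> = (\<integral>\<^sup>+z. ?h (code r (fst z)) (snd z) \<partial>\<sigma>)" by (rule key) measurable
    also have "\<dots> \<le> (\<integral>\<^sup>+z. ennreal (dist (fst z) (snd z)) + ennreal (2 * r) \<partial>\<sigma>)"
    proof (intro nn_integral_mono)
      fix z :: "'a \<times> 'a"
      have "dist (dense_seq (code r (fst z))) (snd z) + r \<le> dist (fst z) (snd z) + 2 * r"
        using dist_code[OF r, of "fst z"] dist_triangle[of "dense_seq (code r (fst z))" "snd z" "fst z"]
        by (simp add: dist_commute)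
      then show "?h (code r (fst z)) (snd z) \<le> ennreal (dist (fst z) (snd z)) + ennreal (2 * r)"
        using r by (simp add: ennreal_leI flip: ennreal_plus)
    qed
    also have "\<dots> = (\<integral>\<^sup>+z. ennreal (dist (fst z) (snd z)) \<partial>\<sigma>) + ennreal (2 * r)"
      by (subst nn_integral_add) (auto simp: \<sigma>.emeasure_space_1)
    finally show ?thesis .
  qed
  show ?thesis
  proof (rule that[OF Q'p Q's law cost])
    fix f :: "(nat \<Rightarrow> 'a) \<Rightarrow> ennreal" assume f: "f \<in> borel_measurable seq_space" "\<And>w y. f (w(Suc i := y)) = f w"
    show "(\<integral>\<^sup>+w. f w \<partial>Q') = (\<integral>\<^sup>+w. f w \<partial>Q)"
      using f by (subst int) (auto simp: prob_space.emeasure_space_1[OF Kp])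
  qed
qed

text \<open>The indicator of an event about coordinate \<open>j\<close> does not change when
  coordinate \<open>n\<close> is overwritten, so the laws of the other coordinates survive an
  extension step.\<close>

lemma law_eqI:
  assumes "sets Q = sets seq_space" "sets Q' = sets seq_space"
    and "\<And>f. f \<in> borel_measurable seq_space \<Longrightarrow> (\<And>w y. f (w(n := y)) = f w) \<Longrightarrow> (\<integral>\<^sup>+w. f w \<partial>Q') = (\<integral>\<^sup>+w. f w \<partial>Q)"
    and "j \<noteq> n"
  shows "distr Q' borel (\<lambda>w::nat\<Rightarrow>'a::polish_space. w j) = distr Q borel (\<lambda>w. w j)"
proof (rule measure_eqI)
  fix B assume "B \<in> sets (distr Q' borel (\<lambda>w. w j))"
  then have B[measurable]: "B \<in> sets borel" by simp
  have [measurable_cong]: "sets Q' = sets seq_space" "sets Q = sets seq_space" by fact+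
  have *: "emeasure (distr R borel (\<lambda>w. w j)) B = (\<integral>\<^sup>+w. indicator B (w j) \<partial>R)" if [measurable_cong]: "sets R = sets seq_space" for R
    by (subst nn_integral_indicator[symmetric], simp, subst nn_integral_distr) auto
  show "emeasure (distr Q' borel (\<lambda>w. w j)) B = emeasure (distr Q borel (\<lambda>w. w j)) B"
    unfolding *[OF assms(1)] *[OF assms(2)] by (rule assms(3)) (use assms(4) in auto)
qed simp

section \<open>The Wasserstein distance as a metric\<close>

lemma P1D:
  assumes "\<mu> \<in> P1"
  shows "prob_space \<mu>" "sets \<mu> = sets borel"
  using assms by (auto simp: P1_def)

lemma coupling_of_random_variables:
  fixes X Y :: "'b \<Rightarrow> 'a::polish_space"
  assumes "prob_space M" "X \<in> measurable M borel" "Y \<in> measurable M borel"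
  shows "distr M borel (\<lambda>\<omega>. (X \<omega>, Y \<omega>)) \<in> couplings (distr M borel X) (distr M borel Y)"
    "(\<integral>\<^sup>+z. ennreal (dist (fst z) (snd z)) \<partial>distr M borel (\<lambda>\<omega>. (X \<omega>, Y \<omega>))) = (\<integral>\<^sup>+\<omega>. ennreal (dist (X \<omega>) (Y \<omega>)) \<partial>M)"
proof -
  note [measurable] = assms(2,3)
  have m: "(\<lambda>\<omega>. (X \<omega>, Y \<omega>)) \<in> measurable M borel" by (subst borel_prod[symmetric]) measurable
  have fs: "fst \<in> borel_measurable (borel :: ('a\<times>'a) measure)" "snd \<in> borel_measurable (borel :: ('a\<times>'a) measure)"
    by (auto simp: borel_prod[symmetric])
  show "distr M borel (\<lambda>\<omega>. (X \<omega>, Y \<omega>)) \<in> couplings (distr M borel X) (distr M borel Y)"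
    unfolding couplings_def using m fs assms(1)
    by (auto simp: distr_distr o_def intro: prob_space.prob_space_distr)
  have "(\<lambda>z. ennreal (dist (fst z) (snd z))) \<in> borel_measurable (borel :: ('a\<times>'a) measure)"
    by (intro measurable_compose[OF _ measurable_ennreal] borel_measurable_dist fs)
  then show "(\<integral>\<^sup>+z. ennreal (dist (fst z) (snd z)) \<partial>distr M borel (\<lambda>\<omega>. (X \<omega>, Y \<omega>))) = (\<integral>\<^sup>+\<omega>. ennreal (dist (X \<omega>) (Y \<omega>)) \<partial>M)"
    using m by (subst nn_integral_distr) auto
qed

lemma W1_le:
  assumes "\<sigma> \<in> couplings \<mu> \<nu>" "(\<integral>\<^sup>+z. ennreal (dist (fst z) (snd z)) \<partial>\<sigma>) \<le> ennreal c" "0 \<le> c"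
  shows "W1 \<mu> \<nu> \<le> c"
  unfolding W1_def using assms by (intro enn2real_leI INF_lower2[OF assms(1)]) auto

lemma W1_le_random_variables:
  fixes X Y :: "'b \<Rightarrow> 'a::polish_space"
  assumes "prob_space M" "X \<in> measurable M borel" "Y \<in> measurable M borel"
    "(\<integral>\<^sup>+\<omega>. ennreal (dist (X \<omega>) (Y \<omega>)) \<partial>M) \<le> ennreal c" "0 \<le> c"
  shows "W1 (distr M borel X) (distr M borel Y) \<le> c"
  by (rule W1_le[OF coupling_of_random_variables(1)[OF assms(1-3)]])
    (use assms in \<open>simp_all add: coupling_of_random_variables(2)[OF assms(1-3)]\<close>)

text \<open>The product coupling has finite cost by the first moments. This rules out that
  \<open>enn2real\<close> in \<open>W1\<close> turns an infinite infimum into zero.\<close>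

lemma finite_coupling_exists:
  fixes \<mu> :: "'a::polish_space measure"
  assumes "\<mu> \<in> P1" "\<nu> \<in> P1"
  obtains \<sigma> where "\<sigma> \<in> couplings \<mu> \<nu>" "(\<integral>\<^sup>+z. ennreal (dist (fst z) (snd z)) \<partial>\<sigma>) < \<infinity>"
proof -
  note m = P1D[OF assms(1)] and n = P1D[OF assms(2)]
  interpret \<mu>: prob_space \<mu> by fact
  interpret \<nu>: prob_space \<nu> by fact
  interpret pair_prob_space \<mu> \<nu> ..
  note [measurable_cong] = m(2) n(2)
  obtain x0 y0 where fin: "(\<integral>\<^sup>+x. ennreal (dist x0 x) \<partial>\<mu>) < \<infinity>" "(\<integral>\<^sup>+x. ennreal (dist y0 x) \<partial>\<nu>) < \<infinity>"
    using assms by (auto simp: P1_def)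
  have P: "prob_space (\<mu> \<Otimes>\<^sub>M \<nu>)" by unfold_locales
  have d1: "distr (\<mu> \<Otimes>\<^sub>M \<nu>) borel fst = \<mu>"
    using m(2) \<nu>.distr_pair_fst[of \<mu>] by (metis distr_cong)
  have d2: "distr (\<mu> \<Otimes>\<^sub>M \<nu>) borel snd = \<nu>"
  proof (rule measure_eqI)
    fix B assume "B \<in> sets (distr (\<mu> \<Otimes>\<^sub>M \<nu>) borel snd)"
    then have B[measurable]: "B \<in> sets borel" by simp
    have "snd -` B \<inter> space (\<mu> \<Otimes>\<^sub>M \<nu>) = space \<mu> \<times> B"
      using B sets.sets_into_space[of B \<nu>] n(2) by (auto simp: space_pair_measure)
    then show "emeasure (distr (\<mu> \<Otimes>\<^sub>M \<nu>) borel snd) B = emeasure \<nu> B"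
      using B n by (simp add: emeasure_distr \<nu>.emeasure_pair_measure_Times \<mu>.emeasure_space_1)
  qed (simp add: n)
  have "distr (\<mu> \<Otimes>\<^sub>M \<nu>) borel (\<lambda>\<omega>. (fst \<omega>, snd \<omega>)) \<in> couplings \<mu> \<nu>"
    using coupling_of_random_variables(1)[OF P, of fst snd] d1 d2 by simp
  moreover have "(\<integral>\<^sup>+z. ennreal (dist (fst z) (snd z)) \<partial>distr (\<mu> \<Otimes>\<^sub>M \<nu>) borel (\<lambda>\<omega>. (fst \<omega>, snd \<omega>))) < \<infinity>"
  proof (subst coupling_of_random_variables(2)[OF P])
    have "(\<integral>\<^sup>+z. ennreal (dist (fst z) (snd z)) \<partial>(\<mu> \<Otimes>\<^sub>M \<nu>))
      \<le> (\<integral>\<^sup>+z. ennreal (dist x0 (fst z)) + ennreal (dist x0 y0) + ennreal (dist y0 (snd z)) \<partial>(\<mu> \<Otimes>\<^sub>M \<nu>))"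
    proof (intro nn_integral_mono)
      fix z :: "'a \<times> 'a"
      have "dist (fst z) (snd z) \<le> dist x0 (fst z) + dist x0 y0 + dist y0 (snd z)"
        by (metis add.assoc add_left_mono dist_commute dist_triangle order_trans)
      then show "ennreal (dist (fst z) (snd z)) \<le> ennreal (dist x0 (fst z)) + ennreal (dist x0 y0) + ennreal (dist y0 (snd z))"
        by (simp add: ennreal_leI flip: ennreal_plus)
    qed
    also have "\<dots> = (\<integral>\<^sup>+x. ennreal (dist x0 x) \<partial>\<mu>) + ennreal (dist x0 y0) + (\<integral>\<^sup>+x. ennreal (dist y0 x) \<partial>\<nu>)"
    proof -
      have "(\<integral>\<^sup>+z. ennreal (dist x0 (fst z)) \<partial>(\<mu> \<Otimes>\<^sub>M \<nu>)) = (\<integral>\<^sup>+x. ennreal (dist x0 x) \<partial>distr (\<mu> \<Otimes>\<^sub>M \<nu>) borel fst)"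
        by (subst nn_integral_distr) auto
      moreover have "(\<integral>\<^sup>+z. ennreal (dist y0 (snd z)) \<partial>(\<mu> \<Otimes>\<^sub>M \<nu>)) = (\<integral>\<^sup>+x. ennreal (dist y0 x) \<partial>distr (\<mu> \<Otimes>\<^sub>M \<nu>) borel snd)"
        by (subst nn_integral_distr) auto
      ultimately show ?thesis
        by (simp add: nn_integral_add d1 d2 prob_space.emeasure_space_1[OF P])
    qed
    also have "\<dots> < \<infinity>" using fin by simp
    finally show "(\<integral>\<^sup>+z. ennreal (dist (fst z) (snd z)) \<partial>(\<mu> \<Otimes>\<^sub>M \<nu>)) < \<infinity>" .
  qed auto
  ultimately show ?thesis by (rule that)
qed

text \<open>Once the infimum is finite it equals \<open>ennreal (W1 \<mu> \<nu>)\<close>, and a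
  positive \<open>\<epsilon>\<close> leaves room for a near-minimiser.\<close>

lemma almost_optimal_coupling:
  fixes \<mu> :: "'a::polish_space measure"
  assumes "\<mu> \<in> P1" "\<nu> \<in> P1" "0 < \<epsilon>"
  obtains \<sigma> where "\<sigma> \<in> couplings \<mu> \<nu>" "(\<integral>\<^sup>+z. ennreal (dist (fst z) (snd z)) \<partial>\<sigma>) < ennreal (W1 \<mu> \<nu> + \<epsilon>)"
proof -
  let ?I = "INF \<sigma>\<in>couplings \<mu> \<nu>. \<integral>\<^sup>+z. ennreal (dist (fst z) (snd z)) \<partial>\<sigma>"
  obtain \<sigma>0 where "\<sigma>0 \<in> couplings \<mu> \<nu>" "(\<integral>\<^sup>+z. ennreal (dist (fst z) (snd z)) \<partial>\<sigma>0) < \<infinity>"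
    using finite_coupling_exists[OF assms(1,2)] by blast
  then have "?I < top" by (auto simp: INF_less_iff)
  then have "?I = ennreal (W1 \<mu> \<nu>)" by (simp add: W1_def)
  also have "\<dots> < ennreal (W1 \<mu> \<nu> + \<epsilon>)" using assms by (intro ennreal_lessI) (auto simp: W1_def add_nonneg_pos)
  finally show ?thesis using that by (auto simp: INF_less_iff)
qed

text \<open>Each extension draws one new coordinate and changes neither the earlier laws nor the
  earlier costs. The base case copies one point of law \<open>\<nu> 0\<close> into all coordinates,
  those beyond \<open>N\<close> being placeholders that later steps overwrite.\<close>

lemma coupling_chain:
  fixes \<nu> :: "nat \<Rightarrow> 'a::polish_space measure"
  assumes "\<And>i. i \<le> N \<Longrightarrow> \<nu> i \<in> P1" "0 < \<epsilon>"
  shows "\<exists>Q. prob_space Q \<and> sets Q = sets seq_space \<and> (\<forall>i\<le>N. distr Q borel (\<lambda>w. w i) = \<nu> i) \<and>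
    (\<forall>i<N. (\<integral>\<^sup>+w. ennreal (dist (w i) (w (Suc i))) \<partial>Q) \<le> ennreal (W1 (\<nu> i) (\<nu> (Suc i)) + \<epsilon>))"
  using assms(1)
proof (induction N)
  case 0
  then have n: "prob_space (\<nu> 0)" "sets (\<nu> 0) = sets borel" by (auto simp: P1D)
  have [measurable_cong]: "sets (\<nu> 0) = sets borel" by fact
  have m: "(\<lambda>x _. x) \<in> measurable (\<nu> 0) seq_space" by (rule measurable_PiM_single') auto
  have "distr (distr (\<nu> 0) seq_space (\<lambda>x _. x)) borel (\<lambda>w. w 0) = distr (\<nu> 0) (\<nu> 0) (\<lambda>x. x)"
  proof -
    have "distr (distr (\<nu> 0) seq_space (\<lambda>x _. x)) borel (\<lambda>w. w (0::nat)) = distr (\<nu> 0) borel ((\<lambda>w. w (0::nat)) \<circ> (\<lambda>x _. x))"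
      by (rule distr_distr[OF _ m]) measurable
    then show ?thesis using n by (simp add: o_def cong: distr_cong)
  qed
  then show ?case
    using m by (intro exI[of _ "distr (\<nu> 0) seq_space (\<lambda>x _. x)"])
      (auto simp: prob_space.prob_space_distr[OF n(1)])
next
  case (Suc N)
  from Suc.IH[OF Suc.prems[OF le_SucI]] obtain Q where Q: "prob_space Q" "sets Q = sets seq_space" "\<And>i. i \<le> N \<Longrightarrow> distr Q borel (\<lambda>w. w i) = \<nu> i"
    "\<And>i. i < N \<Longrightarrow> (\<integral>\<^sup>+w. ennreal (dist (w i) (w (Suc i))) \<partial>Q) \<le> ennreal (W1 (\<nu> i) (\<nu> (Suc i)) + \<epsilon>)"
    by blast
  obtain \<sigma> where \<sigma>: "\<sigma> \<in> couplings (\<nu> N) (\<nu> (Suc N))"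
    "(\<integral>\<^sup>+z. ennreal (dist (fst z) (snd z)) \<partial>\<sigma>) < ennreal (W1 (\<nu> N) (\<nu> (Suc N)) + \<epsilon>/2)"
    using almost_optimal_coupling[of "\<nu> N" "\<nu> (Suc N)" "\<epsilon>/2"] Suc.prems assms(2) by auto
  \<comment> \<open>The error is shared: \<open>\<epsilon>/2\<close> for the near-optimal coupling
    and \<open>2 * (\<epsilon>/4)\<close> for the size of the cells.\<close>
  have \<epsilon>4: "0 < \<epsilon> / 4" using assms(2) by simp
  obtain Q' where Q': "prob_space Q'" "sets Q' = sets seq_space" "distr Q' borel (\<lambda>w. w (Suc N)) = \<nu> (Suc N)"
    "(\<integral>\<^sup>+w. ennreal (dist (w N) (w (Suc N))) \<partial>Q') \<le> (\<integral>\<^sup>+z. ennreal (dist (fst z) (snd z)) \<partial>\<sigma>) + ennreal (2 * (\<epsilon>/4))"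
    "\<And>f. f \<in> borel_measurable seq_space \<Longrightarrow> (\<And>w y. f (w(Suc N := y)) = f w) \<Longrightarrow> (\<integral>\<^sup>+w. f w \<partial>Q') = (\<integral>\<^sup>+w. f w \<partial>Q)"
    using extend_by_coupling[OF Q(1,2) Q(3)[OF order_refl] \<sigma>(1) \<epsilon>4] by blast
  have "distr Q' borel (\<lambda>w. w i) = \<nu> i" if "i \<le> Suc N" for i
  proof (cases "i = Suc N")
    case False
    then have "distr Q' borel (\<lambda>w. w i) = distr Q borel (\<lambda>w. w i)"
      by (intro law_eqI[OF Q(2) Q'(2), of "Suc N"] Q'(5)) auto
    then show ?thesis using Q(3) that False by simp
  qed (use Q'(3) in simp)
  moreover have "(\<integral>\<^sup>+w. ennreal (dist (w i) (w (Suc i))) \<partial>Q') \<le> ennreal (W1 (\<nu> i) (\<nu> (Suc i)) + \<epsilon>)" if "i < Suc N" for i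
  proof (cases "i = N")
    case True
    note Q'(4)
    also have "(\<integral>\<^sup>+z. ennreal (dist (fst z) (snd z)) \<partial>\<sigma>) + ennreal (2 * (\<epsilon>/4)) \<le> ennreal (W1 (\<nu> N) (\<nu> (Suc N)) + \<epsilon>/2) + ennreal (2 * (\<epsilon>/4))"
      using \<sigma>(2) by (intro add_right_mono) simp
    also have "\<dots> = ennreal (W1 (\<nu> N) (\<nu> (Suc N)) + \<epsilon>/2 + 2 * (\<epsilon>/4))"
      using assms(2) by (intro ennreal_plus[symmetric]) (auto simp: W1_def)
    finally show ?thesis using True by (simp add: add.assoc)
  next
    case False
    then have "(\<integral>\<^sup>+w. ennreal (dist (w i) (w (Suc i))) \<partial>Q') = (\<integral>\<^sup>+w. ennreal (dist (w i) (w (Suc i))) \<partial>Q)"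
      using that by (intro Q'(5)) auto
    then show ?thesis using Q(4) that False by simp
  qed
  ultimately show ?case using Q'(1,2) by blast
qed

lemma W1_nonneg: "0 \<le> W1 \<mu> \<nu>" by (simp add: W1_def)

text \<open>A chain through the three measures puts both couplings on one probability space, where
  the triangle inequality of \<open>dist\<close> can be integrated.\<close>

lemma W1_triangle:
  fixes \<mu> :: "'a::polish_space measure"
  assumes "\<mu> \<in> P1" "\<nu> \<in> P1" "\<rho> \<in> P1"
  shows "W1 \<mu> \<rho> \<le> W1 \<mu> \<nu> + W1 \<nu> \<rho>"
proof (rule field_le_epsilon)
  fix e :: real assume e: "0 < e"
  define n where "n i = (if i = 0 then \<mu> else if i = 1 then \<nu> else \<rho>)" for i :: nat
  have n: "n i \<in> P1" for i using assms by (simp add: n_def)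
  obtain Q where Q: "prob_space Q" "sets Q = sets seq_space" "\<And>i. i \<le> 2 \<Longrightarrow> distr Q borel (\<lambda>w. w i) = n i"
    "\<And>i. i < 2 \<Longrightarrow> (\<integral>\<^sup>+w. ennreal (dist (w i) (w (Suc i))) \<partial>Q) \<le> ennreal (W1 (n i) (n (Suc i)) + e/2)"
    using coupling_chain[of 2 n "e/2", OF n half_gt_zero[OF e]] by blast
  have [measurable_cong]: "sets Q = sets seq_space" by fact
  have "(\<integral>\<^sup>+w. ennreal (dist (w 0) (w 2)) \<partial>Q) \<le> (\<integral>\<^sup>+w. ennreal (dist (w 0) (w 1)) + ennreal (dist (w 1) (w 2)) \<partial>Q)"
    by (intro nn_integral_mono) (simp add: ennreal_leI dist_triangle flip: ennreal_plus)
  also have "\<dots> = (\<integral>\<^sup>+w. ennreal (dist (w 0) (w 1)) \<partial>Q) + (\<integral>\<^sup>+w. ennreal (dist (w 1) (w 2)) \<partial>Q)"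
    by (rule nn_integral_add) auto
  also have "\<dots> \<le> ennreal (W1 \<mu> \<nu> + e/2) + ennreal (W1 \<nu> \<rho> + e/2)"
    using Q(4)[of 0] Q(4)[of 1] by (intro add_mono) (auto simp: n_def numeral_2_eq_2)
  also have "\<dots> = ennreal (W1 \<mu> \<nu> + W1 \<nu> \<rho> + e)"
    using e by (simp add: W1_nonneg flip: ennreal_plus)
  finally have "W1 (distr Q borel (\<lambda>w. w 0)) (distr Q borel (\<lambda>w. w 2)) \<le> W1 \<mu> \<nu> + W1 \<nu> \<rho> + e"
    using e by (intro W1_le_random_variables Q(1)) (auto simp: W1_nonneg)
  then show "W1 \<mu> \<rho> \<le> W1 \<mu> \<nu> + W1 \<nu> \<rho> + e" using Q(3)[of 0] Q(3)[of 2] by (simp add: n_def)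
qed

lemma W1_commute: "W1 \<mu> \<nu> = W1 \<nu> (\<mu> :: 'a::polish_space measure)"
proof -
  have "(INF \<sigma>\<in>couplings \<nu> \<mu>. \<integral>\<^sup>+z. ennreal (dist (fst z) (snd z)) \<partial>\<sigma>) \<le> (INF \<sigma>\<in>couplings \<mu> \<nu>. \<integral>\<^sup>+z. ennreal (dist (fst z) (snd z)) \<partial>\<sigma>)"
    for \<mu> \<nu> :: "'a measure"
  proof (rule INF_greatest)
    fix \<sigma> assume "\<sigma> \<in> couplings \<mu> \<nu>"
    note s = couplingsD[OF this]
    have [measurable_cong]: "sets \<sigma> = sets (borel \<Otimes>\<^sub>M borel)" using s by (simp add: borel_pair)
    show "(INF \<sigma>\<in>couplings \<nu> \<mu>. \<integral>\<^sup>+z. ennreal (dist (fst z) (snd z)) \<partial>\<sigma>) \<le> (\<integral>\<^sup>+z. ennreal (dist (fst z) (snd z)) \<partial>\<sigma>)"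
      using coupling_of_random_variables[OF s(1), of snd fst] s
      by (intro INF_lower2[of "distr \<sigma> borel (\<lambda>z. (snd z, fst z))"]) (auto simp: dist_commute)
  qed
  then show ?thesis unfolding W1_def by (intro arg_cong[where f=enn2real] antisym)
qed

lemma W1_refl:
  fixes \<mu> :: "'a::polish_space measure"
  assumes "\<mu> \<in> P1"
  shows "W1 \<mu> \<mu> = 0"
proof -
  have [measurable_cong]: "sets \<mu> = sets borel" using P1D[OF assms] by simp
  have "distr \<mu> borel (\<lambda>x. x) = \<mu>" using P1D[OF assms] by (metis distr_cong distr_id)
  then have "W1 \<mu> \<mu> \<le> 0"
    using W1_le_random_variables[of \<mu> "\<lambda>x. x" "\<lambda>x. x" 0] P1D[OF assms] by auto
  then show ?thesis using W1_nonneg[of \<mu> \<mu>] by simp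
qed

text \<open>Markov's inequality: a coupling of cost below \<open>e * \<delta>\<close> puts mass at
  most \<open>e\<close> on pairs at distance \<open>\<delta>\<close> or more, so the \<mu>-mass of
  \<open>C\<close> is at most the \<nu>-mass of its closed \<delta>-neighbourhood plus
  \<open>e\<close>. These neighbourhoods shrink to the closed set \<open>C\<close>.\<close>

lemma W1_zero_closed_le:
  fixes \<mu> :: "'a::polish_space measure"
  assumes "\<mu> \<in> P1" "\<nu> \<in> P1" "W1 \<mu> \<nu> = 0" "closed C"
  shows "measure \<mu> C \<le> measure \<nu> C"
proof (cases "C = {}")
  case False
  note m = P1D[OF assms(1)] and n = P1D[OF assms(2)]
  interpret \<mu>: prob_space \<mu> by fact
  interpret \<nu>: prob_space \<nu> by fact
  define T where "T k = {x. infdist x C \<le> 1 / real (Suc k)}" for k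
  have Tc: "closed (T k)" for k unfolding T_def by (intro closed_Collect_le continuous_intros)
  have Tb[measurable]: "T k \<in> sets borel" and [measurable]: "C \<in> sets borel" for k using Tc assms(4) by auto
  have le: "measure \<mu> C \<le> measure \<nu> (T k)" for k
  proof (rule field_le_epsilon)
    fix e :: real assume e: "0 < e"
    let ?\<delta> = "1 / real (Suc k)"
    obtain \<sigma> where \<sigma>: "\<sigma> \<in> couplings \<mu> \<nu>" "(\<integral>\<^sup>+z. ennreal (dist (fst z) (snd z)) \<partial>\<sigma>) < ennreal (0 + e * ?\<delta>)"
      using almost_optimal_coupling[OF assms(1,2), of "e * ?\<delta>"] e unfolding assms(3) by auto
    note s = couplingsD[OF \<sigma>(1)]
    interpret \<sigma>: prob_space \<sigma> by fact
    have [measurable_cong]: "sets \<sigma> = sets (borel \<Otimes>\<^sub>M borel)" using s by (simp add: borel_pair)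
    have sp: "space \<sigma> = UNIV" using s(2) by (auto dest: sets_eq_imp_space_eq)
    let ?D = "{z\<in>space \<sigma>. ?\<delta> \<le> dist (fst z) (snd z)}"
    have D: "emeasure \<sigma> ?D \<le> ennreal e"
    proof -
      have "ennreal ?\<delta> * emeasure \<sigma> ?D = (\<integral>\<^sup>+z. ennreal ?\<delta> * indicator ?D z \<partial>\<sigma>)"
        by (subst nn_integral_cmult_indicator) auto
      also have "\<dots> \<le> (\<integral>\<^sup>+z. ennreal (dist (fst z) (snd z)) \<partial>\<sigma>)"
        by (intro nn_integral_mono) (auto split: split_indicator intro!: ennreal_leI)
      also have "\<dots> \<le> ennreal (e * ?\<delta>)" using \<sigma>(2) by simp
      finally have "?\<delta> * measure \<sigma> ?D \<le> e * ?\<delta>"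
        using e by (simp add: \<sigma>.emeasure_eq_measure ennreal_le_iff flip: ennreal_mult del: of_nat_Suc)
      then have "measure \<sigma> ?D \<le> e" by (simp add: field_simps del: of_nat_Suc)
      then show ?thesis by (simp add: \<sigma>.emeasure_eq_measure ennreal_leI)
    qed
    have "emeasure \<mu> C = emeasure \<sigma> {z\<in>space \<sigma>. fst z \<in> C}"
      unfolding s(3)[symmetric] by (subst emeasure_distr) (auto intro!: arg_cong[where f="emeasure \<sigma>"])
    also have "\<dots> \<le> emeasure \<sigma> ({z\<in>space \<sigma>. snd z \<in> T k} \<union> ?D)"
    proof (rule emeasure_mono)
      show "{z\<in>space \<sigma>. fst z \<in> C} \<subseteq> {z\<in>space \<sigma>. snd z \<in> T k} \<union> ?D"
      proof
        fix z assume z: "z \<in> {z\<in>space \<sigma>. fst z \<in> C}"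
        then have "infdist (snd z) C \<le> dist (fst z) (snd z)" using infdist_le[of "fst z" C "snd z"] by (simp add: dist_commute)
        then show "z \<in> {z\<in>space \<sigma>. snd z \<in> T k} \<union> ?D" using z by (auto simp: T_def)
      qed
    qed measurable
    also have "\<dots> \<le> emeasure \<sigma> {z\<in>space \<sigma>. snd z \<in> T k} + emeasure \<sigma> ?D"
      by (rule emeasure_subadditive) measurable
    also have "emeasure \<sigma> {z\<in>space \<sigma>. snd z \<in> T k} = emeasure \<nu> (T k)"
      unfolding s(4)[symmetric] by (subst emeasure_distr) (auto intro!: arg_cong[where f="emeasure \<sigma>"])
    finally have "emeasure \<mu> C \<le> emeasure \<nu> (T k) + ennreal e" using D by (meson add_left_mono order_trans)
    then show "measure \<mu> C \<le> measure \<nu> (T k) + e"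
      using e by (simp add: \<mu>.emeasure_eq_measure \<nu>.emeasure_eq_measure ennreal_le_iff flip: ennreal_plus)
  qed
  have "(\<lambda>k. measure \<nu> (T k)) \<longlonglongrightarrow> measure \<nu> (\<Inter>k. T k)"
  proof (rule \<nu>.finite_Lim_measure_decseq)
    show "range T \<subseteq> sets \<nu>" using n Tb by (simp add: image_subset_iff)
    have "1 / real (Suc (Suc k)) \<le> 1 / real (Suc k)" for k by (simp add: frac_le)
    then show "decseq T" unfolding decseq_Suc_iff T_def by (auto intro: order_trans)
  qed
  moreover have "(\<Inter>k. T k) = C"
  proof (intro equalityI subsetI)
    fix x assume x: "x \<in> (\<Inter>k. T k)"
    have "infdist x C \<le> 0"
    proof (rule field_le_epsilon)
      fix e :: real assume "0 < e"
      then obtain k where "inverse (real (Suc k)) < e" using reals_Archimedean by blast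
      moreover have "infdist x C \<le> 1 / real (Suc k)" using x unfolding T_def by blast
      ultimately show "infdist x C \<le> 0 + e" by (simp only: inverse_eq_divide)
    qed
    then have "infdist x C = 0" using infdist_nonneg[of x C] by simp
    then show "x \<in> C" using assms(4) False by (simp add: in_closed_iff_infdist_zero)
  qed (auto simp: T_def)
  ultimately show ?thesis using le by (metis LIMSEQ_le_const)
qed simp

text \<open>Closed sets are stable under intersection and generate the Borel sets; on them the two
  inequalities from \<open>W1_zero_closed_le\<close> give equality.\<close>

lemma W1_zero_imp_eq:
  fixes \<mu> :: "'a::polish_space measure"
  assumes "\<mu> \<in> P1" "\<nu> \<in> P1" "W1 \<mu> \<nu> = 0"
  shows "\<mu> = \<nu>"
proof -
  note m = P1D[OF assms(1)] and n = P1D[OF assms(2)]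
  interpret \<mu>: prob_space \<mu> by fact
  interpret \<nu>: prob_space \<nu> by fact
  have sp: "space \<mu> = UNIV" "space \<nu> = UNIV" using m n by (auto dest: sets_eq_imp_space_eq)
  show ?thesis
  proof (rule measure_eqI_generator_eq[where E="{C. closed C}" and A="\<lambda>_. UNIV" and \<Omega>=UNIV])
    show "Int_stable {C::'a set. closed C}" by (auto simp: Int_stable_def)
    show "sets \<mu> = sigma_sets UNIV {C. closed C}" "sets \<nu> = sigma_sets UNIV {C. closed C}"
      using m n by (auto simp: borel_eq_closed)
    fix C :: "'a set" assume "C \<in> {C. closed C}"
    then show "emeasure \<mu> C = emeasure \<nu> C"
      using W1_zero_closed_le[OF assms] W1_zero_closed_le[OF assms(2,1)] assms(3) W1_commute[of \<mu> \<nu>]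
      by (simp add: \<mu>.emeasure_eq_measure \<nu>.emeasure_eq_measure antisym)
  qed auto
qed

lemma Metric_space_P1: "Metric_space (P1 :: 'a::polish_space measure set) W1"
proof
  fix \<mu> \<nu> \<rho> :: "'a measure"
  show "0 \<le> W1 \<mu> \<nu>" by (rule W1_nonneg)
  show "W1 \<mu> \<nu> = W1 \<nu> \<mu>" by (rule W1_commute)
  show "(W1 \<mu> \<nu> = 0) = (\<mu> = \<nu>)" if "\<mu> \<in> P1" "\<nu> \<in> P1" using W1_zero_imp_eq[OF that] W1_refl that by auto
  show "W1 \<mu> \<rho> \<le> W1 \<mu> \<nu> + W1 \<nu> \<rho>" if "\<mu> \<in> P1" "\<nu> \<in> P1" "\<rho> \<in> P1" using that by (rule W1_triangle)
qed

section \<open>The Skorokhod metric\<close>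

abbreviation cadlag_paths :: "(real \<Rightarrow> 'a::metric_space) set" where
  "cadlag_paths \<equiv> cadlag UNIV dist"

lemma cadlag_right:
  fixes \<gamma> :: "real \<Rightarrow> 'a::metric_space"
  assumes "\<gamma> \<in> cadlag_paths" "0 \<le> t" "t < 1" "0 < \<epsilon>"
  obtains \<delta> where "0 < \<delta>" "t + \<delta> \<le> 1" "\<And>s. t \<le> s \<Longrightarrow> s < t + \<delta> \<Longrightarrow> dist (\<gamma> t) (\<gamma> s) < \<epsilon>"
  using Met_TC.right_contD[OF Met_TC.cadlag_right_cont[OF assms(1)] assms(2-4)] by blast

lemma cadlag_left:
  fixes \<gamma> :: "real \<Rightarrow> 'a::metric_space"
  assumes "\<gamma> \<in> cadlag_paths" "0 < t" "t \<le> 1" "0 < \<epsilon>"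
  obtains \<delta> where "0 < \<delta>" "\<And>s s'. t - \<delta> < s \<Longrightarrow> s < t \<Longrightarrow> t - \<delta> < s' \<Longrightarrow> s' < t \<Longrightarrow> dist (\<gamma> s) (\<gamma> s') < \<epsilon>"
proof -
  have "t \<in> {0<..1}" using assms by simp
  then obtain l where "limitin Met_TC.mtopology \<gamma> l (at_left t)"
    using assms(1) unfolding cadlag_def by blast
  then have "\<forall>e>0. \<forall>\<^sub>F s in at_left t. \<gamma> s \<in> UNIV \<and> dist (\<gamma> s) l < e"
    unfolding Met_TC.limitin_metric by blast
  from this[rule_format, of "\<epsilon>/2"] have "\<forall>\<^sub>F s in at_left t. dist (\<gamma> s) l < \<epsilon> / 2"
    using assms(4) by simp
  then obtain b where b: "b < t" "\<And>s. b < s \<Longrightarrow> s < t \<Longrightarrow> dist (\<gamma> s) l < \<epsilon> / 2"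
    by (auto simp: eventually_at_left_field)
  show ?thesis
  proof (rule that[of "t - b"])
    fix s s' assume "t - (t - b) < s" "s < t" "t - (t - b) < s'" "s' < t"
    then show "dist (\<gamma> s) (\<gamma> s') < \<epsilon>" using b(2)[of s] b(2)[of s'] dist_triangle2[of "\<gamma> s" "\<gamma> s'" l] by auto
  qed (use b in auto)
qed

text \<open>Compactness of \<open>[0,1]\<close> in the form suited to cadlag paths.\<close>

lemma cadlag_interval_induct:
  fixes \<gamma> :: "real \<Rightarrow> 'a::metric_space"
  assumes \<gamma>: "\<gamma> \<in> cadlag_paths" and \<epsilon>: "0 < \<epsilon>"
    and join: "\<And>a b c. 0 \<le> a \<Longrightarrow> a \<le> b \<Longrightarrow> b \<le> c \<Longrightarrow> c \<le> 1 \<Longrightarrow> P a b \<Longrightarrow> P b c \<Longrightarrow> P a c"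
    and osc: "\<And>a b. 0 \<le> a \<Longrightarrow> a \<le> b \<Longrightarrow> b \<le> 1 \<Longrightarrow> (\<And>s s'. a \<le> s \<Longrightarrow> s < b \<Longrightarrow> a \<le> s' \<Longrightarrow> s' < b \<Longrightarrow> dist (\<gamma> s) (\<gamma> s') < \<epsilon>) \<Longrightarrow> P a b"
  shows "P 0 1"
proof -
  define Q where "Q a b \<longleftrightarrow> (0 \<le> a \<and> a \<le> b \<and> b \<le> 1 \<longrightarrow> P a b)" for a b
  have "Q 0 1"
  proof (rule Bolzano)
    fix a b c assume "Q a b" "Q b c" "a \<le> b" "b \<le> c"
    then show "Q a c" using join[of a b c] by (auto simp: Q_def)
  next
    fix x :: real assume x: "0 \<le> x" "x \<le> 1"
    have "\<exists>d>0. \<forall>s s'. x - d < s \<longrightarrow> s < x \<longrightarrow> x - d < s' \<longrightarrow> s' < x \<longrightarrow> 0 \<le> s \<longrightarrow> 0 \<le> s' \<longrightarrow> dist (\<gamma> s) (\<gamma> s') < \<epsilon>"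
    proof (cases "x = 0")
      case False
      with x have "0 < x" by simp
      obtain \<delta> where "0 < \<delta>" "\<And>s s'. x - \<delta> < s \<Longrightarrow> s < x \<Longrightarrow> x - \<delta> < s' \<Longrightarrow> s' < x \<Longrightarrow> dist (\<gamma> s) (\<gamma> s') < \<epsilon>"
        using cadlag_left[OF \<gamma> \<open>0 < x\<close> x(2) \<epsilon>] by blast
      then show ?thesis by blast
    qed (auto intro: exI[of _ 1])
    then obtain d1 where d1: "d1 > 0" "\<And>s s'. x - d1 < s \<Longrightarrow> s < x \<Longrightarrow> x - d1 < s' \<Longrightarrow> s' < x \<Longrightarrow> 0 \<le> s \<Longrightarrow> 0 \<le> s' \<Longrightarrow> dist (\<gamma> s) (\<gamma> s') < \<epsilon>"
      by blast
    have "\<exists>d>0. \<forall>s s'. x \<le> s \<longrightarrow> s < x + d \<longrightarrow> x \<le> s' \<longrightarrow> s' < x + d \<longrightarrow> s < 1 \<longrightarrow> s' < 1 \<longrightarrow> dist (\<gamma> s) (\<gamma> s') < \<epsilon>"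
    proof (cases "x = 1")
      case False
      with x have "x < 1" by simp
      moreover have "0 < \<epsilon> / 2" using \<epsilon> by simp
      ultimately obtain \<delta> where \<delta>: "0 < \<delta>" "\<And>s. x \<le> s \<Longrightarrow> s < x + \<delta> \<Longrightarrow> dist (\<gamma> x) (\<gamma> s) < \<epsilon> / 2"
        using cadlag_right[OF \<gamma> x(1)] by metis
      have "dist (\<gamma> s) (\<gamma> s') < \<epsilon>" if "x \<le> s" "s < x + \<delta>" "x \<le> s'" "s' < x + \<delta>" for s s'
        using \<delta>(2)[of s] \<delta>(2)[of s'] dist_triangle3[of "\<gamma> s" "\<gamma> s'" "\<gamma> x"] that by linarith
      then show ?thesis using \<delta>(1) by blast
    qed (auto intro: exI[of _ 1])
    then obtain d2 where d2: "d2 > 0" "\<And>s s'. x \<le> s \<Longrightarrow> s < x + d2 \<Longrightarrow> x \<le> s' \<Longrightarrow> s' < x + d2 \<Longrightarrow> s < 1 \<Longrightarrow> s' < 1 \<Longrightarrow> dist (\<gamma> s) (\<gamma> s') < \<epsilon>"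
      by blast
    show "\<exists>d>0. \<forall>a b. a \<le> x \<and> x \<le> b \<and> b - a < d \<longrightarrow> Q a b"
    proof (intro exI[of _ "min d1 d2"] conjI allI impI)
      fix a b assume ab: "a \<le> x \<and> x \<le> b \<and> b - a < min d1 d2"
      show "Q a b"
        unfolding Q_def
      proof
        assume 01: "0 \<le> a \<and> a \<le> b \<and> b \<le> 1"
        \<comment> \<open>The interval is cut at \<open>x\<close>: the left limit controls the part
          before \<open>x\<close>, right continuity the part from \<open>x\<close> on. Oscillation
          over half-open intervals lets a jump sit at the cut.\<close>
        have "P a x" using ab 01 x by (intro osc d1(2)) auto
        moreover have "P x b" using ab 01 x by (intro osc d2(2)) auto
        ultimately show "P a b" using ab 01 by (intro join[of a x b]) auto
      qed
    qed (use d1 d2 in auto)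
  qed simp
  then show ?thesis by (simp add: Q_def)
qed

text \<open>Bounds on pieces of small oscillation patch to [0,1); the value at 1 may come from a
  jump and is added separately.\<close>

lemma cadlag_bounded:
  fixes \<gamma> :: "real \<Rightarrow> 'a::metric_space"
  assumes \<gamma>: "\<gamma> \<in> cadlag_paths"
  obtains B where "\<And>t. t \<in> {0..1} \<Longrightarrow> dist (\<gamma> 0) (\<gamma> t) \<le> B"
proof -
  have "\<exists>B. \<forall>t\<in>{0..<1}. dist (\<gamma> 0) (\<gamma> t) \<le> B"
  proof (rule cadlag_interval_induct[OF \<gamma>, of 1 "\<lambda>a b. \<exists>B. \<forall>t\<in>{a..<b}. dist (\<gamma> 0) (\<gamma> t) \<le> B"])
    fix a b c :: real assume "\<exists>B. \<forall>t\<in>{a..<b}. dist (\<gamma> 0) (\<gamma> t) \<le> B" "\<exists>B. \<forall>t\<in>{b..<c}. dist (\<gamma> 0) (\<gamma> t) \<le> B"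
    then obtain B B' where B: "\<forall>t\<in>{a..<b}. dist (\<gamma> 0) (\<gamma> t) \<le> B" "\<forall>t\<in>{b..<c}. dist (\<gamma> 0) (\<gamma> t) \<le> B'" by blast
    have "dist (\<gamma> 0) (\<gamma> t) \<le> max B B'" if "t \<in> {a..<c}" for t
      using B that by (cases "t < b") (fastforce simp: le_max_iff_disj)+
    then show "\<exists>B. \<forall>t\<in>{a..<c}. dist (\<gamma> 0) (\<gamma> t) \<le> B" by blast
  next
    fix a b assume *: "\<And>s s'. a \<le> s \<Longrightarrow> s < b \<Longrightarrow> a \<le> s' \<Longrightarrow> s' < b \<Longrightarrow> dist (\<gamma> s) (\<gamma> s') < 1"
    have "dist (\<gamma> 0) (\<gamma> t) \<le> dist (\<gamma> 0) (\<gamma> a) + 1" if "t \<in> {a..<b}" for t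
      using *[of a t] that dist_triangle[of "\<gamma> 0" "\<gamma> t" "\<gamma> a"] by auto
    then show "\<exists>B. \<forall>t\<in>{a..<b}. dist (\<gamma> 0) (\<gamma> t) \<le> B" by blast
  qed simp
  then obtain B where "\<forall>t\<in>{0..<1}. dist (\<gamma> 0) (\<gamma> t) \<le> B" by blast
  then have "dist (\<gamma> 0) (\<gamma> t) \<le> max B (dist (\<gamma> 0) (\<gamma> 1))" if "t \<in> {0..1}" for t
    using that by (cases "t = 1") (auto simp: le_max_iff_disj)
  then show ?thesis by (rule that)
qed

text \<open>The bound \<open>time_change_norm \<theta> \<le> ennreal a\<close> written as bounds on
  increments, with the fixed end points made explicit. In this form composition, inversion and
  gluing are elementary.\<close>

definition time_change_le :: "(real \<Rightarrow> real) \<Rightarrow> real \<Rightarrow> bool" where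
  "time_change_le \<theta> a \<longleftrightarrow> \<theta> 0 = 0 \<and> \<theta> 1 = 1 \<and>
     (\<forall>s t. 0 \<le> s \<longrightarrow> s < t \<longrightarrow> t \<le> 1 \<longrightarrow> exp (-a) * (t - s) \<le> \<theta> t - \<theta> s \<and> \<theta> t - \<theta> s \<le> exp a * (t - s))"

lemma time_change_leD:
  assumes "time_change_le \<theta> a"
  shows "\<theta> 0 = 0" "\<theta> 1 = 1"
    "0 \<le> s \<Longrightarrow> s < t \<Longrightarrow> t \<le> 1 \<Longrightarrow> exp (-a) * (t - s) \<le> \<theta> t - \<theta> s"
    "0 \<le> s \<Longrightarrow> s < t \<Longrightarrow> t \<le> 1 \<Longrightarrow> \<theta> t - \<theta> s \<le> exp a * (t - s)"
    "0 \<le> s \<Longrightarrow> s < t \<Longrightarrow> t \<le> 1 \<Longrightarrow> \<theta> s < \<theta> t"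
proof -
  show *: "0 \<le> s \<Longrightarrow> s < t \<Longrightarrow> t \<le> 1 \<Longrightarrow> exp (-a) * (t - s) \<le> \<theta> t - \<theta> s"
    using assms by (simp add: time_change_le_def)
  show "\<theta> s < \<theta> t" if "0 \<le> s" "s < t" "t \<le> 1"
  proof -
    have "0 < exp (-a) * (t - s)" using that by simp
    with *[OF that] show ?thesis by linarith
  qed
qed (use assms in \<open>auto simp: time_change_le_def\<close>)

lemma time_change_le_range:
  assumes "time_change_le \<theta> a" "t \<in> {0..1}"
  shows "\<theta> t \<in> {0..1}"
  using time_change_leD[OF assms(1)] time_change_leD(5)[OF assms(1), of 0 t] time_change_leD(5)[OF assms(1), of t 1] assms(2)
  by (cases "t = 0"; cases "t = 1") auto

text \<open>Comparison with the fixed point 0: slopes lie between \<open>exp (-a)\<close> and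
  \<open>exp a\<close>, and \<open>1 - exp (-a) \<le> exp a - 1\<close>.\<close>

lemma time_change_le_near:
  assumes "time_change_le \<theta> a" "t \<in> {0..1}" "0 \<le> a"
  shows "\<bar>\<theta> t - t\<bar> \<le> exp a - 1"
proof (cases "t = 0")
  case True
  then show ?thesis using time_change_leD(1)[OF assms(1)] assms(3) by simp
next
  case False
  then have t: "0 < t" "t \<le> 1" using assms by auto
  have 1: "exp (-a) * t \<le> \<theta> t" "\<theta> t \<le> exp a * t"
    using time_change_leD(1)[OF assms(1)] time_change_leD(3,4)[OF assms(1), of 0 t] t by auto
  have e: "1 \<le> exp a" "exp (-a) \<le> 1" using assms(3) by auto
  have "(exp a - 1) * t \<le> exp a - 1" using e t by (simp add: mult_left_le)
  moreover have "(1 - exp (-a)) * t \<le> 1 - exp (-a)" using e t by (simp add: mult_left_le)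
  moreover have "1 - exp (-a) \<le> exp a - 1"
  proof -
    have "2 \<le> exp a + exp (-a)" using exp_ge_add_one_self[of a] exp_ge_add_one_self[of "-a"] by linarith
    then show ?thesis by simp
  qed
  ultimately show ?thesis using 1 by (auto simp: algebra_simps abs_le_iff)
qed

lemma time_change_norm_le_iff:
  assumes \<theta>: "strict_mono_on {0..1} \<theta>" and a: "0 \<le> a"
  shows "time_change_norm \<theta> \<le> ennreal a \<longleftrightarrow>
    (\<forall>s t. 0 \<le> s \<longrightarrow> s < t \<longrightarrow> t \<le> 1 \<longrightarrow> exp (-a) * (t - s) \<le> \<theta> t - \<theta> s \<and> \<theta> t - \<theta> s \<le> exp a * (t - s))"
proof -
  have "\<bar>ln ((\<theta> t - \<theta> s) / (t - s))\<bar> \<le> a \<longleftrightarrow> exp (-a) * (t - s) \<le> \<theta> t - \<theta> s \<and> \<theta> t - \<theta> s \<le> exp a * (t - s)"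
    if st: "0 \<le> s" "s < t" "t \<le> 1" for s t
  proof -
    have "\<theta> s < \<theta> t" using strict_mono_onD[OF \<theta>, of s t] st by auto
    then have pos: "0 < (\<theta> t - \<theta> s) / (t - s)" using st by simp
    have "\<bar>ln ((\<theta> t - \<theta> s) / (t - s))\<bar> \<le> a \<longleftrightarrow> -a \<le> ln ((\<theta> t - \<theta> s) / (t - s)) \<and> ln ((\<theta> t - \<theta> s) / (t - s)) \<le> a"
      by (auto simp: abs_le_iff)
    also have "\<dots> \<longleftrightarrow> exp (-a) \<le> (\<theta> t - \<theta> s) / (t - s) \<and> (\<theta> t - \<theta> s) / (t - s) \<le> exp a"
      using pos by (simp add: ln_ge_iff ln_le_cancel_iff[of _ "exp a", simplified])
    also have "\<dots> \<longleftrightarrow> exp (-a) * (t - s) \<le> \<theta> t - \<theta> s \<and> \<theta> t - \<theta> s \<le> exp a * (t - s)"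
      using st by (simp add: pos_le_divide_eq pos_divide_le_eq)
    finally show ?thesis .
  qed
  then show ?thesis
    using a by (auto simp: time_change_norm_def SUP_le_iff ennreal_le_iff)
qed

lemma time_change_le_continuous:
  assumes "time_change_le \<theta> a"
  shows "continuous_on {0..1} \<theta>"
proof (rule lipschitz_on_continuous_on[of "exp a"], rule lipschitz_onI)
  fix s t :: real assume st: "s \<in> {0..1}" "t \<in> {0..1}"
  note tc = time_change_leD(4,5)[OF assms]
  show "dist (\<theta> s) (\<theta> t) \<le> exp a * dist s t"
  proof (cases s t rule: linorder_cases)
    case less
    then have "\<theta> t - \<theta> s \<le> exp a * (t - s)" "\<theta> s < \<theta> t" using tc[of s t] st by auto
    then show ?thesis using less by (simp add: dist_real_def)
  next
    case greater
    then have "\<theta> s - \<theta> t \<le> exp a * (s - t)" "\<theta> t < \<theta> s" using tc[of t s] st by auto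
    then show ?thesis using greater by (simp add: dist_real_def)
  qed simp
qed simp

lemma time_change_le_imp:
  assumes "time_change_le \<theta> a" "0 \<le> a"
  shows "\<theta> \<in> time_changes" "time_change_norm \<theta> \<le> ennreal a"
proof -
  note tc = time_change_leD[OF assms(1)]
  have sm: "strict_mono_on {0..1} \<theta>" by (rule strict_mono_onI) (use tc(5) in auto)
  have "continuous_on {0..1} \<theta>" by (rule time_change_le_continuous[OF assms(1)])
  moreover have "\<theta> ` {0..1} = {0..1}"
  proof
    show "\<theta> ` {0..1} \<subseteq> {0..1}" using time_change_le_range[OF assms(1)] by auto
    show "{0..1} \<subseteq> \<theta> ` {0..1}"
    proof
      fix y :: real assume "y \<in> {0..1}"
      then obtain x where "0 \<le> x" "x \<le> 1" "\<theta> x = y"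
        using IVT'[of \<theta> 0 y 1] tc(1,2) \<open>continuous_on {0..1} \<theta>\<close> by auto
      then show "y \<in> \<theta> ` {0..1}" by auto
    qed
  qed
  moreover have "inj_on \<theta> {0..1}" using sm by (rule strict_mono_on_imp_inj_on)
  ultimately obtain \<kappa> where "homeomorphism {0..1} {0..1} \<theta> \<kappa>" using homeomorphism_compact[of "{0..1}" \<theta> "{0..1}"] by auto
  with sm show "\<theta> \<in> time_changes" by (auto simp: time_changes_def)
  show "time_change_norm \<theta> \<le> ennreal a"
    using time_change_norm_le_iff[OF sm assms(2)] tc(3,4) by auto
qed

lemma time_change_le_of:
  assumes "\<theta> \<in> time_changes" "time_change_norm \<theta> \<le> ennreal a" "0 \<le> a"
  shows "time_change_le \<theta> a"
proof -
  obtain \<kappa> where sm: "strict_mono_on {0..1} \<theta>" and h: "homeomorphism {0..1} {0..1} \<theta> \<kappa>"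
    using assms by (auto simp: time_changes_def)
  have im: "\<theta> ` {0..1} = {0..1}" using h by (rule homeomorphism_image1)
  have "0 \<in> \<theta> ` {0..1}" "1 \<in> \<theta> ` {0..1}" unfolding im by auto
  then obtain x y where xy: "x \<in> {0..1}" "y \<in> {0..1}" "\<theta> x = 0" "\<theta> y = 1" by (metis imageE)
  have "\<theta> 0 \<in> {0..1}" "\<theta> 1 \<in> {0..1}" using im by auto
  moreover have "\<theta> 0 \<le> 0" "1 \<le> \<theta> 1"
    using strict_mono_on_leD[OF sm, of 0 x] strict_mono_on_leD[OF sm, of y 1] xy by auto
  ultimately show ?thesis
    using time_change_norm_le_iff[OF sm assms(3)] assms(2) by (auto simp: time_change_le_def)
qed

lemma time_change_le_id: "0 \<le> a \<Longrightarrow> time_change_le (\<lambda>t. t) a"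
proof -
  assume a: "0 \<le> a"
  have "exp (-a) * (t - s) \<le> t - s" "t - s \<le> exp a * (t - s)" if "s < t" for s t :: real
    using a that by (simp_all add: mult_le_cancel_right1 mult_le_cancel_right2)
  then show ?thesis by (auto simp: time_change_le_def)
qed

text \<open>Inversion swaps the reciprocal bounds \<open>exp (-a)\<close> and \<open>exp a\<close>
  on slopes, so the same \<open>a\<close> serves.\<close>

lemma time_change_le_inverse:
  assumes "time_change_le \<theta> a"
  obtains \<kappa> where "time_change_le \<kappa> a" "\<And>t. t \<in> {0..1} \<Longrightarrow> \<theta> (\<kappa> t) = t"
proof -
  note tc = time_change_leD[OF assms]
  have c: "continuous_on {0..1} \<theta>" by (rule time_change_le_continuous[OF assms])
  have "\<exists>x\<in>{0..1}. \<theta> x = y" if "y \<in> {0..1}" for y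
    using IVT'[of \<theta> 0 y 1] tc(1,2) c that by auto
  then obtain \<kappa> where \<kappa>: "\<And>y. y \<in> {0..1} \<Longrightarrow> \<kappa> y \<in> {0..1} \<and> \<theta> (\<kappa> y) = y" by metis
  have lt: "\<kappa> s < \<kappa> t" if "s \<in> {0..1}" "t \<in> {0..1}" "s < t" for s t
  proof (rule ccontr)
    assume "\<not> \<kappa> s < \<kappa> t"
    then have "\<theta> (\<kappa> t) \<le> \<theta> (\<kappa> s)" using tc(5)[of "\<kappa> t" "\<kappa> s"] \<kappa>[OF that(1)] \<kappa>[OF that(2)] by (cases "\<kappa> t = \<kappa> s") auto
    then show False using \<kappa> that by auto
  qed
  have "\<kappa> 0 = 0" using tc(1) tc(5)[of 0 "\<kappa> 0"] \<kappa>[of 0] by (cases "\<kappa> 0 = 0") auto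
  moreover have "\<kappa> 1 = 1" using tc(2) tc(5)[of "\<kappa> 1" 1] \<kappa>[of 1] by (cases "\<kappa> 1 = 1") auto
  moreover have "exp (-a) * (t - s) \<le> \<kappa> t - \<kappa> s" "\<kappa> t - \<kappa> s \<le> exp a * (t - s)" if st: "0 \<le> s" "s < t" "t \<le> 1" for s t
  proof -
    have in01: "s \<in> {0..1}" "t \<in> {0..1}" using st by auto
    have "exp (-a) * (\<kappa> t - \<kappa> s) \<le> t - s" "t - s \<le> exp a * (\<kappa> t - \<kappa> s)"
      using tc(3,4)[of "\<kappa> s" "\<kappa> t"] lt[OF in01 st(2)] \<kappa>[OF in01(1)] \<kappa>[OF in01(2)] by auto
    then show "exp (-a) * (t - s) \<le> \<kappa> t - \<kappa> s" "\<kappa> t - \<kappa> s \<le> exp a * (t - s)"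
      by (simp_all add: exp_minus field_simps)
  qed
  ultimately have "time_change_le \<kappa> a" by (simp add: time_change_le_def)
  then show ?thesis using \<kappa> that by blast
qed

lemma time_change_le_compose:
  assumes "time_change_le \<theta> a" "time_change_le \<theta>' b"
  shows "time_change_le (\<lambda>t. \<theta>' (\<theta> t)) (a + b)"
  unfolding time_change_le_def
proof (intro conjI allI impI)
  fix s t :: real assume st: "0 \<le> s" "s < t" "t \<le> 1"
  note tc = time_change_leD[OF assms(1)] and tc' = time_change_leD[OF assms(2)]
  have r: "\<theta> s \<in> {0..1}" "\<theta> t \<in> {0..1}" using time_change_le_range[OF assms(1)] st by auto
  have lt: "\<theta> s < \<theta> t" using tc(5) st by auto
  have "exp (- (a + b)) * (t - s) = exp (-b) * (exp (-a) * (t - s))" by (simp add: exp_add[symmetric] add.commute)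
  also have "\<dots> \<le> exp (-b) * (\<theta> t - \<theta> s)" using tc(3)[of s t] st by (intro mult_left_mono) auto
  also have "\<dots> \<le> \<theta>' (\<theta> t) - \<theta>' (\<theta> s)" using tc'(3)[of "\<theta> s" "\<theta> t"] r lt by auto
  finally show "exp (- (a + b)) * (t - s) \<le> \<theta>' (\<theta> t) - \<theta>' (\<theta> s)" .
  have "\<theta>' (\<theta> t) - \<theta>' (\<theta> s) \<le> exp b * (\<theta> t - \<theta> s)" using tc'(4)[of "\<theta> s" "\<theta> t"] r lt by auto
  also have "\<dots> \<le> exp b * (exp a * (t - s))" using tc(4)[of s t] st by (intro mult_left_mono) auto
  also have "\<dots> = exp (a + b) * (t - s)" by (simp add: exp_add)
  finally show "\<theta>' (\<theta> t) - \<theta>' (\<theta> s) \<le> exp (a + b) * (t - s)" .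
qed (use time_change_leD(1,2)[OF assms(1)] time_change_leD(1,2)[OF assms(2)] in simp_all)

abbreviation sk_dist :: "(real \<Rightarrow> 'a::metric_space) \<Rightarrow> (real \<Rightarrow> 'a) \<Rightarrow> real" where
  "sk_dist \<equiv> skorokhod_dist dist"

lemma sk_dist_leI:
  fixes \<gamma> :: "real \<Rightarrow> 'a::metric_space"
  assumes "time_change_le \<theta> a" "0 \<le> a" "\<And>t. t \<in> {0..1} \<Longrightarrow> dist (\<gamma> t) (\<gamma>' (\<theta> t)) \<le> a"
  shows "sk_dist \<gamma> \<gamma>' \<le> a"
  unfolding skorokhod_dist_def
proof (rule enn2real_leI)
  show "(INF \<theta>\<in>time_changes. max (time_change_norm \<theta>) (SUP t\<in>{0..1}. ennreal (dist (\<gamma> t) (\<gamma>' (\<theta> t))))) \<le> ennreal a"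
    using time_change_le_imp[OF assms(1,2)] assms(3)
    by (intro INF_lower2[of \<theta>]) (auto intro!: SUP_least ennreal_leI)
qed (rule assms)

text \<open>Cadlag paths are bounded, so the identity time change has finite cost and
  \<open>enn2real\<close> in the distance does not hide an infinite infimum. This is what allows a
  near-optimal time change to be extracted.\<close>

lemma sk_dist_lessD:
  fixes \<gamma> :: "real \<Rightarrow> 'a::metric_space"
  assumes D: "\<gamma> \<in> cadlag_paths" "\<gamma>' \<in> cadlag_paths" and lt: "sk_dist \<gamma> \<gamma>' < a"
  obtains \<theta> where "time_change_le \<theta> a" "\<And>t. t \<in> {0..1} \<Longrightarrow> dist (\<gamma> t) (\<gamma>' (\<theta> t)) \<le> a"
proof -
  have a: "0 < a" using lt by (simp add: skorokhod_dist_def order.strict_trans1[OF enn2real_nonneg])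
  let ?c = "\<lambda>\<theta>. max (time_change_norm \<theta>) (SUP t\<in>{0..1}. ennreal (dist (\<gamma> t) (\<gamma>' (\<theta> t))))"
  obtain B B' where B: "\<And>t. t \<in> {0..1} \<Longrightarrow> dist (\<gamma> 0) (\<gamma> t) \<le> B" "\<And>t. t \<in> {0..1} \<Longrightarrow> dist (\<gamma>' 0) (\<gamma>' t) \<le> B'"
    using cadlag_bounded[OF D(1)] cadlag_bounded[OF D(2)] by metis
  have "(INF \<theta>\<in>time_changes. ?c \<theta>) \<le> ?c (\<lambda>t. t)"
    using time_change_le_imp[OF time_change_le_id[of 0]] by (intro INF_lower) auto
  also have "\<dots> \<le> ennreal (B + dist (\<gamma> 0) (\<gamma>' 0) + B')"
  proof (intro max.boundedI SUP_least ennreal_leI)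
    show "time_change_norm (\<lambda>t. t) \<le> ennreal (B + dist (\<gamma> 0) (\<gamma>' 0) + B')"
      using time_change_le_imp(2)[OF time_change_le_id[of 0]] by auto
    fix t :: real assume "t \<in> {0..1}"
    then have "dist (\<gamma> 0) (\<gamma> t) \<le> B" "dist (\<gamma>' 0) (\<gamma>' t) \<le> B'" using B by auto
    moreover have "dist (\<gamma> t) (\<gamma>' t) \<le> dist (\<gamma> 0) (\<gamma> t) + dist (\<gamma> 0) (\<gamma>' 0) + dist (\<gamma>' 0) (\<gamma>' t)"
      using dist_triangle3[of "\<gamma> t" "\<gamma>' t" "\<gamma> 0"] dist_triangle[of "\<gamma> 0" "\<gamma>' t" "\<gamma>' 0"] by linarith
    ultimately show "dist (\<gamma> t) (\<gamma>' t) \<le> B + dist (\<gamma> 0) (\<gamma>' 0) + B'" by linarith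
  qed
  finally have "(INF \<theta>\<in>time_changes. ?c \<theta>) < top" by (rule order.strict_trans1) simp
  then have "(INF \<theta>\<in>time_changes. ?c \<theta>) = ennreal (sk_dist \<gamma> \<gamma>')" by (simp add: skorokhod_dist_def)
  also have "\<dots> < ennreal a" using lt a by (intro ennreal_lessI) auto
  finally obtain \<theta> where \<theta>: "\<theta> \<in> time_changes" "?c \<theta> < ennreal a" by (auto simp: INF_less_iff)
  have c: "time_change_norm \<theta> \<le> ennreal a" "(SUP t\<in>{0..1}. ennreal (dist (\<gamma> t) (\<gamma>' (\<theta> t)))) \<le> ennreal a"
    using \<theta>(2) by (auto simp: less_imp_le)
  show ?thesis
  proof (rule that[of \<theta>])
    show "time_change_le \<theta> a" using time_change_le_of[OF \<theta>(1) c(1)] a by simp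
    show "dist (\<gamma> t) (\<gamma>' (\<theta> t)) \<le> a" if "t \<in> {0..1}" for t
      using c(2) that a by (auto simp: SUP_le_iff ennreal_le_iff)
  qed
qed

lemma sk_dist_nonneg: "0 \<le> sk_dist \<gamma> \<gamma>'" by (simp add: skorokhod_dist_def)

text \<open>Inverse time changes obey the same norm bound and only relabel the times in the
  supremum. Arbitrary functions are covered because \<open>Metric_space\<close> asks for symmetry
  off the carrier too.\<close>

lemma sk_dist_commute_le:
  fixes \<gamma> :: "real \<Rightarrow> 'a::metric_space"
  shows "sk_dist \<gamma>' \<gamma> \<le> sk_dist \<gamma> \<gamma>'"
proof -
  let ?c = "\<lambda>\<theta> \<gamma> \<gamma>'. max (time_change_norm \<theta>) (SUP t\<in>{0..1}. ennreal (dist (\<gamma> t) (\<gamma>' (\<theta> t) :: 'a)))"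
  have le: "(INF \<theta>\<in>time_changes. ?c \<theta> \<gamma>' \<gamma>) \<le> (INF \<theta>\<in>time_changes. ?c \<theta> \<gamma> \<gamma>')" for \<gamma> \<gamma>' :: "real \<Rightarrow> 'a"
  proof (rule INF_mono)
    fix \<theta> assume \<theta>: "\<theta> \<in> time_changes"
    show "\<exists>\<kappa>\<in>time_changes. ?c \<kappa> \<gamma>' \<gamma> \<le> ?c \<theta> \<gamma> \<gamma>'"
    proof (cases "time_change_norm \<theta> = top")
      \<comment> \<open>An infinite norm makes the right-hand side infinite, so any time change is a
        witness.\<close>
      case True
      then have "?c \<theta> \<gamma> \<gamma>' = top" by (simp add: max.absorb1)
      then show ?thesis using \<theta> by (intro bexI[of _ \<theta>]) (simp_all only: top_greatest)
    next
      case False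
      define a where "a = enn2real (time_change_norm \<theta>)"
      have a: "time_change_norm \<theta> = ennreal a" "0 \<le> a" using False by (auto simp: a_def less_top)
      have tc: "time_change_le \<theta> a" using a by (intro time_change_le_of[OF \<theta>]) auto
      obtain \<kappa> where \<kappa>: "time_change_le \<kappa> a" "\<And>t. t \<in> {0..1} \<Longrightarrow> \<theta> (\<kappa> t) = t"
        using time_change_le_inverse[OF tc] by blast
      have "(SUP t\<in>{0..1}. ennreal (dist (\<gamma>' t) (\<gamma> (\<kappa> t)))) \<le> (SUP t\<in>{0..1}. ennreal (dist (\<gamma> t) (\<gamma>' (\<theta> t))))"
      proof (rule SUP_mono)
        fix t :: real assume t: "t \<in> {0..1}"
        then show "\<exists>s\<in>{0..1}. ennreal (dist (\<gamma>' t) (\<gamma> (\<kappa> t))) \<le> ennreal (dist (\<gamma> s) (\<gamma>' (\<theta> s)))"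
          using time_change_le_range[OF \<kappa>(1) t] \<kappa>(2)[OF t] by (intro bexI[of _ "\<kappa> t"]) (auto simp: dist_commute)
      qed
      then have "?c \<kappa> \<gamma>' \<gamma> \<le> ?c \<theta> \<gamma> \<gamma>'"
        using time_change_le_imp(2)[OF \<kappa>(1) a(2)] unfolding a(1) by (intro max.mono)
      then show ?thesis using time_change_le_imp(1)[OF \<kappa>(1) a(2)] by blast
    qed
  qed
  have "(INF \<theta>\<in>time_changes. ?c \<theta> \<gamma>' \<gamma>) = (INF \<theta>\<in>time_changes. ?c \<theta> \<gamma> \<gamma>')"
    by (intro antisym le)
  then show ?thesis by (simp add: skorokhod_dist_def)
qed

lemma sk_dist_triangle:
  fixes \<gamma> :: "real \<Rightarrow> 'a::metric_space"
  assumes D: "\<gamma> \<in> cadlag_paths" "\<gamma>' \<in> cadlag_paths" "\<gamma>'' \<in> cadlag_paths"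
  shows "sk_dist \<gamma> \<gamma>'' \<le> sk_dist \<gamma> \<gamma>' + sk_dist \<gamma>' \<gamma>''"
proof (rule field_le_epsilon)
  fix e :: real assume e: "0 < e"
  define a b where "a = sk_dist \<gamma> \<gamma>' + e/2" and "b = sk_dist \<gamma>' \<gamma>'' + e/2"
  have ab: "sk_dist \<gamma> \<gamma>' < a" "sk_dist \<gamma>' \<gamma>'' < b" using e by (auto simp: a_def b_def)
  obtain \<theta> where \<theta>: "time_change_le \<theta> a" "\<And>t. t \<in> {0..1} \<Longrightarrow> dist (\<gamma> t) (\<gamma>' (\<theta> t)) \<le> a"
    using sk_dist_lessD[OF D(1,2) ab(1)] by blast
  obtain \<theta>' where \<theta>': "time_change_le \<theta>' b" "\<And>t. t \<in> {0..1} \<Longrightarrow> dist (\<gamma>' t) (\<gamma>'' (\<theta>' t)) \<le> b"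
    using sk_dist_lessD[OF D(2,3) ab(2)] by blast
  have "sk_dist \<gamma> \<gamma>'' \<le> a + b"
  proof (rule sk_dist_leI[OF time_change_le_compose[OF \<theta>(1) \<theta>'(1)]])
    show "0 \<le> a + b" using ab sk_dist_nonneg[of \<gamma> \<gamma>'] sk_dist_nonneg[of \<gamma>' \<gamma>''] by linarith
    fix t :: real assume t: "t \<in> {0..1}"
    show "dist (\<gamma> t) (\<gamma>'' (\<theta>' (\<theta> t))) \<le> a + b"
      using \<theta>(2)[OF t] \<theta>'(2)[OF time_change_le_range[OF \<theta>(1) t]]
        dist_triangle[of "\<gamma> t" "\<gamma>'' (\<theta>' (\<theta> t))" "\<gamma>' (\<theta> t)"] by linarith
  qed
  then show "sk_dist \<gamma> \<gamma>'' \<le> sk_dist \<gamma> \<gamma>' + sk_dist \<gamma>' \<gamma>'' + e" by (simp add: a_def b_def)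
qed

lemma exp_small: "0 < \<delta> \<Longrightarrow> \<exists>a0>0. \<forall>a. 0 \<le> a \<longrightarrow> a \<le> a0 \<longrightarrow> exp a - 1 < (\<delta>::real)"
proof (intro exI[of _ "ln (1 + \<delta>) / 2"] conjI allI impI)
  fix a assume d: "0 < \<delta>" and a: "0 \<le> a" "a \<le> ln (1 + \<delta>) / 2"
  have "0 < ln (1 + \<delta>)" using d by simp
  then have "a < ln (1 + \<delta>)" using a by linarith
  then have "exp a < exp (ln (1 + \<delta>))" by (simp only: exp_less_mono)
  then show "exp a - 1 < \<delta>" using d by simp
qed simp

text \<open>At time 1 all time changes agree. For \<open>t < 1\<close> the two paths are compared at
  a time \<open>s\<close> slightly to the right of \<open>t\<close>: both \<open>s\<close> and its
  image stay where right continuity keeps the respective path near its value at \<open>t\<close>.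
  The three errors are each at most \<open>e / 3\<close>.\<close>

lemma sk_dist_zero_imp_eq:
  fixes \<gamma> :: "real \<Rightarrow> 'a::metric_space"
  assumes D: "\<gamma> \<in> cadlag_paths" "\<gamma>' \<in> cadlag_paths" and z: "sk_dist \<gamma> \<gamma>' = 0"
  shows "\<gamma> = \<gamma>'"
proof (rule PiE_ext)
  show "\<gamma> \<in> {0..1} \<rightarrow>\<^sub>E UNIV" "\<gamma>' \<in> {0..1} \<rightarrow>\<^sub>E UNIV" using D by (auto simp: cadlag_def)
  fix t :: real assume t: "t \<in> {0..1}"
  have "dist (\<gamma> t) (\<gamma>' t) \<le> 0"
  proof (rule field_le_epsilon)
    fix e :: real assume e: "0 < e"
    show "dist (\<gamma> t) (\<gamma>' t) \<le> 0 + e"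
    proof (cases "t = 1")
      case True
      obtain \<theta> where \<theta>: "time_change_le \<theta> e" "\<And>t. t \<in> {0..1} \<Longrightarrow> dist (\<gamma> t) (\<gamma>' (\<theta> t)) \<le> e"
        using sk_dist_lessD[OF D, of e] z e by auto
      then show ?thesis using \<theta>(2)[of 1] time_change_leD(2)[OF \<theta>(1)] True by simp
    next
      case False
      then have t1: "0 \<le> t" "t < 1" using t by auto
      have e3: "0 < e / 3" using e by simp
      obtain \<delta>1 where \<delta>1: "0 < \<delta>1" "t + \<delta>1 \<le> 1" "\<And>s. t \<le> s \<Longrightarrow> s < t + \<delta>1 \<Longrightarrow> dist (\<gamma> t) (\<gamma> s) < e / 3"
        using cadlag_right[OF D(1) t1 e3] by blast
      obtain \<delta>2 where \<delta>2: "0 < \<delta>2" "t + \<delta>2 \<le> 1" "\<And>s. t \<le> s \<Longrightarrow> s < t + \<delta>2 \<Longrightarrow> dist (\<gamma>' t) (\<gamma>' s) < e / 3"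
        using cadlag_right[OF D(2) t1 e3] by blast
      define \<delta> where "\<delta> = min \<delta>1 \<delta>2"
      have \<delta>: "0 < \<delta> / 2" using \<delta>1 \<delta>2 by (simp add: \<delta>_def)
      obtain a0 where a0: "a0 > 0" "\<And>a. 0 \<le> a \<Longrightarrow> a \<le> a0 \<Longrightarrow> exp a - 1 < \<delta> / 2" using exp_small[OF \<delta>] by blast
      define a where "a = min a0 (e / 3)"
      have a: "0 < a" "a \<le> a0" "a \<le> e / 3" using a0 e3 by (auto simp: a_def)
      obtain \<theta> where \<theta>: "time_change_le \<theta> a" "\<And>t. t \<in> {0..1} \<Longrightarrow> dist (\<gamma> t) (\<gamma>' (\<theta> t)) \<le> a"
        using sk_dist_lessD[OF D, of a] z a by auto
      define s where "s = t + \<delta> / 2"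
      have s: "s \<in> {0..1}" "t \<le> s" "s < t + \<delta>1" using \<delta> \<delta>1 t1 by (auto simp: s_def \<delta>_def)
      have "\<bar>\<theta> s - s\<bar> < \<delta> / 2"
        using time_change_le_near[OF \<theta>(1) s(1)] a0(2)[of a] a by linarith
      then have "t \<le> \<theta> s" "\<theta> s < t + \<delta>2" using s_def \<delta>_def by linarith+
      then show ?thesis
        using \<delta>1(3)[OF s(2,3)] \<delta>2(3)[of "\<theta> s"] \<theta>(2)[OF s(1)] a(3)
          dist_triangle[of "\<gamma> t" "\<gamma>' t" "\<gamma> s"] dist_triangle2[of "\<gamma> s" "\<gamma>' t" "\<gamma>' (\<theta> s)"] by linarith
    qed
  qed
  then show "\<gamma> t = \<gamma>' t" by simp
qed

lemma Metric_space_skorokhod: "Metric_space (cadlag_paths :: (real \<Rightarrow> 'a::metric_space) set) sk_dist"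
proof
  fix x y z :: "real \<Rightarrow> 'a"
  show "0 \<le> sk_dist x y" by (rule sk_dist_nonneg)
  show "(sk_dist x y = 0) = (x = y)" if "x \<in> cadlag_paths" "y \<in> cadlag_paths"
  proof
    assume "x = y"
    then have "sk_dist x y \<le> 0" using sk_dist_leI[OF time_change_le_id[of 0], of x x] by simp
    then show "sk_dist x y = 0" using sk_dist_nonneg[of x y] by simp
  qed (use sk_dist_zero_imp_eq[OF that] in auto)
  show "sk_dist x z \<le> sk_dist x y + sk_dist y z" if "x \<in> cadlag_paths" "y \<in> cadlag_paths" "z \<in> cadlag_paths"
    using sk_dist_triangle that by blast
next
  fix x y :: "real \<Rightarrow> 'a"
  show "sk_dist x y = sk_dist y x"
    by (intro antisym sk_dist_commute_le)
qed

interpretation Sk: Metric_space "cadlag_paths :: (real \<Rightarrow> 'a::metric_space) set" sk_dist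
  by (rule Metric_space_skorokhod)

section \<open>Evaluations on the Skorokhod space\<close>

lemma space_skorokhod_borel[simp]: "space (skorokhod_borel UNIV dist) = (cadlag_paths :: (real \<Rightarrow> 'a::metric_space) set)"
  by (simp add: skorokhod_borel_def metric_borel_def space_measure_of_conv)

lemma sets_skorokhod_borel:
  "sets (skorokhod_borel UNIV dist) = sigma_sets (cadlag_paths :: (real \<Rightarrow> 'a::metric_space) set) {U. openin Sk.mtopology U}"
proof -
  have "{U. openin Sk.mtopology U} \<subseteq> Pow (cadlag_paths :: (real \<Rightarrow> 'a) set)"
    using openin_subset[of Sk.mtopology] by auto
  then show ?thesis by (simp add: skorokhod_borel_def metric_borel_def sets_measure_of)
qed

lemma open_in_skorokhod_borel: "openin Sk.mtopology U \<Longrightarrow> U \<in> sets (skorokhod_borel UNIV (dist :: 'a::metric_space \<Rightarrow> _))"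
  by (simp add: sets_skorokhod_borel)

lemma openin_skI:
  fixes U :: "(real \<Rightarrow> 'a::metric_space) set"
  assumes "U \<subseteq> cadlag_paths" "\<And>\<gamma>. \<gamma> \<in> U \<Longrightarrow> \<exists>r>0. \<forall>\<gamma>'\<in>cadlag_paths. sk_dist \<gamma> \<gamma>' < r \<longrightarrow> \<gamma>' \<in> U"
  shows "openin Sk.mtopology U"
  unfolding Sk.openin_mtopology
proof (intro conjI allI impI)
  fix \<gamma> assume "\<gamma> \<in> U"
  then obtain r where "r > 0" "\<forall>\<gamma>'\<in>cadlag_paths. sk_dist \<gamma> \<gamma>' < r \<longrightarrow> \<gamma>' \<in> U" using assms(2) by blast
  then show "\<exists>r>0. Sk.mball \<gamma> r \<subseteq> U" by (intro exI[of _ r]) auto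
qed fact

text \<open>The complement is open: if a path leaves \<open>C\<close> at an interior time
  \<open>s\<close>, a Skorokhod-close path does so at the time-changed instant, which is still
  strictly between \<open>t\<close> and \<open>r\<close>.\<close>

lemma sets_paths_in_closed:
  fixes C :: "'a::metric_space set"
  assumes C: "closed C" and t: "0 \<le> t" "r \<le> 1"
  shows "{\<gamma>\<in>cadlag_paths. \<forall>s\<in>{t<..<r}. \<gamma> s \<in> C} \<in> sets (skorokhod_borel UNIV dist)" (is "?G \<in> _")
proof -
  have "openin Sk.mtopology (cadlag_paths - ?G)"
  proof (rule openin_skI)
    fix \<gamma> assume "\<gamma> \<in> cadlag_paths - ?G"
    then obtain s where \<gamma>: "\<gamma> \<in> cadlag_paths" and s: "t < s" "s < r" "\<gamma> s \<notin> C" by auto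
    have "open (- C)" using C by auto
    then obtain e where e: "e > 0" "ball (\<gamma> s) e \<subseteq> - C" using s(3) open_contains_ball by (metis ComplI)
    have "0 < min (s - t) (r - s)" using s by simp
    then obtain a0 where a0: "a0 > 0" "\<And>a. 0 \<le> a \<Longrightarrow> a \<le> a0 \<Longrightarrow> exp a - 1 < min (s - t) (r - s)"
      using exp_small by blast
    define a where "a = min a0 (e / 2)"
    have a: "0 < a" "a \<le> a0" "a < e" using a0 e by (auto simp: a_def)
    show "\<exists>a>0. \<forall>\<gamma>'\<in>cadlag_paths. sk_dist \<gamma> \<gamma>' < a \<longrightarrow> \<gamma>' \<in> cadlag_paths - ?G"
    proof (intro exI[of _ a] conjI ballI impI)
      fix \<gamma>' :: "real \<Rightarrow> 'a" assume \<gamma>': "\<gamma>' \<in> cadlag_paths" "sk_dist \<gamma> \<gamma>' < a"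
      obtain \<theta> where \<theta>: "time_change_le \<theta> a" "\<And>t. t \<in> {0..1} \<Longrightarrow> dist (\<gamma> t) (\<gamma>' (\<theta> t)) \<le> a"
        using sk_dist_lessD[OF \<gamma> \<gamma>'] by blast
      have s01: "s \<in> {0..1}" using s t by auto
      have "\<bar>\<theta> s - s\<bar> < min (s - t) (r - s)"
        using time_change_le_near[OF \<theta>(1) s01] a0(2)[of a] a by linarith
      then have "\<theta> s \<in> {t<..<r}" by auto
      moreover have "\<gamma>' (\<theta> s) \<in> ball (\<gamma> s) e" using \<theta>(2)[OF s01] a by auto
      ultimately show "\<gamma>' \<in> cadlag_paths - ?G" using \<gamma>'(1) e(2) by blast
    qed (rule a)
  qed auto
  then have "cadlag_paths - ?G \<in> sets (skorokhod_borel UNIV (dist :: 'a \<Rightarrow> _))" by (rule open_in_skorokhod_borel)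
  then have "space (skorokhod_borel UNIV dist) - (cadlag_paths - ?G) \<in> sets (skorokhod_borel UNIV (dist :: 'a \<Rightarrow> _))" by (rule sets.compl_sets)
  moreover have "space (skorokhod_borel UNIV dist) - (cadlag_paths - ?G) = ?G" by auto
  ultimately show ?thesis by simp
qed

text \<open>Evaluation at 1 is continuous because time changes fix 1, but at interior times it is
  not. Below 1, right continuity expresses the event that the value lies in an open \<open>U\<close>
  through countably many events of staying in a closed subset of \<open>U\<close> on a short
  interval after \<open>t\<close>.\<close>

lemma measurable_eval_skorokhod:
  assumes t: "t \<in> {0..1}"
  shows "(\<lambda>\<gamma>. \<gamma> t) \<in> measurable (skorokhod_borel UNIV dist) (borel :: 'a::metric_space measure)"
proof (rule borel_measurableI)
  fix U :: "'a set" assume U: "open U"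
  let ?S = "skorokhod_borel UNIV (dist :: 'a \<Rightarrow> _)"
  have eq: "(\<lambda>\<gamma>. \<gamma> t) -` U \<inter> space ?S = {\<gamma>\<in>cadlag_paths. \<gamma> t \<in> U}" by auto
  show "(\<lambda>\<gamma>. \<gamma> t) -` U \<inter> space ?S \<in> sets ?S"
  proof (cases "t = 1")
    case True
    have "openin Sk.mtopology {\<gamma>\<in>cadlag_paths. \<gamma> t \<in> U}"
    proof (rule openin_skI)
      fix \<gamma> assume "\<gamma> \<in> {\<gamma>\<in>cadlag_paths. \<gamma> t \<in> U}"
      then have \<gamma>: "\<gamma> \<in> cadlag_paths" "\<gamma> 1 \<in> U" using True by auto
      obtain e where e: "e > 0" "ball (\<gamma> 1) e \<subseteq> U" using U \<gamma>(2) open_contains_ball by metis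
      show "\<exists>r>0. \<forall>\<gamma>'\<in>cadlag_paths. sk_dist \<gamma> \<gamma>' < r \<longrightarrow> \<gamma>' \<in> {\<gamma>\<in>cadlag_paths. \<gamma> t \<in> U}"
      proof (intro exI[of _ "e/2"] conjI ballI impI)
        fix \<gamma>' :: "real \<Rightarrow> 'a" assume \<gamma>': "\<gamma>' \<in> cadlag_paths" "sk_dist \<gamma> \<gamma>' < e / 2"
        obtain \<theta> where \<theta>: "time_change_le \<theta> (e/2)" "\<And>t. t \<in> {0..1} \<Longrightarrow> dist (\<gamma> t) (\<gamma>' (\<theta> t)) \<le> e / 2"
          using sk_dist_lessD[OF \<gamma>(1) \<gamma>'] by blast
        have "\<gamma>' 1 \<in> ball (\<gamma> 1) e" using \<theta>(2)[of 1] time_change_leD(2)[OF \<theta>(1)] e(1) by auto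
        then show "\<gamma>' \<in> {\<gamma>\<in>cadlag_paths. \<gamma> t \<in> U}" using e(2) \<gamma>'(1) True by auto
      qed (use e in auto)
    qed auto
    then show ?thesis unfolding eq by (rule open_in_skorokhod_borel)
  next
    case False
    then have t1: "0 \<le> t" "t < 1" using t by auto
    show ?thesis
    \<comment> \<open>\<open>infdist\<close> to the empty set is 0, so the whole space is treated
      apart.\<close>
    proof (cases "U = UNIV")
      case True
      then show ?thesis using sets.top[of ?S] by simp
    next
      case nU: False
      \<comment> \<open>Points at distance at least \<open>1 / (k + 1)\<close> from the complement
        of \<open>U\<close>. The margin survives the passage from times shortly after
        \<open>t\<close> back to \<open>t\<close>.\<close>
      define C where "C k = {x. 1 / real (Suc k) \<le> infdist x (- U)}" for k
      define r where "r m = t + (1 - t) / real (Suc m)" for m :: nat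
      have Cc: "closed (C k)" for k unfolding C_def by (intro closed_Collect_le continuous_intros)
      have r: "t < r m" "r m \<le> 1" for m
        using t1 by (auto simp: r_def field_simps mult_left_le_one_le)
      have "{\<gamma>\<in>cadlag_paths. \<gamma> t \<in> U} = (\<Union>k. \<Union>m. {\<gamma>\<in>cadlag_paths. \<forall>s\<in>{t<..<r m}. \<gamma> s \<in> C k})" (is "?L = ?R")
      proof (intro equalityI subsetI)
        fix \<gamma> assume "\<gamma> \<in> ?L"
        then have \<gamma>: "\<gamma> \<in> cadlag_paths" "\<gamma> t \<in> U" by auto
        have "infdist (\<gamma> t) (- U) \<noteq> 0"
          using in_closed_iff_infdist_zero[of "- U" "\<gamma> t"] U nU \<gamma>(2) by auto
        then have pos: "0 < infdist (\<gamma> t) (- U)" using infdist_nonneg[of "\<gamma> t" "-U"] by linarith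
        then have "0 < infdist (\<gamma> t) (- U) / 2" by simp
        then obtain k where k: "inverse (real (Suc k)) < infdist (\<gamma> t) (- U) / 2" using reals_Archimedean by blast
        obtain \<delta> where \<delta>: "0 < \<delta>" "\<And>s. t \<le> s \<Longrightarrow> s < t + \<delta> \<Longrightarrow> dist (\<gamma> t) (\<gamma> s) < infdist (\<gamma> t) (- U) / 2"
          using cadlag_right[OF \<gamma>(1) t1 \<open>0 < infdist (\<gamma> t) (- U) / 2\<close>] by metis
        obtain m where m: "inverse (real (Suc m)) < \<delta>" using reals_Archimedean[OF \<delta>(1)] by blast
        have "(1 - t) / real (Suc m) \<le> inverse (real (Suc m))" using t1 by (simp add: field_simps)
        then have "r m \<le> t + \<delta>" using m by (simp add: r_def)
        have "\<gamma> s \<in> C k" if "s \<in> {t<..<r m}" for s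
          using \<delta>(2)[of s] that \<open>r m \<le> t + \<delta>\<close> k infdist_triangle[of "\<gamma> t" "- U" "\<gamma> s"]
          by (auto simp: C_def inverse_eq_divide)
        then have "\<gamma> \<in> {\<gamma>\<in>cadlag_paths. \<forall>s\<in>{t<..<r m}. \<gamma> s \<in> C k}" using \<gamma>(1) by simp
        then show "\<gamma> \<in> ?R" by blast
      next
        fix \<gamma> assume "\<gamma> \<in> ?R"
        then obtain k m where km: "\<gamma> \<in> {\<gamma>\<in>cadlag_paths. \<forall>s\<in>{t<..<r m}. \<gamma> s \<in> C k}" by blast
        then have \<gamma>: "\<gamma> \<in> cadlag_paths" and C: "\<And>s. s \<in> {t<..<r m} \<Longrightarrow> \<gamma> s \<in> C k" by blast+
        have "\<gamma> t \<in> U"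
        proof (rule ccontr)
          assume "\<gamma> t \<notin> U"
          have "0 < 1 / real (Suc k)" by simp
          then obtain \<delta> where \<delta>: "0 < \<delta>" "\<And>s. t \<le> s \<Longrightarrow> s < t + \<delta> \<Longrightarrow> dist (\<gamma> t) (\<gamma> s) < 1 / real (Suc k)"
            using cadlag_right[OF \<gamma> t1] by metis
          define s where "s = min ((t + r m) / 2) (t + \<delta> / 2)"
          have s: "t < s" "s < r m" "s < t + \<delta>" using r[of m] \<delta>(1) by (auto simp: s_def min_def)
          have "infdist (\<gamma> s) (- U) \<le> dist (\<gamma> s) (\<gamma> t)" using \<open>\<gamma> t \<notin> U\<close> by (intro infdist_le) auto
          moreover have "1 / real (Suc k) \<le> infdist (\<gamma> s) (- U)" using C[of s] s unfolding C_def by auto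
          ultimately show False using \<delta>(2)[of s] s by (simp add: dist_commute)
        qed
        then show "\<gamma> \<in> ?L" using \<gamma> by simp
      qed
      moreover have "?R \<in> sets ?S"
        by (intro sets.countable_UN sets_paths_in_closed[OF Cc t1(1) r(2)] image_subsetI)
      ultimately show ?thesis unfolding eq by simp
    qed
  qed
qed

section \<open>Discretization and measurability of path-valued maps\<close>

definition dyadic_floor :: "nat \<Rightarrow> real \<Rightarrow> real" where
  "dyadic_floor n t = of_int \<lfloor>t * 2^n\<rfloor> / 2^n"

definition dyadic_ceil :: "nat \<Rightarrow> real \<Rightarrow> real" where
  "dyadic_ceil n t = of_int \<lceil>t * 2^n\<rceil> / 2^n"

text \<open>Sampling on the dyadic grid and rounding to the dense sequence leaves a path that is
  determined by finitely many natural numbers.\<close>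

definition discretize :: "nat \<Rightarrow> (real \<Rightarrow> 'a::polish_space) \<Rightarrow> real \<Rightarrow> 'a" where
  "discretize n \<gamma> = (\<lambda>t\<in>{0..1}. dense_seq (code ((1/2)^n) (\<gamma> (dyadic_floor n t))))"

lemma dyadic_ceil_bounds: "t \<le> dyadic_ceil n t" "dyadic_ceil n t < t + (1/2)^n"
proof -
  have "t * 2^n \<le> of_int \<lceil>t * 2^n\<rceil>" "of_int \<lceil>t * 2^n\<rceil> < t * 2^n + 1" by linarith+
  then show "t \<le> dyadic_ceil n t" "dyadic_ceil n t < t + (1/2)^n"
    by (auto simp: dyadic_ceil_def field_simps)
qed

lemma dyadic_floor_between:
  assumes "dyadic_ceil n a \<le> x" "x < dyadic_ceil n b"
  shows "a \<le> dyadic_floor n x" "dyadic_floor n x < b"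
proof -
  have "of_int \<lceil>a * 2^n\<rceil> \<le> x * 2^n" using assms(1) by (simp add: dyadic_ceil_def field_simps)
  then have "\<lceil>a * 2^n\<rceil> \<le> \<lfloor>x * 2^n\<rfloor>" by (simp add: le_floor_iff)
  then have "a * 2^n \<le> of_int \<lfloor>x * 2^n\<rfloor>" by (simp add: ceiling_le_iff)
  then show "a \<le> dyadic_floor n x" by (simp add: dyadic_floor_def field_simps)
  have "x * 2^n < of_int \<lceil>b * 2^n\<rceil>" using assms(2) by (simp add: dyadic_ceil_def field_simps)
  then have "\<lfloor>x * 2^n\<rfloor> < \<lceil>b * 2^n\<rceil>" by (simp add: floor_less_iff)
  then have "of_int \<lfloor>x * 2^n\<rfloor> < b * 2^n" by (simp add: less_ceiling_iff)
  then show "dyadic_floor n x < b" by (simp add: dyadic_floor_def field_simps)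
qed

lemma discretize_cadlag: "discretize n \<gamma> \<in> (cadlag_paths :: (real \<Rightarrow> 'a::polish_space) set)"
  unfolding cadlag_def
proof (intro CollectI conjI ballI)
  show "discretize n \<gamma> \<in> {0..1} \<rightarrow>\<^sub>E UNIV" by (auto simp: discretize_def)
  fix t :: real assume t: "t \<in> {0..<1}"
  have "\<forall>\<^sub>F s in at_right t. discretize n \<gamma> s = discretize n \<gamma> t"
    unfolding eventually_at_right_field
  proof (intro exI[of _ "min 1 ((of_int \<lfloor>t * 2^n\<rfloor> + 1) / 2^n)"] conjI allI impI)
    have "t * 2^n < of_int \<lfloor>t * 2^n\<rfloor> + 1" by linarith
    then show "t < min 1 ((of_int \<lfloor>t * 2^n\<rfloor> + 1) / 2^n)" using t by (simp add: field_simps)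
    fix s assume s: "t < s" "s < min 1 ((of_int \<lfloor>t * 2^n\<rfloor> + 1) / 2^n)"
    then have "s * 2^n < of_int \<lfloor>t * 2^n\<rfloor> + 1" "t * 2^n \<le> s * 2^n" by (auto simp: field_simps)
    then have "\<lfloor>s * 2^n\<rfloor> = \<lfloor>t * 2^n\<rfloor>" by linarith
    then show "discretize n \<gamma> s = discretize n \<gamma> t" using s t by (simp add: discretize_def dyadic_floor_def)
  qed
  then show "limitin Met_TC.mtopology (discretize n \<gamma>) (discretize n \<gamma> t) (at_right t)"
    unfolding Met_TC.limitin_metric by (auto elim!: eventually_mono)
next
  fix t :: real assume t: "t \<in> {0<..1}"
  \<comment> \<open>Just before \<open>t\<close> the floor of \<open>s * 2^n\<close> is the ceiling
    of \<open>t * 2^n\<close> minus 1, also when \<open>t\<close> is a grid point.\<close>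
  let ?l = "dense_seq (code ((1/2)^n) (\<gamma> ((of_int \<lceil>t * 2^n\<rceil> - 1) / 2^n)))"
  have "\<forall>\<^sub>F s in at_left t. discretize n \<gamma> s = ?l"
    unfolding eventually_at_left_field
  proof (intro exI[of _ "max 0 ((of_int \<lceil>t * 2^n\<rceil> - 1) / 2^n)"] conjI allI impI)
    have "of_int \<lceil>t * 2^n\<rceil> - 1 < t * 2^n" by linarith
    then show "max 0 ((of_int \<lceil>t * 2^n\<rceil> - 1) / 2^n) < t" using t by (simp add: field_simps)
    fix s assume s: "max 0 ((of_int \<lceil>t * 2^n\<rceil> - 1) / 2^n) < s" "s < t"
    then have "of_int \<lceil>t * 2^n\<rceil> - 1 < s * 2^n" "s * 2^n < t * 2^n" by (auto simp: field_simps)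
    then have "\<lfloor>s * 2^n\<rfloor> = \<lceil>t * 2^n\<rceil> - 1" by linarith
    then show "discretize n \<gamma> s = ?l" using s t by (simp add: discretize_def dyadic_floor_def)
  qed
  then show "\<exists>l. limitin Met_TC.mtopology (discretize n \<gamma>) l (at_left t)"
    unfolding Met_TC.limitin_metric by (intro exI[of _ ?l]) (auto elim!: eventually_mono)
qed

text \<open>The grid value used at time \<open>\<theta> t\<close> lies in the same interval of small oscillation as \<open>t\<close>
  as soon as the time change maps the end points of these intervals to the grid points above them.\<close>

lemma discretize_tendsto:
  fixes \<gamma> :: "real \<Rightarrow> 'a::polish_space"
  assumes \<gamma>: "\<gamma> \<in> cadlag_paths" and \<epsilon>: "0 < \<epsilon>"
  shows "\<exists>N. \<forall>n\<ge>N. sk_dist \<gamma> (discretize n \<gamma>) \<le> \<epsilon>"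
proof -
  \<comment> \<open>Maps built on adjacent pieces send the common end point to the same grid point
    above it and can therefore be glued; the threshold level becomes the larger of the two.\<close>
  define P where "P a b \<longleftrightarrow> (\<exists>N. \<forall>n\<ge>N. \<exists>\<theta>. \<theta> a = dyadic_ceil n a \<and> \<theta> b = dyadic_ceil n b \<and>
    (\<forall>s t. a \<le> s \<longrightarrow> s < t \<longrightarrow> t \<le> b \<longrightarrow> exp (-\<epsilon>) * (t - s) \<le> \<theta> t - \<theta> s \<and> \<theta> t - \<theta> s \<le> exp \<epsilon> * (t - s)) \<and>
    (\<forall>t\<in>{a..<b}. dist (\<gamma> t) (\<gamma> (dyadic_floor n (\<theta> t))) \<le> \<epsilon> / 2))" for a b
  have "0 < \<epsilon> / 2" using \<epsilon> by simp
  from \<gamma> this have "P 0 1"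
  proof (rule cadlag_interval_induct)
    fix a b c :: real assume abc: "a \<le> b" "b \<le> c" and P: "P a b" "P b c"
    obtain N1 where N1: "\<And>n. N1 \<le> n \<Longrightarrow> \<exists>\<theta>. \<theta> a = dyadic_ceil n a \<and> \<theta> b = dyadic_ceil n b \<and>
    (\<forall>s t. a \<le> s \<longrightarrow> s < t \<longrightarrow> t \<le> b \<longrightarrow> exp (-\<epsilon>) * (t - s) \<le> \<theta> t - \<theta> s \<and> \<theta> t - \<theta> s \<le> exp \<epsilon> * (t - s)) \<and>
    (\<forall>t\<in>{a..<b}. dist (\<gamma> t) (\<gamma> (dyadic_floor n (\<theta> t))) \<le> \<epsilon> / 2)" using P(1) unfolding P_def by blast
    obtain N2 where N2: "\<And>n. N2 \<le> n \<Longrightarrow> \<exists>\<theta>. \<theta> b = dyadic_ceil n b \<and> \<theta> c = dyadic_ceil n c \<and>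
    (\<forall>s t. b \<le> s \<longrightarrow> s < t \<longrightarrow> t \<le> c \<longrightarrow> exp (-\<epsilon>) * (t - s) \<le> \<theta> t - \<theta> s \<and> \<theta> t - \<theta> s \<le> exp \<epsilon> * (t - s)) \<and>
    (\<forall>t\<in>{b..<c}. dist (\<gamma> t) (\<gamma> (dyadic_floor n (\<theta> t))) \<le> \<epsilon> / 2)" using P(2) unfolding P_def by blast
    show "P a c"
      unfolding P_def
    proof (intro exI[of _ "max N1 N2"] allI impI)
      fix n assume n: "max N1 N2 \<le> n"
      obtain \<theta>1 where \<theta>1: "\<theta>1 a = dyadic_ceil n a" "\<theta>1 b = dyadic_ceil n b"
        "\<And>s t. a \<le> s \<Longrightarrow> s < t \<Longrightarrow> t \<le> b \<Longrightarrow> exp (-\<epsilon>) * (t - s) \<le> \<theta>1 t - \<theta>1 s \<and> \<theta>1 t - \<theta>1 s \<le> exp \<epsilon> * (t - s)"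
        "\<And>t. t \<in> {a..<b} \<Longrightarrow> dist (\<gamma> t) (\<gamma> (dyadic_floor n (\<theta>1 t))) \<le> \<epsilon> / 2" using N1[of n] n by auto
      obtain \<theta>2 where \<theta>2: "\<theta>2 b = dyadic_ceil n b" "\<theta>2 c = dyadic_ceil n c"
        "\<And>s t. b \<le> s \<Longrightarrow> s < t \<Longrightarrow> t \<le> c \<Longrightarrow> exp (-\<epsilon>) * (t - s) \<le> \<theta>2 t - \<theta>2 s \<and> \<theta>2 t - \<theta>2 s \<le> exp \<epsilon> * (t - s)"
        "\<And>t. t \<in> {b..<c} \<Longrightarrow> dist (\<gamma> t) (\<gamma> (dyadic_floor n (\<theta>2 t))) \<le> \<epsilon> / 2" using N2[of n] n by auto
      define \<theta> where "\<theta> t = (if t \<le> b then \<theta>1 t else \<theta>2 t)" for t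
      have bi: "exp (-\<epsilon>) * (t - s) \<le> \<theta> t - \<theta> s \<and> \<theta> t - \<theta> s \<le> exp \<epsilon> * (t - s)" if st: "a \<le> s" "s < t" "t \<le> c" for s t
      proof -
        consider "t \<le> b" | "b \<le> s" | "s < b" "b < t" by linarith
        then show ?thesis
        proof cases
          case 1 then show ?thesis using \<theta>1(3)[of s t] st by (simp add: \<theta>_def)
        next
          case 2
          have "\<theta> s = \<theta>2 s" using 2 \<theta>1(2) \<theta>2(1) by (auto simp: \<theta>_def)
          then show ?thesis using \<theta>2(3)[of s t] st 2 by (simp add: \<theta>_def)
        next
          case 3
          then show ?thesis using \<theta>1(3)[of s b] \<theta>2(3)[of b t] st \<theta>1(2) \<theta>2(1)
            by (auto simp: \<theta>_def algebra_simps)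
        qed
      qed
      have near: "dist (\<gamma> t) (\<gamma> (dyadic_floor n (\<theta> t))) \<le> \<epsilon> / 2" if "t \<in> {a..<c}" for t
      proof -
        consider "t < b" | "t = b" | "b < t" by linarith
        then show ?thesis using \<theta>1(4)[of t] \<theta>2(4)[of t] that \<theta>1(2) \<theta>2(1) by cases (auto simp: \<theta>_def)
      qed
      show "\<exists>\<theta>. \<theta> a = dyadic_ceil n a \<and> \<theta> c = dyadic_ceil n c \<and>
        (\<forall>s t. a \<le> s \<longrightarrow> s < t \<longrightarrow> t \<le> c \<longrightarrow> exp (-\<epsilon>) * (t - s) \<le> \<theta> t - \<theta> s \<and> \<theta> t - \<theta> s \<le> exp \<epsilon> * (t - s)) \<and>
        (\<forall>t\<in>{a..<c}. dist (\<gamma> t) (\<gamma> (dyadic_floor n (\<theta> t))) \<le> \<epsilon> / 2)"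
        using bi near \<theta>1(1,2) \<theta>2(1,2) abc by (intro exI[of _ \<theta>]) (auto simp: \<theta>_def)
    qed
  next
    fix a b :: real assume ab: "0 \<le> a" "a \<le> b" "b \<le> 1"
      and osc: "\<And>s s'. a \<le> s \<Longrightarrow> s < b \<Longrightarrow> a \<le> s' \<Longrightarrow> s' < b \<Longrightarrow> dist (\<gamma> s) (\<gamma> s') < \<epsilon> / 2"
    show "P a b"
    proof (cases "a = b")
      case True
      have "\<exists>\<theta>. \<theta> b = dyadic_ceil n b" for n by (rule exI[of _ "\<lambda>_. dyadic_ceil n b"]) simp
      then show ?thesis using True unfolding P_def by auto
    next
      case False
      with ab have lt: "a < b" by simp
      \<comment> \<open>Rounding up moves each end point by less than \<open>(1/2)^n\<close>. Once
        this is below \<open>\<eta>\<close>, the affine map has slope between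
        \<open>exp (-\<epsilon>)\<close> and \<open>exp \<epsilon>\<close>.\<close>
      define \<eta> where "\<eta> = (b - a) * min (1 - exp (-\<epsilon>)) (exp \<epsilon> - 1)"
      have \<eta>: "0 < \<eta>" using lt \<epsilon> by (simp add: \<eta>_def)
      have \<eta>2: "\<eta> \<le> (b - a) * (1 - exp (-\<epsilon>))" "\<eta> \<le> (b - a) * (exp \<epsilon> - 1)"
        using lt unfolding \<eta>_def by (intro mult_left_mono; simp)+
      obtain N where N: "(1/2)^N < \<eta>" using real_arch_pow_inv[OF \<eta>, of "1/2"] by auto
      show ?thesis
        unfolding P_def
      proof (intro exI[of _ N] allI impI)
        fix n assume n: "N \<le> n"
        have "(1/2::real)^n \<le> (1/2)^N" using n by (intro power_decreasing) auto
        then have small: "(1/2::real)^n < \<eta>" using N by linarith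
        define \<sigma> where "\<sigma> = (dyadic_ceil n b - dyadic_ceil n a) / (b - a)"
        define \<theta> where "\<theta> t = dyadic_ceil n a + \<sigma> * (t - a)" for t
        have \<sigma>ba: "\<sigma> * (b - a) = dyadic_ceil n b - dyadic_ceil n a" using lt by (simp add: \<sigma>_def)
        have "exp (-\<epsilon>) * (b - a) \<le> \<sigma> * (b - a)" "\<sigma> * (b - a) \<le> exp \<epsilon> * (b - a)"
          unfolding \<sigma>ba using dyadic_ceil_bounds[where t=a and n=n] dyadic_ceil_bounds[where t=b and n=n] small \<eta>2
          by (auto simp: algebra_simps)
        then have \<sigma>: "exp (-\<epsilon>) \<le> \<sigma>" "\<sigma> \<le> exp \<epsilon>" using lt by auto
        have \<sigma>0: "0 < \<sigma>" using \<sigma>(1) exp_gt_zero[of "-\<epsilon>"] by linarith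
        have "dist (\<gamma> t) (\<gamma> (dyadic_floor n (\<theta> t))) \<le> \<epsilon> / 2" if t: "t \<in> {a..<b}" for t
        proof -
          have "dyadic_ceil n a \<le> \<theta> t" using \<sigma>0 t by (auto simp: \<theta>_def)
          moreover have "\<sigma> * (t - a) < \<sigma> * (b - a)" using \<sigma>0 t by (intro mult_strict_left_mono) auto
          then have "\<theta> t < dyadic_ceil n b" by (simp add: \<theta>_def \<sigma>ba)
          ultimately show ?thesis
            using dyadic_floor_between[of n a "\<theta> t" b] osc[of t "dyadic_floor n (\<theta> t)"] t by auto
        qed
        moreover have "\<theta> t - \<theta> s = \<sigma> * (t - s)" for s t by (simp add: \<theta>_def algebra_simps)
        then have "\<forall>s t. a \<le> s \<longrightarrow> s < t \<longrightarrow> t \<le> b \<longrightarrow> exp (-\<epsilon>) * (t - s) \<le> \<theta> t - \<theta> s \<and> \<theta> t - \<theta> s \<le> exp \<epsilon> * (t - s)"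
          using \<sigma> by (auto intro: mult_right_mono)
        moreover have "\<theta> a = dyadic_ceil n a" "\<theta> b = dyadic_ceil n b" by (simp_all add: \<theta>_def \<sigma>ba)
        ultimately show "\<exists>\<theta>. \<theta> a = dyadic_ceil n a \<and> \<theta> b = dyadic_ceil n b \<and>
          (\<forall>s t. a \<le> s \<longrightarrow> s < t \<longrightarrow> t \<le> b \<longrightarrow> exp (-\<epsilon>) * (t - s) \<le> \<theta> t - \<theta> s \<and> \<theta> t - \<theta> s \<le> exp \<epsilon> * (t - s)) \<and>
          (\<forall>t\<in>{a..<b}. dist (\<gamma> t) (\<gamma> (dyadic_floor n (\<theta> t))) \<le> \<epsilon> / 2)" by blast
      qed
    qed
  qed
  then obtain N1 where N1: "\<And>n. N1 \<le> n \<Longrightarrow> \<exists>\<theta>. \<theta> 0 = dyadic_ceil n 0 \<and> \<theta> 1 = dyadic_ceil n 1 \<and>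
    (\<forall>s t. 0 \<le> s \<longrightarrow> s < t \<longrightarrow> t \<le> 1 \<longrightarrow> exp (-\<epsilon>) * (t - s) \<le> \<theta> t - \<theta> s \<and> \<theta> t - \<theta> s \<le> exp \<epsilon> * (t - s)) \<and>
    (\<forall>t\<in>{0..<1}. dist (\<gamma> t) (\<gamma> (dyadic_floor n (\<theta> t))) \<le> \<epsilon> / 2)" unfolding P_def by blast
  have "0 < \<epsilon> / 2" using \<epsilon> by simp
  then obtain N2 where N2: "(1/2)^N2 < \<epsilon> / 2" using real_arch_pow_inv[of "\<epsilon>/2" "1/2"] by auto
  show ?thesis
  proof (intro exI[of _ "max N1 N2"] allI impI)
    fix n assume n: "max N1 N2 \<le> n"
    have "(1/2::real)^n \<le> (1/2)^N2" using n by (intro power_decreasing) auto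
    then have small: "(1/2::real)^n < \<epsilon> / 2" using N2 by linarith
    obtain \<theta> where \<theta>: "\<theta> 0 = dyadic_ceil n 0" "\<theta> 1 = dyadic_ceil n 1"
      "\<And>s t. 0 \<le> s \<Longrightarrow> s < t \<Longrightarrow> t \<le> 1 \<Longrightarrow> exp (-\<epsilon>) * (t - s) \<le> \<theta> t - \<theta> s \<and> \<theta> t - \<theta> s \<le> exp \<epsilon> * (t - s)"
      "\<And>t. t \<in> {0..<1} \<Longrightarrow> dist (\<gamma> t) (\<gamma> (dyadic_floor n (\<theta> t))) \<le> \<epsilon> / 2" using N1[of n] n by auto
    \<comment> \<open>0 and 1 are grid points, so the glued map fixes both ends.\<close>
    have \<theta>01: "\<theta> 0 = 0" "\<theta> 1 = 1" using \<theta>(1,2) by (auto simp: dyadic_ceil_def)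
    then have tc: "time_change_le \<theta> \<epsilon>" using \<theta>(3) by (auto simp: time_change_le_def)
    show "sk_dist \<gamma> (discretize n \<gamma>) \<le> \<epsilon>"
    proof (rule sk_dist_leI[OF tc])
      fix t :: real assume t: "t \<in> {0..1}"
      have "dist (\<gamma> t) (\<gamma> (dyadic_floor n (\<theta> t))) \<le> \<epsilon> / 2"
        using \<theta>(4)[of t] t \<epsilon> \<theta>01 by (cases "t = 1") (auto simp: dyadic_floor_def)
      moreover have "dist (\<gamma> (dyadic_floor n (\<theta> t))) (discretize n \<gamma> (\<theta> t)) < (1/2)^n"
        using time_change_le_range[OF tc t] dist_code[of "(1/2)^n" "\<gamma> (dyadic_floor n (\<theta> t))"] by (simp add: discretize_def)
      ultimately show "dist (\<gamma> t) (discretize n \<gamma> (\<theta> t)) \<le> \<epsilon>"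
        using small dist_triangle[of "\<gamma> t" "discretize n \<gamma> (\<theta> t)" "\<gamma> (dyadic_floor n (\<theta> t))"] by linarith
    qed (use \<epsilon> in auto)
  qed
qed

lemma measurable_map_count_space:
  fixes f :: "'i \<Rightarrow> 'b \<Rightarrow> nat"
  assumes "\<And>i. i \<in> set xs \<Longrightarrow> f i \<in> measurable M (count_space UNIV)"
  shows "(\<lambda>\<omega>. map (\<lambda>i. f i \<omega>) xs) \<in> measurable M (count_space UNIV)"
  using assms
proof (induction xs)
  case (Cons x xs)
  have g: "(\<lambda>\<omega>. map (\<lambda>i. f i \<omega>) xs) \<in> measurable M (count_space UNIV)" using Cons by auto
  have "(\<lambda>\<omega>. (\<lambda>a \<omega>. a # map (\<lambda>i. f i \<omega>) xs) (f x \<omega>) \<omega>) \<in> measurable M (count_space UNIV)"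
    by (rule measurable_compose_countable[OF measurable_compose[OF g]]) (use Cons in auto)
  then show ?case by simp
qed simp

text \<open>The discretized path is a function of a list of \<open>2^n + 1\<close> codes. Lists of
  naturals are countable, so preimages of arbitrary sets \<open>V\<close> are measurable.\<close>

lemma measurable_discretize:
  fixes \<Phi> :: "'b \<Rightarrow> real \<Rightarrow> 'a::polish_space"
  assumes "\<And>t. t \<in> {0..1} \<Longrightarrow> (\<lambda>\<omega>. \<Phi> \<omega> t) \<in> measurable M borel"
  shows "{\<omega>\<in>space M. discretize n (\<Phi> \<omega>) \<in> V} \<in> sets M"
proof -
  define c where "c \<omega> = map (\<lambda>i. code ((1/2)^n) (\<Phi> \<omega> (real i / 2^n))) [0..<Suc (2^n)]" for \<omega>
  define st where "st l = (\<lambda>t\<in>{0..1::real}. dense_seq (l ! nat \<lfloor>t * 2^n\<rfloor>) :: 'a)" for l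
  have "discretize n (\<Phi> \<omega>) = st (c \<omega>)" for \<omega>
    unfolding discretize_def st_def
  proof (rule restrict_ext)
    fix t :: real assume t: "t \<in> {0..1}"
    then have 0: "0 \<le> \<lfloor>t * 2^n\<rfloor>" by simp
    have "t * 2^n \<le> 2^n" using t by simp
    then have "t * 2^n < 2^n + 1" by linarith
    then have "\<lfloor>t * 2^n\<rfloor> \<le> 2^n" by (simp only: floor_le_iff of_int_power of_int_numeral)
    then have le: "nat \<lfloor>t * 2^n\<rfloor> \<le> 2^n" by (simp add: nat_le_iff)
    have "map (\<lambda>i. f (real i)) [0..<Suc (2^n)] ! i = f (real i)" if "i \<le> 2^n" for i and f :: "real \<Rightarrow> nat"
      using that by (simp add: nth_append del: upt_Suc)
    from this[OF le, of "\<lambda>x. code ((1/2)^n) (\<Phi> \<omega> (x / 2^n))"]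
    have "c \<omega> ! nat \<lfloor>t * 2^n\<rfloor> = code ((1/2)^n) (\<Phi> \<omega> (real (nat \<lfloor>t * 2^n\<rfloor>) / 2^n))"
      unfolding c_def .
    moreover have "real (nat \<lfloor>t * 2^n\<rfloor>) / 2^n = dyadic_floor n t" using 0 by (simp add: dyadic_floor_def)
    ultimately show "dense_seq (code ((1/2)^n) (\<Phi> \<omega> (dyadic_floor n t))) = (dense_seq (c \<omega> ! nat \<lfloor>t * 2^n\<rfloor>) :: 'a)" by simp
  qed
  moreover have cm: "c \<in> measurable M (count_space UNIV)"
    unfolding c_def
  proof (rule measurable_map_count_space)
    fix i assume "i \<in> set [0..<Suc (2^n)]"
    then have "i \<le> 2^n" by auto
    then have "real i \<le> 2^n" by (metis of_nat_le_iff of_nat_numeral of_nat_power)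
    then have "real i / 2^n \<in> {0..1}" by simp
    then show "(\<lambda>\<omega>. code ((1/2)^n) (\<Phi> \<omega> (real i / 2^n))) \<in> measurable M (count_space UNIV)"
      by (intro measurable_compose[OF _ measurable_code] assms)
  qed
  moreover have "{\<omega>\<in>space M. c \<omega> \<in> {l. st l \<in> V}} \<in> sets M"
    using measurable_sets[OF cm, of "{l. st l \<in> V}"] by (simp add: vimage_def Int_def conj_commute)
  ultimately show ?thesis by simp
qed

text \<open>A path lies in an open set \<open>U\<close> iff for some \<open>k\<close> its
  discretizations eventually lie in \<open>V k\<close>, the set of points whose ball of radius
  \<open>1 / (k + 1)\<close> is inside \<open>U\<close>. By \<open>measurable_discretize\<close>
  this is a countable combination of measurable events, so measurability into the Skorokhod space
  reduces to that of the evaluations.\<close>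

lemma measurable_path_map:
  fixes \<Phi> :: "'b \<Rightarrow> real \<Rightarrow> 'a::polish_space"
  assumes \<Phi>: "\<And>\<omega>. \<omega> \<in> space M \<Longrightarrow> \<Phi> \<omega> \<in> cadlag_paths"
    and m: "\<And>t. t \<in> {0..1} \<Longrightarrow> (\<lambda>\<omega>. \<Phi> \<omega> t) \<in> measurable M borel"
  shows "\<Phi> \<in> measurable M (skorokhod_borel UNIV dist)"
  unfolding skorokhod_borel_def metric_borel_def
proof (rule measurable_measure_of)
  show "{U. openin Sk.mtopology U} \<subseteq> Pow (cadlag_paths :: (real \<Rightarrow> 'a) set)"
    using openin_subset[of Sk.mtopology] by auto
  show "\<Phi> \<in> space M \<rightarrow> cadlag_paths" using \<Phi> by auto
  fix U :: "(real \<Rightarrow> 'a) set" assume "U \<in> {U. openin Sk.mtopology U}"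
  then have U: "openin Sk.mtopology U" by simp
  define V where "V k = {x. Sk.mball x (1 / real (Suc k)) \<subseteq> U}" for k
  have "\<Phi> -` U \<inter> space M = {\<omega>\<in>space M. \<exists>k N. \<forall>n\<ge>N. discretize n (\<Phi> \<omega>) \<in> V k}"
  proof (intro equalityI subsetI)
    fix \<omega> assume \<omega>: "\<omega> \<in> \<Phi> -` U \<inter> space M"
    then have D: "\<Phi> \<omega> \<in> cadlag_paths" using \<Phi> by auto
    obtain r where r: "r > 0" "Sk.mball (\<Phi> \<omega>) r \<subseteq> U" using U \<omega> by (auto simp: Sk.openin_mtopology)
    have "0 < r / 2" using r by simp
    then obtain k where k: "inverse (real (Suc k)) < r / 2" using reals_Archimedean by blast
    have "0 < r / 4" using r by simp
    then obtain N where N: "\<And>n. N \<le> n \<Longrightarrow> sk_dist (\<Phi> \<omega>) (discretize n (\<Phi> \<omega>)) \<le> r / 4"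
      using discretize_tendsto[OF D] by blast
    have "discretize n (\<Phi> \<omega>) \<in> V k" if n: "N \<le> n" for n
      unfolding V_def
    proof (intro CollectI subsetI)
      fix y assume y: "y \<in> Sk.mball (discretize n (\<Phi> \<omega>)) (1 / real (Suc k))"
      then have "sk_dist (discretize n (\<Phi> \<omega>)) y < r / 2" "y \<in> cadlag_paths" using k by (auto simp: inverse_eq_divide)
      then have "sk_dist (\<Phi> \<omega>) y < r"
        using Sk.triangle[OF D discretize_cadlag[of n "\<Phi> \<omega>"], of y] N[OF n] r(1) by linarith
      then show "y \<in> U" using r(2) D \<open>y \<in> cadlag_paths\<close> by auto
    qed
    then show "\<omega> \<in> {\<omega>\<in>space M. \<exists>k N. \<forall>n\<ge>N. discretize n (\<Phi> \<omega>) \<in> V k}" using \<omega> by blast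
  next
    fix \<omega> assume "\<omega> \<in> {\<omega>\<in>space M. \<exists>k N. \<forall>n\<ge>N. discretize n (\<Phi> \<omega>) \<in> V k}"
    then obtain k N where \<omega>: "\<omega> \<in> space M" and N: "\<And>n. N \<le> n \<Longrightarrow> discretize n (\<Phi> \<omega>) \<in> V k" by blast
    have D: "\<Phi> \<omega> \<in> cadlag_paths" using \<Phi> \<omega> by auto
    have "0 < 1 / real (Suc k) / 2" by simp
    then obtain N' where N': "\<And>n. N' \<le> n \<Longrightarrow> sk_dist (\<Phi> \<omega>) (discretize n (\<Phi> \<omega>)) \<le> 1 / real (Suc k) / 2"
      using discretize_tendsto[OF D] by blast
    let ?n = "max N N'"
    have "sk_dist (discretize ?n (\<Phi> \<omega>)) (\<Phi> \<omega>) \<le> 1 / real (Suc k) / 2"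
      using N'[of ?n] by (simp add: Sk.commute)
    also have "\<dots> < 1 / real (Suc k)" using \<open>0 < 1 / real (Suc k) / 2\<close> by linarith
    finally have "\<Phi> \<omega> \<in> Sk.mball (discretize ?n (\<Phi> \<omega>)) (1 / real (Suc k))" using D discretize_cadlag by auto
    then show "\<omega> \<in> \<Phi> -` U \<inter> space M" using N[of ?n] \<omega> unfolding V_def by auto
  qed
  also have "\<dots> \<in> sets M"
    using measurable_discretize[where \<Phi>=\<Phi>, OF m]
    by (intro sets.sets_Collect_countable_Ex sets.sets_Collect_countable_All sets.sets_Collect_imp) auto
  finally show "\<Phi> -` U \<inter> space M \<in> sets M" .
qed

section \<open>Limits of laws on sequence spaces with prescribed marginals\<close>

text \<open>Points are encoded by the bits telling which of the balls around the dense sequence contain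
  them. Along a subsequence all cylinder probabilities converge, and the limit is realised on
  \<open>[0,1)\<close> by successively splitting intervals. Since the marginals do not move, the limit is
  carried by genuine codes, so that no tightness argument is needed.\<close>

abbreviation bit_space :: "(nat \<Rightarrow> bool) measure" where
  "bit_space \<equiv> PiM UNIV (\<lambda>_. count_space UNIV)"

text \<open>The latest bit comes first, so that prolonging a history is consing, as in the
  additivity relation for cylinder probabilities.\<close>

fun history :: "(nat \<Rightarrow> bool) \<Rightarrow> nat \<Rightarrow> bool list" where
  "history \<beta> 0 = []"
| "history \<beta> (Suc n) = \<beta> n # history \<beta> n"

lemma length_history[simp]: "length (history \<beta> n) = n"
  by (induction n) auto

lemma history_eq_iff: "history \<beta> n = history \<beta>' n \<longleftrightarrow> (\<forall>i<n. \<beta> i = \<beta>' i)"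
  by (induction n) (auto simp: less_Suc_eq)

lemma measurable_history[measurable]: "(\<lambda>\<beta>. history \<beta> n) \<in> measurable bit_space (count_space UNIV)"
proof (induction n)
  case (Suc n)
  note [measurable] = Suc
  show ?case by simp measurable
qed simp

text \<open>The interval of a history is split by the mass of its continuation with
  \<open>False\<close>: that part lies on the left, the part for \<open>True\<close> on the
  right.\<close>

fun left_end :: "(bool list \<Rightarrow> real) \<Rightarrow> bool list \<Rightarrow> real" where
  "left_end q [] = 0"
| "left_end q (b # s) = left_end q s + (if b then q (False # s) else 0)"

fun split_history :: "(bool list \<Rightarrow> real) \<Rightarrow> real \<Rightarrow> nat \<Rightarrow> bool list" where
  "split_history q u 0 = []"
| "split_history q u (Suc n) = (let s = split_history q u n in (left_end q s + q (False # s) \<le> u) # s)"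

text \<open>For \<open>u\<close> uniform in [0,1), the bits start with \<open>s\<close> exactly when
  \<open>u\<close> lies in the half-open interval of length \<open>q s\<close> starting at
  \<open>left_end q s\<close>.\<close>

lemma bit_law_exists:
  fixes q :: "bool list \<Rightarrow> real"
  assumes q: "q [] = 1" "\<And>s. 0 \<le> q s" "\<And>s. q (False # s) + q (True # s) = q s"
  obtains S where "prob_space S" "sets S = sets bit_space"
    "\<And>s. measure S {\<beta>. history \<beta> (length s) = s} = q s"
proof -
  define U where "U = restrict_space lborel {0..<1::real}"
  have sU: "space U = {0..<1}" by (simp add: U_def space_restrict_space)
  define bit where "bit u n = hd (split_history q u (Suc n))" for u n
  have hist: "history (bit u) n = split_history q u n" for u n
    by (induction n) (auto simp: bit_def Let_def)
  have len: "length (split_history q u n) = n" for u n by (induction n) (auto simp: Let_def)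
  have int: "split_history q u (length s) = s \<longleftrightarrow> left_end q s \<le> u \<and> u < left_end q s + q s" if "u \<in> {0..<1}" for u s
  proof (induction s)
    case Nil
    then show ?case using that q by simp
  next
    case (Cons b s)
    have "split_history q u (length (b # s)) = b # s \<longleftrightarrow>
      split_history q u (length s) = s \<and> (left_end q s + q (False # s) \<le> u) = b"
      by (auto simp: Let_def)
    then show ?case
      unfolding Cons using q(2)[of "False # s"] q(2)[of "True # s"] q(3)[of s] by (cases b) auto
  qed
  have sub: "0 \<le> left_end q s \<and> left_end q s + q s \<le> 1" for s
  proof (induction s)
    case Nil then show ?case using q by simp
  next
    case (Cons b s)
    then show ?case using q(2)[of "False # s"] q(2)[of "True # s"] q(3)[of s] by (cases b) auto
  qed
  have set: "{u\<in>space U. split_history q u n = s} = (if length s = n then {left_end q s..<left_end q s + q s} else {})" for n s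
    using int[of _ s] sub[of s] len[of _ n] unfolding sU by (auto simp: Suc_le_eq)
  have hm: "(\<lambda>u. split_history q u n) \<in> measurable U (count_space UNIV)" for n
  proof (subst measurable_count_space_eq2_countable, intro conjI ballI)
    show "(\<lambda>u. split_history q u n) -` {a} \<inter> space U \<in> sets U" for a
    proof -
      have "(\<lambda>u. split_history q u n) -` {a} \<inter> space U = {u\<in>space U. split_history q u n = a}" by auto
      also have "\<dots> \<in> sets U" using sub[of a] unfolding set by (auto simp: U_def sets_restrict_space_iff)
      finally show ?thesis .
    qed
  qed auto
  have bm: "bit \<in> measurable U bit_space"
  proof (rule measurable_PiM_single')
    fix n
    have "(\<lambda>u. hd (split_history q u (Suc n))) \<in> measurable U (count_space UNIV)"
      by (rule measurable_compose[OF hm]) simp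
    then show "(\<lambda>u. bit u n) \<in> measurable U (count_space UNIV)" by (simp add: bit_def)
  qed auto
  have pU: "prob_space U"
    by (rule prob_spaceI) (simp add: sU U_def emeasure_restrict_space)
  show ?thesis
  proof (rule that[of "distr U bit_space bit"])
    show "prob_space (distr U bit_space bit)" by (rule prob_space.prob_space_distr[OF pU bm])
    fix s
    have "{\<beta>. history \<beta> (length s) = s} \<in> sets bit_space"
    proof -
      have "{\<beta>\<in>space bit_space. history \<beta> (length s) = s} \<in> sets bit_space" by measurable
      then show ?thesis by (simp add: space_PiM)
    qed
    then have "measure (distr U bit_space bit) {\<beta>. history \<beta> (length s) = s} = measure U {u\<in>space U. split_history q u (length s) = s}"
      using bm by (subst measure_distr) (auto simp: hist intro!: arg_cong[where f="measure U"])
    also have "\<dots> = q s"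
      unfolding set using sub[of s] q(2)[of s] by (auto simp: U_def measure_restrict_space)
    finally show "measure (distr U bit_space bit) {\<beta>. history \<beta> (length s) = s} = q s" .
  qed simp
qed

text \<open>A countable power of [0,1] is compact by Tychonoff and then also sequentially compact,
  which encapsulates the diagonal argument.\<close>

lemma convergent_subsequence_coordinatewise:
  fixes p :: "nat \<Rightarrow> 'i::countable \<Rightarrow> real"
  assumes "\<And>n s. 0 \<le> p n s \<and> p n s \<le> 1"
  obtains r q where "strict_mono (r :: nat \<Rightarrow> nat)" "\<And>s. (\<lambda>n. p (r n) s) \<longlonglongrightarrow> q s"
proof -
  have "compactin (product_topology (\<lambda>_::'i. euclideanreal) UNIV) (PiE UNIV (\<lambda>_. {0..1}))"
    by (simp add: compactin_PiE)
  then have "compact (PiE UNIV (\<lambda>_::'i. {0..1::real}))"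
    by (metis compactin_euclidean_iff euclidean_product_topology)
  then have "seq_compact (PiE UNIV (\<lambda>_::'i. {0..1::real}))" by (rule compact_imp_seq_compact)
  then obtain q r where r: "strict_mono (r :: nat \<Rightarrow> nat)" "(p \<circ> r) \<longlonglongrightarrow> q"
    by (rule seq_compactE[where f=p]) (use assms in auto)
  have "(\<lambda>n. p (r n) s) \<longlonglongrightarrow> q s" for s
  proof -
    have "continuous_on UNIV (\<lambda>x::'i \<Rightarrow> real. x s)" by simp
    from continuous_on_tendsto_compose[OF this r(2)] show ?thesis by simp
  qed
  with r(1) show ?thesis by (rule that)
qed

section \<open>Encoding points by bits and passing to the limit\<close>

definition point_bits :: "'a::polish_space \<Rightarrow> nat \<Rightarrow> bool" where
  "point_bits x l = (case prod_decode l of (i, k) \<Rightarrow> dist x (dense_seq i) < (1/2)^k)"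

definition seq_bits :: "(nat \<Rightarrow> 'a::polish_space) \<Rightarrow> nat \<Rightarrow> bool" where
  "seq_bits w m = (case prod_decode m of (j, l) \<Rightarrow> point_bits (w j) l)"

definition bit_code :: "(nat \<Rightarrow> bool) \<Rightarrow> nat \<Rightarrow> nat" where
  "bit_code \<beta> k = (LEAST i. \<beta> (prod_encode (i, k)))"

text \<open>The constant fallback makes the sequence converge for every bit sequence, so that the
  limit is a measurable function.\<close>

definition decode :: "(nat \<Rightarrow> bool) \<Rightarrow> 'a::polish_space" where
  "decode \<beta> = lim (\<lambda>k. if Cauchy (\<lambda>k. dense_seq (bit_code \<beta> k) :: 'a) then dense_seq (bit_code \<beta> k) else dense_seq 0)"

lemma bit_code_point_bits: "bit_code (point_bits x) k = code ((1/2)^k) x"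
  by (simp add: bit_code_def point_bits_def code_def)

lemma decode_point_bits: "decode (point_bits x) = (x :: 'a::polish_space)"
proof -
  have "(\<lambda>k. dense_seq (code ((1/2)^k) x)) \<longlonglongrightarrow> x"
  proof (rule metric_tendsto_imp_tendsto)
    show "(\<lambda>k. (1/2::real)^k) \<longlonglongrightarrow> 0" by (rule LIMSEQ_power_zero) simp
    show "eventually (\<lambda>k. dist (dense_seq (code ((1/2)^k) x)) x \<le> dist ((1/2::real)^k) 0) sequentially"
      using dist_code[of "(1/2)^_" x] by (intro always_eventually allI) (auto simp: dist_commute less_imp_le)
  qed
  moreover from this have "Cauchy (\<lambda>k. dense_seq (code ((1/2)^k) x) :: 'a)" by (rule LIMSEQ_imp_Cauchy)
  ultimately show ?thesis by (simp add: decode_def bit_code_point_bits limI)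
qed

lemma measurable_bit_code[measurable]: "(\<lambda>\<beta>. bit_code \<beta> k) \<in> measurable bit_space (count_space UNIV)"
  unfolding bit_code_def by measurable

lemma measurable_decode[measurable]: "decode \<in> measurable bit_space (borel :: 'a::polish_space measure)"
proof (rule borel_measurable_LIMSEQ_metric)
  let ?f = "\<lambda>k \<beta>. if Cauchy (\<lambda>k. dense_seq (bit_code \<beta> k) :: 'a) then dense_seq (bit_code \<beta> k) else dense_seq 0 :: 'a"
  have [measurable]: "(\<lambda>\<beta>. dense_seq (bit_code \<beta> k) :: 'a) \<in> borel_measurable bit_space" for k
    by (rule measurable_compose[OF measurable_bit_code]) simp
  show "?f k \<in> borel_measurable bit_space" for k by measurable
  show "(\<lambda>k. ?f k \<beta>) \<longlonglongrightarrow> decode \<beta>" for \<beta>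
  proof -
    have "convergent (\<lambda>k. ?f k \<beta>)"
      by (cases "Cauchy (\<lambda>k. dense_seq (bit_code \<beta> k) :: 'a)") (auto simp: Cauchy_convergent_iff convergent_const)
    then show ?thesis unfolding decode_def by (simp add: convergent_LIMSEQ_iff)
  qed
qed

lemma measurable_point_bits[measurable]: "point_bits \<in> measurable borel bit_space"
  by (rule measurable_PiM_single') (auto simp: point_bits_def split_beta)

lemma measurable_seq_bits[measurable]: "seq_bits \<in> measurable seq_space bit_space"
proof (rule measurable_PiM_single')
  fix m
  show "(\<lambda>w. seq_bits w m) \<in> measurable seq_space (count_space UNIV)"
    unfolding seq_bits_def point_bits_def split_beta by measurable
qed auto

text \<open>Cost bounds pass to the limit by rounding: at scale \<open>(1/2)^k\<close> the cost is
  compared with a sum over pairs of cells of a distance of dense points times the probability of the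
  pair. Each such event depends on finitely many bits, so its probability converges, and Fatou's
  lemma for the counting measure handles the infinite sum.\<close>

lemma limit_law_exists:
  fixes Q :: "nat \<Rightarrow> (nat \<Rightarrow> 'a::polish_space) measure" and m :: "nat \<Rightarrow> 'a measure"
  assumes Q: "\<And>n. prob_space (Q n)" "\<And>n. sets (Q n) = sets seq_space"
    and m: "\<And>j. eventually (\<lambda>n. distr (Q n) borel (\<lambda>w. w j) = m j) sequentially"
  obtains R where "prob_space R" "sets R = sets seq_space" "\<And>j. distr R borel (\<lambda>w. w j) = m j"
    "\<And>i j C. eventually (\<lambda>n. (\<integral>\<^sup>+w. ennreal (dist (w i) (w j)) \<partial>Q n) \<le> C) sequentially \<Longrightarrow>
        (\<integral>\<^sup>+w. ennreal (dist (w i) (w j)) \<partial>R) \<le> C"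
proof -
  note [measurable_cong] = Q(2)
  have spQ: "space (Q n) = UNIV" for n using sets_eq_imp_space_eq[OF Q(2)] by (simp add: space_PiM)
  have sB: "space bit_space = UNIV" by (simp add: space_PiM)
  define p where "p n s = measure (Q n) {w. history (seq_bits w) (length s) = s}" for n s
  have Hs[measurable]: "{w. history (seq_bits w) k \<in> A} \<in> sets (Q n)" for n k A
  proof -
    have "(\<lambda>w. history (seq_bits w) k) \<in> measurable (Q n) (count_space UNIV)"
      using measurable_compose[OF measurable_seq_bits measurable_history] Q(2) by (simp cong: measurable_cong_sets)
    from measurable_sets[OF this, of A] show ?thesis by (simp add: vimage_def spQ)
  qed
  have p01: "0 \<le> p n s \<and> p n s \<le> 1" for n s
    using prob_space.prob_le_1[OF Q(1)] by (simp add: p_def)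
  obtain r q where r: "strict_mono (r :: nat \<Rightarrow> nat)" and pq: "\<And>s. (\<lambda>n. p (r n) s) \<longlonglongrightarrow> q s"
    using convergent_subsequence_coordinatewise[of p, OF p01] by blast
  have q0: "0 \<le> q s" for s using pq[of s] p01 by (intro LIMSEQ_le_const) auto
  have q1: "q [] = 1"
  proof -
    have "p n [] = 1" for n using prob_space.prob_space[OF Q(1)[of n]] by (simp add: p_def spQ)
    then have "(\<lambda>n. p (r n) []) \<longlonglongrightarrow> 1" by simp
    with pq[of "[]"] show ?thesis by (rule LIMSEQ_unique)
  qed
  have qs: "q (False # s) + q (True # s) = q s" for s
  proof -
    have "p n (False # s) + p n (True # s) = p n s" for n
    proof -
      interpret prob_space "Q n" by (rule Q)
      have "p n (False # s) + p n (True # s) = measure (Q n) ({w. history (seq_bits w) (length (False # s)) = False # s} \<union> {w. history (seq_bits w) (length (True # s)) = True # s})"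
        unfolding p_def
        using Hs[where A="{False # s}" and k="length (False # s)" and n=n] Hs[where A="{True # s}" and k="length (True # s)" and n=n]
        unfolding singleton_iff by (intro finite_measure_Union[symmetric]) auto
      also have "{w. history (seq_bits w) (length (False # s)) = False # s} \<union> {w. history (seq_bits w) (length (True # s)) = True # s} = {w :: nat \<Rightarrow> 'a. history (seq_bits w) (length s) = s}"
        by auto
      finally show ?thesis by (simp add: p_def)
    qed
    moreover have "(\<lambda>n. p (r n) (False # s) + p (r n) (True # s)) \<longlonglongrightarrow> q (False # s) + q (True # s)"
      by (intro tendsto_add pq)
    ultimately have "(\<lambda>n. p (r n) s) \<longlonglongrightarrow> q (False # s) + q (True # s)" by simp
    then show ?thesis using pq[of s] by (rule LIMSEQ_unique)
  qed
  obtain S where S: "prob_space S" "sets S = sets bit_space" and Sq: "\<And>s. measure S {\<beta>. history \<beta> (length s) = s} = q s"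
    using bit_law_exists[of q, OF q1 q0 qs] by blast
  interpret S: prob_space S by fact
  note [measurable_cong] = S(2)
  have spS: "space S = UNIV" using sets_eq_imp_space_eq[OF S(2)] by (simp add: space_PiM)
  have HS: "{\<beta>. history \<beta> k \<in> A} \<in> sets S" for k A
    using measurable_sets[OF measurable_history, of A k] S(2) by (simp add: vimage_def sB)
  \<comment> \<open>An event read off from the first \<open>N\<close> bits is a finite disjoint
    union of cylinders.\<close>
  have conv: "(\<lambda>n. measure (Q (r n)) {w. seq_bits w \<in> E}) \<longlonglongrightarrow> measure S E" and Em: "E \<in> sets S"
    if E: "\<And>\<beta> \<beta>'. (\<And>i. i < N \<Longrightarrow> \<beta> i = \<beta>' i) \<Longrightarrow> \<beta> \<in> E \<Longrightarrow> \<beta>' \<in> E" for E N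
  proof -
    define A where "A = (\<lambda>\<beta>. history \<beta> N) ` E"
    have EA: "\<beta> \<in> E \<longleftrightarrow> history \<beta> N \<in> A" for \<beta>
      unfolding A_def using E by (auto simp: history_eq_iff)
    have fin: "finite A"
      using finite_lists_length_eq[of "UNIV :: bool set" N] by (rule finite_subset[rotated]) (auto simp: A_def)
    have lenA: "length s = N" if "s \<in> A" for s using that by (auto simp: A_def)
    have E_eq: "E = {\<beta>. history \<beta> N \<in> A}" using EA by auto
    show "E \<in> sets S" unfolding E_eq by (rule HS)
    have 1: "measure (Q n) {w. seq_bits w \<in> E} = (\<Sum>s\<in>A. p n s)" for n
    proof -
      interpret prob_space "Q n" by (rule Q)
      have "{w. seq_bits w \<in> E} = (\<Union>s\<in>A. {w :: nat \<Rightarrow> 'a. history (seq_bits w) (length s) = s})"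
        using lenA by (auto simp: EA)
      moreover have "measure (Q n) (\<Union>s\<in>A. {w. history (seq_bits w) (length s) = s}) = (\<Sum>s\<in>A. p n s)"
        unfolding p_def
      proof (rule finite_measure_finite_Union[OF fin])
        show "(\<lambda>s. {w. history (seq_bits w) (length s) = s}) ` A \<subseteq> sets (Q n)" using Hs[of _ "{_}"] by auto
        show "disjoint_family_on (\<lambda>s. {w :: nat \<Rightarrow> 'a. history (seq_bits w) (length s) = s}) A"
          using lenA by (auto simp: disjoint_family_on_def)
      qed
      ultimately show ?thesis by simp
    qed
    have 2: "measure S E = (\<Sum>s\<in>A. q s)"
    proof -
      have "E = (\<Union>s\<in>A. {\<beta>. history \<beta> (length s) = s})" using lenA by (auto simp: EA)
      moreover have "measure S (\<Union>s\<in>A. {\<beta>. history \<beta> (length s) = s}) = (\<Sum>s\<in>A. measure S {\<beta>. history \<beta> (length s) = s})"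
      proof (rule S.finite_measure_finite_Union[OF fin])
        show "(\<lambda>s. {\<beta>. history \<beta> (length s) = s}) ` A \<subseteq> sets S" using HS[of _ "{_}"] by auto
        show "disjoint_family_on (\<lambda>s. {\<beta>. history \<beta> (length s) = s}) A"
          using lenA by (auto simp: disjoint_family_on_def)
      qed
      ultimately show ?thesis by (simp add: Sq)
    qed
    show "(\<lambda>n. measure (Q (r n)) {w. seq_bits w \<in> E}) \<longlonglongrightarrow> measure S E"
      unfolding 1 2 by (intro tendsto_sum pq)
  qed
  define row where "row j \<beta> = (\<lambda>l. \<beta> (prod_encode (j, l)))" for j and \<beta> :: "nat \<Rightarrow> bool"
  have row_m[measurable]: "row j \<in> measurable bit_space bit_space" for j
    unfolding row_def by (rule measurable_PiM_single') (auto simp: space_PiM)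
  have row_seq: "row j (seq_bits w) = point_bits (w j)" for j and w :: "nat \<Rightarrow> 'a"
    by (auto simp: row_def seq_bits_def)
  \<comment> \<open>Cylinder events of a single row have, eventually along the subsequence, the
    probability prescribed by \<open>m j\<close>. So the limit row has exactly the law of the bits
    of a point distributed by \<open>m j\<close>, and no mass is lost.\<close>
  have row_law: "distr S bit_space (row j) = distr (m j) bit_space point_bits" for j
  proof (rule measure_eqI_PiM_infinite)
    obtain n where n: "distr (Q n) borel (\<lambda>w. w j) = m j" using eventually_happens[OF m] by auto
    have msets[measurable_cong]: "sets (m j) = sets borel" unfolding n[symmetric] by simp
    have mp: "prob_space (m j)" unfolding n[symmetric] by (rule prob_space.prob_space_distr[OF Q(1)]) measurable
    show "finite_measure (distr S bit_space (row j))"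
      by (intro S.finite_measure_distr) measurable
    fix A :: "nat \<Rightarrow> bool set" and J :: "nat set" assume J: "finite J"
    define E where "E = {\<beta>. \<forall>l\<in>J. \<beta> (prod_encode (j, l)) \<in> A l}"
    have pe: "prod_emb UNIV (\<lambda>_. count_space UNIV) J (Pi\<^sub>E J A) = {\<beta>. \<forall>l\<in>J. \<beta> l \<in> A l}"
      by (auto simp: prod_emb_iff PiE_iff)
    have pes: "{\<beta>. \<forall>l\<in>J. \<beta> l \<in> A l} \<in> sets bit_space"
      unfolding pe[symmetric] using J by (intro sets_PiM_I) auto
    obtain N where N: "\<And>l. l \<in> J \<Longrightarrow> prod_encode (j, l) < N"
      using finite_nat_set_iff_bounded[of "(\<lambda>l. prod_encode (j, l)) ` J"] J by auto
    have lim: "(\<lambda>n. measure (Q (r n)) {w. seq_bits w \<in> E}) \<longlonglongrightarrow> measure S E"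
      by (rule conv[of N]) (use N in \<open>auto simp: E_def\<close>)
    have ev: "eventually (\<lambda>n. measure (Q (r n)) {w. seq_bits w \<in> E} = measure (distr (m j) bit_space point_bits) {\<beta>. \<forall>l\<in>J. \<beta> l \<in> A l}) sequentially"
      using eventually_subseq[OF r m[of j]]
    proof eventually_elim
      case (elim n)
      have "measure (distr (m j) bit_space point_bits) {\<beta>. \<forall>l\<in>J. \<beta> l \<in> A l}
        = measure (distr (Q (r n)) bit_space (point_bits \<circ> (\<lambda>w. w j))) {\<beta>. \<forall>l\<in>J. \<beta> l \<in> A l}"
        unfolding elim[symmetric] by (subst distr_distr) auto
      also have "\<dots> = measure (Q (r n)) {w. seq_bits w \<in> E}"
        using pes by (subst measure_distr) (auto simp: spQ E_def seq_bits_def vimage_def)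
      finally show ?case by simp
    qed
    have "measure S E = measure (distr (m j) bit_space point_bits) {\<beta>. \<forall>l\<in>J. \<beta> l \<in> A l}"
      by (rule LIMSEQ_unique[OF lim tendsto_eventually[OF ev]])
    moreover have "measure (distr S bit_space (row j)) {\<beta>. \<forall>l\<in>J. \<beta> l \<in> A l} = measure S E"
      using pes by (subst measure_distr) (auto simp: spS E_def row_def vimage_def)
    moreover have "finite_measure (distr S bit_space (row j))"
      by (intro S.finite_measure_distr) measurable
    moreover have "finite_measure (distr (m j) bit_space point_bits)"
      by (intro finite_measure.finite_measure_distr prob_space.finite_measure mp) measurable
    ultimately show "emeasure (distr S bit_space (row j)) (prod_emb UNIV (\<lambda>_. count_space UNIV) J (Pi\<^sub>E J A))
        = emeasure (distr (m j) bit_space point_bits) (prod_emb UNIV (\<lambda>_. count_space UNIV) J (Pi\<^sub>E J A))"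
      unfolding pe by (simp add: finite_measure.emeasure_eq_measure)
  qed auto
  have m_sets[measurable_cong]: "sets (m j) = sets borel" for j
  proof -
    obtain n where "distr (Q n) borel (\<lambda>w. w j) = m j" using eventually_happens[OF m] by auto
    from this[symmetric] show ?thesis by simp
  qed
  define dec where "dec \<beta> = (\<lambda>j. decode (row j \<beta>) :: 'a)" for \<beta>
  have dec_m[measurable]: "dec \<in> measurable S seq_space"
    unfolding dec_def by (rule measurable_PiM_single') auto
  define R where "R = distr S seq_space dec"
  have law: "distr R borel (\<lambda>w. w j) = m j" for j
  proof -
    have "distr R borel (\<lambda>w. w j) = distr S borel (decode \<circ> row j)"
      unfolding R_def by (subst distr_distr) (auto simp: o_def dec_def)
    also have "\<dots> = distr (distr S bit_space (row j)) borel decode" by (subst distr_distr) auto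
    also have "\<dots> = distr (distr (m j) bit_space point_bits) borel decode" by (simp only: row_law)
    also have "\<dots> = distr (m j) borel (decode \<circ> point_bits)" by (subst distr_distr) auto
    also have "\<dots> = m j" by (simp add: o_def decode_point_bits distr_id2 m_sets)
    finally show ?thesis .
  qed
  \<comment> \<open>Both properties hold for the bits of every actual point and transfer to almost
    every limit row because the laws coincide. The bit itself is included since a
    \<open>LEAST\<close> over an empty set would be arbitrary.\<close>
  have genuine: "AE \<beta> in S. dist (decode (row j \<beta>) :: 'a) (dense_seq (bit_code (row j \<beta>) k)) \<le> (1/2)^k \<and> row j \<beta> (prod_encode (bit_code (row j \<beta>) k, k))" for j k
  proof -
    have [measurable]: "(\<lambda>\<beta>. dense_seq (bit_code \<beta> k) :: 'a) \<in> borel_measurable bit_space"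
      by (rule measurable_compose[OF measurable_bit_code]) simp
    have [measurable]: "Measurable.pred bit_space (\<lambda>\<beta>. \<beta> (prod_encode (bit_code \<beta> k, k)))"
      by (rule measurable_compose_countable[where f="\<lambda>i \<beta>. \<beta> (prod_encode (i, k))"]) measurable
    let ?P = "\<lambda>\<beta>. dist (decode \<beta> :: 'a) (dense_seq (bit_code \<beta> k)) \<le> (1/2)^k \<and> \<beta> (prod_encode (bit_code \<beta> k, k))"
    have P: "{\<beta>\<in>space bit_space. ?P \<beta>} \<in> sets bit_space" by measurable
    have "AE x in m j. ?P (point_bits x)"
    proof (rule AE_I2)
      fix x :: 'a
      have "dist x (dense_seq (code ((1/2)^k) x)) < (1/2)^k" by (rule dist_code) simp
      then show "?P (point_bits x)" by (simp add: decode_point_bits bit_code_point_bits point_bits_def)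
    qed
    then have "AE \<beta> in distr (m j) bit_space point_bits. ?P \<beta>"
      by (subst AE_distr_iff) (use P in auto)
    then have "AE \<beta> in distr S bit_space (row j). ?P \<beta>" by (simp only: row_law)
    then show ?thesis by (subst (asm) AE_distr_iff) (use P in auto)
  qed
  have cost: "(\<integral>\<^sup>+w. ennreal (dist (w i) (w j)) \<partial>R) \<le> C"
    if C: "eventually (\<lambda>n. (\<integral>\<^sup>+w. ennreal (dist (w i) (w j)) \<partial>Q n) \<le> C) sequentially" for i j C
  proof (rule ennreal_le_epsilon)
    fix e :: real assume e: "0 < e"
    obtain k where k: "(1/2)^k < e / 4" using real_arch_pow_inv[of "e/4" "1/2"] e by auto
    \<comment> \<open>That \<open>a\<close> is the least suitable index is decided by finitely many
      bits, so the probability of the event converges.\<close>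
    define first where "first j a \<beta> \<longleftrightarrow> \<beta> (prod_encode (j, prod_encode (a, k))) \<and> (\<forall>i<a. \<not> \<beta> (prod_encode (j, prod_encode (i, k))))" for j a \<beta>
    \<comment> \<open>With \<open>(1/2)^k < e / 4\<close> the two rounding errors total less than
      \<open>e / 2\<close>, so \<open>g\<close> bounds the distance from above on its cell and
      exceeds it by at most \<open>e\<close>.\<close>
    define g where "g z = ennreal (dist (dense_seq (fst z) :: 'a) (dense_seq (snd z)) + e / 2)" for z :: "nat \<times> nat"
    define E where "E z = {\<beta>. first i (fst z) \<beta> \<and> first j (snd z) \<beta>}" for z
    have first_seq: "first l a (seq_bits w) \<longleftrightarrow> a = code ((1/2)^k) (w l)" for l a and w :: "nat \<Rightarrow> 'a"
    proof -
      have "first l a (seq_bits w) \<longleftrightarrow> dist (w l) (dense_seq a) < (1/2)^k \<and> (\<forall>i<a. \<not> dist (w l) (dense_seq i) < (1/2)^k)"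
        by (simp add: first_def seq_bits_def point_bits_def)
      also have "\<dots> \<longleftrightarrow> a = code ((1/2)^k) (w l)"
        unfolding code_def using dist_code[of "(1/2)^k" "w l"]
        by (auto simp: code_def intro!: Least_equality[symmetric] dest: not_less_Least) (metis linorder_not_less)
      finally show ?thesis .
    qed
    have Econv: "(\<lambda>n. measure (Q (r n)) {w. seq_bits w \<in> E z}) \<longlonglongrightarrow> measure S (E z)" and Es[measurable]: "E z \<in> sets S" for z
    proof -
      define J where "J = (\<lambda>a. prod_encode (i, prod_encode (a, k))) ` {..fst z} \<union> (\<lambda>a. prod_encode (j, prod_encode (a, k))) ` {..snd z}"
      obtain N where N: "\<forall>x\<in>J. x < N" using finite_nat_set_iff_bounded[of J] by (auto simp: J_def)
      have inv: "\<beta>' \<in> E z" if eq: "\<And>i. i < N \<Longrightarrow> \<beta> i = \<beta>' i" and "\<beta> \<in> E z" for \<beta> \<beta>'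
      proof -
        have "\<beta> (prod_encode (i, prod_encode (a, k))) = \<beta>' (prod_encode (i, prod_encode (a, k)))" if "a \<le> fst z" for a
          using that N by (intro eq) (auto simp: J_def)
        moreover have "\<beta> (prod_encode (j, prod_encode (a, k))) = \<beta>' (prod_encode (j, prod_encode (a, k)))" if "a \<le> snd z" for a
          using that N by (intro eq) (auto simp: J_def)
        ultimately show ?thesis using \<open>\<beta> \<in> E z\<close> by (simp add: E_def first_def)
      qed
      show "(\<lambda>n. measure (Q (r n)) {w. seq_bits w \<in> E z}) \<longlonglongrightarrow> measure S (E z)"
        by (rule conv[of N], rule inv) auto
      show "E z \<in> sets S" by (rule Em[of N], rule inv) auto
    qed
    have Eseq: "seq_bits w \<in> E z \<longleftrightarrow> z = (code ((1/2)^k) (w i), code ((1/2)^k) (w j))" for w :: "nat \<Rightarrow> 'a" and z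
      by (cases z) (simp add: E_def first_seq)
    have EQ[measurable]: "{w. seq_bits w \<in> E z} \<in> sets (Q n)" for z n
    proof -
      have "{w\<in>space (Q n). z = (code ((1/2)^k) (w i), code ((1/2)^k) (w j))} \<in> sets (Q n)" by (cases z) simp
      then show ?thesis by (simp add: Eseq spQ)
    qed
    have "(\<integral>\<^sup>+w. ennreal (dist (w i) (w j)) \<partial>R) = (\<integral>\<^sup>+\<beta>. ennreal (dist (dec \<beta> i) (dec \<beta> j)) \<partial>S)"
      unfolding R_def by (subst nn_integral_distr) auto
    also have "\<dots> \<le> (\<integral>\<^sup>+\<beta>. \<integral>\<^sup>+z. g z * indicator (E z) \<beta> \<partial>count_space UNIV \<partial>S)"
    proof (rule nn_integral_mono_AE)
      show "AE \<beta> in S. ennreal (dist (dec \<beta> i) (dec \<beta> j)) \<le> (\<integral>\<^sup>+z. g z * indicator (E z) \<beta> \<partial>count_space UNIV)"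
        using genuine[of i k] genuine[of j k]
      proof eventually_elim
        case (elim \<beta>)
        define z where "z = (bit_code (row i \<beta>) k, bit_code (row j \<beta>) k)"
        have "\<beta> \<in> E z"
          using elim by (auto simp: E_def z_def first_def row_def bit_code_def dest: not_less_Least)
        have "dist (dec \<beta> i) (dec \<beta> j) \<le> dist (dense_seq (fst z) :: 'a) (dense_seq (snd z)) + dist (dec \<beta> i) (dense_seq (fst z)) + dist (dec \<beta> j) (dense_seq (snd z))"
          using dist_triangle[of "dec \<beta> i" "dec \<beta> j" "dense_seq (fst z)"] dist_triangle2[of "dense_seq (fst z)" "dec \<beta> j" "dense_seq (snd z)"]
          by linarith
        also have "\<dots> \<le> dist (dense_seq (fst z) :: 'a) (dense_seq (snd z)) + e / 2"
          using elim k by (auto simp: dec_def z_def)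
        finally have "ennreal (dist (dec \<beta> i) (dec \<beta> j)) \<le> g z * indicator (E z) \<beta>"
          using \<open>\<beta> \<in> E z\<close> by (simp add: g_def ennreal_leI)
        also have "\<dots> = (\<integral>\<^sup>+z'. g z' * indicator (E z') \<beta> * indicator {z} z' \<partial>count_space UNIV)"
          by (subst nn_integral_indicator_singleton) auto
        also have "\<dots> \<le> (\<integral>\<^sup>+z. g z * indicator (E z) \<beta> \<partial>count_space UNIV)"
          by (intro nn_integral_mono) (auto split: split_indicator)
        finally show ?case .
      qed
    qed
    also have "\<dots> = (\<integral>\<^sup>+z. \<integral>\<^sup>+\<beta>. g z * indicator (E z) \<beta> \<partial>S \<partial>count_space UNIV)"
      by (rule nn_integral_count_space_nn_integral) auto
    also have "\<dots> = (\<integral>\<^sup>+z. g z * ennreal (measure S (E z)) \<partial>count_space UNIV)"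
      by (intro nn_integral_cong) (simp add: nn_integral_cmult_indicator S.emeasure_eq_measure)
    also have "\<dots> = (\<integral>\<^sup>+z. liminf (\<lambda>n. g z * ennreal (measure (Q (r n)) {w. seq_bits w \<in> E z})) \<partial>count_space UNIV)"
    proof (intro nn_integral_cong lim_imp_Liminf[symmetric])
      fix z
      show "(\<lambda>n. g z * ennreal (measure (Q (r n)) {w. seq_bits w \<in> E z})) \<longlonglongrightarrow> g z * ennreal (measure S (E z))"
        unfolding g_def by (intro ennreal_tendsto_cmult tendsto_ennrealI Econv) simp
    qed simp
    also have "\<dots> \<le> liminf (\<lambda>n. \<integral>\<^sup>+z. g z * ennreal (measure (Q (r n)) {w. seq_bits w \<in> E z}) \<partial>count_space UNIV)"
      by (rule nn_integral_liminf) simp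
    also have "\<dots> \<le> C + ennreal e"
    proof (rule Liminf_le)
      have "eventually (\<lambda>n. (\<integral>\<^sup>+w. ennreal (dist (w i) (w j)) \<partial>Q (r n)) \<le> C) sequentially"
        by (rule eventually_subseq[OF r C])
      then show "eventually (\<lambda>n. (\<integral>\<^sup>+z. g z * ennreal (measure (Q (r n)) {w. seq_bits w \<in> E z}) \<partial>count_space UNIV) \<le> C + ennreal e) sequentially"
      proof eventually_elim
        case (elim n)
        interpret Q: prob_space "Q (r n)" by (rule Q)
        let ?c = "\<lambda>w. (code ((1/2)^k) (w i), code ((1/2)^k) (w j)) :: nat \<times> nat"
        have "(\<integral>\<^sup>+z. g z * ennreal (measure (Q (r n)) {w. seq_bits w \<in> E z}) \<partial>count_space UNIV)
            = (\<integral>\<^sup>+z. \<integral>\<^sup>+w. g z * indicator {w. seq_bits w \<in> E z} w \<partial>Q (r n) \<partial>count_space UNIV)"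
          by (intro nn_integral_cong) (simp add: nn_integral_cmult_indicator Q.emeasure_eq_measure)
        also have "\<dots> = (\<integral>\<^sup>+w. \<integral>\<^sup>+z. g z * indicator {w. seq_bits w \<in> E z} w \<partial>count_space UNIV \<partial>Q (r n))"
          by (rule nn_integral_count_space_nn_integral[symmetric]) auto
        also have "\<dots> = (\<integral>\<^sup>+w. g (?c w) \<partial>Q (r n))"
        proof (rule nn_integral_cong)
          fix w :: "nat \<Rightarrow> 'a"
          have "(\<integral>\<^sup>+z. g z * indicator {w. seq_bits w \<in> E z} w \<partial>count_space UNIV) = (\<integral>\<^sup>+z. g z * indicator {?c w} z \<partial>count_space UNIV)"
            by (intro nn_integral_cong) (auto simp: Eseq split: split_indicator)
          also have "\<dots> = g (?c w)" by (subst nn_integral_indicator_singleton) auto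
          finally show "(\<integral>\<^sup>+z. g z * indicator {w. seq_bits w \<in> E z} w \<partial>count_space UNIV) = g (?c w)" .
        qed
        also have "\<dots> \<le> (\<integral>\<^sup>+w. ennreal (dist (w i) (w j)) + ennreal e \<partial>Q (r n))"
        proof (rule nn_integral_mono)
          fix w :: "nat \<Rightarrow> 'a"
          have "dist (dense_seq (code ((1/2)^k) (w i)) :: 'a) (dense_seq (code ((1/2)^k) (w j))) + e / 2 \<le> dist (w i) (w j) + e"
            using dist_code[of "(1/2)^k" "w i"] dist_code[of "(1/2)^k" "w j"] k
              dist_triangle[of "dense_seq (code ((1/2)^k) (w i))" "dense_seq (code ((1/2)^k) (w j))" "w i"]
              dist_triangle[of "w i" "dense_seq (code ((1/2)^k) (w j))" "w j"]
            by (simp add: dist_commute)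
          then show "g (?c w) \<le> ennreal (dist (w i) (w j)) + ennreal e"
            using e by (simp add: g_def ennreal_leI flip: ennreal_plus)
        qed
        also have "\<dots> = (\<integral>\<^sup>+w. ennreal (dist (w i) (w j)) \<partial>Q (r n)) + ennreal e"
          by (subst nn_integral_add) (auto simp: Q.emeasure_space_1)
        also have "\<dots> \<le> C + ennreal e" using elim by (rule add_right_mono)
        finally show ?case .
      qed
    qed simp
    finally show "(\<integral>\<^sup>+w. ennreal (dist (w i) (w j)) \<partial>R) \<le> C + ennreal e" .
  qed
  show ?thesis
  proof (rule that[OF _ _ law cost])
    show "prob_space R" unfolding R_def by (rule S.prob_space_distr) measurable
  qed (auto simp: R_def)
qed

section \<open>Processes with prescribed marginals\<close>

definition dyadics :: "real set" where
  "dyadics = {x. \<exists>i k. x = real i / 2^k \<and> x \<le> 1}"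

text \<open>Unlike \<open>dyadic_ceil\<close> it lies strictly to the right of \<open>t\<close> even
  at grid points, as a right limit requires.\<close>

definition next_dyadic :: "nat \<Rightarrow> real \<Rightarrow> real" where
  "next_dyadic n t = (of_int \<lfloor>t * 2^n\<rfloor> + 1) / 2^n"

lemma dyadics_01: "x \<in> dyadics \<Longrightarrow> 0 \<le> x \<and> x \<le> 1"
  by (auto simp: dyadics_def)

lemma one_in_dyadics[simp]: "1 \<in> dyadics" unfolding dyadics_def by (rule CollectI, rule exI[of _ 1], rule exI[of _ 0]) simp

lemma next_dyadic_bounds: "t < next_dyadic n t" "next_dyadic n t \<le> t + (1/2)^n"
proof -
  have "t * 2^n < of_int \<lfloor>t * 2^n\<rfloor> + 1" "of_int \<lfloor>t * 2^n\<rfloor> \<le> t * 2^n" by linarith+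
  then show "t < next_dyadic n t" "next_dyadic n t \<le> t + (1/2)^n"
    by (auto simp: next_dyadic_def field_simps)
qed

lemma next_dyadic_in:
  assumes "0 \<le> t" "t < 1"
  shows "next_dyadic n t \<in> dyadics"
proof -
  have "0 \<le> \<lfloor>t * 2^n\<rfloor>" using assms by simp
  then have eq: "of_int \<lfloor>t * 2^n\<rfloor> + 1 = real (nat \<lfloor>t * 2^n\<rfloor> + 1)" by simp
  have "t * 2^n < 2^n" using assms by simp
  then have "\<lfloor>t * 2^n\<rfloor> < 2^n" by (simp add: floor_less_iff)
  then have "\<lfloor>t * 2^n\<rfloor> + 1 \<le> 2^n" by simp
  then have "real_of_int (\<lfloor>t * 2^n\<rfloor> + 1) \<le> real_of_int (2^n)" by (simp only: of_int_le_iff)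
  then have "next_dyadic n t \<le> 1" by (simp add: next_dyadic_def)
  moreover have "next_dyadic n t = real (nat \<lfloor>t * 2^n\<rfloor> + 1) / 2^n" by (simp only: next_dyadic_def eq)
  ultimately show ?thesis unfolding dyadics_def by blast
qed

lemma next_dyadic_mono: "m \<le> n \<Longrightarrow> next_dyadic n t \<le> next_dyadic m t"
proof -
  assume "m \<le> n"
  then obtain k where n: "n = m + k" using le_Suc_ex by blast
  have "t * 2^m < of_int \<lfloor>t * 2^m\<rfloor> + 1" by linarith
  then have "t * 2^m * 2^k < (of_int \<lfloor>t * 2^m\<rfloor> + 1) * 2^k" by simp
  then have "t * 2^n < of_int ((\<lfloor>t * 2^m\<rfloor> + 1) * 2^k)" by (simp add: n power_add mult.assoc)
  then have "\<lfloor>t * 2^n\<rfloor> < (\<lfloor>t * 2^m\<rfloor> + 1) * 2^k" by (simp only: floor_less_iff)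
  then have "\<lfloor>t * 2^n\<rfloor> + 1 \<le> (\<lfloor>t * 2^m\<rfloor> + 1) * 2^k" by simp
  then have "real_of_int (\<lfloor>t * 2^n\<rfloor> + 1) \<le> real_of_int ((\<lfloor>t * 2^m\<rfloor> + 1) * 2^k)" by (simp only: of_int_le_iff)
  then have "real_of_int \<lfloor>t * 2^n\<rfloor> + 1 \<le> (real_of_int \<lfloor>t * 2^m\<rfloor> + 1) * 2^k" by simp
  then have "next_dyadic n t \<le> (real_of_int \<lfloor>t * 2^m\<rfloor> + 1) * 2^k / 2^n"
    unfolding next_dyadic_def by (rule divide_right_mono) simp
  also have "\<dots> = next_dyadic m t" by (simp add: next_dyadic_def n power_add)
  finally show ?thesis .
qed

lemma next_dyadic_tendsto: "(\<lambda>n. next_dyadic n t) \<longlonglongrightarrow> t"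
proof (rule tendsto_sandwich[of "\<lambda>_. t" _ _ "\<lambda>n. t + (1/2)^n"])
  have "(\<lambda>n. t + (1/2::real)^n) \<longlonglongrightarrow> t + 0" by (intro tendsto_intros LIMSEQ_power_zero) auto
  then show "(\<lambda>n. t + (1/2::real)^n) \<longlonglongrightarrow> t" by simp
qed (auto intro!: always_eventually simp: next_dyadic_bounds less_imp_le[OF next_dyadic_bounds(1)])

lemma chain_increment_le:
  fixes Q :: "(nat \<Rightarrow> 'a::polish_space) measure"
  assumes Q: "sets Q = sets seq_space" and ab: "a \<le> b"
    and step: "\<And>i. a \<le> i \<Longrightarrow> i < b \<Longrightarrow> (\<integral>\<^sup>+w. ennreal (dist (w i) (w (Suc i))) \<partial>Q) \<le> ennreal (c i)" and c: "\<And>i. 0 \<le> c i"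
  shows "(\<integral>\<^sup>+w. ennreal (dist (w a) (w b)) \<partial>Q) \<le> ennreal (\<Sum>i\<in>{a..<b}. c i)"
  using ab step
proof (induction b rule: dec_induct)
  case (step n)
  note [measurable_cong] = Q
  have "(\<integral>\<^sup>+w. ennreal (dist (w a) (w (Suc n))) \<partial>Q) \<le> (\<integral>\<^sup>+w. ennreal (dist (w a) (w n)) + ennreal (dist (w n) (w (Suc n))) \<partial>Q)"
    by (intro nn_integral_mono) (simp add: ennreal_leI dist_triangle flip: ennreal_plus)
  also have "\<dots> = (\<integral>\<^sup>+w. ennreal (dist (w a) (w n)) \<partial>Q) + (\<integral>\<^sup>+w. ennreal (dist (w n) (w (Suc n))) \<partial>Q)"
    by (rule nn_integral_add) auto
  also have "\<dots> \<le> ennreal (\<Sum>i\<in>{a..<n}. c i) + ennreal (c n)"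
    using step by (intro add_mono) auto
  also have "\<dots> = ennreal (\<Sum>i\<in>{a..<Suc n}. c i)"
    using step(1) c by (simp add: sum_nonneg flip: ennreal_plus)
  finally show ?case .
qed simp

text \<open>The chains of all levels are moved onto one sequence space whose coordinates enumerate
  the dyadic times. From some level on each coordinate sits exactly at its time, which gives the
  eventually constant marginals that \<open>limit_law_exists\<close> asks for.\<close>

lemma dyadic_process_exists:
  fixes \<nu> :: "real \<Rightarrow> 'a::polish_space measure" and W :: "real \<Rightarrow> real"
  assumes \<nu>: "\<And>t. t \<in> {0..1} \<Longrightarrow> \<nu> t \<in> P1"
    and W: "\<And>s t. 0 \<le> s \<Longrightarrow> s \<le> t \<Longrightarrow> t \<le> 1 \<Longrightarrow> W1 (\<nu> s) (\<nu> t) \<le> W t - W s"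
  obtains R :: "(nat \<Rightarrow> 'a) measure" and \<xi> :: "real \<Rightarrow> (nat \<Rightarrow> 'a) \<Rightarrow> 'a"
    where "prob_space R" "\<And>s. \<xi> s \<in> measurable R borel" "\<And>s. s \<in> dyadics \<Longrightarrow> distr R borel (\<xi> s) = \<nu> s"
      "\<And>s t. s \<in> dyadics \<Longrightarrow> t \<in> dyadics \<Longrightarrow> s \<le> t \<Longrightarrow> (\<integral>\<^sup>+w. ennreal (dist (\<xi> s w) (\<xi> t w)) \<partial>R) \<le> ennreal (W t - W s)"
proof -
  have Wmono: "W s \<le> W t" if "0 \<le> s" "s \<le> t" "t \<le> 1" for s t
    using W[OF that] W1_nonneg[of "\<nu> s" "\<nu> t"] by linarith
  define g where "g n i = min 1 (real i / 2^n)" for n i :: nat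
  have g01: "g n i \<in> {0..1}" for n i by (simp add: g_def)
  \<comment> \<open>An error of \<open>(1/4)^n\<close> per step adds up to at most
    \<open>(1/2)^n\<close> over the \<open>2^n\<close> steps of level \<open>n\<close>, which
    vanishes in the limit.\<close>
  define ch where "ch n Q \<longleftrightarrow> prob_space Q \<and> sets Q = sets seq_space \<and> (\<forall>i\<le>2^n. distr Q borel (\<lambda>w. w i) = \<nu> (g n i)) \<and>
    (\<forall>i<2^n. (\<integral>\<^sup>+w. ennreal (dist (w i) (w (Suc i))) \<partial>Q) \<le> ennreal (W1 (\<nu> (g n i)) (\<nu> (g n (Suc i))) + (1/4)^n))"
    for n :: nat and Q :: "(nat \<Rightarrow> 'a) measure"
  have "\<exists>Q. ch n Q" for n
    unfolding ch_def by (rule coupling_chain) (use \<nu>[OF g01] in auto)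
  then obtain C where "\<And>n. ch n (C n)" by metis
  then have C: "\<And>n. prob_space (C n)" "\<And>n. sets (C n) = sets seq_space"
    "\<And>n i. i \<le> 2^n \<Longrightarrow> distr (C n) borel (\<lambda>w. w i) = \<nu> (g n i)"
    "\<And>n i. i < 2^n \<Longrightarrow> (\<integral>\<^sup>+w. ennreal (dist (w i) (w (Suc i))) \<partial>C n) \<le> ennreal (W1 (\<nu> (g n i)) (\<nu> (g n (Suc i))) + (1/4)^n)"
    unfolding ch_def by blast+
  note [measurable_cong] = C(2)
  have inc: "(\<integral>\<^sup>+w. ennreal (dist (w a) (w b)) \<partial>C n) \<le> ennreal (W (g n b) - W (g n a) + (1/2)^n)" if ab: "a \<le> b" "b \<le> 2^n" for a b n
  proof -
    \<comment> \<open>The increments of \<open>W\<close> along the grid are nonnegative; the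
      absolute value makes this evident for every index.\<close>
    let ?c = "\<lambda>i. \<bar>W (g n (Suc i)) - W (g n i)\<bar> + (1/4)^n"
    have gm: "g n i \<le> g n (Suc i)" for i unfolding g_def by (intro min.mono divide_right_mono) auto
    have "(\<integral>\<^sup>+w. ennreal (dist (w a) (w b)) \<partial>C n) \<le> ennreal (\<Sum>i\<in>{a..<b}. ?c i)"
    proof (rule chain_increment_le[OF C(2) ab(1)])
      fix i assume "a \<le> i" "i < b"
      then have i: "i < 2^n" using ab by simp
      have "W1 (\<nu> (g n i)) (\<nu> (g n (Suc i))) \<le> W (g n (Suc i)) - W (g n i)"
        using gm[of i] g01[of n i] g01[of n "Suc i"] by (intro W) auto
      then show "(\<integral>\<^sup>+w. ennreal (dist (w i) (w (Suc i))) \<partial>C n) \<le> ennreal (?c i)"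
        by (intro order_trans[OF C(4)[OF i]] ennreal_leI) auto
    qed simp
    also have "(\<Sum>i\<in>{a..<b}. ?c i) = (\<Sum>i\<in>{a..<b}. W (g n (Suc i)) - W (g n i)) + real (b - a) * (1/4)^n"
    proof -
      have "W (g n i) \<le> W (g n (Suc i))" for i using gm[of i] g01[of n i] g01[of n "Suc i"] by (intro Wmono) auto
      then show ?thesis by (simp add: sum.distrib)
    qed
    also have "(\<Sum>i\<in>{a..<b}. W (g n (Suc i)) - W (g n i)) = W (g n b) - W (g n a)"
      using sum_Suc_diff'[of a b "\<lambda>i. W (g n i)"] ab by simp
    also have "real (b - a) * (1/4)^n \<le> 2^n * (1/4)^n"
    proof (rule mult_right_mono)
      have "real (b - a) \<le> real (2^n)" using ab by (simp only: of_nat_le_iff)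
      then show "real (b - a) \<le> 2^n" by simp
    qed simp
    also have "(2::real)^n * (1/4)^n = (1/2)^n" by (simp add: power_mult_distrib[symmetric])
    finally show ?thesis by (simp add: ennreal_leI)
  qed
  define dy where "dy j = (case prod_decode j of (i, k) \<Rightarrow> min 1 (real i / 2^k))" for j
  \<comment> \<open>Rounding down is exact once the level reaches the exponent of the dyadic time;
    below that level only the range and the monotonicity of the index matter.\<close>
  define ix where "ix n j = nat \<lfloor>dy j * 2^n\<rfloor>" for n j
  have dy01: "0 \<le> dy j" "dy j \<le> 1" for j by (auto simp: dy_def split: prod.splits)
  have ix_le: "ix n j \<le> 2^n" for n j
  proof -
    have "dy j * 2^n \<le> 2^n" using dy01[of j] by simp
    then have "dy j * 2^n < 2^n + 1" by linarith
    then have "\<lfloor>dy j * 2^n\<rfloor> \<le> 2^n" by (simp only: floor_le_iff of_int_power of_int_numeral)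
    then show ?thesis by (simp add: ix_def nat_le_iff)
  qed
  have ix_mono: "ix n i \<le> ix n j" if "dy i \<le> dy j" for n i j
    unfolding ix_def using that by (intro nat_mono floor_mono mult_right_mono) auto
  have g_ix: "eventually (\<lambda>n. g n (ix n j) = dy j) sequentially" for j
  proof -
    obtain i k where ik: "prod_decode j = (i, k)" by (cases "prod_decode j")
    have "g n (ix n j) = dy j" if n: "k \<le> n" for n
    proof -
      have "\<exists>l::nat. dy j = real l / 2^n"
      proof (cases "real i / 2^k \<le> 1")
        case True
        have p: "(2::real)^n = 2^k * 2^(n - k)" using n by (simp flip: power_add)
        have "dy j = real i / 2^k" by (simp only: dy_def ik prod.case min.absorb2[OF True])
        then have "dy j = real (i * 2^(n - k)) / 2^n" by (simp add: p)
        then show ?thesis by blast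
      next
        case False
        then have "dy j = real (2^n) / 2^n" by (simp add: dy_def ik min_def)
        then show ?thesis by blast
      qed
      then obtain l where l: "dy j = real l / 2^n" by blast
      then have "ix n j = l" by (simp add: ix_def)
      then show ?thesis using l dy01[of j] by (simp add: g_def min_def)
    qed
    then show ?thesis by (auto simp: eventually_sequentially)
  qed
  define Q where "Q n = distr (C n) seq_space (\<lambda>w j. w (ix n j))" for n
  have m: "(\<lambda>w j. w (ix n j)) \<in> measurable (C n) seq_space" for n
    by (rule measurable_PiM_single') auto
  have Qp: "prob_space (Q n)" and Qs: "sets (Q n) = sets seq_space" for n
    unfolding Q_def using prob_space.prob_space_distr[OF C(1) m] by auto
  have Qd: "distr (Q n) borel (\<lambda>w. w j) = \<nu> (g n (ix n j))" for n j
  proof -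
    have "distr (Q n) borel (\<lambda>w. w j) = distr (C n) borel ((\<lambda>w. w j) \<circ> (\<lambda>w j. w (ix n j)))"
      unfolding Q_def by (rule distr_distr[OF _ m]) measurable
    then show ?thesis using C(3)[OF ix_le] by (simp add: o_def)
  qed
  have "eventually (\<lambda>n. distr (Q n) borel (\<lambda>w. w j) = \<nu> (dy j)) sequentially" for j
    using g_ix[of j] by eventually_elim (simp add: Qd)
  from limit_law_exists[of Q "\<lambda>j. \<nu> (dy j)", OF Qp Qs this]
  obtain R where R: "prob_space R" "sets R = sets seq_space" "\<And>j. distr R borel (\<lambda>w. w j) = \<nu> (dy j)"
    and Rc: "\<And>i j C. eventually (\<lambda>n. (\<integral>\<^sup>+w. ennreal (dist (w i) (w j)) \<partial>Q n) \<le> C) sequentially \<Longrightarrow>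
        (\<integral>\<^sup>+w. ennreal (dist (w i) (w j)) \<partial>R) \<le> C" by blast
  note [measurable_cong] = R(2)
  have Rinc: "(\<integral>\<^sup>+w. ennreal (dist (w i) (w j)) \<partial>R) \<le> ennreal (W (dy j) - W (dy i))" if ij: "dy i \<le> dy j" for i j
  proof (rule ennreal_le_epsilon)
    fix e :: real assume e: "0 < e"
    have nonneg: "0 \<le> W (dy j) - W (dy i)" using Wmono[of "dy i" "dy j"] dy01 ij by auto
    have "(\<integral>\<^sup>+w. ennreal (dist (w i) (w j)) \<partial>R) \<le> ennreal (W (dy j) - W (dy i) + e)"
    proof (rule Rc)
      have "(\<lambda>n. (1/2::real)^n) \<longlonglongrightarrow> 0" by (rule LIMSEQ_power_zero) simp
      then have "eventually (\<lambda>n. (1/2::real)^n < e) sequentially" by (rule order_tendstoD) (rule e)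
      then show "eventually (\<lambda>n. (\<integral>\<^sup>+w. ennreal (dist (w i) (w j)) \<partial>Q n) \<le> ennreal (W (dy j) - W (dy i) + e)) sequentially"
        using g_ix[of i] g_ix[of j]
      proof eventually_elim
        case (elim n)
        have "(\<integral>\<^sup>+w. ennreal (dist (w i) (w j)) \<partial>Q n) = (\<integral>\<^sup>+w. ennreal (dist (w (ix n i)) (w (ix n j))) \<partial>C n)"
          unfolding Q_def by (subst nn_integral_distr[OF m]) auto
        also have "\<dots> \<le> ennreal (W (dy j) - W (dy i) + (1/2)^n)"
          using inc[OF ix_mono[OF ij] ix_le, where n=n] unfolding elim(2) elim(3) .
        also have "\<dots> \<le> ennreal (W (dy j) - W (dy i) + e)" using elim by (intro ennreal_leI) simp
        finally show ?case .
      qed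
    qed
    then show "(\<integral>\<^sup>+w. ennreal (dist (w i) (w j)) \<partial>R) \<le> ennreal (W (dy j) - W (dy i)) + ennreal e"
      using nonneg e by simp
  qed
  \<comment> \<open>A dyadic time has many representations as a fraction; any index of the
    enumeration that hits it will do.\<close>
  define idx where "idx s = (SOME j. dy j = s)" for s
  have idx: "dy (idx s) = s" if "s \<in> dyadics" for s
  proof -
    obtain i k where "s = real i / 2^k" "s \<le> 1" using \<open>s \<in> dyadics\<close> unfolding dyadics_def by blast
    then have "dy (prod_encode (i, k)) = s" by (simp add: dy_def)
    then show ?thesis unfolding idx_def by (rule someI)
  qed
  show ?thesis
  proof (rule that[OF R(1), of "\<lambda>s w. w (idx s)"])
    show "(\<integral>\<^sup>+w. ennreal (dist (w (idx s)) (w (idx t))) \<partial>R) \<le> ennreal (W t - W s)"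
      if "s \<in> dyadics" "t \<in> dyadics" "s \<le> t" for s t
      using Rinc[of "idx s" "idx t"] idx that by simp
  qed (auto simp: R(3) idx)
qed

section \<open>Regularization of paths\<close>

text \<open>Domination by increments of \<open>G\<close> transfers one-sided limits to the path: on
  the right by the assumption on \<open>G\<close>; on the left because the monotone \<open>G\<close>
  is bounded before \<open>t\<close>, so values near \<open>t\<close> are Cauchy and completeness
  applies.\<close>

lemma cadlag_of_dominated:
  fixes \<gamma> :: "real \<Rightarrow> 'a::complete_space"
  assumes ext: "\<gamma> \<in> {0..1} \<rightarrow>\<^sub>E UNIV"
    and dom: "\<And>s t. 0 \<le> s \<Longrightarrow> s \<le> t \<Longrightarrow> t \<le> 1 \<Longrightarrow> dist (\<gamma> s) (\<gamma> t) \<le> G t - G s"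
    and right: "\<And>t \<epsilon>. 0 \<le> t \<Longrightarrow> t < 1 \<Longrightarrow> 0 < \<epsilon> \<Longrightarrow> \<exists>r>t. r \<le> 1 \<and> G r < G t + (\<epsilon> :: real)"
  shows "\<gamma> \<in> cadlag_paths"
  unfolding cadlag_def
proof (intro CollectI conjI ballI ext)
  have Gm: "G s \<le> G t" if "0 \<le> s" "s \<le> t" "t \<le> 1" for s t
    using dom[OF that] zero_le_dist[of "\<gamma> s" "\<gamma> t"] by linarith
  fix t :: real assume t: "t \<in> {0..<1}"
  show "limitin Met_TC.mtopology \<gamma> (\<gamma> t) (at_right t)"
    unfolding Met_TC.limitin_metric
  proof (intro conjI allI impI)
    fix \<epsilon> :: real assume "0 < \<epsilon>"
    then obtain r where r: "r > t" "r \<le> 1" "G r < G t + \<epsilon>" using right[of t \<epsilon>] t by auto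
    show "\<forall>\<^sub>F x in at_right t. \<gamma> x \<in> UNIV \<and> dist (\<gamma> x) (\<gamma> t) < \<epsilon>"
      unfolding eventually_at_right_field
    proof (intro exI[of _ r] conjI allI impI)
      fix y assume y: "t < y" "y < r"
      have "dist (\<gamma> t) (\<gamma> y) \<le> G y - G t" using dom[of t y] y t r by auto
      moreover have "G y \<le> G r" using Gm[of y r] y t r by auto
      ultimately show "dist (\<gamma> y) (\<gamma> t) < \<epsilon>" using r(3) by (simp add: dist_commute)
    qed (use r in auto)
  qed simp
next
  have Gm: "G s \<le> G t" if "0 \<le> s" "s \<le> t" "t \<le> 1" for s t
    using dom[OF that] zero_le_dist[of "\<gamma> s" "\<gamma> t"] by linarith
  fix t :: real assume t: "t \<in> {0<..1}"
  \<comment> \<open>\<open>L\<close> is the left limit of \<open>G\<close> at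
    \<open>t\<close>.\<close>
  define L where "L = Sup (G ` {0..<t})"
  have bdd: "bdd_above (G ` {0..<t})" using t by (intro bdd_aboveI[of _ "G 1"]) (auto intro: Gm)
  have GL: "G s \<le> L" if "s \<in> {0..<t}" for s unfolding L_def using that bdd by (intro cSup_upper) auto
  have ex: "\<exists>s0\<in>{0..<t}. L - \<epsilon> < G s0" if "0 < \<epsilon>" for \<epsilon>
  proof -
    have "G ` {0..<t} \<noteq> {}" "L - \<epsilon> < Sup (G ` {0..<t})" using t that by (auto simp: L_def)
    from less_cSupD[OF this] show ?thesis by auto
  qed
  have osc: "dist (\<gamma> s) (\<gamma> s') \<le> L - G s0" if "s0 \<in> {0..<t}" "s0 \<le> s" "s < t" "s0 \<le> s'" "s' < t" for s0 s s'
    using dom[of s s'] dom[of s' s] GL[of s] GL[of s'] Gm[of s0 s] Gm[of s0 s'] that t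
    by (cases "s \<le> s'") (auto simp: dist_commute)
  define p where "p n = t - t / real (n + 2)" for n :: nat
  have p: "p n \<in> {0..<t}" for n using t by (auto simp: p_def field_simps)
  have plim: "p \<longlonglongrightarrow> t"
  proof -
    have "(\<lambda>n. t - t / real (n + 2)) \<longlonglongrightarrow> t - 0"
      by (intro tendsto_diff tendsto_const tendsto_divide_0[OF tendsto_const] filterlim_at_top_imp_at_infinity
        filterlim_compose[OF filterlim_real_sequentially] filterlim_add_const_nat_at_top)
    then show ?thesis by (simp add: p_def[abs_def])
  qed
  have tail: "\<forall>\<^sub>F n in sequentially. s0 \<le> p n" if "s0 < t" for s0
    using order_tendstoD(1)[OF plim that] by (auto elim: eventually_mono)
  have "Cauchy (\<lambda>n. \<gamma> (p n))"
  proof (rule metric_CauchyI)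
    fix e :: real assume "0 < e"
    then obtain s0 where s0: "s0 \<in> {0..<t}" "L - e < G s0" using ex by blast
    obtain N where N: "\<And>n. N \<le> n \<Longrightarrow> s0 \<le> p n" using tail[of s0] s0 by (auto simp: eventually_sequentially)
    have "dist (\<gamma> (p m)) (\<gamma> (p n)) < e" if "N \<le> m" "N \<le> n" for m n
      using osc[OF s0(1) N[OF that(1)] _ N[OF that(2)]] p[of m] p[of n] s0(2) by auto
    then show "\<exists>N. \<forall>m\<ge>N. \<forall>n\<ge>N. dist (\<gamma> (p m)) (\<gamma> (p n)) < e" by blast
  qed
  then obtain l where l: "(\<lambda>n. \<gamma> (p n)) \<longlonglongrightarrow> l" using Cauchy_convergent_iff convergent_def by blast
  show "\<exists>l. limitin Met_TC.mtopology \<gamma> l (at_left t)"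
    unfolding Met_TC.limitin_metric
  proof (intro exI[of _ l] conjI allI impI)
    fix \<epsilon> :: real assume \<epsilon>: "0 < \<epsilon>"
    then obtain s0 where s0: "s0 \<in> {0..<t}" "L - \<epsilon> < G s0" using ex by blast
    have "dist (\<gamma> s) l \<le> L - G s0" if s: "s0 \<le> s" "s < t" for s
    proof (rule Lim_dist_ubound[OF _ l])
      show "\<forall>\<^sub>F n in sequentially. dist (\<gamma> s) (\<gamma> (p n)) \<le> L - G s0"
        using tail[of s0] s0(1) osc[OF s0(1) s] p by (auto elim!: eventually_mono)
    qed simp
    then show "\<forall>\<^sub>F x in at_left t. \<gamma> x \<in> UNIV \<and> dist (\<gamma> x) l < \<epsilon>"
      unfolding eventually_at_left_field
    proof (intro exI[of _ s0] conjI allI impI)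
      fix y assume "s0 < y" "y < t"
      then have "dist (\<gamma> y) l \<le> L - G s0" by (intro \<open>\<And>s. s0 \<le> s \<Longrightarrow> s < t \<Longrightarrow> dist (\<gamma> s) l \<le> L - G s0\<close>) auto
      then show "dist (\<gamma> y) l < \<epsilon>" using s0(2) by linarith
    qed (use s0 in auto)
  qed simp
qed

text \<open>There is no right limit at 1, so the value there is kept.\<close>

definition regularize :: "(real \<Rightarrow> 'a::polish_space) \<Rightarrow> real \<Rightarrow> 'a" where
  "regularize g = (\<lambda>t\<in>{0..1}. if t = 1 then g 1 else lim (\<lambda>n. g (next_dyadic n t)))"

text \<open>The running variation \<open>v\<close> over the dyadics dominates increments at dyadic
  times. Its right limit \<open>G\<close> then dominates the increments of the right limits of
  \<open>g\<close>, which yields the cadlag property and the variation bound together.\<close>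

lemma regularize_path:
  fixes g :: "real \<Rightarrow> 'a::polish_space"
  assumes fin: "pvar dist g dyadics < \<infinity>"
  shows "regularize g \<in> cadlag_paths" "pvar dist (regularize g) {0..1} < \<infinity>"
    "\<And>t. 0 \<le> t \<Longrightarrow> t < 1 \<Longrightarrow> (\<lambda>n. g (next_dyadic n t)) \<longlonglongrightarrow> regularize g t"
proof -
  define v where "v s = enn2real (pvar dist g (dyadics \<inter> {..s}))" for s
  have ve: "ennreal (v s) = pvar dist g (dyadics \<inter> {..s})" for s
  proof -
    have "pvar dist g (dyadics \<inter> {..s}) \<le> pvar dist g dyadics" by (rule pvar_mono) auto
    then show ?thesis using fin by (auto simp: v_def ennreal_enn2real_if top_unique)
  qed
  have v0: "0 \<le> v s" for s by (simp add: v_def)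
  have inc: "dist (g s) (g t) \<le> v t - v s" if "s \<in> dyadics" "t \<in> dyadics" "s \<le> t" for s t
  proof -
    have "pvar dist g (dyadics \<inter> {..s}) + ennreal (dist (g s) (g t)) \<le> pvar dist g (dyadics \<inter> {..t})"
      using that by (intro Met_TC.pvar_append) auto
    then have "ennreal (v s + dist (g s) (g t)) \<le> ennreal (v t)" by (simp add: ve[symmetric] v0)
    then have "v s + dist (g s) (g t) \<le> v t" using v0 by (simp only: ennreal_le_iff)
    then show ?thesis by linarith
  qed
  have vm: "v s \<le> v t" if "s \<in> dyadics" "t \<in> dyadics" "s \<le> t" for s t
    using inc[OF that] zero_le_dist[of "g s" "g t"] by linarith
  let ?x = "\<lambda>t n. next_dyadic n t"
  have xin: "?x t n \<in> dyadics" if "0 \<le> t" "t < 1" for t n using next_dyadic_in[OF that] .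
  define G where "G t = (if t < 1 then lim (\<lambda>n. v (?x t n)) else v 1)" for t
  have Glim: "(\<lambda>n. v (?x t n)) \<longlonglongrightarrow> G t" if t: "0 \<le> t" "t < 1" for t
  proof -
    have "convergent (\<lambda>n. v (?x t n))"
    proof (rule Bseq_monoseq_convergent)
      show "Bseq (\<lambda>n. v (?x t n))"
      proof (rule BseqI')
        fix n show "norm (v (?x t n)) \<le> v 1" using v0[of "?x t n"] vm[OF xin[OF t] one_in_dyadics] dyadics_01[OF xin[OF t]] by auto
      qed
      show "monoseq (\<lambda>n. v (?x t n))"
        by (intro decseq_imp_monoseq decseq_SucI vm xin t next_dyadic_mono) simp
    qed
    then show ?thesis using t by (simp add: G_def convergent_LIMSEQ_iff)
  qed
  have Gle: "G t \<le> v (?x t n)" if t: "0 \<le> t" "t < 1" for t n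
  proof (rule LIMSEQ_le_const2[OF Glim[OF t]])
    show "\<exists>N. \<forall>m\<ge>N. v (?x t m) \<le> v (?x t n)" using vm xin[OF t] next_dyadic_mono by blast
  qed
  have rlim: "(\<lambda>n. g (?x t n)) \<longlonglongrightarrow> regularize g t" if t: "0 \<le> t" "t < 1" for t
  proof -
    have "Cauchy (\<lambda>n. g (?x t n))"
    proof (rule metric_CauchyI)
      fix e :: real assume "0 < e"
      then have "eventually (\<lambda>n. v (?x t n) < G t + e) sequentially" by (intro order_tendstoD(2)[OF Glim[OF t]]) simp
      then obtain N where N: "\<And>n. N \<le> n \<Longrightarrow> v (?x t n) < G t + e" by (auto simp: eventually_sequentially)
      have "dist (g (?x t m)) (g (?x t n)) < e" if "N \<le> m" "N \<le> n" for m n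
      proof (cases "m \<le> n")
        case True
        then show ?thesis using inc[OF xin[OF t] xin[OF t] next_dyadic_mono[OF True]] N[OF that(1)] Gle[OF t, of n]
          by (simp add: dist_commute)
      next
        case False
        then have "n \<le> m" by simp
        then show ?thesis using inc[OF xin[OF t] xin[OF t] next_dyadic_mono[of n m]] N[OF that(2)] Gle[OF t, of m] by simp
      qed
      then show "\<exists>N. \<forall>m\<ge>N. \<forall>n\<ge>N. dist (g (?x t m)) (g (?x t n)) < e" by blast
    qed
    then show ?thesis using t by (simp add: regularize_def Cauchy_convergent_iff convergent_LIMSEQ_iff)
  qed
  have near: "\<forall>\<^sub>F n in sequentially. ?x t n < s" if "t < s" for s t
    by (rule order_tendstoD(2)[OF next_dyadic_tendsto that])
  have r1: "dist (regularize g t) (g s) \<le> v s - G t" if t: "0 \<le> t" "t < 1" and s: "s \<in> dyadics" "t < s" for s t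
  proof (rule tendsto_le[OF _ tendsto_diff[OF tendsto_const Glim[OF t]] tendsto_dist[OF rlim[OF t] tendsto_const]])
    show "\<forall>\<^sub>F n in sequentially. dist (g (?x t n)) (g s) \<le> v s - v (?x t n)"
      using near[OF s(2)] inc[OF xin[OF t] s(1)] by (auto elim!: eventually_mono)
  qed simp
  have dom: "dist (regularize g s) (regularize g t) \<le> G t - G s" if st: "0 \<le> s" "s \<le> t" "t \<le> 1" for s t
  proof -
    consider "s = t" | "s < t" "t = 1" | "s < t" "t < 1" using st by linarith
    then show ?thesis
    proof cases
      case 1 then show ?thesis by simp
    next
      case 2
      then show ?thesis using r1[of s 1] st by (simp add: regularize_def G_def)
    next
      case 3
      have t: "0 \<le> t" using st by simp
      show ?thesis
      proof (rule tendsto_le[OF _ tendsto_diff[OF Glim[OF t 3(2)] tendsto_const] tendsto_dist[OF tendsto_const rlim[OF t 3(2)]]])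
        have "dist (regularize g s) (g (?x t n)) \<le> v (?x t n) - G s" for n
          using r1[of s "?x t n"] xin[OF t 3(2)] st 3 next_dyadic_bounds(1)[of t n] by auto
        then show "\<forall>\<^sub>F n in sequentially. dist (regularize g s) (g (?x t n)) \<le> v (?x t n) - G s" by simp
      qed simp
    qed
  qed
  show "regularize g \<in> cadlag_paths"
  proof (rule cadlag_of_dominated[OF _ dom])
    show "regularize g \<in> {0..1} \<rightarrow>\<^sub>E UNIV" by (simp add: regularize_def)
    fix t \<epsilon> :: real assume t: "0 \<le> t" "t < 1" and \<epsilon>: "0 < \<epsilon>"
    have "eventually (\<lambda>n. v (?x t n) < G t + \<epsilon>) sequentially" using \<epsilon> by (intro order_tendstoD(2)[OF Glim[OF t]]) simp
    then obtain n where n: "v (?x t n) < G t + \<epsilon>" by (meson eventually_happens trivial_limit_sequentially)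
    \<comment> \<open>\<open>r\<close> is strictly before the grid point because \<open>r1\<close>
      compares \<open>G r\<close> with \<open>v\<close> only at later dyadic times.\<close>
    define r where "r = (t + ?x t n) / 2"
    have x1: "t < ?x t n" "?x t n \<le> 1" using next_dyadic_bounds(1) dyadics_01[OF xin[OF t]] by auto
    then have r: "t < r" "r < ?x t n" "r < 1" "0 \<le> r" using t by (auto simp: r_def)
    have "G r \<le> v (?x t n)"
      using r1[OF r(4,3) xin[OF t] r(2)] zero_le_dist[of "regularize g r" "g (?x t n)"] by linarith
    then show "\<exists>r>t. r \<le> 1 \<and> G r < G t + \<epsilon>" using r n by (intro exI[of _ r]) auto
  qed
  have G0: "0 \<le> G s" if "0 \<le> s" "s \<le> 1" for s
  proof (cases "s = 1")
    case True then show ?thesis using v0[of 1] by (simp add: G_def)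
  next
    case False
    then show ?thesis using that v0 by (intro LIMSEQ_le_const[OF Glim]) auto
  qed
  have "pvar dist (regularize g) {0..1} \<le> ennreal (G 1 - 0)"
  proof (rule Met_TC.pvar_le_dominated)
    fix s :: real assume s: "s \<in> {0..1}"
    then have "dist (regularize g s) (regularize g 1) \<le> G 1 - G s" by (intro dom) auto
    then have "G s \<le> G 1" using zero_le_dist[of "regularize g s" "regularize g 1"] by linarith
    then show "0 \<le> G s \<and> G s \<le> G 1" using G0[of s] s by simp
  qed (use dom in auto)
  also have "\<dots> < \<infinity>" by simp
  finally show "pvar dist (regularize g) {0..1} < \<infinity>" .
  show "\<And>t. 0 \<le> t \<Longrightarrow> t < 1 \<Longrightarrow> (\<lambda>n. g (?x t n)) \<longlonglongrightarrow> regularize g t" by (rule rlim)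
qed

section \<open>The path measure\<close>

text \<open>Fatou's lemma: the cost is lower semicontinuous along almost sure convergence of both
  end points.\<close>

lemma nn_integral_dist_limit:
  fixes X Y :: "nat \<Rightarrow> 'b \<Rightarrow> 'a::{metric_space, second_countable_topology}"
  assumes [measurable]: "\<And>n. X n \<in> borel_measurable M" "\<And>n. Y n \<in> borel_measurable M"
    and X: "AE \<omega> in M. (\<lambda>n. X n \<omega>) \<longlonglongrightarrow> X' \<omega>" and Y: "AE \<omega> in M. (\<lambda>n. Y n \<omega>) \<longlonglongrightarrow> Y' \<omega>"
    and le: "\<forall>\<^sub>F n in sequentially. (\<integral>\<^sup>+\<omega>. ennreal (dist (X n \<omega>) (Y n \<omega>)) \<partial>M) \<le> ennreal (c n)"
    and c: "c \<longlonglongrightarrow> C"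
  shows "(\<integral>\<^sup>+\<omega>. ennreal (dist (X' \<omega>) (Y' \<omega>)) \<partial>M) \<le> ennreal C"
proof -
  have "(\<integral>\<^sup>+\<omega>. ennreal (dist (X' \<omega>) (Y' \<omega>)) \<partial>M) = (\<integral>\<^sup>+\<omega>. liminf (\<lambda>n. ennreal (dist (X n \<omega>) (Y n \<omega>))) \<partial>M)"
  proof (rule nn_integral_cong_AE)
    show "AE \<omega> in M. ennreal (dist (X' \<omega>) (Y' \<omega>)) = liminf (\<lambda>n. ennreal (dist (X n \<omega>) (Y n \<omega>)))"
      using X Y by eventually_elim (intro lim_imp_Liminf[symmetric] tendsto_ennrealI tendsto_dist, auto)
  qed
  also have "\<dots> \<le> liminf (\<lambda>n. \<integral>\<^sup>+\<omega>. ennreal (dist (X n \<omega>) (Y n \<omega>)) \<partial>M)"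
    by (rule nn_integral_liminf) measurable
  also have "\<dots> \<le> liminf (\<lambda>n. ennreal (c n))" by (rule Liminf_mono) (rule le)
  also have "\<dots> = ennreal C" by (intro lim_imp_Liminf tendsto_ennrealI c) simp
  finally show ?thesis .
qed

text \<open>The expected summands are bounded by increments of \<open>W\<close>, and these telescope
  over the stopped grid.\<close>

lemma nn_integral_dyadic_sum_le:
  fixes \<Phi> :: "'b \<Rightarrow> real \<Rightarrow> 'a::{metric_space, second_countable_topology}"
  assumes m: "\<And>i. (\<lambda>\<omega>. \<Phi> \<omega> (min (real i / 2^n) t)) \<in> borel_measurable M"
    and le: "\<And>i. i < 2^n \<Longrightarrow> (\<integral>\<^sup>+\<omega>. ennreal (dist (\<Phi> \<omega> (min (real i / 2^n) t)) (\<Phi> \<omega> (min (real (Suc i) / 2^n) t))) \<partial>M)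
        \<le> ennreal (W (min (real (Suc i) / 2^n) t) - W (min (real i / 2^n) t))"
    and W: "\<And>i. W (min (real i / 2^n) t) \<le> W (min (real (Suc i) / 2^n) t)" and t: "0 \<le> t" "t \<le> 1"
  shows "(\<integral>\<^sup>+\<omega>. ennreal (dyadic_sum dist (\<Phi> \<omega>) t n) \<partial>M) \<le> ennreal (W t - W 0)"
proof -
  note [measurable] = m
  let ?d = "\<lambda>\<omega> i. ennreal (dist (\<Phi> \<omega> (min (real i / 2^n) t)) (\<Phi> \<omega> (min (real (Suc i) / 2^n) t)))"
  have "(\<integral>\<^sup>+\<omega>. ennreal (dyadic_sum dist (\<Phi> \<omega>) t n) \<partial>M) = (\<integral>\<^sup>+\<omega>. (\<Sum>i<2^n. ?d \<omega> i) \<partial>M)"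
    by (simp only: Met_TC.sum_dyadic_eq)
  also have "\<dots> = (\<Sum>i<2^n. \<integral>\<^sup>+\<omega>. ?d \<omega> i \<partial>M)"
    by (rule nn_integral_sum) (use m[of "Suc _"] in measurable)
  also have "\<dots> \<le> (\<Sum>i<2^n. ennreal (W (min (real (Suc i) / 2^n) t) - W (min (real i / 2^n) t)))"
    by (intro sum_mono le) auto
  also have "\<dots> = ennreal (\<Sum>i<2^n. W (min (real (Suc i) / 2^n) t) - W (min (real i / 2^n) t))"
    using W by (intro sum_ennreal) auto
  also have "(\<Sum>i<2^n. W (min (real (Suc i) / 2^n) t) - W (min (real i / 2^n) t)) = W (min (real (2^n) / 2^n) t) - W (min (real 0 / 2^n) t)"
    by (rule sum_lessThan_telescope)
  also have "\<dots> = W t - W 0" using t by (simp add: min_def)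
  finally show ?thesis .
qed

lemma path_measure_exists:
  fixes \<nu> :: "real \<Rightarrow> 'a::polish_space measure" and W :: "real \<Rightarrow> real"
  assumes \<nu>: "\<And>t. t \<in> {0..1} \<Longrightarrow> \<nu> t \<in> P1"
    and W: "\<And>s t. 0 \<le> s \<Longrightarrow> s \<le> t \<Longrightarrow> t \<le> 1 \<Longrightarrow> W1 (\<nu> s) (\<nu> t) \<le> W t - W s"
    and right: "\<And>t. 0 \<le> t \<Longrightarrow> t < 1 \<Longrightarrow> (W \<longlongrightarrow> W t) (at_right t)"
  obtains \<pi> where "prob_space \<pi>" "sets \<pi> = sets (skorokhod_borel UNIV (dist :: 'a \<Rightarrow> _))"
    "AE \<gamma> in \<pi>. pvar dist \<gamma> {0..1} < \<infinity>"
    "\<And>t. t \<in> {0..1} \<Longrightarrow> distr \<pi> borel (\<lambda>\<gamma>. \<gamma> t) = \<nu> t"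
    "\<And>s t. 0 \<le> s \<Longrightarrow> s \<le> t \<Longrightarrow> t \<le> 1 \<Longrightarrow> (\<integral>\<^sup>+\<gamma>. ennreal (dist (\<gamma> s) (\<gamma> t)) \<partial>\<pi>) \<le> ennreal (W t - W s)"
proof -
  have Wmono: "W s \<le> W t" if "0 \<le> s" "s \<le> t" "t \<le> 1" for s t
    using W[OF that] W1_nonneg[of "\<nu> s" "\<nu> t"] by linarith
  obtain R :: "(nat \<Rightarrow> 'a) measure" and \<xi> where R: "prob_space R" and \<xi>m[measurable]: "\<And>s. \<xi> s \<in> measurable R borel"
    and \<xi>d: "\<And>s. s \<in> dyadics \<Longrightarrow> distr R borel (\<xi> s) = \<nu> s"
    and \<xi>i: "\<And>s t. s \<in> dyadics \<Longrightarrow> t \<in> dyadics \<Longrightarrow> s \<le> t \<Longrightarrow> (\<integral>\<^sup>+w. ennreal (dist (\<xi> s w) (\<xi> t w)) \<partial>R) \<le> ennreal (W t - W s)"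
    using dyadic_process_exists[of \<nu> W, OF \<nu> W] by blast
  interpret R: prob_space R by fact
  \<comment> \<open>Bounded dyadic sums are a measurable event, and by
    \<open>pvar_dyadics_le\<close> they force finite variation along the dyadics.\<close>
  define good where "good w \<longleftrightarrow> (SUP n. ennreal (dyadic_sum dist (\<lambda>s. \<xi> s w) 1 n)) < \<infinity>" for w
  have gm[measurable]: "Measurable.pred R good" unfolding good_def dyadic_sum_def by measurable
  have grid: "min (real i / 2^n) 1 \<in> dyadics" for i n :: nat
    by (cases "real i / 2^n \<le> 1") (auto simp: dyadics_def min_def)
  have "(\<integral>\<^sup>+w. (SUP n. ennreal (dyadic_sum dist (\<lambda>s. \<xi> s w) 1 n)) \<partial>R) = (SUP n. \<integral>\<^sup>+w. ennreal (dyadic_sum dist (\<lambda>s. \<xi> s w) 1 n) \<partial>R)"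
  proof (rule nn_integral_monotone_convergence_SUP)
    show "incseq (\<lambda>n w. ennreal (dyadic_sum dist (\<lambda>s. \<xi> s w) 1 n))"
      using Met_TC.dyadic_sum_incseq[of "\<lambda>s. \<xi> s _" 1]
      by (auto simp: incseq_def le_fun_def intro!: ennreal_leI)
  qed (unfold dyadic_sum_def, measurable)
  also have "\<dots> \<le> ennreal (W 1 - W 0)"
  proof (rule SUP_least, rule nn_integral_dyadic_sum_le)
    fix n i :: nat
    have mm: "min (real i / 2^n) 1 \<le> min (real (Suc i) / 2^n) 1" by (intro min.mono divide_right_mono) auto
    show "W (min (real i / 2^n) 1) \<le> W (min (real (Suc i) / 2^n) 1)" using mm by (intro Wmono) auto
    show "(\<integral>\<^sup>+w. ennreal (dist (\<xi> (min (real i / 2^n) 1) w) (\<xi> (min (real (Suc i) / 2^n) 1) w)) \<partial>R)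
        \<le> ennreal (W (min (real (Suc i) / 2^n) 1) - W (min (real i / 2^n) 1))"
      using mm by (intro \<xi>i grid)
  qed auto
  also have "\<dots> < \<infinity>" by simp
  finally have "(\<integral>\<^sup>+w. (SUP n. ennreal (dyadic_sum dist (\<lambda>s. \<xi> s w) 1 n)) \<partial>R) \<noteq> \<infinity>" by simp
  then have "AE w in R. (SUP n. ennreal (dyadic_sum dist (\<lambda>s. \<xi> s w) 1 n)) \<noteq> \<infinity>"
    by (rule nn_integral_PInf_AE[rotated]) (unfold dyadic_sum_def, measurable)
  then have good: "AE w in R. good w"
    unfolding good_def by eventually_elim (simp only: less_top[symmetric] infinity_ennreal_def simp_thms)
  have good_pvar: "pvar dist (\<lambda>s. \<xi> s w) dyadics < \<infinity>" if "good w" for w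
  proof -
    have "pvar dist (\<lambda>s. \<xi> s w) dyadics \<le> (SUP n. ennreal (dyadic_sum dist (\<lambda>s. \<xi> s w) 1 n))"
      by (rule Met_TC.pvar_dyadics_le) (auto simp: dyadics_def)
    also have "\<dots> < \<infinity>" using that unfolding good_def .
    finally show ?thesis .
  qed
  \<comment> \<open>A constant path off the good event makes every path regularizable, so
    \<open>\<Phi>\<close> is cadlag everywhere and not only almost surely.\<close>
  define \<xi>' where "\<xi>' s w = (if good w then \<xi> s w else dense_seq 0)" for s w
  have \<xi>'m[measurable]: "\<xi>' s \<in> measurable R borel" for s unfolding \<xi>'_def by measurable
  have good_pvar': "pvar dist (\<lambda>s. \<xi>' s w) dyadics < \<infinity>" for w
  proof (cases "good w")
    case False
    have "pvar dist (\<lambda>s. \<xi>' s w) dyadics \<le> 0" by (rule pvar_least) (simp add: \<xi>'_def False)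
    then show ?thesis by (simp add: order.strict_trans1)
  qed (use good_pvar[of w] in \<open>simp add: \<xi>'_def\<close>)
  define \<Phi> where "\<Phi> w = regularize (\<lambda>s. \<xi>' s w)" for w
  note reg = regularize_path[OF good_pvar', folded \<Phi>_def]
  have \<Phi>1: "\<Phi> w 1 = \<xi>' 1 w" for w by (simp add: \<Phi>_def regularize_def)
  have \<Phi>m: "(\<lambda>w. \<Phi> w t) \<in> measurable R borel" if t: "t \<in> {0..1}" for t
  proof (cases "t = 1")
    case False
    with t have "0 \<le> t" "t < 1" by auto
    then show ?thesis by (intro borel_measurable_LIMSEQ_metric[OF \<xi>'m reg(3)])
  qed (simp add: \<Phi>1)
  have \<Phi>S: "\<Phi> \<in> measurable R (skorokhod_borel UNIV dist)"
    by (rule measurable_path_map[OF reg(1) \<Phi>m])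
  have lim: "AE w in R. (\<lambda>n. \<xi> (next_dyadic n t) w) \<longlonglongrightarrow> \<Phi> w t" if t: "0 \<le> t" "t < 1" for t
    using good
  proof eventually_elim
    case (elim w)
    with reg(3)[OF t, of w] show ?case by (simp add: \<xi>'_def)
  qed
  have Wlim: "(\<lambda>n. W (next_dyadic n t)) \<longlonglongrightarrow> W t" if t: "0 \<le> t" "t < 1" for t
  proof (rule filterlim_compose[OF right[OF t]])
    show "filterlim (\<lambda>n. next_dyadic n t) (at_right t) sequentially"
      unfolding filterlim_at using next_dyadic_tendsto next_dyadic_bounds(1)[of t]
      by (auto intro!: always_eventually simp: less_imp_neq[symmetric] less_imp_le)
  qed
  have near: "\<forall>\<^sub>F n in sequentially. next_dyadic n t < s" if "t < s" for s t
    by (rule order_tendstoD(2)[OF next_dyadic_tendsto that])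
  \<comment> \<open>Limits are taken at one end point at a time: here the earlier one while the
    later stays dyadic, then the later one in \<open>i2\<close>. Right continuity of
    \<open>W\<close> keeps the bounds exact.\<close>
  have i1: "(\<integral>\<^sup>+w. ennreal (dist (\<Phi> w t) (\<xi> s w)) \<partial>R) \<le> ennreal (W s - W t)"
    if t: "0 \<le> t" "t < s" and s: "s \<in> dyadics" for s t
  proof -
    have t1: "t < 1" using t dyadics_01[OF s] by linarith
    show ?thesis
    proof (rule nn_integral_dist_limit[OF _ _ lim[OF t(1) t1], where Y="\<lambda>_. \<xi> s" and c="\<lambda>n. W s - W (next_dyadic n t)"])
      show "\<forall>\<^sub>F n in sequentially. (\<integral>\<^sup>+w. ennreal (dist (\<xi> (next_dyadic n t) w) (\<xi> s w)) \<partial>R) \<le> ennreal (W s - W (next_dyadic n t))"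
        using near[OF t(2)] by eventually_elim (intro \<xi>i next_dyadic_in s t(1) t1 less_imp_le)
      show "(\<lambda>n. W s - W (next_dyadic n t)) \<longlonglongrightarrow> W s - W t" by (intro tendsto_diff tendsto_const Wlim t(1) t1)
    qed auto
  qed
  have \<Phi>1ae: "AE w in R. \<Phi> w 1 = \<xi> 1 w" using good by eventually_elim (simp add: \<Phi>1 \<xi>'_def)
  have i2: "(\<integral>\<^sup>+w. ennreal (dist (\<Phi> w s) (\<Phi> w t)) \<partial>R) \<le> ennreal (W t - W s)" if st: "0 \<le> s" "s \<le> t" "t \<le> 1" for s t
  proof -
    consider "s = t" | "s < t" "t = 1" | "s < t" "t < 1" using st by linarith
    then show ?thesis
    proof cases
      case 1 then show ?thesis by simp
    next
      case 2
      have "(\<integral>\<^sup>+w. ennreal (dist (\<Phi> w s) (\<Phi> w t)) \<partial>R) = (\<integral>\<^sup>+w. ennreal (dist (\<Phi> w s) (\<xi> 1 w)) \<partial>R)"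
        unfolding 2(2) by (rule nn_integral_cong_AE) (use \<Phi>1ae in eventually_elim, simp)
      then show ?thesis using i1[of s 1] st 2 by simp
    next
      case 3
      have t: "0 \<le> t" using st by simp
      show ?thesis
      proof (rule nn_integral_dist_limit[OF _ _ _ lim[OF t 3(2)], where X="\<lambda>_ w. \<Phi> w s" and c="\<lambda>n. W (next_dyadic n t) - W s"])
        show "\<forall>\<^sub>F n in sequentially. (\<integral>\<^sup>+w. ennreal (dist (\<Phi> w s) (\<xi> (next_dyadic n t) w)) \<partial>R) \<le> ennreal (W (next_dyadic n t) - W s)"
        proof (intro always_eventually allI i1 st(1) next_dyadic_in t 3(2))
          fix n show "s < next_dyadic n t" using next_dyadic_bounds(1)[of t n] 3(1) by linarith
        qed
        show "(\<lambda>n. W (next_dyadic n t) - W s) \<longlonglongrightarrow> W t - W s" by (intro tendsto_diff tendsto_const Wlim t 3(2))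
        show "(\<lambda>w. \<Phi> w s) \<in> borel_measurable R" using st by (intro \<Phi>m) auto
      qed auto
    qed
  qed
  \<comment> \<open>The law is identified through the distance: it and \<open>\<nu> t\<close> are
    both within \<open>W (next_dyadic n t) - W t\<close> of the law at the next grid time, and this
    tends to zero.\<close>
  have law: "distr R borel (\<lambda>w. \<Phi> w t) = \<nu> t" if t: "t \<in> {0..1}" for t
  proof (cases "t = 1")
    case True
    have "distr R borel (\<lambda>w. \<Phi> w t) = distr R borel (\<xi> 1)"
      unfolding True by (rule distr_cong_AE) (use \<Phi>1ae \<Phi>m in auto)
    then show ?thesis using \<xi>d[of 1] True by simp
  next
    case False
    then have t1: "0 \<le> t" "t < 1" using t by auto
    note [measurable] = \<Phi>m[OF t]
    have d: "next_dyadic n t \<in> dyadics" for n by (rule next_dyadic_in[OF t1])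
    have d01: "next_dyadic n t \<in> {0..1}" for n using dyadics_01[OF d[of n]] by auto
    let ?l = "distr R borel (\<lambda>w. \<Phi> w t)"
    \<comment> \<open>\<open>W1_zero_imp_eq\<close> concerns measures in \<open>P1\<close>; the
      first moment comes from the finite expected distance to the position at a dyadic time.\<close>
    have "?l \<in> P1"
    proof -
      have "\<nu> (next_dyadic 0 t) \<in> P1" by (rule \<nu>[OF d01])
      then obtain x0 where x0: "(\<integral>\<^sup>+x. ennreal (dist x0 x) \<partial>\<nu> (next_dyadic 0 t)) < \<infinity>" by (auto simp: P1_def)
      have "(\<integral>\<^sup>+x. ennreal (dist x0 x) \<partial>?l) = (\<integral>\<^sup>+w. ennreal (dist x0 (\<Phi> w t)) \<partial>R)"
        by (subst nn_integral_distr) auto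
      also have "\<dots> \<le> (\<integral>\<^sup>+w. ennreal (dist x0 (\<xi> (next_dyadic 0 t) w)) + ennreal (dist (\<Phi> w t) (\<xi> (next_dyadic 0 t) w)) \<partial>R)"
        by (intro nn_integral_mono) (simp add: ennreal_leI dist_triangle2 flip: ennreal_plus)
      also have "\<dots> = (\<integral>\<^sup>+w. ennreal (dist x0 (\<xi> (next_dyadic 0 t) w)) \<partial>R) + (\<integral>\<^sup>+w. ennreal (dist (\<Phi> w t) (\<xi> (next_dyadic 0 t) w)) \<partial>R)"
        by (rule nn_integral_add) auto
      also have "(\<integral>\<^sup>+w. ennreal (dist x0 (\<xi> (next_dyadic 0 t) w)) \<partial>R) = (\<integral>\<^sup>+x. ennreal (dist x0 x) \<partial>\<nu> (next_dyadic 0 t))"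
        unfolding \<xi>d[OF d, symmetric] by (subst nn_integral_distr) auto
      also have "\<dots> + (\<integral>\<^sup>+w. ennreal (dist (\<Phi> w t) (\<xi> (next_dyadic 0 t) w)) \<partial>R) < \<infinity>"
        using x0 le_less_trans[OF i1[OF t1(1) next_dyadic_bounds(1) d[of 0]] ennreal_less_top] by simp
      finally have "(\<integral>\<^sup>+x. ennreal (dist x0 x) \<partial>?l) < \<infinity>" .
      moreover have "prob_space ?l" by (rule R.prob_space_distr) measurable
      ultimately show ?thesis unfolding P1_def by auto
    qed
    have le: "W1 ?l (\<nu> t) \<le> 2 * (W (next_dyadic n t) - W t)" for n
    proof -
      have c0: "0 \<le> W (next_dyadic n t) - W t"
        using Wmono[of t "next_dyadic n t"] t1 d01[of n] next_dyadic_bounds(1)[of t n] by auto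
      have "W1 ?l (distr R borel (\<xi> (next_dyadic n t))) \<le> W (next_dyadic n t) - W t"
        by (rule W1_le_random_variables[OF R _ _ i1[OF t1(1) next_dyadic_bounds(1) d] c0]) measurable
      moreover have "W1 (\<nu> t) (\<nu> (next_dyadic n t)) \<le> W (next_dyadic n t) - W t"
        using t1 d01[of n] next_dyadic_bounds(1)[of t n] by (intro W) auto
      moreover have "W1 ?l (\<nu> t) \<le> W1 ?l (\<nu> (next_dyadic n t)) + W1 (\<nu> (next_dyadic n t)) (\<nu> t)"
        by (rule W1_triangle) (use \<open>?l \<in> P1\<close> \<nu> t d01 in auto)
      ultimately show ?thesis unfolding \<xi>d[OF d] W1_commute[of "\<nu> t" "\<nu> (next_dyadic n t)"] mult_2
        by (meson add_mono order_trans)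
    qed
    have "(\<lambda>n. 2 * (W (next_dyadic n t) - W t)) \<longlonglongrightarrow> 2 * (W t - W t)" by (intro tendsto_intros Wlim t1)
    then have "W1 ?l (\<nu> t) \<le> 2 * (W t - W t)" using le by (intro LIMSEQ_le_const) auto
    then have "W1 ?l (\<nu> t) = 0" using W1_nonneg[of ?l "\<nu> t"] by simp
    then show ?thesis using W1_zero_imp_eq \<open>?l \<in> P1\<close> \<nu>[OF t] by blast
  qed
  define \<pi> where "\<pi> = distr R (skorokhod_borel UNIV dist) \<Phi>"
  have ev: "(\<lambda>\<gamma>. \<gamma> t) \<in> measurable (skorokhod_borel UNIV dist) (borel :: 'a measure)" if "t \<in> {0..1}" for t
    by (rule measurable_eval_skorokhod[OF that])
  \<comment> \<open>For cadlag paths the variation is the supremum of the dyadic sums, which makes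
    the event Borel in the Skorokhod space.\<close>
  have pm: "{\<gamma> \<in> space (skorokhod_borel UNIV (dist :: 'a \<Rightarrow> _)). pvar dist \<gamma> {0..1} < \<infinity>} \<in> sets (skorokhod_borel UNIV dist)"
  proof -
    have [measurable]: "(\<lambda>\<gamma>. \<gamma> (min (real i / 2^n) 1)) \<in> measurable (skorokhod_borel UNIV dist) (borel :: 'a measure)" for i n :: nat
      by (rule ev) auto
    have [measurable]: "(\<lambda>\<gamma>. \<gamma> (min (real (Suc i) / 2^n) 1)) \<in> measurable (skorokhod_borel UNIV dist) (borel :: 'a measure)" for i n :: nat
      by (rule ev) auto
    have "{\<gamma> \<in> space (skorokhod_borel UNIV (dist :: 'a \<Rightarrow> _)). pvar dist \<gamma> {0..1} < \<infinity>}
        = {\<gamma> \<in> space (skorokhod_borel UNIV (dist :: 'a \<Rightarrow> _)). (SUP n. ennreal (dyadic_sum dist \<gamma> 1 n)) < \<infinity>}"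
    proof (intro Collect_cong conj_cong refl)
      fix \<gamma> assume "\<gamma> \<in> space (skorokhod_borel UNIV (dist :: 'a \<Rightarrow> _))"
      then have "pvar dist \<gamma> {0..1} = (SUP n. ennreal (dyadic_sum dist \<gamma> 1 n))"
        by (intro Met_TC.pvar_eq_SUP_dyadic[OF Met_TC.cadlag_right_cont]) (simp_all add: space_skorokhod_borel)
      then show "(pvar dist \<gamma> {0..1} < \<infinity>) = ((SUP n. ennreal (dyadic_sum dist \<gamma> 1 n)) < \<infinity>)" by (simp only:)
    qed
    also have "\<dots> \<in> sets (skorokhod_borel UNIV dist)" unfolding dyadic_sum_def by measurable
    finally show ?thesis .
  qed
  show ?thesis
  proof (rule that[of \<pi>])
    show "prob_space \<pi>" unfolding \<pi>_def by (rule R.prob_space_distr[OF \<Phi>S])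
    show "AE \<gamma> in \<pi>. pvar dist \<gamma> {0..1} < \<infinity>"
      unfolding \<pi>_def by (subst AE_distr_iff[OF \<Phi>S pm]) (simp only: reg(2) simp_thms eventually_True)
    show "distr \<pi> borel (\<lambda>\<gamma>. \<gamma> t) = \<nu> t" if t: "t \<in> {0..1}" for t
      unfolding \<pi>_def using law[OF t] by (subst distr_distr[OF ev[OF t] \<Phi>S]) (simp add: o_def)
    show "(\<integral>\<^sup>+\<gamma>. ennreal (dist (\<gamma> s) (\<gamma> t)) \<partial>\<pi>) \<le> ennreal (W t - W s)" if st: "0 \<le> s" "s \<le> t" "t \<le> 1" for s t
    proof -
      have [measurable]: "(\<lambda>\<gamma>. \<gamma> s) \<in> measurable (skorokhod_borel UNIV dist) (borel :: 'a measure)"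
        "(\<lambda>\<gamma>. \<gamma> t) \<in> measurable (skorokhod_borel UNIV dist) (borel :: 'a measure)" using st by (auto intro!: ev)
      show ?thesis unfolding \<pi>_def using i2[OF st] by (subst nn_integral_distr[OF \<Phi>S]) auto
    qed
  qed (simp add: \<pi>_def)
qed

section \<open>Kernels of measures on the line\<close>

lemma emeasure_UNIV_eq_SUP_atMost:
  assumes "sets N = sets borel"
  shows "emeasure N UNIV = (SUP n::nat. emeasure N {..real n})"
proof -
  have "(SUP n::nat. emeasure N {..real n}) = emeasure N (\<Union>n::nat. {..real n})"
    by (rule SUP_emeasure_incseq) (auto simp: incseq_def assms)
  also have "(\<Union>n::nat. {..real n}) = UNIV" by (auto simp: real_arch_simple)
  finally show ?thesis by simp
qed

text \<open>Half-lines form an intersection-stable generator of the Borel sets, and finiteness of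
  the measures permits complements. Measurability in \<open>x\<close> is carried through the
  induction together with the identity.\<close>

lemma kernel_integral_eq:
  fixes \<kappa> :: "'b \<Rightarrow> real measure" and N :: "real measure"
  assumes \<kappa>: "\<And>x. sets (\<kappa> x) = sets borel" "\<And>x. finite_measure (\<kappa> x)"
    and N: "finite_measure N" "sets N = sets borel"
    and base: "\<And>t. (\<lambda>x. emeasure (\<kappa> x) {..t}) \<in> borel_measurable M"
      "\<And>t. (\<integral>\<^sup>+x. emeasure (\<kappa> x) {..t} \<partial>M) = emeasure N {..t}"
    and A: "A \<in> sets borel"
  shows "(\<lambda>x. emeasure (\<kappa> x) A) \<in> borel_measurable M \<and> (\<integral>\<^sup>+x. emeasure (\<kappa> x) A \<partial>M) = emeasure N A"
proof -
  interpret N: finite_measure N by fact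
  have sp: "space (\<kappa> x) = UNIV" "space N = UNIV" for x
    using \<kappa>(1)[of x] N(2) by (auto dest: sets_eq_imp_space_eq)
  have borel: "sets borel = sigma_sets UNIV (range (atMost :: real \<Rightarrow> real set))"
    by (simp add: borel_eq_atMost)
  have U: "(\<lambda>x. emeasure (\<kappa> x) UNIV) \<in> borel_measurable M" "(\<integral>\<^sup>+x. emeasure (\<kappa> x) UNIV \<partial>M) = emeasure N UNIV"
  proof -
    note [measurable] = base(1)
    show "(\<lambda>x. emeasure (\<kappa> x) UNIV) \<in> borel_measurable M"
      unfolding emeasure_UNIV_eq_SUP_atMost[OF \<kappa>(1)] by measurable
    have "(\<integral>\<^sup>+x. emeasure (\<kappa> x) UNIV \<partial>M) = (SUP n::nat. \<integral>\<^sup>+x. emeasure (\<kappa> x) {..real n} \<partial>M)"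
      unfolding emeasure_UNIV_eq_SUP_atMost[OF \<kappa>(1)]
      by (rule nn_integral_monotone_convergence_SUP)
        (auto simp: incseq_def le_fun_def \<kappa>(1) base(1) intro!: emeasure_mono)
    then show "(\<integral>\<^sup>+x. emeasure (\<kappa> x) UNIV \<partial>M) = emeasure N UNIV"
      unfolding base(2) emeasure_UNIV_eq_SUP_atMost[OF N(2)] .
  qed
  have st: "Int_stable (range (atMost :: real \<Rightarrow> real set))"
    by (auto simp: Int_stable_def)
  have sub: "range (atMost :: real \<Rightarrow> real set) \<subseteq> Pow UNIV" by simp
  from A have "A \<in> sigma_sets UNIV (range atMost)" unfolding borel .
  from st sub this show ?thesis
  proof (induction A rule: sigma_sets_induct_disjoint)
    case empty
    then show ?case by simp
  next
    case (basic A)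
    then show ?case using base by auto
  next
    case (compl A)
    then have As: "A \<in> sets borel" unfolding borel by simp
    have d: "emeasure (\<kappa> x) (UNIV - A) = emeasure (\<kappa> x) UNIV - emeasure (\<kappa> x) A" for x
      using emeasure_compl[of A "\<kappa> x"] finite_measure.emeasure_finite[OF \<kappa>(2)[of x], of A] As sp \<kappa>(1) by simp
    have "(\<integral>\<^sup>+x. emeasure (\<kappa> x) UNIV - emeasure (\<kappa> x) A \<partial>M) = (\<integral>\<^sup>+x. emeasure (\<kappa> x) UNIV \<partial>M) - (\<integral>\<^sup>+x. emeasure (\<kappa> x) A \<partial>M)"
      by (rule nn_integral_diff) (use compl U As in \<open>auto simp: N.emeasure_eq_measure \<kappa>(1) intro!: emeasure_mono\<close>)
    then show ?case
      using compl U emeasure_compl[of A N] As N(2) sp by (auto simp: d N.emeasure_eq_measure)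
  next
    case (union A)
    then have As: "range A \<subseteq> sets borel" unfolding borel by auto
    have d: "emeasure (\<kappa> x) (\<Union>i. A i) = (\<Sum>i. emeasure (\<kappa> x) (A i))" for x
      by (rule suminf_emeasure[symmetric]) (use union As \<kappa>(1) in auto)
    have dN: "emeasure N (\<Union>i. A i) = (\<Sum>i. emeasure N (A i))"
      by (rule suminf_emeasure[symmetric]) (use union As N(2) in auto)
    have m: "(\<lambda>x. emeasure (\<kappa> x) (A i)) \<in> borel_measurable M" for i using union by blast
    have "(\<lambda>x. \<Sum>i. emeasure (\<kappa> x) (A i)) \<in> borel_measurable M" by (rule borel_measurable_suminf_order[OF m])
    moreover have "(\<integral>\<^sup>+x. (\<Sum>i. emeasure (\<kappa> x) (A i)) \<partial>M) = (\<Sum>i. emeasure N (A i))"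
      using union by (simp add: nn_integral_suminf[OF m])
    ultimately show ?case unfolding d dN by blast
  qed
qed

lemma emeasure_interval_measure_UNIV_le:
  assumes "\<And>x y. x \<le> y \<Longrightarrow> F x \<le> F y" "\<And>a. continuous (at_right a) F" "\<And>t. t < 0 \<Longrightarrow> F t = 0" "\<And>t. F t \<le> B"
  shows "emeasure (interval_measure F) UNIV \<le> ennreal B"
  unfolding emeasure_UNIV_eq_SUP_atMost[OF sets_interval_measure]
  by (rule SUP_least) (simp add: emeasure_interval_measure_atMost[OF assms(1-3)] ennreal_leI assms(4))

text \<open>A finite partition of [0,1) has a last point, which is below 1.\<close>

lemma pvar_Ico_eq_SUP: "pvar d u {0..<1} = (SUP n. pvar d u {0..1 - 1 / real (Suc n)})"
proof (rule antisym)
  show "pvar d u {0..<1} \<le> (SUP n. pvar d u {0..1 - 1 / real (Suc n)})"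
  proof (rule pvar_least)
    fix k p assume p: "\<And>i. i \<le> k \<Longrightarrow> p i < p (Suc i)" "\<And>i. i \<le> Suc k \<Longrightarrow> p i \<in> {0..<1::real}"
    define b where "b = Max (p ` {..Suc k})"
    have "b \<in> p ` {..Suc k}" unfolding b_def by (rule Max_in) auto
    then have "b < 1" using p(2) by auto
    then obtain n where n: "inverse (real (Suc n)) < 1 - b" using reals_Archimedean[of "1 - b"] by auto
    have "p i \<le> b" if "i \<le> Suc k" for i unfolding b_def using that by (intro Max_ge) auto
    then have "p i \<in> {0..1 - 1 / real (Suc n)}" if "i \<le> Suc k" for i
      using n p(2)[OF that] that by (fastforce simp: inverse_eq_divide)
    with p(1) have "(\<Sum>i\<le>k. ennreal (d (u (p i)) (u (p (Suc i))))) \<le> pvar d u {0..1 - 1 / real (Suc n)}"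
      by (intro sum_le_pvar_strict)
    also have "\<dots> \<le> (SUP n. pvar d u {0..1 - 1 / real (Suc n)})" by (rule SUP_upper) simp
    finally show "(\<Sum>i\<le>k. ennreal (d (u (p i)) (u (p (Suc i))))) \<le> (SUP n. pvar d u {0..1 - 1 / real (Suc n)})" .
  qed
  have "{0..1 - 1 / real (Suc n)} \<subseteq> {0..<1::real}" for n
  proof -
    have "0 < 1 / real (Suc n)" by simp
    then show ?thesis unfolding subset_iff atLeastAtMost_iff atLeastLessThan_iff
      by (metis diff_less_eq le_less_trans less_add_same_cancel1)
  qed
  then show "(SUP n. pvar d u {0..1 - 1 / real (Suc n)}) \<le> pvar d u {0..<1}"
    by (intro SUP_least pvar_mono)
qed

lemma pvar_singleton: "pvar d u {a} = 0"
proof -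
  have "pvar d u {a} \<le> 0"
  proof (rule pvar_least)
    fix k p assume p: "\<And>i. i \<le> k \<Longrightarrow> p i < p (Suc i)" "\<And>i. i \<le> Suc k \<Longrightarrow> p i \<in> {a}"
    then have "p 0 < p 1" "p 0 = a" "p 1 = a" using p(1)[of 0] p(2)[of 0] p(2)[of 1] by auto
    then show "(\<Sum>i\<le>k. ennreal (d (u (p i)) (u (p (Suc i))))) \<le> 0" by simp
  qed
  then show ?thesis by simp
qed

context Metric_space
begin

context
  fixes u assumes u: "right_cont u" and fin: "pvar d u {0..<1} < \<infinity>"
begin

text \<open>The cumulative distribution function \<open>c\<close> of \<open>\<bar>m\<bar> \<L>\<^sup>1\<close> dominates the increments, so
  \<open>c - var_upto\<close> is monotone and the variation measure is bounded by \<open>\<bar>m\<bar> \<L>\<^sup>1\<close>.\<close>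

lemma var_upto_null_of_abs_cont:
  assumes m: "set_integrable lebesgue {0..1} m"
    and dm: "\<And>s t. 0 \<le> s \<Longrightarrow> s \<le> t \<Longrightarrow> t \<le> 1 \<Longrightarrow> d (u s) (u t) \<le> set_lebesgue_integral lebesgue {s..t} m"
    and Z: "Z \<in> null_sets lborel"
  shows "emeasure (interval_measure (var_upto d u)) Z = 0"
proof -
  let ?F = "var_upto d u"
  \<comment> \<open>\<open>m\<close> may take negative values and is controlled on [0,1] only;
    absolute value and cut-off turn it into an integrable density.\<close>
  define h where "h x = \<bar>m x\<bar> * indicator {0..1} x" for x
  have hi: "integrable lebesgue h"
  proof -
    have "integrable lebesgue (\<lambda>x. \<bar>indicator {0..1} x *\<^sub>R m x\<bar>)"
      using m unfolding set_integrable_def by (rule integrable_abs)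
    moreover have "(\<lambda>x. \<bar>indicator {0..1} x *\<^sub>R m x\<bar>) = h" by (auto simp: h_def abs_mult)
    ultimately show ?thesis by simp
  qed
  then have hm[measurable]: "h \<in> borel_measurable lebesgue" by auto
  have h0: "0 \<le> h x" for x by (simp add: h_def)
  \<comment> \<open>\<open>m\<close> is only Lebesgue measurable, so the density is taken over the
    completed measure and the result is pushed down to the Borel sets.\<close>
  define \<Lambda> where "\<Lambda> = distr (density lebesgue (\<lambda>x. ennreal (h x))) borel (\<lambda>x. x)"
  have id: "(\<lambda>x. x) \<in> measurable (density lebesgue (\<lambda>x. ennreal (h x))) (borel :: real measure)"
    by (simp add: measurable_def)
  have \<Lambda>s: "sets \<Lambda> = sets borel" by (simp add: \<Lambda>_def)
  have \<Lambda>e: "emeasure \<Lambda> A = (\<integral>\<^sup>+x\<in>A. ennreal (h x) \<partial>lebesgue)" if A: "A \<in> sets borel" for A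
  proof -
    have "A \<in> sets lebesgue" using A by (metis sets_completionI_sets sets_lborel)
    then show ?thesis unfolding \<Lambda>_def using A id by (simp add: emeasure_distr emeasure_density)
  qed
  have "emeasure \<Lambda> UNIV < \<infinity>"
    using hi h0 by (simp add: \<Lambda>e integrable_iff_bounded)
  then have \<Lambda>fin: "finite_measure \<Lambda>" by (intro finite_measureI) (auto simp: \<Lambda>_def)
  interpret \<Lambda>: finite_borel_measure \<Lambda>
    using \<Lambda>fin \<Lambda>s by (simp add: finite_borel_measure_def finite_borel_measure_axioms_def)
  have \<Lambda>null: "emeasure \<Lambda> A = 0" if "A \<in> null_sets lborel" for A
  proof -
    have A: "A \<in> sets borel" "AE x in lebesgue. x \<notin> A"
      using that AE_not_in[OF that] by (auto simp: null_sets_def AE_completion_iff)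
    have "(\<integral>\<^sup>+x\<in>A. ennreal (h x) \<partial>lebesgue) = (\<integral>\<^sup>+x. 0 \<partial>(lebesgue :: real measure))"
      by (rule nn_integral_cong_AE) (use A(2) in eventually_elim, simp)
    then show ?thesis using A by (simp add: \<Lambda>e)
  qed
  define c where "c = cdf \<Lambda>"
  have cm: "c s \<le> c t" if "s \<le> t" for s t unfolding c_def using that by (rule \<Lambda>.cdf_nondecreasing)
  have cc: "continuous (at_right a) c" for a unfolding c_def by (rule \<Lambda>.cdf_is_right_cont)
  have c0: "c t = 0" if "t < 0" for t
  proof -
    have "(\<integral>\<^sup>+x\<in>{..t}. ennreal (h x) \<partial>lebesgue) = (\<integral>\<^sup>+x. 0 \<partial>(lebesgue :: real measure))"
      using that by (intro nn_integral_cong) (auto simp: h_def split: split_indicator)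
    then have "emeasure \<Lambda> {..t} = 0" by (simp add: \<Lambda>e)
    then show ?thesis by (simp add: c_def cdf_def measure_def)
  qed
  have dc: "d (u s) (u t) \<le> c t - c s" if st: "0 \<le> s" "s < t" "t \<le> 1" for s t
  proof -
    have ir: "integrable lebesgue (\<lambda>x. indicator {s..t} x *\<^sub>R m x)"
    proof -
      have "set_integrable lebesgue {s..t} m"
        by (rule set_integrable_subset[OF m]) (use st in auto)
      then show ?thesis by (simp add: set_integrable_def)
    qed
    have "d (u s) (u t) \<le> (LINT x|lebesgue. indicator {s..t} x *\<^sub>R m x)"
      using dm[of s t] st by (simp add: set_lebesgue_integral_def)
    also have "\<dots> \<le> (LINT x|lebesgue. \<bar>indicator {s..t} x *\<^sub>R m x\<bar>)"
      by (rule integral_mono[OF ir integrable_abs[OF ir]]) simp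
    finally have 1: "d (u s) (u t) \<le> (LINT x|lebesgue. \<bar>indicator {s..t} x *\<^sub>R m x\<bar>)" .
    have "ennreal (LINT x|lebesgue. \<bar>indicator {s..t} x *\<^sub>R m x\<bar>) = (\<integral>\<^sup>+x. ennreal \<bar>indicator {s..t} x *\<^sub>R m x\<bar> \<partial>lebesgue)"
      by (rule nn_integral_eq_integral[symmetric]) (use integrable_abs[OF ir] in auto)
    also have "\<dots> = (\<integral>\<^sup>+x\<in>{s..t}. ennreal (h x) \<partial>lebesgue)"
      using st by (intro nn_integral_cong) (auto simp: h_def abs_mult split: split_indicator)
    also have "\<dots> = emeasure \<Lambda> ({s} \<union> {s<..t})"
      using st by (subst \<Lambda>e) (auto intro!: nn_integral_cong split: split_indicator)
    also have "\<dots> \<le> emeasure \<Lambda> {s} + emeasure \<Lambda> {s<..t}"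
      by (rule emeasure_subadditive) (auto simp: \<Lambda>s)
    also have "emeasure \<Lambda> {s} = 0" by (rule \<Lambda>null) auto
    finally have "(LINT x|lebesgue. \<bar>indicator {s..t} x *\<^sub>R m x\<bar>) \<le> measure \<Lambda> {s<..t}"
      by (simp add: \<Lambda>.emeasure_eq_measure ennreal_le_iff)
    with 1 show ?thesis using \<Lambda>.cdf_diff_eq[OF st(2)] by (simp add: c_def)
  qed
  have F0: "?F t = 0" if "t \<le> 0" for t
  proof -
    have "{..t} \<inter> {0..<1} = (if t = 0 then {0} else {})" using that by auto
    moreover have "pvar d u {} \<le> pvar d u {0}" by (rule pvar_mono) simp
    ultimately have "pvar d u ({..t} \<inter> {0..<1}) = 0" by (simp add: pvar_singleton split: if_splits)
    then show ?thesis by (simp add: var_upto_def)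
  qed
  \<comment> \<open>Continuing the variation function after \<open>s\<close> by the increments of
    \<open>c\<close> still dominates the curve, and \<open>var_upto\<close> cannot exceed such a
    function.\<close>
  have Fc0: "?F t - ?F s \<le> c t - c s" if st: "0 \<le> s" "s < t" "s < 1" for s t
  proof -
    define G where "G x = (if x \<le> s then ?F x else ?F s + (c x - c s))" for x
    have "pvar d u ({..t} \<inter> {0..<1}) \<le> ennreal ((?F s + (c t - c s)) - 0)"
    proof (rule pvar_le_dominated)
      fix x y assume xy: "x \<in> {..t} \<inter> {0..<1}" "y \<in> {..t} \<inter> {0..<1}" "x < y"
      consider "y \<le> s" | "s < x" | "x \<le> s" "s < y" by linarith
      then show "d (u x) (u y) \<le> G y - G x"
      proof cases
        case 1 then show ?thesis using dist_le_var_upto[OF u fin, of x y] xy by (simp add: G_def)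
      next
        case 2 then show ?thesis using dc[of x y] xy by (simp add: G_def)
      next
        case 3
        have "d (u x) (u y) \<le> d (u x) (u s) + d (u s) (u y)"
          using xy st by (intro triangle right_cont_in[OF u]) auto
        moreover have "d (u x) (u s) \<le> ?F s - ?F x" using xy st 3 by (intro dist_le_var_upto[OF u fin]) auto
        moreover have "d (u s) (u y) \<le> c y - c s" using xy st 3 by (intro dc) auto
        ultimately show ?thesis using 3 by (simp add: G_def)
      qed
    next
      fix x assume x: "x \<in> {..t} \<inter> {0..<1}"
      show "0 \<le> G x \<and> G x \<le> ?F s + (c t - c s)"
        using x st var_upto_nonneg[OF u fin, of x] var_upto_nonneg[OF u fin, of s] var_upto_mono[OF u fin, of x s]
          cm[of s x] cm[of x t] cm[of s t] by (auto simp: G_def)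
    qed
    then have "ennreal (?F t) \<le> ennreal (?F s + (c t - c s))" by (simp add: ennreal_var_upto[OF u fin])
    moreover have "0 \<le> ?F s + (c t - c s)" using var_upto_nonneg[OF u fin, of s] cm[of s t] st by simp
    ultimately show ?thesis by (simp add: ennreal_le_iff)
  qed
  have Fc: "?F t - ?F s \<le> c t - c s" if "s \<le> t" for s t
  proof -
    consider "s = t" | "1 \<le> s" | "t \<le> 0" | "0 \<le> s" "s < t" "s < 1" | "s < 0" "0 < t" using \<open>s \<le> t\<close> by linarith
    then show ?thesis
    proof cases
      case 2
      then show ?thesis using var_upto_ge1[OF u fin, of s] var_upto_ge1[OF u fin, of t] cm[OF that] that by simp
    next
      case 3 then show ?thesis using F0[of s] F0[of t] cm[OF that] that by simp
    next
      case 4 then show ?thesis by (rule Fc0)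
    next
      case 5
      then show ?thesis using Fc0[of 0 t] F0[of s] F0[of 0] cm[of s 0] by simp
    qed simp
  qed
  define H where "H t = c t - ?F t" for t
  have Hm: "H s \<le> H t" if "s \<le> t" for s t using Fc[OF that] by (simp add: H_def)
  have Hc: "continuous (at_right a) H" for a
    unfolding H_def by (intro continuous_diff cc var_upto_continuous[OF u fin])
  have H0: "H t = 0" if "t < 0" for t using that by (simp add: H_def c0 F0)
  have Hn: "0 \<le> H t" for t using Hm[of "min t (-1)" t] H0[of "min t (-1)"] by auto
  have HB: "H t \<le> measure \<Lambda> UNIV" for t
  proof -
    have "c t \<le> measure \<Lambda> UNIV" unfolding c_def cdf_def by (rule \<Lambda>.finite_measure_mono) (auto simp: \<Lambda>s)
    then show ?thesis using var_upto_nonneg[OF u fin, of t] by (simp add: H_def)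
  qed
  have Hfin: "finite_measure (interval_measure H)"
    using emeasure_interval_measure_UNIV_le[of H, OF Hm Hc H0 HB] by (intro finite_measureI) (auto simp: top_unique)
  \<comment> \<open>A kernel over \<open>bool\<close> expresses a sum of two measures, so
    \<open>kernel_integral_eq\<close> shows that the measures of \<open>?F\<close> and
    \<open>H\<close> add up to \<open>\<Lambda>\<close>. A null set of the sum is null for each of
    them.\<close>
  define \<kappa> where "\<kappa> b = (if b then interval_measure ?F else interval_measure H)" for b
  have "(\<integral>\<^sup>+b. emeasure (\<kappa> b) Z \<partial>count_space UNIV) = emeasure \<Lambda> Z"
  proof (rule kernel_integral_eq[THEN conjunct2])
    show "finite_measure (\<kappa> b)" for b
      using Hfin finite_interval_measure_var_upto[OF u fin] by (simp add: \<kappa>_def)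
    show "(\<integral>\<^sup>+b. emeasure (\<kappa> b) {..t} \<partial>count_space UNIV) = emeasure \<Lambda> {..t}" for t
    proof -
      have "(\<integral>\<^sup>+b. emeasure (\<kappa> b) {..t} \<partial>count_space UNIV) = ennreal (?F t) + ennreal (H t)"
        by (simp add: nn_integral_count_space_finite UNIV_bool \<kappa>_def emeasure_var_upto_atMost[OF u fin]
          emeasure_interval_measure_atMost[of H, OF Hm Hc H0] add.commute)
      also have "\<dots> = ennreal (c t)"
        using var_upto_nonneg[OF u fin, of t] Hn[of t] by (simp add: H_def flip: ennreal_plus)
      finally show ?thesis by (simp add: c_def cdf_def \<Lambda>.emeasure_eq_measure)
    qed
    show "sets (\<kappa> b) = sets borel" for b by (simp add: \<kappa>_def)
    show "finite_measure \<Lambda>" "sets \<Lambda> = sets borel" by fact+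
    show "(\<lambda>b. emeasure (\<kappa> b) {..t}) \<in> borel_measurable (count_space UNIV)" for t by simp
    show "Z \<in> sets borel" using Z by (simp add: null_sets_def)
  qed
  then have "emeasure (interval_measure ?F) Z + emeasure (interval_measure H) Z = 0"
    using \<Lambda>null[OF Z] by (simp add: nn_integral_count_space_finite UNIV_bool \<kappa>_def add.commute)
  then show ?thesis by simp
qed

end

end

text \<open>Variation measures of paths and metric derivatives take uncontrolled values on an
  exceptional null set; completion absorbs it.\<close>

lemma measurable_completion_AE_eq:
  assumes g: "g \<in> measurable M N" and f: "f \<in> space M \<rightarrow> space N" and ae: "AE x in M. f x = g x"
  shows "f \<in> measurable (completion M) N"
proof (rule measurableI)
  show "f x \<in> space N" if "x \<in> space (completion M)" for x using that f by auto
  fix A assume A: "A \<in> sets N"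
  show "f -` A \<inter> space (completion M) \<in> sets (completion M)"
  proof (rule completion.in_sets_AE[where A="g -` A \<inter> space M"])
    show "AE x in completion M. (x \<in> g -` A \<inter> space M) = (x \<in> f -` A \<inter> space (completion M))"
      using ae unfolding AE_completion_iff by eventually_elim auto
    show "g -` A \<inter> space M \<in> sets (completion M)" using measurable_sets[OF g A] by (rule sets_completionI_sets)
  qed auto
qed

text \<open>Right continuity makes the path the limit of step functions sampled at the next grid
  point, capped at 1.\<close>

lemma cadlag_borel_measurable:
  fixes \<gamma> :: "real \<Rightarrow> 'a::metric_space"
  assumes "\<gamma> \<in> cadlag_paths"
  shows "\<gamma> \<in> borel_measurable (restrict_space borel {0..1})"
proof (rule borel_measurable_LIMSEQ_metric)
  define x where "x n t = min 1 (next_dyadic n t)" for n t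
  show "(\<lambda>t. \<gamma> (x n t)) \<in> borel_measurable (restrict_space borel {0..1})" for n
  proof -
    have "(\<lambda>t::real. (\<lambda>i::int. \<gamma> (min 1 ((of_int i + 1) / 2^n))) \<lfloor>t * 2^n\<rfloor>) \<in> borel_measurable borel"
      by (rule measurable_compose[where N="count_space UNIV"]) measurable
    then show ?thesis by (intro measurable_restrict_space1) (simp add: x_def next_dyadic_def)
  qed
  fix t :: real assume "t \<in> space (restrict_space borel {0..1})"
  then have t: "0 \<le> t" "t \<le> 1" by (auto simp: space_restrict_space)
  have xt: "t \<le> x n t" "x n t \<le> 1" for n using next_dyadic_bounds(1)[of t n] t by (auto simp: x_def)
  have xlim: "(\<lambda>n. x n t) \<longlonglongrightarrow> t"
  proof -
    have "(\<lambda>n. min 1 (next_dyadic n t)) \<longlonglongrightarrow> min 1 t" by (intro tendsto_min tendsto_const next_dyadic_tendsto)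
    then show ?thesis using t by (simp add: x_def min_def)
  qed
  show "(\<lambda>n. \<gamma> (x n t)) \<longlonglongrightarrow> \<gamma> t"
  proof (cases "t = 1")
    case True
    then have "x n t = 1" for n using xt[of n] by simp
    then show ?thesis using True by simp
  next
    case False
    then have t1: "t < 1" using t by simp
    show ?thesis
    proof (rule metric_LIMSEQ_I)
      fix e :: real assume e: "0 < e"
      obtain \<delta> where \<delta>: "0 < \<delta>" "\<And>s. t \<le> s \<Longrightarrow> s < t + \<delta> \<Longrightarrow> dist (\<gamma> t) (\<gamma> s) < e"
        using cadlag_right[OF assms t(1) t1 e] by metis
      have "eventually (\<lambda>n. x n t < t + \<delta>) sequentially" by (rule order_tendstoD(2)[OF xlim]) (use \<delta> in simp)
      then obtain N where "\<forall>n\<ge>N. x n t < t + \<delta>" unfolding eventually_sequentially by blast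
      then have "\<forall>n\<ge>N. dist (\<gamma> (x n t)) (\<gamma> t) < e" using \<delta>(2)[OF xt(1)] by (simp add: dist_commute)
      then show "\<exists>N. \<forall>n\<ge>N. dist (\<gamma> (x n t)) (\<gamma> t) < e" by blast
    qed
  qed
qed

text \<open>The path itself competes in the essential variation; measurability and integrability
  come from the cadlag property and boundedness.\<close>

lemma cadlag_BV_of_pvar:
  fixes \<gamma> :: "real \<Rightarrow> 'a::metric_space"
  assumes \<gamma>: "\<gamma> \<in> cadlag_paths" and fin: "pvar dist \<gamma> {0..1} < \<infinity>"
  shows "\<gamma> \<in> cadlag_BV UNIV dist"
proof -
  have ext: "\<gamma> \<in> {0..1} \<rightarrow>\<^sub>E UNIV" using \<gamma> by (simp add: cadlag_def)
  have "ess_var UNIV dist \<gamma> {0..1} \<le> pvar dist \<gamma> {0..1}"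
    unfolding ess_var_def by (rule INF_lower) auto
  with fin have "ess_var UNIV dist \<gamma> {0..1} < \<infinity>" by (rule order.strict_trans1[rotated])
  moreover have "\<gamma> \<in> L1_curves UNIV dist"
  proof -
    have "metric_borel UNIV (dist :: 'a \<Rightarrow> _) = borel"
      by (simp add: metric_borel_def borel_def)
    moreover have "\<gamma> \<in> borel_measurable (lebesgue_on {0..1})"
      using cadlag_borel_measurable[OF \<gamma>]
      by (simp add: measurable_def space_restrict_space sets_restrict_space image_iff) (metis sets_completionI_sets sets_lborel)
    moreover obtain B where B: "\<And>t. t \<in> {0..1} \<Longrightarrow> dist (\<gamma> 0) (\<gamma> t) \<le> B" using cadlag_bounded[OF \<gamma>] by blast
    moreover have "(\<integral>\<^sup>+t. ennreal (dist (\<gamma> t) (\<gamma> 0)) \<partial>lebesgue_on {0..1}) < \<infinity>"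
    proof -
      have "(\<integral>\<^sup>+t. ennreal (dist (\<gamma> t) (\<gamma> 0)) \<partial>lebesgue_on {0..1}) \<le> (\<integral>\<^sup>+t. ennreal B \<partial>lebesgue_on {0..1::real})"
        by (intro nn_integral_mono ennreal_leI) (use B in \<open>auto simp: dist_commute\<close>)
      also have "\<dots> < \<infinity>" by (simp add: emeasure_restrict_space ennreal_mult_less_top)
      finally show ?thesis .
    qed
    ultimately show ?thesis using ext by (auto simp: L1_curves_def)
  qed
  ultimately show ?thesis using \<gamma> by (simp add: cadlag_BV_def)
qed

section \<open>The theorem\<close>

lemma increments_at_interior:
  assumes "t \<in> {0<..<1}"
  shows "increments_at t = at 0"
proof -
  have "{h. t + h \<in> {0..1}} = {-t..1-t}" by auto
  moreover have "0 \<in> interior {-t..1-t}" using assms by (simp add: interior_atLeastAtMost_real)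
  ultimately show ?thesis unfolding increments_at_def by (simp only: at_within_interior)
qed

text \<open>The outcome of the construction. \<open>W\<close> is the variation on closed intervals,
  a jump at 1 included, so that \<open>inc\<close> reaches time 1.\<close>

locale path_law =
  fixes \<mu> :: "real \<Rightarrow> 'a::polish_space measure" and W :: "real \<Rightarrow> real" and \<pi> :: "(real \<Rightarrow> 'a) measure"
  assumes \<mu>: "\<mu> \<in> cadlag_BV P1 W1"
    and W: "\<And>t. t \<in> {0..1} \<Longrightarrow> ennreal (W t) = pvar W1 \<mu> {0..t}" "\<And>t. 0 \<le> W t"
    and prob: "prob_space \<pi>"
    and sets_pi: "sets \<pi> = sets (skorokhod_borel UNIV (dist :: 'a \<Rightarrow> _))"
    and bv: "AE \<gamma> in \<pi>. pvar dist \<gamma> {0..1} < \<infinity>"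
    and law: "\<And>t. t \<in> {0..1} \<Longrightarrow> distr \<pi> borel (\<lambda>\<gamma>. \<gamma> t) = \<mu> t"
    and inc: "\<And>s t. 0 \<le> s \<Longrightarrow> s \<le> t \<Longrightarrow> t \<le> 1 \<Longrightarrow> (\<integral>\<^sup>+\<gamma>. ennreal (dist (\<gamma> s) (\<gamma> t)) \<partial>\<pi>) \<le> ennreal (W t - W s)"
begin

sublocale prob_space \<pi> by (rule prob)

sublocale P1: Metric_space "P1 :: 'a measure set" W1 by (rule Metric_space_P1)

lemma rc: "P1.right_cont \<mu>" and fin: "pvar W1 \<mu> {0..<1} < \<infinity>"
  using P1.cadlag_BV_right_cont[OF \<mu>] by auto

lemma space_pi: "space \<pi> = cadlag_paths"
  using sets_eq_imp_space_eq[OF sets_pi] by simp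

lemma measurable_eval: "t \<in> {0..1} \<Longrightarrow> (\<lambda>\<gamma>. \<gamma> t) \<in> measurable \<pi> borel"
  using measurable_eval_skorokhod[of t] sets_pi by (simp cong: measurable_cong_sets)

lemma W_mono: "0 \<le> s \<Longrightarrow> s \<le> t \<Longrightarrow> t \<le> 1 \<Longrightarrow> W s \<le> W t"
proof -
  assume st: "0 \<le> s" "s \<le> t" "t \<le> 1"
  have "pvar W1 \<mu> {0..s} \<le> pvar W1 \<mu> {0..t}" using st by (intro pvar_mono) auto
  then have "ennreal (W s) \<le> ennreal (W t)" using st by (simp add: W)
  then show ?thesis using W(2) by (simp add: ennreal_le_iff)
qed

lemma W_0: "W 0 = 0"
proof -
  have "ennreal (W 0) = 0" using W(1)[of 0] by (simp add: pvar_singleton)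
  then show ?thesis using W(2)[of 0] by (simp add: ennreal_eq_0_iff)
qed

lemma var_upto_eq_W: "0 \<le> t \<Longrightarrow> t < 1 \<Longrightarrow> var_upto W1 \<mu> t = W t"
proof -
  assume t: "0 \<le> t" "t < 1"
  then have "{..t} \<inter> {0..<1} = {0..t}" by auto
  then have "ennreal (var_upto W1 \<mu> t) = ennreal (W t)" using t by (simp add: P1.ennreal_var_upto[OF rc fin] W)
  then show ?thesis using W(2) P1.var_upto_nonneg[OF rc fin] by simp
qed

lemma grid_01:
  fixes t :: real
  assumes "t \<in> {0..1}"
  shows "min (real i / 2^n) t \<in> {0..1}" "min (real i / 2^n) t \<le> min (real (Suc i) / 2^n) t"
  using assms by (auto simp: min_le_iff_disj divide_right_mono)

lemma measurable_dyadic_sum: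
  assumes t: "t \<in> {0..1}"
  shows "(\<lambda>\<gamma>. dyadic_sum dist \<gamma> t n) \<in> borel_measurable \<pi>"
proof -
  have [measurable]: "(\<lambda>\<gamma>. \<gamma> (min (real i / 2^n) t)) \<in> measurable \<pi> borel" for i
    by (rule measurable_eval[OF grid_01(1)[OF t]])
  have [measurable]: "(\<lambda>\<gamma>. \<gamma> (min (real (Suc i) / 2^n) t)) \<in> measurable \<pi> borel" for i
    by (rule measurable_eval[OF grid_01(1)[OF t]])
  show ?thesis unfolding dyadic_sum_def by measurable
qed

lemma pvar_eq_SUP:
  assumes "\<gamma> \<in> space \<pi>" "t \<in> {0..1}"
  shows "pvar dist \<gamma> {0..t} = (SUP n. ennreal (dyadic_sum dist \<gamma> t n))"
  using assms Met_TC.pvar_eq_SUP_dyadic[OF Met_TC.cadlag_right_cont] by (simp add: space_pi)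

lemma measurable_pvar: "t \<in> {0..1} \<Longrightarrow> (\<lambda>\<gamma>. pvar dist \<gamma> {0..t}) \<in> borel_measurable \<pi>"
proof -
  assume t: "t \<in> {0..1}"
  note [measurable] = measurable_dyadic_sum[OF t]
  have "(\<lambda>\<gamma>. SUP n. ennreal (dyadic_sum dist \<gamma> t n)) \<in> borel_measurable \<pi>" by measurable
  then show ?thesis by (subst measurable_cong[OF pvar_eq_SUP[OF _ t]])
qed

text \<open>The joint law of the two evaluations is a coupling of the marginals.\<close>

lemma W1_le_cost:
  assumes "s \<in> {0..1}" "t \<in> {0..1}"
  shows "ennreal (W1 (\<mu> s) (\<mu> t)) \<le> (\<integral>\<^sup>+\<gamma>. ennreal (dist (\<gamma> s) (\<gamma> t)) \<partial>\<pi>)" (is "_ \<le> ?I")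
proof (cases "?I = top")
  case False
  then have I: "?I = ennreal (enn2real ?I)" by (simp add: less_top)
  have "W1 (distr \<pi> borel (\<lambda>\<gamma>. \<gamma> s)) (distr \<pi> borel (\<lambda>\<gamma>. \<gamma> t)) \<le> enn2real ?I"
    by (rule W1_le_random_variables[OF prob measurable_eval[OF assms(1)] measurable_eval[OF assms(2)]])
      (use I in auto)
  then show ?thesis using law assms by (subst I) (simp add: ennreal_leI)
qed simp

lemma nn_integral_pvar:
  assumes t: "t \<in> {0..1}"
  shows "(\<integral>\<^sup>+\<gamma>. pvar dist \<gamma> {0..t} \<partial>\<pi>) = ennreal (W t)"
proof (rule antisym)
  have grid_m: "(\<lambda>\<gamma>. \<gamma> (min (real i / 2^n) t)) \<in> measurable \<pi> borel" for i n
    by (rule measurable_eval[OF grid_01(1)[OF t]])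
  have "(\<integral>\<^sup>+\<gamma>. pvar dist \<gamma> {0..t} \<partial>\<pi>) = (\<integral>\<^sup>+\<gamma>. (SUP n. ennreal (dyadic_sum dist \<gamma> t n)) \<partial>\<pi>)"
    by (intro nn_integral_cong pvar_eq_SUP t)
  also have "\<dots> = (SUP n. \<integral>\<^sup>+\<gamma>. ennreal (dyadic_sum dist \<gamma> t n) \<partial>\<pi>)"
  proof (rule nn_integral_monotone_convergence_SUP)
    show "incseq (\<lambda>n \<gamma>. ennreal (dyadic_sum dist \<gamma> t n))"
      using Met_TC.dyadic_sum_incseq[OF _ t] by (auto simp: incseq_def le_fun_def intro!: ennreal_leI)
    show "(\<lambda>\<gamma>. ennreal (dyadic_sum dist \<gamma> t n)) \<in> borel_measurable \<pi>" for n
      using measurable_dyadic_sum[OF t] by (rule measurable_compose) simp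
  qed
  also have "\<dots> \<le> ennreal (W t - W 0)"
  proof (rule SUP_least, rule nn_integral_dyadic_sum_le)
    fix n i :: nat
    show "(\<lambda>\<gamma>. \<gamma> (min (real i / 2^n) t)) \<in> measurable \<pi> borel" by (rule grid_m)
    have g: "0 \<le> min (real i / 2^n) t" "min (real i / 2^n) t \<le> min (real (Suc i) / 2^n) t" "min (real (Suc i) / 2^n) t \<le> 1"
      using grid_01[OF t, of i n] grid_01(1)[OF t, of "Suc i" n] by auto
    show "(\<integral>\<^sup>+\<gamma>. ennreal (dist (\<gamma> (min (real i / 2^n) t)) (\<gamma> (min (real (Suc i) / 2^n) t))) \<partial>\<pi>)
        \<le> ennreal (W (min (real (Suc i) / 2^n) t) - W (min (real i / 2^n) t))" by (rule inc[OF g])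
    show "W (min (real i / 2^n) t) \<le> W (min (real (Suc i) / 2^n) t)" by (rule W_mono[OF g])
  qed (use t in auto)
  finally show "(\<integral>\<^sup>+\<gamma>. pvar dist \<gamma> {0..t} \<partial>\<pi>) \<le> ennreal (W t)" by (simp add: W_0)
  have "ennreal (W t) = (SUP n. ennreal (dyadic_sum W1 \<mu> t n))"
    using W(1)[OF t] P1.pvar_eq_SUP_dyadic[OF rc t] by simp
  also have "\<dots> \<le> (\<integral>\<^sup>+\<gamma>. pvar dist \<gamma> {0..t} \<partial>\<pi>)"
  proof (rule SUP_least)
    fix n
    have "ennreal (dyadic_sum W1 \<mu> t n) = (\<Sum>i<2^n. ennreal (W1 (\<mu> (min (real i / 2^n) t)) (\<mu> (min (real (Suc i) / 2^n) t))))"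
      by (rule P1.sum_dyadic_eq)
    also have "\<dots> \<le> (\<Sum>i<2^n. \<integral>\<^sup>+\<gamma>. ennreal (dist (\<gamma> (min (real i / 2^n) t)) (\<gamma> (min (real (Suc i) / 2^n) t))) \<partial>\<pi>)"
      by (intro sum_mono W1_le_cost grid_01(1)[OF t])
    also have "\<dots> = (\<integral>\<^sup>+\<gamma>. (\<Sum>i<2^n. ennreal (dist (\<gamma> (min (real i / 2^n) t)) (\<gamma> (min (real (Suc i) / 2^n) t)))) \<partial>\<pi>)"
      by (rule nn_integral_sum[symmetric]) (use grid_m grid_m[of "Suc _"] in measurable)
    also have "\<dots> = (\<integral>\<^sup>+\<gamma>. ennreal (dyadic_sum dist \<gamma> t n) \<partial>\<pi>)" by (simp only: Met_TC.sum_dyadic_eq)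
    also have "\<dots> \<le> (\<integral>\<^sup>+\<gamma>. pvar dist \<gamma> {0..t} \<partial>\<pi>)"
      by (intro nn_integral_mono Met_TC.dyadic_sum_le_pvar t) auto
    finally show "ennreal (dyadic_sum W1 \<mu> t n) \<le> (\<integral>\<^sup>+\<gamma>. pvar dist \<gamma> {0..t} \<partial>\<pi>)" .
  qed
  finally show "ennreal (W t) \<le> (\<integral>\<^sup>+\<gamma>. pvar dist \<gamma> {0..t} \<partial>\<pi>)" .
qed

text \<open>For times in [0,1) this is \<open>nn_integral_pvar\<close>. From time 1 on, monotone
  convergence over intervals that end before 1 keeps out the jump at 1, which \<open>W\<close>
  counts and \<open>var_upto\<close> ignores.\<close>

lemma pvar_upto_measurable_integral:
  "(\<lambda>\<gamma>. pvar dist \<gamma> ({..t} \<inter> {0..<1})) \<in> borel_measurable \<pi>"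
  "(\<integral>\<^sup>+\<gamma>. pvar dist \<gamma> ({..t} \<inter> {0..<1}) \<partial>\<pi>) = ennreal (var_upto W1 \<mu> t)"
proof -
  consider "t < 0" | "0 \<le> t" "t < 1" | "1 \<le> t" by linarith
  then have "(\<lambda>\<gamma>. pvar dist \<gamma> ({..t} \<inter> {0..<1})) \<in> borel_measurable \<pi> \<and>
    (\<integral>\<^sup>+\<gamma>. pvar dist \<gamma> ({..t} \<inter> {0..<1}) \<partial>\<pi>) = ennreal (var_upto W1 \<mu> t)"
  proof cases
    case 1
    then have "{..t} \<inter> {0..<1} = {}" by auto
    moreover have "pvar dist \<gamma> {} = 0" for \<gamma> :: "real \<Rightarrow> 'a"
      using pvar_mono[of "{}" "{0}" dist \<gamma>] by (simp add: pvar_singleton)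
    ultimately show ?thesis using P1.var_upto_neg[OF rc fin 1] by simp
  next
    case 2
    then have "{..t} \<inter> {0..<1} = {0..t}" by auto
    then show ?thesis using 2 measurable_pvar[of t] nn_integral_pvar[of t] var_upto_eq_W[OF 2] by simp
  next
    case 3
    then have eq: "{..t} \<inter> {0..<1} = {0..<1::real}" by auto
    define x where "x n = 1 - 1 / real (Suc n)" for n
    have x: "0 \<le> x n" "x n < 1" "x n \<in> {0..1}" for n by (auto simp: x_def)
    have sup: "pvar d u {0..<1} = (SUP n. pvar d u {0..x n})" for d :: "'c \<Rightarrow> 'c \<Rightarrow> real" and u
      unfolding x_def by (rule pvar_Ico_eq_SUP)
    have xm: "x m \<le> x n" if "m \<le> n" for m n using that by (simp add: x_def frac_le)
    note [measurable] = measurable_pvar[OF x(3)]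
    have "(\<lambda>\<gamma>. pvar dist \<gamma> {0..<1}) \<in> borel_measurable \<pi>" unfolding sup by measurable
    moreover have "(\<integral>\<^sup>+\<gamma>. pvar dist \<gamma> {0..<1} \<partial>\<pi>) = (SUP n. \<integral>\<^sup>+\<gamma>. pvar dist \<gamma> {0..x n} \<partial>\<pi>)"
      unfolding sup
    proof (rule nn_integral_monotone_convergence_SUP)
      show "incseq (\<lambda>n \<gamma>. pvar dist \<gamma> {0..x n})"
        using xm by (auto simp: incseq_def le_fun_def intro!: pvar_mono) (meson order_trans)
    qed measurable
    moreover have "\<dots> = (SUP n. pvar W1 \<mu> {0..x n})" using x(3) by (simp add: nn_integral_pvar W)
    moreover have "\<dots> = ennreal (var_upto W1 \<mu> t)"
      unfolding sup[symmetric] P1.ennreal_var_upto[OF rc fin] eq ..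
    ultimately show ?thesis unfolding eq by simp
  qed
  then show "(\<lambda>\<gamma>. pvar dist \<gamma> ({..t} \<inter> {0..<1})) \<in> borel_measurable \<pi>"
    "(\<integral>\<^sup>+\<gamma>. pvar dist \<gamma> ({..t} \<inter> {0..<1}) \<partial>\<pi>) = ennreal (var_upto W1 \<mu> t)" by auto
qed

text \<open>A version of the variation measure that is finite for every path and lives on the whole
  line, as \<open>kernel_integral_eq\<close> requires; the null measure stands in for exceptional
  paths.\<close>

definition path_var :: "(real \<Rightarrow> 'a) \<Rightarrow> real measure" where
  "path_var \<gamma> = (if \<gamma> \<in> space \<pi> \<and> pvar dist \<gamma> {0..1} < \<infinity> then interval_measure (var_upto dist \<gamma>) else null_measure borel)"

lemma good_path:
  assumes "\<gamma> \<in> space \<pi>" "pvar dist \<gamma> {0..1} < \<infinity>"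
  shows "Met_TC.right_cont \<gamma>" "pvar dist \<gamma> {0..<1} < \<infinity>"
proof -
  show "Met_TC.right_cont \<gamma>" using assms(1) Met_TC.cadlag_right_cont by (simp add: space_pi)
  have "pvar dist \<gamma> {0..<1} \<le> pvar dist \<gamma> {0..1}" by (rule pvar_mono) auto
  then show "pvar dist \<gamma> {0..<1} < \<infinity>" using assms(2) by (rule order.strict_trans1)
qed

lemma sets_path_var: "sets (path_var \<gamma>) = sets borel"
  by (simp add: path_var_def)

lemma finite_path_var: "finite_measure (path_var \<gamma>)"
  using Met_TC.finite_interval_measure_var_upto[OF good_path]
  by (auto simp: path_var_def intro!: finite_measureI)

text \<open>By \<open>kernel_integral_eq\<close> half-lines suffice, and there the mass is the
  variation up to a given time, treated in \<open>pvar_upto_measurable_integral\<close>.\<close>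

lemma path_var_integral:
  assumes "A \<in> sets borel"
  shows "(\<lambda>\<gamma>. emeasure (path_var \<gamma>) A) \<in> borel_measurable \<pi>"
    "(\<integral>\<^sup>+\<gamma>. emeasure (path_var \<gamma>) A \<partial>\<pi>) = emeasure (interval_measure (var_upto W1 \<mu>)) A"
proof -
  have good: "{\<gamma>\<in>space \<pi>. pvar dist \<gamma> {0..1} < \<infinity>} \<in> sets \<pi>"
    using measurable_pvar[of 1] by measurable
  have e: "emeasure (path_var \<gamma>) {..t} = (if pvar dist \<gamma> {0..1} < \<infinity> then pvar dist \<gamma> ({..t} \<inter> {0..<1}) else 0)"
    if "\<gamma> \<in> space \<pi>" for \<gamma> t
    using that Met_TC.emeasure_var_upto_atMost[OF good_path, of \<gamma> t] Met_TC.ennreal_var_upto[OF good_path, of \<gamma> t]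
    by (simp add: path_var_def)
  have "(\<lambda>\<gamma>. emeasure (path_var \<gamma>) A) \<in> borel_measurable \<pi> \<and>
    (\<integral>\<^sup>+\<gamma>. emeasure (path_var \<gamma>) A \<partial>\<pi>) = emeasure (interval_measure (var_upto W1 \<mu>)) A"
  proof (rule kernel_integral_eq[OF sets_path_var finite_path_var P1.finite_interval_measure_var_upto[OF rc fin] sets_interval_measure _ _ assms])
    fix t
    note [measurable] = pvar_upto_measurable_integral(1)[of t] measurable_pvar[of 1, simplified]
    have "(\<lambda>\<gamma>. if pvar dist \<gamma> {0..1} < \<infinity> then pvar dist \<gamma> ({..t} \<inter> {0..<1}) else 0) \<in> borel_measurable \<pi>"
      by measurable
    then show "(\<lambda>\<gamma>. emeasure (path_var \<gamma>) {..t}) \<in> borel_measurable \<pi>"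
      by (subst measurable_cong[OF e])
    have "(\<integral>\<^sup>+\<gamma>. emeasure (path_var \<gamma>) {..t} \<partial>\<pi>) = (\<integral>\<^sup>+\<gamma>. pvar dist \<gamma> ({..t} \<inter> {0..<1}) \<partial>\<pi>)"
    proof (rule nn_integral_cong_AE)
      show "AE \<gamma> in \<pi>. emeasure (path_var \<gamma>) {..t} = pvar dist \<gamma> ({..t} \<inter> {0..<1})"
        using bv AE_space by eventually_elim (simp add: e)
    qed
    then show "(\<integral>\<^sup>+\<gamma>. emeasure (path_var \<gamma>) {..t} \<partial>\<pi>) = emeasure (interval_measure (var_upto W1 \<mu>)) {..t}"
      by (simp add: pvar_upto_measurable_integral(2) P1.emeasure_var_upto_atMost[OF rc fin])
  qed
  then show "(\<lambda>\<gamma>. emeasure (path_var \<gamma>) A) \<in> borel_measurable \<pi>"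
    "(\<integral>\<^sup>+\<gamma>. emeasure (path_var \<gamma>) A \<partial>\<pi>) = emeasure (interval_measure (var_upto W1 \<mu>)) A" by auto
qed

lemma AE_var_measure_path:
  assumes "A \<subseteq> {0..1}"
  shows "AE \<gamma> in \<pi>. emeasure (var_measure UNIV dist \<gamma>) A = emeasure (path_var \<gamma>) A"
  using bv AE_space
proof eventually_elim
  case (elim \<gamma>)
  then show ?case using Met_TC.emeasure_var_measure[OF good_path[OF elim(2,1)] assms] by (simp add: path_var_def)
qed

lemma var_measure_integral:
  assumes "A \<in> sets (restrict_space borel {0..1})"
  shows "(\<lambda>\<gamma>. emeasure (var_measure UNIV dist \<gamma>) A) \<in> borel_measurable (completion \<pi>)"
    "emeasure (var_measure P1 W1 \<mu>) A = (\<integral>\<^sup>+\<gamma>. emeasure (var_measure UNIV dist \<gamma>) A \<partial>\<pi>)"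
proof -
  have A: "A \<in> sets borel" "A \<subseteq> {0..1}" using assms by (auto simp: sets_restrict_space_iff)
  show "(\<lambda>\<gamma>. emeasure (var_measure UNIV dist \<gamma>) A) \<in> borel_measurable (completion \<pi>)"
    by (rule measurable_completion_AE_eq[OF path_var_integral(1)[OF A(1)] _ AE_var_measure_path[OF A(2)]]) auto
  show "emeasure (var_measure P1 W1 \<mu>) A = (\<integral>\<^sup>+\<gamma>. emeasure (var_measure UNIV dist \<gamma>) A \<partial>\<pi>)"
    unfolding P1.emeasure_var_measure[OF rc fin A(2)] path_var_integral(2)[OF A(1), symmetric]
    by (rule nn_integral_cong_AE) (use AE_var_measure_path[OF A(2)] in eventually_elim, simp)
qed

lemma AE_limits:
  assumes dec: "lebesgue_decomp (interval_measure (var_upto W1 \<mu>)) f Z"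
  shows "AE t in lborel. t \<in> {0<..<1} \<longrightarrow> metric_deriv W1 \<mu> t = f t \<and>
    ((\<lambda>h. W1 (\<mu> t) (\<mu> (t + h)) / \<bar>h\<bar>) \<longlongrightarrow> f t) (increments_at t) \<and>
    ((\<lambda>h. \<integral>\<^sup>+\<gamma>. ennreal (dist (\<gamma> t) (\<gamma> (t + h)) / \<bar>h\<bar>) \<partial>\<pi>) \<longlongrightarrow> ennreal (f t)) (increments_at t) \<and>
    ((\<lambda>h. \<integral>\<^sup>+\<gamma>. emeasure (var_measure UNIV dist \<gamma>) (closed_segment t (t + h)) / ennreal \<bar>h\<bar> \<partial>\<pi>)
      \<longlongrightarrow> ennreal (f t)) (increments_at t)"
proof -
  let ?F = "var_upto W1 \<mu>"
  let ?N = "interval_measure ?F"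
  note Nfin = P1.finite_interval_measure_var_upto[OF rc fin]
  interpret N: finite_measure ?N by (rule Nfin)
  have "AE t in lborel. t \<in> {0<..<1} \<longrightarrow> ((\<lambda>h. \<bar>?F (t + h) - ?F t\<bar> / \<bar>h\<bar>) \<longlongrightarrow> f t) (at 0)"
    by (rule AE_increment_derivative[OF _ _ Nfin dec])
      (auto intro: P1.var_upto_mono[OF rc fin] P1.var_upto_continuous[OF rc fin])
  then show ?thesis
    using P1.AE_metric_derivative[OF rc fin dec] lebesgue_decomp_AE_derivative[OF Nfin sets_interval_measure dec]
  proof eventually_elim
    case (elim t)
    show ?case
    proof
      assume t: "t \<in> {0<..<1}"
      note inc0 = increments_at_interior[OF t]
      have l1: "((\<lambda>h. W1 (\<mu> t) (\<mu> (t + h)) / \<bar>h\<bar>) \<longlongrightarrow> f t) (at 0)" using elim(2) t by blast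
      have lF: "((\<lambda>h. \<bar>?F (t + h) - ?F t\<bar> / \<bar>h\<bar>) \<longlongrightarrow> f t) (at 0)" using elim(1) t by blast
      have md: "metric_deriv W1 \<mu> t = f t"
        unfolding metric_deriv_def inc0 by (rule tendsto_Lim[OF _ l1]) simp
      have ev: "\<forall>\<^sub>F h in at 0. h \<noteq> 0 \<and> 0 < t + h \<and> t + h < 1"
        unfolding eventually_at
        using t by (intro exI[of _ "min t (1 - t)"]) (auto simp: dist_real_def)
      have l2: "((\<lambda>h. \<integral>\<^sup>+\<gamma>. ennreal (dist (\<gamma> t) (\<gamma> (t + h)) / \<bar>h\<bar>) \<partial>\<pi>) \<longlongrightarrow> ennreal (f t)) (at 0)"
      proof (rule tendsto_sandwich[OF _ _ tendsto_ennrealI[OF l1] tendsto_ennrealI[OF lF]])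
        have eq: "(\<integral>\<^sup>+\<gamma>. ennreal (dist (\<gamma> t) (\<gamma> (t + h)) / \<bar>h\<bar>) \<partial>\<pi>) = (\<integral>\<^sup>+\<gamma>. ennreal (dist (\<gamma> t) (\<gamma> (t + h))) \<partial>\<pi>) * ennreal (1 / \<bar>h\<bar>)"
          if h: "0 < t + h" "t + h < 1" for h
        proof -
          have [measurable]: "(\<lambda>\<gamma>. \<gamma> t) \<in> measurable \<pi> borel" "(\<lambda>\<gamma>. \<gamma> (t + h)) \<in> measurable \<pi> borel"
            using t h by (auto intro!: measurable_eval)
          have "(\<integral>\<^sup>+\<gamma>. ennreal (dist (\<gamma> t) (\<gamma> (t + h)) / \<bar>h\<bar>) \<partial>\<pi>) = (\<integral>\<^sup>+\<gamma>. ennreal (dist (\<gamma> t) (\<gamma> (t + h))) * ennreal (1 / \<bar>h\<bar>) \<partial>\<pi>)"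
            by (intro nn_integral_cong) (simp flip: ennreal_mult)
          also have "\<dots> = (\<integral>\<^sup>+\<gamma>. ennreal (dist (\<gamma> t) (\<gamma> (t + h))) \<partial>\<pi>) * ennreal (1 / \<bar>h\<bar>)"
            by (rule nn_integral_multc) measurable
          finally show ?thesis .
        qed
        show "\<forall>\<^sub>F h in at 0. ennreal (W1 (\<mu> t) (\<mu> (t + h)) / \<bar>h\<bar>) \<le> (\<integral>\<^sup>+\<gamma>. ennreal (dist (\<gamma> t) (\<gamma> (t + h)) / \<bar>h\<bar>) \<partial>\<pi>)"
          using ev
        proof eventually_elim
          case (elim h)
          have "ennreal (W1 (\<mu> t) (\<mu> (t + h)) / \<bar>h\<bar>) = ennreal (W1 (\<mu> t) (\<mu> (t + h))) * ennreal (1 / \<bar>h\<bar>)"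
            by (simp add: W1_nonneg flip: ennreal_mult)
          also have "\<dots> \<le> (\<integral>\<^sup>+\<gamma>. ennreal (dist (\<gamma> t) (\<gamma> (t + h))) \<partial>\<pi>) * ennreal (1 / \<bar>h\<bar>)"
            using t elim by (intro mult_right_mono W1_le_cost) auto
          finally show ?case using eq[of h] elim by simp
        qed
        show "\<forall>\<^sub>F h in at 0. (\<integral>\<^sup>+\<gamma>. ennreal (dist (\<gamma> t) (\<gamma> (t + h)) / \<bar>h\<bar>) \<partial>\<pi>) \<le> ennreal (\<bar>?F (t + h) - ?F t\<bar> / \<bar>h\<bar>)"
          using ev
        proof eventually_elim
          case (elim h)
          have "(\<integral>\<^sup>+\<gamma>. ennreal (dist (\<gamma> t) (\<gamma> (t + h))) \<partial>\<pi>) \<le> ennreal \<bar>?F (t + h) - ?F t\<bar>"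
          proof (cases "0 \<le> h")
            case True
            then have "(\<integral>\<^sup>+\<gamma>. ennreal (dist (\<gamma> t) (\<gamma> (t + h))) \<partial>\<pi>) \<le> ennreal (W (t + h) - W t)"
              using t elim by (intro inc) auto
            also have "\<dots> \<le> ennreal \<bar>?F (t + h) - ?F t\<bar>"
              using t elim var_upto_eq_W[of t] var_upto_eq_W[of "t + h"] by (intro ennreal_leI) auto
            finally show ?thesis .
          next
            case False
            then have "(\<integral>\<^sup>+\<gamma>. ennreal (dist (\<gamma> (t + h)) (\<gamma> t)) \<partial>\<pi>) \<le> ennreal (W t - W (t + h))"
              using t elim by (intro inc) auto
            also have "\<dots> \<le> ennreal \<bar>?F (t + h) - ?F t\<bar>"
              using t elim var_upto_eq_W[of t] var_upto_eq_W[of "t + h"] by (intro ennreal_leI) auto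
            finally show ?thesis by (simp add: dist_commute)
          qed
          then have "(\<integral>\<^sup>+\<gamma>. ennreal (dist (\<gamma> t) (\<gamma> (t + h))) \<partial>\<pi>) * ennreal (1 / \<bar>h\<bar>) \<le> ennreal \<bar>?F (t + h) - ?F t\<bar> * ennreal (1 / \<bar>h\<bar>)"
            by (rule mult_right_mono) simp
          also have "\<dots> = ennreal (\<bar>?F (t + h) - ?F t\<bar> / \<bar>h\<bar>)" by (simp flip: ennreal_mult)
          finally show ?case using eq[of h] elim by simp
        qed
      qed
      \<comment> \<open>The expectation equals the mass of the closed segment under the variation
        measure of \<open>\<mu>\<close>, divided by the length; closed segments are among the
        shrinking sets that \<open>lebesgue_decomp_AE_derivative\<close> admits.\<close>
      have l3: "((\<lambda>h. \<integral>\<^sup>+\<gamma>. emeasure (var_measure UNIV dist \<gamma>) (closed_segment t (t + h)) / ennreal \<bar>h\<bar> \<partial>\<pi>) \<longlongrightarrow> ennreal (f t)) (at 0)"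
      proof (rule Lim_transform_eventually)
        have "((\<lambda>h. measure ?N (closed_segment t (t + h)) / \<bar>h\<bar>) \<longlongrightarrow> f t) (at 0)"
          by (rule elim(3)[rule_format, OF t])
            (auto simp: closed_segment_eq_real_ivl dist_real_def borel_closed)
        then show "((\<lambda>h. ennreal (measure ?N (closed_segment t (t + h)) / \<bar>h\<bar>)) \<longlongrightarrow> ennreal (f t)) (at 0)"
          by (rule tendsto_ennrealI)
        show "\<forall>\<^sub>F h in at 0. ennreal (measure ?N (closed_segment t (t + h)) / \<bar>h\<bar>) =
          (\<integral>\<^sup>+\<gamma>. emeasure (var_measure UNIV dist \<gamma>) (closed_segment t (t + h)) / ennreal \<bar>h\<bar> \<partial>\<pi>)"
          using ev
        proof eventually_elim
          case (elim h)
          let ?S = "closed_segment t (t + h)"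
          have S: "?S \<in> sets borel" "?S \<subseteq> {0..1}"
            using t elim by (auto simp: closed_segment_eq_real_ivl)
          have "(\<integral>\<^sup>+\<gamma>. emeasure (var_measure UNIV dist \<gamma>) ?S / ennreal \<bar>h\<bar> \<partial>\<pi>) = (\<integral>\<^sup>+\<gamma>. emeasure (path_var \<gamma>) ?S / ennreal \<bar>h\<bar> \<partial>\<pi>)"
            by (rule nn_integral_cong_AE) (use AE_var_measure_path[OF S(2)] in eventually_elim, simp)
          also have "\<dots> = (\<integral>\<^sup>+\<gamma>. emeasure (path_var \<gamma>) ?S \<partial>\<pi>) / ennreal \<bar>h\<bar>"
            by (rule nn_integral_divide[OF path_var_integral(1)[OF S(1)]])
          also have "\<dots> = ennreal (measure ?N ?S) / ennreal \<bar>h\<bar>"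
            by (simp add: path_var_integral(2)[OF S(1)] N.emeasure_eq_measure)
          also have "\<dots> = ennreal (measure ?N ?S / \<bar>h\<bar>)" using elim by (simp add: divide_ennreal)
          finally show ?case by simp
        qed
      qed
      show "metric_deriv W1 \<mu> t = f t \<and>
        ((\<lambda>h. W1 (\<mu> t) (\<mu> (t + h)) / \<bar>h\<bar>) \<longlongrightarrow> f t) (increments_at t) \<and>
        ((\<lambda>h. \<integral>\<^sup>+\<gamma>. ennreal (dist (\<gamma> t) (\<gamma> (t + h)) / \<bar>h\<bar>) \<partial>\<pi>) \<longlongrightarrow> ennreal (f t)) (increments_at t) \<and>
        ((\<lambda>h. \<integral>\<^sup>+\<gamma>. emeasure (var_measure UNIV dist \<gamma>) (closed_segment t (t + h)) / ennreal \<bar>h\<bar> \<partial>\<pi>)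
          \<longlongrightarrow> ennreal (f t)) (increments_at t)"
        unfolding inc0 using md l1 l2 l3 by blast
    qed
  qed
qed

lemma AE_lebesgue_on_01:
  assumes "AE t in lborel. t \<in> {0<..<1} \<longrightarrow> P t"
  shows "AE t in lebesgue_on {0..1::real}. P t"
proof -
  have "AE t in lborel. t \<notin> {0, 1::real}"
    by (intro AE_not_in countable_imp_null_set_lborel) auto
  with assms have "AE t in lborel. t \<in> {0..1} \<longrightarrow> P t" by eventually_elim auto
  then have "AE t in lebesgue. t \<in> {0..1} \<longrightarrow> P t" by (rule AE_completion)
  then show ?thesis by (subst AE_restrict_space_iff) auto
qed

text \<open>\<open>metric_deriv\<close> is a \<open>Lim\<close>, with a controlled value only where
  the limit exists. Almost everywhere it agrees with the Borel density \<open>f\<close>, which makes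
  it Lebesgue measurable and lets it replace \<open>f\<close> under the integral.\<close>

lemma abs_cont_part_metric_deriv:
  assumes dec: "lebesgue_decomp (interval_measure (var_upto W1 \<mu>)) f Z"
  shows "metric_deriv W1 \<mu> \<in> borel_measurable (lebesgue_on {0..1})"
    "\<And>A. A \<in> sets borel \<Longrightarrow> A \<subseteq> {0..1} \<Longrightarrow> emeasure (var_measure P1 W1 \<mu>) A =
      (\<integral>\<^sup>+t\<in>A. ennreal (metric_deriv W1 \<mu> t) \<partial>lebesgue_on {0..1}) + emeasure (interval_measure (var_upto W1 \<mu>)) (A \<inter> Z)"
proof -
  let ?g = "metric_deriv W1 \<mu>"
  have fm: "f \<in> borel_measurable borel" using dec by (simp add: lebesgue_decomp_def)
  have "AE t in lborel. t \<in> {0<..<1} \<longrightarrow> ?g t = f t" using AE_limits[OF dec] by eventually_elim blast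
  note ae = AE_lebesgue_on_01[OF this]
  have ae': "AE t in lebesgue. t \<in> {0..1} \<longrightarrow> ?g t = f t"
    using ae by (subst (asm) AE_restrict_space_iff) auto
  have "(\<lambda>t. if t \<in> {0..1} then ?g t else 0) \<in> borel_measurable (completion lborel)"
  proof (rule measurable_completion_AE_eq)
    show "(\<lambda>t. if t \<in> {0..1} then f t else 0) \<in> borel_measurable lborel" using fm by measurable
    show "AE t in lborel. (if t \<in> {0..1} then ?g t else 0) = (if t \<in> {0..1} then f t else 0)"
      using ae' unfolding AE_completion_iff by eventually_elim auto
  qed auto
  then show "?g \<in> borel_measurable (lebesgue_on {0..1})" by (subst (asm) borel_measurable_if) auto
  fix A :: "real set" assume A: "A \<in> sets borel" "A \<subseteq> {0..1}"
  have "(\<integral>\<^sup>+t\<in>A. ennreal (?g t) \<partial>lebesgue_on {0..1}) = (\<integral>\<^sup>+t\<in>A. ennreal (f t) \<partial>lebesgue_on {0..1})"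
    by (rule nn_integral_cong_AE) (use ae in eventually_elim, simp)
  also have "\<dots> = (\<integral>\<^sup>+t. ennreal (f t) * indicator A t * indicator {0..1} t \<partial>lebesgue)"
    by (rule nn_integral_restrict_space) simp
  also have "\<dots> = (\<integral>\<^sup>+t\<in>A. ennreal (f t) \<partial>lebesgue)"
    using A(2) by (intro nn_integral_cong) (auto split: split_indicator)
  also have "\<dots> = (\<integral>\<^sup>+t\<in>A. ennreal (f t) \<partial>lborel)"
    by (rule nn_integral_completion)
  finally show "emeasure (var_measure P1 W1 \<mu>) A =
      (\<integral>\<^sup>+t\<in>A. ennreal (?g t) \<partial>lebesgue_on {0..1}) + emeasure (interval_measure (var_upto W1 \<mu>)) (A \<inter> Z)"
    using dec A by (simp add: P1.emeasure_var_measure[OF rc fin A(2)] lebesgue_decomp_def)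
qed

lemma conclusion:
  "(AE \<gamma> in \<pi>. \<gamma> \<in> cadlag_BV UNIV dist) \<and>
    (\<forall>t\<in>{0..1}. (\<lambda>\<gamma>. \<gamma> t) \<in> measurable \<pi> borel \<and> distr \<pi> borel (\<lambda>\<gamma>. \<gamma> t) = \<mu> t) \<and>
    (\<forall>A\<in>sets (restrict_space borel {0..1}).
       (\<lambda>\<gamma>. emeasure (var_measure UNIV dist \<gamma>) A) \<in> borel_measurable (completion \<pi>) \<and>
       emeasure (var_measure P1 W1 \<mu>) A =
         (\<integral>\<^sup>+\<gamma>. emeasure (var_measure UNIV dist \<gamma>) A \<partial>\<pi>)) \<and>
    abs_cont_part (var_measure P1 W1 \<mu>) (metric_deriv W1 \<mu>) \<and>
    (AE t in lebesgue_on {0..1}.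
       ((\<lambda>h. W1 (\<mu> t) (\<mu> (t + h)) / \<bar>h\<bar>) \<longlongrightarrow> metric_deriv W1 \<mu> t) (increments_at t) \<and>
       ((\<lambda>h. \<integral>\<^sup>+\<gamma>. ennreal (dist (\<gamma> t) (\<gamma> (t + h)) / \<bar>h\<bar>) \<partial>\<pi>)
          \<longlongrightarrow> ennreal (metric_deriv W1 \<mu> t)) (increments_at t) \<and>
       ((\<lambda>h. \<integral>\<^sup>+\<gamma>. emeasure (var_measure UNIV dist \<gamma>) (closed_segment t (t + h)) / ennreal \<bar>h\<bar> \<partial>\<pi>)
          \<longlongrightarrow> ennreal (metric_deriv W1 \<mu> t)) (increments_at t)) \<and>
    (\<mu> \<in> AC1 P1 W1 \<longrightarrow>
       (\<forall>A\<in>sets (restrict_space borel {0..1}).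
          emeasure (var_measure P1 W1 \<mu>) A =
            (\<integral>\<^sup>+t\<in>A. ennreal (metric_deriv W1 \<mu> t) \<partial>lebesgue_on {0..1})))"
proof (intro conjI)
  let ?N = "interval_measure (var_upto W1 \<mu>)"
  obtain f Z where dec: "lebesgue_decomp ?N f Z"
    using lebesgue_decomp_exists[OF P1.finite_interval_measure_var_upto[OF rc fin] sets_interval_measure] by blast
  then have Z: "Z \<in> null_sets lborel" by (simp add: lebesgue_decomp_def)
  then have Zb: "Z \<in> sets borel" by (auto simp: null_sets_def)
  note acp = abs_cont_part_metric_deriv[OF dec]
  show "AE \<gamma> in \<pi>. \<gamma> \<in> cadlag_BV UNIV dist"
    using bv AE_space by eventually_elim (simp add: cadlag_BV_of_pvar space_pi)
  show "\<forall>t\<in>{0..1}. (\<lambda>\<gamma>. \<gamma> t) \<in> measurable \<pi> borel \<and> distr \<pi> borel (\<lambda>\<gamma>. \<gamma> t) = \<mu> t"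
    using measurable_eval law by blast
  show "\<forall>A\<in>sets (restrict_space borel {0..1}).
       (\<lambda>\<gamma>. emeasure (var_measure UNIV dist \<gamma>) A) \<in> borel_measurable (completion \<pi>) \<and>
       emeasure (var_measure P1 W1 \<mu>) A = (\<integral>\<^sup>+\<gamma>. emeasure (var_measure UNIV dist \<gamma>) A \<partial>\<pi>)"
    using var_measure_integral by blast
  have sv: "sets (var_measure P1 W1 \<mu>) = sets (restrict_space borel {0..1})"
    unfolding P1.var_measure_eq[OF rc fin] by (rule sets_restrict_space_cong) simp
  show "abs_cont_part (var_measure P1 W1 \<mu>) (metric_deriv W1 \<mu>)"
    unfolding abs_cont_part_def
  proof (intro conjI acp(1))
    let ?\<nu> = "var_measure P1 W1 \<mu>"
    \<comment> \<open>The restriction to \<open>Z\<close> is written as a density so that it keeps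
      the sigma-algebra of \<open>?\<nu>\<close>.\<close>
    let ?\<sigma> = "density ?\<nu> (indicator Z)"
    let ?Z = "Z \<inter> {0..1}"
    have im: "indicator Z \<in> borel_measurable ?\<nu>"
    proof -
      have "indicator Z \<in> borel_measurable (restrict_space borel {0..1::real})"
        using Zb by (intro measurable_restrict_space1) simp
      then show ?thesis using sv by (simp cong: measurable_cong_sets)
    qed
    have AZ: "A \<inter> Z \<in> sets ?\<nu>" if "A \<in> sets ?\<nu>" for A
      using that Zb unfolding sv by (auto simp: sets_restrict_space_iff)
    have \<sigma>e: "emeasure ?\<sigma> A = emeasure ?N (A \<inter> Z)" if A: "A \<in> sets ?\<nu>" for A
    proof -
      have A01: "A \<inter> Z \<subseteq> {0..1}" using A unfolding sv by (auto simp: sets_restrict_space_iff)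
      have "emeasure ?\<sigma> A = (\<integral>\<^sup>+t. indicator Z t * indicator A t \<partial>?\<nu>)"
        using im A by (rule emeasure_density)
      also have "\<dots> = (\<integral>\<^sup>+t. indicator (A \<inter> Z) t \<partial>?\<nu>)"
        by (intro nn_integral_cong) (auto split: split_indicator)
      also have "\<dots> = emeasure ?\<nu> (A \<inter> Z)" using AZ[OF A] by (rule nn_integral_indicator)
      finally show ?thesis by (simp add: P1.emeasure_var_measure[OF rc fin A01])
    qed
    have "?Z \<in> sets ?\<nu>" using Zb unfolding sv by (auto simp: sets_restrict_space_iff)
    moreover have "?Z \<in> null_sets lebesgue"
    proof -
      have "?Z \<in> null_sets lborel" using Z by (rule null_set_Int2) simp
      then show ?thesis by (rule null_sets_completionI)
    qed
    moreover have "emeasure ?\<sigma> ({0..1} - ?Z) = 0"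
    proof -
      have "{0..1} - ?Z \<in> sets ?\<nu>" using Zb unfolding sv by (auto simp: sets_restrict_space_iff)
      then show ?thesis using \<sigma>e[of "{0..1} - ?Z"] by (simp add: Int_commute Diff_Int_distrib)
    qed
    moreover have "\<forall>A\<in>sets ?\<nu>. emeasure ?\<nu> A = (\<integral>\<^sup>+t\<in>A. ennreal (metric_deriv W1 \<mu> t) \<partial>lebesgue_on {0..1}) + emeasure ?\<sigma> A"
    proof
      fix A assume A: "A \<in> sets ?\<nu>"
      then have "A \<in> sets borel" "A \<subseteq> {0..1}" unfolding sv by (auto simp: sets_restrict_space_iff)
      then show "emeasure ?\<nu> A = (\<integral>\<^sup>+t\<in>A. ennreal (metric_deriv W1 \<mu> t) \<partial>lebesgue_on {0..1}) + emeasure ?\<sigma> A"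
        unfolding \<sigma>e[OF A] by (rule acp(2))
    qed
    ultimately show "\<exists>\<sigma> Z. sets \<sigma> = sets ?\<nu> \<and> Z \<in> sets ?\<nu> \<and> Z \<in> null_sets lebesgue \<and> emeasure \<sigma> ({0..1} - Z) = 0 \<and>
      (\<forall>A\<in>sets ?\<nu>. emeasure ?\<nu> A = (\<integral>\<^sup>+t\<in>A. ennreal (metric_deriv W1 \<mu> t) \<partial>lebesgue_on {0..1}) + emeasure \<sigma> A)"
      by (intro exI[of _ ?\<sigma>] exI[of _ ?Z] conjI) (simp_all only: sets_density)
  qed
  show "AE t in lebesgue_on {0..1}.
       ((\<lambda>h. W1 (\<mu> t) (\<mu> (t + h)) / \<bar>h\<bar>) \<longlongrightarrow> metric_deriv W1 \<mu> t) (increments_at t) \<and>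
       ((\<lambda>h. \<integral>\<^sup>+\<gamma>. ennreal (dist (\<gamma> t) (\<gamma> (t + h)) / \<bar>h\<bar>) \<partial>\<pi>)
          \<longlongrightarrow> ennreal (metric_deriv W1 \<mu> t)) (increments_at t) \<and>
       ((\<lambda>h. \<integral>\<^sup>+\<gamma>. emeasure (var_measure UNIV dist \<gamma>) (closed_segment t (t + h)) / ennreal \<bar>h\<bar> \<partial>\<pi>)
          \<longlongrightarrow> ennreal (metric_deriv W1 \<mu> t)) (increments_at t)"
    by (rule AE_lebesgue_on_01) (use AE_limits[OF dec] in eventually_elim, metis)
  show "\<mu> \<in> AC1 P1 W1 \<longrightarrow>
       (\<forall>A\<in>sets (restrict_space borel {0..1}).
          emeasure (var_measure P1 W1 \<mu>) A = (\<integral>\<^sup>+t\<in>A. ennreal (metric_deriv W1 \<mu> t) \<partial>lebesgue_on {0..1}))"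
  proof (intro impI ballI)
    fix A :: "real set" assume ac: "\<mu> \<in> AC1 P1 W1" and "A \<in> sets (restrict_space borel {0..1})"
    then have A: "A \<in> sets borel" "A \<subseteq> {0..1}" by (auto simp: sets_restrict_space_iff)
    obtain m where m: "set_integrable lebesgue {0..1} m"
      "\<And>s t. 0 \<le> s \<Longrightarrow> s \<le> t \<Longrightarrow> t \<le> 1 \<Longrightarrow> W1 (\<mu> s) (\<mu> t) \<le> set_lebesgue_integral lebesgue {s..t} m"
      using ac unfolding AC1_def by blast
    \<comment> \<open>Absolute continuity of the curve removes the singular part, so the
      decomposition reduces to its density.\<close>
    have "emeasure ?N Z = 0" by (rule P1.var_upto_null_of_abs_cont[OF rc fin m Z])
    moreover have "emeasure ?N (A \<inter> Z) \<le> emeasure ?N Z" using Zb by (intro emeasure_mono) auto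
    ultimately have "emeasure ?N (A \<inter> Z) = 0" by simp
    then show "emeasure (var_measure P1 W1 \<mu>) A = (\<integral>\<^sup>+t\<in>A. ennreal (metric_deriv W1 \<mu> t) \<partial>lebesgue_on {0..1})"
      using acp(2)[OF A] by simp
  qed
qed

end

lemma path_law_exists:
  fixes \<mu> :: "real \<Rightarrow> 'a::polish_space measure"
  assumes "\<mu> \<in> cadlag_BV P1 W1"
  shows "\<exists>W \<pi>. path_law \<mu> W \<pi>"
proof -
  interpret P1: Metric_space "P1 :: 'a measure set" W1 by (rule Metric_space_P1)
  note rc = P1.cadlag_BV_right_cont(1)[OF assms] and fin = P1.cadlag_BV_right_cont(2)[OF assms]
  \<comment> \<open>The value at 1 is finite by \<open>pvar_Icc01_less_top\<close>, although
    \<open>fin\<close> concerns [0,1) only.\<close>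
  define W where "W t = enn2real (pvar W1 \<mu> {0..t})" for t
  have We: "ennreal (W t) = pvar W1 \<mu> {0..t}" if "t \<in> {0..1}" for t
  proof -
    have "pvar W1 \<mu> {0..t} \<le> pvar W1 \<mu> {0..1}" using that by (intro pvar_mono) auto
    also have "\<dots> < \<infinity>" by (rule P1.pvar_Icc01_less_top[OF rc fin])
    finally show ?thesis by (simp add: W_def)
  qed
  have W0: "0 \<le> W t" for t by (simp add: W_def)
  have P: "\<mu> t \<in> P1" if "t \<in> {0..1}" for t using rc that by (auto simp: P1.right_cont_def)
  have inc: "W1 (\<mu> s) (\<mu> t) \<le> W t - W s" if st: "0 \<le> s" "s \<le> t" "t \<le> 1" for s t
  proof -
    have "pvar W1 \<mu> ({0..1} \<inter> {..s}) + ennreal (W1 (\<mu> s) (\<mu> t)) \<le> pvar W1 \<mu> ({0..1} \<inter> {..t})"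
      using st P by (intro P1.pvar_append) auto
    moreover have "{0..1} \<inter> {..s} = {0..s}" "{0..1} \<inter> {..t} = {0..t}" using st by auto
    ultimately have "ennreal (W s) + ennreal (W1 (\<mu> s) (\<mu> t)) \<le> ennreal (W t)" using st by (simp add: We)
    then have "ennreal (W s + W1 (\<mu> s) (\<mu> t)) \<le> ennreal (W t)" by (simp add: W0 W1_nonneg)
    then have "W s + W1 (\<mu> s) (\<mu> t) \<le> W t" using W0[of t] by (simp only: ennreal_le_iff)
    then show ?thesis by linarith
  qed
  \<comment> \<open>Below 1 the function \<open>W\<close> coincides with the right-continuous
    \<open>var_upto\<close>; the two may differ at 1, which is no limit from the right of an earlier
    time.\<close>
  have right: "(W \<longlongrightarrow> W t) (at_right t)" if t: "0 \<le> t" "t < 1" for t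
  proof -
    have eq: "var_upto W1 \<mu> s = W s" if "0 \<le> s" "s < 1" for s
    proof -
      have "{..s} \<inter> {0..<1} = {0..s}" using that by auto
      then show ?thesis by (simp add: var_upto_def W_def)
    qed
    have "(var_upto W1 \<mu> \<longlongrightarrow> W t) (at_right t)"
      using P1.var_upto_right_cont[OF rc fin, of t] eq[OF t] by simp
    moreover have "\<forall>\<^sub>F s in at_right t. var_upto W1 \<mu> s = W s"
      unfolding eventually_at_right_field using t by (intro exI[of _ 1]) (auto intro!: eq)
    ultimately show ?thesis by (rule Lim_transform_eventually)
  qed
  obtain \<pi> where \<pi>: "prob_space \<pi>" "sets \<pi> = sets (skorokhod_borel UNIV (dist :: 'a \<Rightarrow> _))"
    "AE \<gamma> in \<pi>. pvar dist \<gamma> {0..1} < \<infinity>"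
    "\<And>t. t \<in> {0..1} \<Longrightarrow> distr \<pi> borel (\<lambda>\<gamma>. \<gamma> t) = \<mu> t"
    "\<And>s t. 0 \<le> s \<Longrightarrow> s \<le> t \<Longrightarrow> t \<le> 1 \<Longrightarrow> (\<integral>\<^sup>+\<gamma>. ennreal (dist (\<gamma> s) (\<gamma> t)) \<partial>\<pi>) \<le> ennreal (W t - W s)"
    using path_measure_exists[of \<mu> W, OF P inc right] by blast
  have "path_law \<mu> W \<pi>" unfolding path_law_def using assms We W0 \<pi> by blast
  then show ?thesis by blast
qed

theorem theorem3p3:
  fixes \<mu> :: "real \<Rightarrow> 'a::polish_space measure"
  assumes "\<mu> \<in> cadlag_BV P1 W1"
  shows "\<exists>\<pi> :: (real \<Rightarrow> 'a) measure.
    prob_space \<pi> \<and> sets \<pi> = sets (skorokhod_borel UNIV dist) \<and>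
    (AE \<gamma> in \<pi>. \<gamma> \<in> cadlag_BV UNIV dist) \<and>
    (\<forall>t\<in>{0..1}. (\<lambda>\<gamma>. \<gamma> t) \<in> measurable \<pi> borel \<and> distr \<pi> borel (\<lambda>\<gamma>. \<gamma> t) = \<mu> t) \<and>
    (\<forall>A\<in>sets (restrict_space borel {0..1}).
       (\<lambda>\<gamma>. emeasure (var_measure UNIV dist \<gamma>) A) \<in> borel_measurable (completion \<pi>) \<and>
       emeasure (var_measure P1 W1 \<mu>) A =
         (\<integral>\<^sup>+\<gamma>. emeasure (var_measure UNIV dist \<gamma>) A \<partial>\<pi>)) \<and>
    abs_cont_part (var_measure P1 W1 \<mu>) (metric_deriv W1 \<mu>) \<and>
    (AE t in lebesgue_on {0..1}.
       ((\<lambda>h. W1 (\<mu> t) (\<mu> (t + h)) / \<bar>h\<bar>) \<longlongrightarrow> metric_deriv W1 \<mu> t) (increments_at t) \<and>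
       ((\<lambda>h. \<integral>\<^sup>+\<gamma>. ennreal (dist (\<gamma> t) (\<gamma> (t + h)) / \<bar>h\<bar>) \<partial>\<pi>)
          \<longlongrightarrow> ennreal (metric_deriv W1 \<mu> t)) (increments_at t) \<and>
       ((\<lambda>h. \<integral>\<^sup>+\<gamma>. emeasure (var_measure UNIV dist \<gamma>) (closed_segment t (t + h)) / ennreal \<bar>h\<bar> \<partial>\<pi>)
          \<longlongrightarrow> ennreal (metric_deriv W1 \<mu> t)) (increments_at t)) \<and>
    (\<mu> \<in> AC1 P1 W1 \<longrightarrow>
       (\<forall>A\<in>sets (restrict_space borel {0..1}).
          emeasure (var_measure P1 W1 \<mu>) A =
            (\<integral>\<^sup>+t\<in>A. ennreal (metric_deriv W1 \<mu> t) \<partial>lebesgue_on {0..1})))"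
proof -
  obtain W \<pi> where law: "path_law \<mu> W \<pi>" using path_law_exists[OF assms] by blast
  show ?thesis
    by (rule exI[of _ \<pi>], rule conjI[OF path_law.prob[OF law]], rule conjI[OF path_law.sets_pi[OF law]],
      rule path_law.conclusion[OF law])
qed

end
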